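(* Let $k$ be a commutative ring and let $A$ be a $k$-algebra which is flat as a $k$-module. Consider the conditions: (1) $(F,G)$ is a pair of inverse equivalences, that is, $A$ is an Azumaya algebra; (2) the functor $G=(-)^A:{}_A\mathcal{M}_A\to\mathcal{M}_k$ is fully faithful; (3) the functor $G=(-)^A:{}_A\mathcal{M}_A\to\mathcal{M}_k$ is separable; (4) there exists $R=R^1\otimes R^2\otimes R^3\in A\otimes(A\otimes A)^A$ such that $R^1R^2\otimes R^3=1\otimes 1$; (5) there exists a unique $R=R^1\otimes R^2\otimes R^3\in A\otimes(A\otimes A)^A$ such that $R^1R^2\otimes R^3=1\otimes 1$; (6) there exists a braiding on the monoidal category ${}_A\mathcal{M}_A$, that is, there exists $R\in A^{(3)}$ such that $(A,R)$ is an algebra with a canonical $R$-matrix. Then $(1)\Rightarrow(2)\Leftrightarrow(3)\Leftrightarrow(4)\Leftrightarrow(5)\Rightarrow(6)$. If $A$ is central, then $(2)\Rightarrow(1)$. If $A$ is free as a $k$-module, then $(6)\Rightarrow(5)$, and in this case the braiding on ${}_A\mathcal{M}_A$ is unique. If $k$ is a field, and $A$ is finite dimensional, then $(6)\Rightarrow(1)$, and all six assertions are equivalent.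
   Context: Algebras are associative and unital. $\otimes=\otimes_k$, and $A^{(n)}=A\otimes\cdots\otimes A$ ($n$ factors), with its tensor product algebra structure. $\mathcal{M}_k$ is the category of $k$-modules and ${}_A\mathcal{M}_A$ is the $k$-linear category of $A$-bimodules (left and right $k$-actions agree), monoidal with tensor product $\otimes_A$ and unit object $A$. For an $A$-bimodule $M$, $M^A=\{m\in M: am=ma\ \forall a\in A\}$. The functor $F:\mathcal{M}_k\to{}_A\mathcal{M}_A$, $F(N)=A\otimes N$ with bimodule structure $a(b\otimes n)c=abc\otimes n$, is left adjoint to $G:{}_A\mathcal{M}_A\to\mathcal{M}_k$, $G(M)=M^A$; the unit is $\eta_N(n)=1\otimes n$ and the counit is $\varepsilon_M:A\otimes M^A\to M$, $\varepsilon_M(a\otimes m)=am=ma$. "$(F,G)$ is a pair of inverse equivalences" means that $\eta$ and $\varepsilon$ are natural isomorphisms. $A$ is an Azumaya algebra if $A$ is finitely generated, projective and faithful as a $k$-module and the algebra map $A\otimes A^{\mathrm{op}}\to\mathrm{End}_k(A)$, $a\otimes b\mapsto(x\mapsto axb)$, is an isomorphism; it is known that this is equivalent to $(F,G)$ being a pair of inverse equivalences. $A$ is central if $Z(A)=k$, i.e. the unit map $k\to A$ is an isomorphism onto the center of $A$. A functor $T:\mathcal{C}\to\mathcal{D}$ is separable if the natural transformation $\mathrm{Hom}_{\mathcal{C}}(\bullet,\bullet)\to\mathrm{Hom}_{\mathcal{D}}(T(\bullet),T(\bullet))$, $f\mapsto T(f)$, has a natural left inverse. $A\otimes A$ is an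 $A$-bimodule via $a(x\otimes y)b=ax\otimes yb$. Since $A$ is flat, the canonical map $A\otimes(A\otimes A)^A\to A\otimes A\otimes A$ is injective, and $A\otimes(A\otimes A)^A$ is identified with its image in $A^{(3)}$. An element $R\in A^{(3)}$ is written $R=R^1\otimes R^2\otimes R^3$ with summation implicitly understood. A canonical $R$-matrix for $A$ is an invertible element $R$ of the algebra $A^{(3)}$ such that, with $r=r^1\otimes r^2\otimes r^3$ a second copy of $R$, for all $a\in A$: $R^1\otimes R^2\otimes aR^3=R^1a\otimes R^2\otimes R^3$; $aR^1\otimes R^2\otimes R^3=R^1\otimes R^2a\otimes R^3$; $R^1\otimes aR^2\otimes R^3=R^1\otimes R^2\otimes R^3a$; $R^1\otimes R^2\otimes 1\otimes R^3=r^1R^1\otimes r^2\otimes r^3R^2\otimes R^3$; $R^1\otimes 1\otimes R^2\otimes R^3=R^1\otimes R^2r^1\otimes r^2\otimes R^3r^3$. In that case $(A,R)$ is called an algebra with a canonical $R$-matrix. Braidings on ${}_A\mathcal{M}_A$ correspond bijectively to canonical $R$-matrices via $c_{M,N}(m\otimes_A n)=R^1nR^2\otimes_A mR^3$. A braiding on a monoidal category (treated as strict) is a natural isomorphism $c_{U,V}:U\otimes V\to V\otimes U$ such that $c_{U,V\otimes W}=(V\otimes c_{U,W})\circ(c_{U,V}\otimes W)$ and $c_{U\otimes V,W}=(c_{U,W}\otimes V)\circ(U\otimes c_{V,W})$ for all objects $U,V,W$, where an object also denotes its identity morphism.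
   Formalization: In the last sentence (k a field, A finite dimensional) the algebra A is assumed to be nonzero: the zero algebra over a field satisfies (2)–(6) but not (1). *)

theory Defs
  imports "HOL-Algebra.Free_Abelian_Groups" "HOL-Algebra.QuotRing" "HOL-Algebra.Module"
begin

section \<open>Categories, functors, monoidal categories and braidings\<close>

record ('o, 'f) category =
  Ob :: "'o set"
  Hom :: "'o \<Rightarrow> 'o \<Rightarrow> 'f set"
  idn :: "'o \<Rightarrow> 'f"
  cmp :: "'f \<Rightarrow> 'f \<Rightarrow> 'f"  (infixr \<open>\<cdot>\<index>\<close> 70)

definition inverse_arrows :: "('o, 'f, 'z) category_scheme \<Rightarrow> 'o \<Rightarrow> 'o \<Rightarrow> 'f \<Rightarrow> 'f \<Rightarrow> bool" where
  "inverse_arrows C X Y f g \<longleftrightarrow>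
     f \<in> Hom C X Y \<and> g \<in> Hom C Y X \<and> g \<cdot>\<^bsub>C\<^esub> f = idn C X \<and> f \<cdot>\<^bsub>C\<^esub> g = idn C Y"

definition iso_arrow :: "('o, 'f, 'z) category_scheme \<Rightarrow> 'o \<Rightarrow> 'o \<Rightarrow> 'f \<Rightarrow> bool" where
  "iso_arrow C X Y f \<longleftrightarrow> (\<exists>g. inverse_arrows C X Y f g)"

definition inv_arrow :: "('o, 'f, 'z) category_scheme \<Rightarrow> 'o \<Rightarrow> 'o \<Rightarrow> 'f \<Rightarrow> 'f" where
  "inv_arrow C X Y f = (THE g. inverse_arrows C X Y f g)"

record ('o, 'f, 'p, 'g) cfunctor =
  fob :: "'o \<Rightarrow> 'p"
  far :: "'f \<Rightarrow> 'g"

definition id_functor :: "('o, 'f, 'o, 'f) cfunctor" where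
  "id_functor = \<lparr>fob = (\<lambda>X. X), far = (\<lambda>f. f)\<rparr>"

definition comp_functor ::
  "('p, 'g, 'q, 'h) cfunctor \<Rightarrow> ('o, 'f, 'p, 'g) cfunctor \<Rightarrow> ('o, 'f, 'q, 'h) cfunctor" where
  "comp_functor T S = \<lparr>fob = fob T \<circ> fob S, far = far T \<circ> far S\<rparr>"

definition natural_iso ::
  "('o, 'f, 'y) category_scheme \<Rightarrow> ('p, 'g, 'z) category_scheme \<Rightarrow>
   ('o, 'f, 'p, 'g) cfunctor \<Rightarrow> ('o, 'f, 'p, 'g) cfunctor \<Rightarrow> ('o \<Rightarrow> 'g) \<Rightarrow> bool" where
  "natural_iso C D S T \<theta> \<longleftrightarrow>
     (\<forall>X\<in>Ob C. iso_arrow D (fob S X) (fob T X) (\<theta> X)) \<and>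
     (\<forall>X\<in>Ob C. \<forall>Y\<in>Ob C. \<forall>f\<in>Hom C X Y. far T f \<cdot>\<^bsub>D\<^esub> \<theta> X = \<theta> Y \<cdot>\<^bsub>D\<^esub> far S f)"

definition inverse_equivalences ::
  "('o, 'f, 'y) category_scheme \<Rightarrow> ('p, 'g, 'z) category_scheme \<Rightarrow>
   ('o, 'f, 'p, 'g) cfunctor \<Rightarrow> ('p, 'g, 'o, 'f) cfunctor \<Rightarrow>
   ('o \<Rightarrow> 'f) \<Rightarrow> ('p \<Rightarrow> 'g) \<Rightarrow> bool" where
  "inverse_equivalences C D F G \<eta> \<epsilon> \<longleftrightarrow>
     natural_iso C C id_functor (comp_functor G F) \<eta> \<and>
     natural_iso D D (comp_functor F G) id_functor \<epsilon>"

definition fully_faithful ::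
  "('o, 'f, 'y) category_scheme \<Rightarrow> ('p, 'g, 'z) category_scheme \<Rightarrow>
   ('o, 'f, 'p, 'g) cfunctor \<Rightarrow> bool" where
  "fully_faithful C D T \<longleftrightarrow>
     (\<forall>X\<in>Ob C. \<forall>Y\<in>Ob C. bij_betw (far T) (Hom C X Y) (Hom D (fob T X) (fob T Y)))"

definition separable_functor ::
  "('o, 'f, 'y) category_scheme \<Rightarrow> ('p, 'g, 'z) category_scheme \<Rightarrow>
   ('o, 'f, 'p, 'g) cfunctor \<Rightarrow> bool" where
  "separable_functor C D T \<longleftrightarrow> (\<exists>P.
     (\<forall>X\<in>Ob C. \<forall>Y\<in>Ob C. P X Y \<in> Hom D (fob T X) (fob T Y) \<rightarrow> Hom C X Y) \<and>
     (\<forall>X\<in>Ob C. \<forall>Y\<in>Ob C. \<forall>f\<in>Hom C X Y. P X Y (far T f) = f) \<and>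
     (\<forall>X'\<in>Ob C. \<forall>X\<in>Ob C. \<forall>Y\<in>Ob C. \<forall>Y'\<in>Ob C.
        \<forall>f\<in>Hom C X' X. \<forall>g\<in>Hom C Y Y'. \<forall>h\<in>Hom D (fob T X) (fob T Y).
          P X' Y' (far T g \<cdot>\<^bsub>D\<^esub> h \<cdot>\<^bsub>D\<^esub> far T f) = g \<cdot>\<^bsub>C\<^esub> P X Y h \<cdot>\<^bsub>C\<^esub> f))"

record ('o, 'f) monoidal_category = "('o, 'f) category" +
  tob :: "'o \<Rightarrow> 'o \<Rightarrow> 'o"
  tar :: "'f \<Rightarrow> 'f \<Rightarrow> 'f"
  unit_ob :: 'o
  assoc :: "'o \<Rightarrow> 'o \<Rightarrow> 'o \<Rightarrow> 'f"
  lunit :: "'o \<Rightarrow> 'f"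
  runit :: "'o \<Rightarrow> 'f"

text \<open>
  The two hexagons are the strict axioms
  c(U, V W) = (V c(U,W)) (c(U,V) W)  and  c(U V, W) = (c(U,W) V) (U c(V,W))
  with the associativity constraints (U V) W \<open>\<rightarrow>\<close> U (V W) inserted.
\<close>
definition braiding ::
  "('o, 'f, 'z) monoidal_category_scheme \<Rightarrow> ('o \<Rightarrow> 'o \<Rightarrow> 'f) \<Rightarrow> bool" where
  "braiding C c \<longleftrightarrow>
     (\<forall>U\<in>Ob C. \<forall>V\<in>Ob C. iso_arrow C (tob C U V) (tob C V U) (c U V)) \<and>
     (\<forall>U\<in>Ob C. \<forall>U'\<in>Ob C. \<forall>V\<in>Ob C. \<forall>V'\<in>Ob C. \<forall>f\<in>Hom C U U'. \<forall>g\<in>Hom C V V'.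
        c U' V' \<cdot>\<^bsub>C\<^esub> tar C f g = tar C g f \<cdot>\<^bsub>C\<^esub> c U V) \<and>
     (\<forall>U\<in>Ob C. \<forall>V\<in>Ob C. \<forall>W\<in>Ob C.
        assoc C V W U \<cdot>\<^bsub>C\<^esub> c U (tob C V W) \<cdot>\<^bsub>C\<^esub> assoc C U V W =
        tar C (idn C V) (c U W) \<cdot>\<^bsub>C\<^esub> assoc C V U W \<cdot>\<^bsub>C\<^esub> tar C (c U V) (idn C W)) \<and>
     (\<forall>U\<in>Ob C. \<forall>V\<in>Ob C. \<forall>W\<in>Ob C.
        c (tob C U V) W =
        assoc C W U V \<cdot>\<^bsub>C\<^esub> tar C (c U W) (idn C V) \<cdot>\<^bsub>C\<^esub>
        inv_arrow C (tob C (tob C U W) V) (tob C U (tob C W V)) (assoc C U W V) \<cdot>\<^bsub>C\<^esub>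
        tar C (idn C U) (c V W) \<cdot>\<^bsub>C\<^esub> assoc C U V W)"

text \<open>Arrows between structured sets: a function together with its source and target.\<close>

record ('o, 'u) arrow =
  src :: 'o
  fn :: "'u \<Rightarrow> 'u"
  tgt :: 'o

definition id_arrow :: "('u, 'z) partial_object_scheme \<Rightarrow> (('u, 'z) partial_object_scheme, 'u) arrow" where
  "id_arrow M = \<lparr>src = M, fn = (\<lambda>x\<in>carrier M. x), tgt = M\<rparr>"

definition comp_arrow ::
  "(('u, 'z) partial_object_scheme, 'u) arrow \<Rightarrow> (('u, 'z) partial_object_scheme, 'u) arrow \<Rightarrow>
   (('u, 'z) partial_object_scheme, 'u) arrow" where
  "comp_arrow g f = \<lparr>src = src f, fn = compose (carrier (src f)) (fn g) (fn f), tgt = tgt g\<rparr>"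


section \<open>Modules and algebras over a commutative ring\<close>

definition additive_maps :: "('m, 'y) ring_scheme \<Rightarrow> ('n, 'z) ring_scheme \<Rightarrow> ('m \<Rightarrow> 'n) set" where
  "additive_maps M N = {f \<in> carrier M \<rightarrow>\<^sub>E carrier N.
     \<forall>x\<in>carrier M. \<forall>y\<in>carrier M. f (x \<oplus>\<^bsub>M\<^esub> y) = f x \<oplus>\<^bsub>N\<^esub> f y}"

text \<open>
  The additive map with a given property; below, the property always prescribes the values
  on pure tensors, which determine the map.
\<close>
definition the_additive ::
  "('m, 'y) ring_scheme \<Rightarrow> ('n, 'z) ring_scheme \<Rightarrow> (('m \<Rightarrow> 'n) \<Rightarrow> bool) \<Rightarrow> 'm \<Rightarrow> 'n" where
  "the_additive M N Q = (THE f. f \<in> additive_maps M N \<and> Q f)"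

definition linear_maps ::
  "('k, 'x) ring_scheme \<Rightarrow> ('k, 'm, 'y) module_scheme \<Rightarrow> ('k, 'n, 'z) module_scheme \<Rightarrow> ('m \<Rightarrow> 'n) set" where
  "linear_maps k M N = {f \<in> additive_maps M N.
     \<forall>c\<in>carrier k. \<forall>x\<in>carrier M. f (c \<odot>\<^bsub>M\<^esub> x) = c \<odot>\<^bsub>N\<^esub> f x}"

text \<open>Associative unital algebras; the library's \<open>algebra\<close> is commutative.\<close>
locale k_algebra = module k A + A: ring A for k and A +
  assumes smult_mult_left:
      "\<lbrakk>c \<in> carrier k; x \<in> carrier A; y \<in> carrier A\<rbrakk> \<Longrightarrow>
       (c \<odot>\<^bsub>A\<^esub> x) \<otimes>\<^bsub>A\<^esub> y = c \<odot>\<^bsub>A\<^esub> (x \<otimes>\<^bsub>A\<^esub> y)"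
    and smult_mult_right:
      "\<lbrakk>c \<in> carrier k; x \<in> carrier A; y \<in> carrier A\<rbrakk> \<Longrightarrow>
       x \<otimes>\<^bsub>A\<^esub> (c \<odot>\<^bsub>A\<^esub> y) = c \<odot>\<^bsub>A\<^esub> (x \<otimes>\<^bsub>A\<^esub> y)"

definition module_basis :: "('k, 'x) ring_scheme \<Rightarrow> ('k, 'm, 'z) module_scheme \<Rightarrow> 'm set \<Rightarrow> bool" where
  "module_basis k M B \<longleftrightarrow> B \<subseteq> carrier M \<and>
     (\<forall>x\<in>carrier M. \<exists>!c. c \<in> B \<rightarrow>\<^sub>E carrier k \<and> finite {b \<in> B. c b \<noteq> \<zero>\<^bsub>k\<^esub>} \<and>
        x = (\<Oplus>\<^bsub>M\<^esub> b \<in> {b \<in> B. c b \<noteq> \<zero>\<^bsub>k\<^esub>}. c b \<odot>\<^bsub>M\<^esub> b))"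

definition free_module :: "('k, 'x) ring_scheme \<Rightarrow> ('k, 'm, 'z) module_scheme \<Rightarrow> bool" where
  "free_module k M \<longleftrightarrow> (\<exists>B. module_basis k M B)"

definition finite_dimensional :: "('k, 'x) ring_scheme \<Rightarrow> ('k, 'm, 'z) module_scheme \<Rightarrow> bool" where
  "finite_dimensional k M \<longleftrightarrow> (\<exists>B. finite B \<and> module_basis k M B)"

definition finitely_generated :: "('k, 'x) ring_scheme \<Rightarrow> ('k, 'm, 'z) module_scheme \<Rightarrow> bool" where
  "finitely_generated k M \<longleftrightarrow> (\<exists>S. finite S \<and> S \<subseteq> carrier M \<and>
     (\<forall>x\<in>carrier M. \<exists>c\<in>S \<rightarrow> carrier k. x = (\<Oplus>\<^bsub>M\<^esub> s \<in> S. c s \<odot>\<^bsub>M\<^esub> s)))"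

definition faithful_module :: "('k, 'x) ring_scheme \<Rightarrow> ('k, 'm, 'z) module_scheme \<Rightarrow> bool" where
  "faithful_module k M \<longleftrightarrow>
     (\<forall>c\<in>carrier k. (\<forall>x\<in>carrier M. c \<odot>\<^bsub>M\<^esub> x = \<zero>\<^bsub>M\<^esub>) \<longrightarrow> c = \<zero>\<^bsub>k\<^esub>)"

text \<open>
  Quantification over all modules is quantification over all modules whose carrier is a subset
  of a type \<open>'u\<close>, which is passed as \<open>TYPE('u)\<close> and plays the role of a universe.
\<close>
definition projective_module ::
  "'u itself \<Rightarrow> ('k, 'x) ring_scheme \<Rightarrow> ('k, 'm, 'z) module_scheme \<Rightarrow> bool" where
  "projective_module _ k P \<longleftrightarrow>
     (\<forall>(M :: ('k, 'u) module) (N :: ('k, 'u) module). module k M \<longrightarrow> module k N \<longrightarrow>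
        (\<forall>g\<in>linear_maps k M N. \<forall>f\<in>linear_maps k P N. g ` carrier M = carrier N \<longrightarrow>
          (\<exists>h\<in>linear_maps k P M. \<forall>x\<in>carrier P. g (h x) = f x)))"


section \<open>Tensor products\<close>

text \<open>
  The tensor product of a right \<open>S\<close>-module \<open>M\<close> (action \<open>r\<close>) and a left \<open>S\<close>-module \<open>N\<close>
  (action \<open>l\<close>) is the free abelian group on \<open>M \<times> N\<close> modulo the usual relations.
\<close>
type_synonym ('m, 'n) tensor = "(('m \<times> 'n) \<Rightarrow>\<^sub>0 int) set"

definition tensor_relations ::
  "('m, 'y) ring_scheme \<Rightarrow> ('n, 'z) ring_scheme \<Rightarrow> 's set \<Rightarrow> ('m \<Rightarrow> 's \<Rightarrow> 'm) \<Rightarrow> ('s \<Rightarrow> 'n \<Rightarrow> 'n) \<Rightarrow>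
   (('m \<times> 'n) \<Rightarrow>\<^sub>0 int) set" where
  "tensor_relations M N S r l =
     {frag_of (x \<oplus>\<^bsub>M\<^esub> x', y) - frag_of (x, y) - frag_of (x', y) | x x' y.
        x \<in> carrier M \<and> x' \<in> carrier M \<and> y \<in> carrier N} \<union>
     {frag_of (x, y \<oplus>\<^bsub>N\<^esub> y') - frag_of (x, y) - frag_of (x, y') | x y y'.
        x \<in> carrier M \<and> y \<in> carrier N \<and> y' \<in> carrier N} \<union>
     {frag_of (r x s, y) - frag_of (x, l s y) | x s y.
        x \<in> carrier M \<and> s \<in> S \<and> y \<in> carrier N}"

definition tensor_kernel ::
  "('m, 'y) ring_scheme \<Rightarrow> ('n, 'z) ring_scheme \<Rightarrow> 's set \<Rightarrow> ('m \<Rightarrow> 's \<Rightarrow> 'm) \<Rightarrow> ('s \<Rightarrow> 'n \<Rightarrow> 'n) \<Rightarrow>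
   (('m \<times> 'n) \<Rightarrow>\<^sub>0 int) set" where
  "tensor_kernel M N S r l =
     generate (free_Abelian_group (carrier M \<times> carrier N)) (tensor_relations M N S r l)"

definition pure_tensor ::
  "('m, 'y) ring_scheme \<Rightarrow> ('n, 'z) ring_scheme \<Rightarrow> 's set \<Rightarrow> ('m \<Rightarrow> 's \<Rightarrow> 'm) \<Rightarrow> ('s \<Rightarrow> 'n \<Rightarrow> 'n) \<Rightarrow>
   'm \<Rightarrow> 'n \<Rightarrow> ('m, 'n) tensor" where
  "pure_tensor M N S r l x y =
     tensor_kernel M N S r l #>\<^bsub>free_Abelian_group (carrier M \<times> carrier N)\<^esub> frag_of (x, y)"

text \<open>The multiplicative part of the record is irrelevant here.\<close>
definition tensor_group ::
  "('m, 'y) ring_scheme \<Rightarrow> ('n, 'z) ring_scheme \<Rightarrow> 's set \<Rightarrow> ('m \<Rightarrow> 's \<Rightarrow> 'm) \<Rightarrow> ('s \<Rightarrow> 'n \<Rightarrow> 'n) \<Rightarrow>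
   ('m, 'n) tensor ring" where
  "tensor_group M N S r l =
     (let Q = free_Abelian_group (carrier M \<times> carrier N) Mod tensor_kernel M N S r l
      in \<lparr>carrier = carrier Q, monoid.mult = undefined, one = undefined,
          zero = one Q, add = monoid.mult Q\<rparr>)"


subsection \<open>Over the base ring\<close>

definition ktens ::
  "('k, 'x) ring_scheme \<Rightarrow> ('k, 'm, 'y) module_scheme \<Rightarrow> ('k, 'n, 'z) module_scheme \<Rightarrow>
   'm \<Rightarrow> 'n \<Rightarrow> ('m, 'n) tensor" where
  "ktens k M N = pure_tensor M N (carrier k) (\<lambda>x c. c \<odot>\<^bsub>M\<^esub> x) (\<lambda>c y. c \<odot>\<^bsub>N\<^esub> y)"

definition ktensor ::
  "('k, 'x) ring_scheme \<Rightarrow> ('k, 'm, 'y) module_scheme \<Rightarrow> ('k, 'n, 'z) module_scheme \<Rightarrow>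
   ('k, ('m, 'n) tensor) module" where
  "ktensor k M N =
     (let T = tensor_group M N (carrier k) (\<lambda>x c. c \<odot>\<^bsub>M\<^esub> x) (\<lambda>c y. c \<odot>\<^bsub>N\<^esub> y)
      in ring.extend T (module.fields
           (\<lambda>c. the_additive T T (\<lambda>f. \<forall>x\<in>carrier M. \<forall>y\<in>carrier N.
              f (ktens k M N x y) = ktens k M N (c \<odot>\<^bsub>M\<^esub> x) y))))"

text \<open>The map \<open>f \<otimes> g\<close>.\<close>
definition ktensor_map ::
  "('k, 'x) ring_scheme \<Rightarrow> ('k, 'm, 'y) module_scheme \<Rightarrow> ('k, 'n, 'z) module_scheme \<Rightarrow>
   ('k, 'p, 'v) module_scheme \<Rightarrow> ('k, 'q, 'w) module_scheme \<Rightarrow>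
   ('m \<Rightarrow> 'p) \<Rightarrow> ('n \<Rightarrow> 'q) \<Rightarrow> ('m, 'n) tensor \<Rightarrow> ('p, 'q) tensor" where
  "ktensor_map k M N P Q f g = the_additive (ktensor k M N) (ktensor k P Q)
     (\<lambda>h. \<forall>x\<in>carrier M. \<forall>y\<in>carrier N. h (ktens k M N x y) = ktens k P Q (f x) (g y))"

definition flat_module ::
  "'u itself \<Rightarrow> ('k, 'x) ring_scheme \<Rightarrow> ('k, 'm, 'z) module_scheme \<Rightarrow> bool" where
  "flat_module _ k P \<longleftrightarrow>
     (\<forall>(M :: ('k, 'u) module) (N :: ('k, 'u) module). module k M \<longrightarrow> module k N \<longrightarrow>
        (\<forall>f\<in>linear_maps k M N. inj_on f (carrier M) \<longrightarrow>
          inj_on (ktensor_map k P M P N (\<lambda>x. x) f) (carrier (ktensor k P M))))"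

text \<open>Tensor product algebra: \<open>(a \<otimes> b)(a' \<otimes> b') = aa' \<otimes> bb'\<close>.\<close>
definition tensor_alg ::
  "('k, 'x) ring_scheme \<Rightarrow> ('k, 'a, 'y) module_scheme \<Rightarrow> ('k, 'b, 'z) module_scheme \<Rightarrow>
   ('k, ('a, 'b) tensor) module" where
  "tensor_alg k A B =
     (let T = ktensor k A B; t = ktens k A B in
      T\<lparr>monoid.mult := (\<lambda>X Y.
           the_additive T T (\<lambda>f. \<forall>a\<in>carrier A. \<forall>b\<in>carrier B. f (t a b) =
             the_additive T T (\<lambda>g. \<forall>a'\<in>carrier A. \<forall>b'\<in>carrier B.
               g (t a' b') = t (a \<otimes>\<^bsub>A\<^esub> a') (b \<otimes>\<^bsub>B\<^esub> b')) Y) X),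
        one := t \<one>\<^bsub>A\<^esub> \<one>\<^bsub>B\<^esub>\<rparr>)"

type_synonym 'a tensor2 = "('a, 'a) tensor"
type_synonym 'a tensor3 = "('a, 'a tensor2) tensor"
type_synonym 'a tensor4 = "('a, 'a tensor3) tensor"

definition alg2 :: "('k, 'x) ring_scheme \<Rightarrow> ('k, 'a) module \<Rightarrow> ('k, 'a tensor2) module" where
  "alg2 k A = tensor_alg k A A"

definition alg3 :: "('k, 'x) ring_scheme \<Rightarrow> ('k, 'a) module \<Rightarrow> ('k, 'a tensor3) module" where
  "alg3 k A = tensor_alg k A (alg2 k A)"

definition alg4 :: "('k, 'x) ring_scheme \<Rightarrow> ('k, 'a) module \<Rightarrow> ('k, 'a tensor4) module" where
  "alg4 k A = tensor_alg k A (alg3 k A)"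

definition tens2 :: "('k, 'x) ring_scheme \<Rightarrow> ('k, 'a) module \<Rightarrow> 'a \<Rightarrow> 'a \<Rightarrow> 'a tensor2" where
  "tens2 k A a b = ktens k A A a b"

definition tens3 :: "('k, 'x) ring_scheme \<Rightarrow> ('k, 'a) module \<Rightarrow> 'a \<Rightarrow> 'a \<Rightarrow> 'a \<Rightarrow> 'a tensor3" where
  "tens3 k A a b c = ktens k A (alg2 k A) a (tens2 k A b c)"

definition tens4 ::
  "('k, 'x) ring_scheme \<Rightarrow> ('k, 'a) module \<Rightarrow> 'a \<Rightarrow> 'a \<Rightarrow> 'a \<Rightarrow> 'a \<Rightarrow> 'a tensor4" where
  "tens4 k A a b c d = ktens k A (alg3 k A) a (tens3 k A b c d)"

text \<open>
  \<open>sweedler3 k A T \<phi> R\<close> is \<open>\<phi> R\<^sup>1 R\<^sup>2 R\<^sup>3\<close> in \<open>T\<close>, summation understood: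
  the image of \<open>R\<close> under the additive map \<open>a \<otimes> b \<otimes> c \<mapsto> \<phi> a b c\<close>.
\<close>
definition sweedler3 ::
  "('k, 'x) ring_scheme \<Rightarrow> ('k, 'a) module \<Rightarrow> ('t, 'z) ring_scheme \<Rightarrow>
   ('a \<Rightarrow> 'a \<Rightarrow> 'a \<Rightarrow> 't) \<Rightarrow> 'a tensor3 \<Rightarrow> 't" where
  "sweedler3 k A T \<phi> R = the_additive (alg3 k A) T
     (\<lambda>f. \<forall>a\<in>carrier A. \<forall>b\<in>carrier A. \<forall>c\<in>carrier A. f (tens3 k A a b c) = \<phi> a b c) R"


section \<open>Azumaya algebras\<close>

definition center :: "('k, 'a) module \<Rightarrow> 'a set" where
  "center A = {z \<in> carrier A. \<forall>a\<in>carrier A. z \<otimes>\<^bsub>A\<^esub> a = a \<otimes>\<^bsub>A\<^esub> z}"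

definition central_algebra :: "('k, 'x) ring_scheme \<Rightarrow> ('k, 'a) module \<Rightarrow> bool" where
  "central_algebra k A \<longleftrightarrow> bij_betw (\<lambda>c. c \<odot>\<^bsub>A\<^esub> \<one>\<^bsub>A\<^esub>) (carrier k) (center A)"

definition op_algebra :: "('k, 'a) module \<Rightarrow> ('k, 'a) module" where
  "op_algebra A = A\<lparr>monoid.mult := (\<lambda>x y. y \<otimes>\<^bsub>A\<^esub> x)\<rparr>"

definition End_algebra :: "('k, 'x) ring_scheme \<Rightarrow> ('k, 'a) module \<Rightarrow> ('k, 'a \<Rightarrow> 'a) module" where
  "End_algebra k A =
     \<lparr>carrier = linear_maps k A A,
      monoid.mult = (\<lambda>g f. compose (carrier A) g f), one = (\<lambda>x\<in>carrier A. x),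
      zero = (\<lambda>x\<in>carrier A. \<zero>\<^bsub>A\<^esub>), add = (\<lambda>f g. \<lambda>x\<in>carrier A. f x \<oplus>\<^bsub>A\<^esub> g x),
      smult = (\<lambda>c f. \<lambda>x\<in>carrier A. c \<odot>\<^bsub>A\<^esub> f x)\<rparr>"

definition azumaya :: "'u itself \<Rightarrow> ('k, 'x) ring_scheme \<Rightarrow> ('k, 'a) module \<Rightarrow> bool" where
  "azumaya U k A \<longleftrightarrow>
     finitely_generated k A \<and> projective_module U k A \<and> faithful_module k A \<and>
     the_additive (tensor_alg k A (op_algebra A)) (End_algebra k A)
       (\<lambda>f. \<forall>a\<in>carrier A. \<forall>b\<in>carrier A. f (ktens k A (op_algebra A) a b) =
          (\<lambda>x\<in>carrier A. a \<otimes>\<^bsub>A\<^esub> x \<otimes>\<^bsub>A\<^esub> b))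
     \<in> ring_iso (tensor_alg k A (op_algebra A)) (End_algebra k A)"


section \<open>Bimodules\<close>

record ('k, 'a, 'm) bimodule = "('k, 'm) module" +
  lact :: "'a \<Rightarrow> 'm \<Rightarrow> 'm"  (infixl \<open>\<rightharpoonup>\<index>\<close> 70)
  ract :: "'m \<Rightarrow> 'a \<Rightarrow> 'm"  (infixl \<open>\<leftharpoonup>\<index>\<close> 70)

text \<open>The last two axioms say that the left and right actions of the base ring agree.\<close>
locale bimodule = module k M for k and A :: "('k, 'a) module" and
    M :: "('k, 'a, 'm) bimodule" (structure) +
  assumes lact_closed: "\<lbrakk>a \<in> carrier A; m \<in> carrier M\<rbrakk> \<Longrightarrow> a \<rightharpoonup> m \<in> carrier M"
    and ract_closed: "\<lbrakk>a \<in> carrier A; m \<in> carrier M\<rbrakk> \<Longrightarrow> m \<leftharpoonup> a \<in> carrier M"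
    and lact_l_distr: "\<lbrakk>a \<in> carrier A; b \<in> carrier A; m \<in> carrier M\<rbrakk> \<Longrightarrow>
      (a \<oplus>\<^bsub>A\<^esub> b) \<rightharpoonup> m = (a \<rightharpoonup> m) \<oplus>\<^bsub>M\<^esub> (b \<rightharpoonup> m)"
    and lact_r_distr: "\<lbrakk>a \<in> carrier A; m \<in> carrier M; n \<in> carrier M\<rbrakk> \<Longrightarrow>
      a \<rightharpoonup> (m \<oplus>\<^bsub>M\<^esub> n) = (a \<rightharpoonup> m) \<oplus>\<^bsub>M\<^esub> (a \<rightharpoonup> n)"
    and ract_l_distr: "\<lbrakk>a \<in> carrier A; m \<in> carrier M; n \<in> carrier M\<rbrakk> \<Longrightarrow>
      (m \<oplus>\<^bsub>M\<^esub> n) \<leftharpoonup> a = (m \<leftharpoonup> a) \<oplus>\<^bsub>M\<^esub> (n \<leftharpoonup> a)"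
    and ract_r_distr: "\<lbrakk>a \<in> carrier A; b \<in> carrier A; m \<in> carrier M\<rbrakk> \<Longrightarrow>
      m \<leftharpoonup> (a \<oplus>\<^bsub>A\<^esub> b) = (m \<leftharpoonup> a) \<oplus>\<^bsub>M\<^esub> (m \<leftharpoonup> b)"
    and lact_assoc: "\<lbrakk>a \<in> carrier A; b \<in> carrier A; m \<in> carrier M\<rbrakk> \<Longrightarrow>
      (a \<otimes>\<^bsub>A\<^esub> b) \<rightharpoonup> m = a \<rightharpoonup> (b \<rightharpoonup> m)"
    and ract_assoc: "\<lbrakk>a \<in> carrier A; b \<in> carrier A; m \<in> carrier M\<rbrakk> \<Longrightarrow>
      m \<leftharpoonup> (a \<otimes>\<^bsub>A\<^esub> b) = (m \<leftharpoonup> a) \<leftharpoonup> b"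
    and lact_one: "m \<in> carrier M \<Longrightarrow> \<one>\<^bsub>A\<^esub> \<rightharpoonup> m = m"
    and ract_one: "m \<in> carrier M \<Longrightarrow> m \<leftharpoonup> \<one>\<^bsub>A\<^esub> = m"
    and lact_ract: "\<lbrakk>a \<in> carrier A; b \<in> carrier A; m \<in> carrier M\<rbrakk> \<Longrightarrow>
      (a \<rightharpoonup> m) \<leftharpoonup> b = a \<rightharpoonup> (m \<leftharpoonup> b)"
    and lact_scalar: "\<lbrakk>c \<in> carrier k; m \<in> carrier M\<rbrakk> \<Longrightarrow> (c \<odot>\<^bsub>A\<^esub> \<one>\<^bsub>A\<^esub>) \<rightharpoonup> m = c \<odot>\<^bsub>M\<^esub> m"
    and ract_scalar: "\<lbrakk>c \<in> carrier k; m \<in> carrier M\<rbrakk> \<Longrightarrow> m \<leftharpoonup> (c \<odot>\<^bsub>A\<^esub> \<one>\<^bsub>A\<^esub>) = c \<odot>\<^bsub>M\<^esub> m"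

definition bimodule_maps ::
  "('k, 'x) ring_scheme \<Rightarrow> ('k, 'a) module \<Rightarrow> ('k, 'a, 'm) bimodule \<Rightarrow> ('k, 'a, 'n) bimodule \<Rightarrow>
   ('m \<Rightarrow> 'n) set" where
  "bimodule_maps k A M N = {f \<in> linear_maps k M N. \<forall>a\<in>carrier A. \<forall>m\<in>carrier M.
     f (a \<rightharpoonup>\<^bsub>M\<^esub> m) = a \<rightharpoonup>\<^bsub>N\<^esub> f m \<and> f (m \<leftharpoonup>\<^bsub>M\<^esub> a) = f m \<leftharpoonup>\<^bsub>N\<^esub> a}"

text \<open>\<open>M\<^sup>A\<close> as a \<open>k\<close>-module\<close>
definition invariants :: "('k, 'a) module \<Rightarrow> ('k, 'a, 'm) bimodule \<Rightarrow> ('k, 'm) module" where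
  "invariants A M =
     (module.truncate M)\<lparr>carrier := {m \<in> carrier M. \<forall>a\<in>carrier A. a \<rightharpoonup>\<^bsub>M\<^esub> m = m \<leftharpoonup>\<^bsub>M\<^esub> a}\<rparr>"

text \<open>\<open>A \<otimes> N\<close> with \<open>a (b \<otimes> n) c = abc \<otimes> n\<close>\<close>
definition induced_bimodule ::
  "('k, 'x) ring_scheme \<Rightarrow> ('k, 'a) module \<Rightarrow> ('k, 'n) module \<Rightarrow> ('k, 'a, ('a, 'n) tensor) bimodule" where
  "induced_bimodule k A N =
     (let T = ktensor k A N; t = ktens k A N in
      module.extend T (bimodule.fields
        (\<lambda>a. the_additive T T (\<lambda>f. \<forall>b\<in>carrier A. \<forall>n\<in>carrier N. f (t b n) = t (a \<otimes>\<^bsub>A\<^esub> b) n))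
        (\<lambda>X c. the_additive T T (\<lambda>f. \<forall>b\<in>carrier A. \<forall>n\<in>carrier N. f (t b n) = t (b \<otimes>\<^bsub>A\<^esub> c) n) X)))"

text \<open>\<open>A \<otimes> A\<close> with \<open>a (x \<otimes> y) b = ax \<otimes> yb\<close>\<close>
definition AA_bimodule :: "('k, 'x) ring_scheme \<Rightarrow> ('k, 'a) module \<Rightarrow> ('k, 'a, 'a tensor2) bimodule" where
  "AA_bimodule k A =
     (let T = ktensor k A A; t = tens2 k A in
      module.extend T (bimodule.fields
        (\<lambda>a. the_additive T T (\<lambda>f. \<forall>x\<in>carrier A. \<forall>y\<in>carrier A. f (t x y) = t (a \<otimes>\<^bsub>A\<^esub> x) y))
        (\<lambda>X b. the_additive T T (\<lambda>f. \<forall>x\<in>carrier A. \<forall>y\<in>carrier A. f (t x y) = t x (y \<otimes>\<^bsub>A\<^esub> b)) X)))"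

definition regular_bimodule :: "('k, 'a) module \<Rightarrow> ('k, 'a, 'a) bimodule" where
  "regular_bimodule A =
     module.extend A (bimodule.fields (\<lambda>a x. a \<otimes>\<^bsub>A\<^esub> x) (\<lambda>x a. x \<otimes>\<^bsub>A\<^esub> a))"

definition atens ::
  "('k, 'a) module \<Rightarrow> ('k, 'a, 'm) bimodule \<Rightarrow> ('k, 'a, 'n) bimodule \<Rightarrow> 'm \<Rightarrow> 'n \<Rightarrow> ('m, 'n) tensor" where
  "atens A M N = pure_tensor M N (carrier A) (\<lambda>m a. m \<leftharpoonup>\<^bsub>M\<^esub> a) (\<lambda>a n. a \<rightharpoonup>\<^bsub>N\<^esub> n)"

text \<open>\<open>M \<otimes>\<^sub>A N\<close>\<close>
definition atensor ::
  "('k, 'a) module \<Rightarrow> ('k, 'a, 'm) bimodule \<Rightarrow> ('k, 'a, 'n) bimodule \<Rightarrow>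
   ('k, 'a, ('m, 'n) tensor) bimodule" where
  "atensor A M N =
     (let T = tensor_group M N (carrier A) (\<lambda>m a. m \<leftharpoonup>\<^bsub>M\<^esub> a) (\<lambda>a n. a \<rightharpoonup>\<^bsub>N\<^esub> n);
          t = atens A M N;
          ind = (\<lambda>\<phi>. the_additive T T (\<lambda>f. \<forall>m\<in>carrier M. \<forall>n\<in>carrier N. f (t m n) = \<phi> m n))
      in \<lparr>carrier = carrier T, monoid.mult = undefined, one = undefined, zero = zero T, add = add T,
          smult = (\<lambda>c. ind (\<lambda>m n. t (c \<odot>\<^bsub>M\<^esub> m) n)),
          lact = (\<lambda>a. ind (\<lambda>m n. t (a \<rightharpoonup>\<^bsub>M\<^esub> m) n)),
          ract = (\<lambda>X a. ind (\<lambda>m n. t m (n \<leftharpoonup>\<^bsub>N\<^esub> a)) X)\<rparr>)"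


section \<open>The categories of modules and bimodules in a universe\<close>

text \<open>
  A tensor product lives on a new type, so it is replaced by an isomorphic copy on the universe
  \<open>'u\<close> along a chosen injection. If \<open>'u\<close> is infinite and at least as large as the base ring
  and the algebra, such an injection exists for every tensor product that occurs.
  Record fields that carry no module structure, and operations outside the carrier, are
  arbitrary; objects differing only there are distinct but isomorphic via the identity map.
\<close>
definition emb :: "'x set \<Rightarrow> 'x \<Rightarrow> 'u" where
  "emb S = (SOME e. inj_on e S)"

definition bimodule_copy :: "('k, 'a, 'x) bimodule \<Rightarrow> ('k, 'a, 'u) bimodule" where
  "bimodule_copy M =
     (let e = emb (carrier M); d = inv_into (carrier M) e in
      \<lparr>carrier = e ` carrier M, monoid.mult = undefined, one = undefined,
       zero = e \<zero>\<^bsub>M\<^esub>, add = (\<lambda>x y. e (d x \<oplus>\<^bsub>M\<^esub> d y)),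
       smult = (\<lambda>c x. e (c \<odot>\<^bsub>M\<^esub> d x)),
       lact = (\<lambda>a x. e (a \<rightharpoonup>\<^bsub>M\<^esub> d x)),
       ract = (\<lambda>x a. e (d x \<leftharpoonup>\<^bsub>M\<^esub> a))\<rparr>)"

type_synonym ('k, 'u) mod_arrow = "(('k, 'u) module, 'u) arrow"
type_synonym ('k, 'a, 'u) bimod_arrow = "(('k, 'a, 'u) bimodule, 'u) arrow"

definition Mod_cat ::
  "'u itself \<Rightarrow> ('k, 'x) ring_scheme \<Rightarrow> (('k, 'u) module, ('k, 'u) mod_arrow) category" where
  "Mod_cat _ k =
     \<lparr>Ob = {M. module k M},
      Hom = (\<lambda>M N. {\<lparr>src = M, fn = f, tgt = N\<rparr> | f. f \<in> linear_maps k M N}),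
      idn = id_arrow, cmp = comp_arrow\<rparr>"

text \<open>The copy in the universe of \<open>M \<otimes>\<^sub>A N\<close>, and its pure tensors\<close>

definition utensor ::
  "('k, 'a) module \<Rightarrow> ('k, 'a, 'u) bimodule \<Rightarrow> ('k, 'a, 'u) bimodule \<Rightarrow> ('k, 'a, 'u) bimodule" where
  "utensor A M N = bimodule_copy (atensor A M N)"

definition utens ::
  "('k, 'a) module \<Rightarrow> ('k, 'a, 'u) bimodule \<Rightarrow> ('k, 'a, 'u) bimodule \<Rightarrow> 'u \<Rightarrow> 'u \<Rightarrow> 'u" where
  "utens A M N m n = emb (carrier (atensor A M N)) (atens A M N m n)"

definition utensor_arrow ::
  "('k, 'a) module \<Rightarrow> ('k, 'a, 'u) bimod_arrow \<Rightarrow> ('k, 'a, 'u) bimod_arrow \<Rightarrow> ('k, 'a, 'u) bimod_arrow" where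
  "utensor_arrow A f g =
     (let S = utensor A (src f) (src g); T = utensor A (tgt f) (tgt g) in
      \<lparr>src = S,
       fn = the_additive S T (\<lambda>h. \<forall>m\<in>carrier (src f). \<forall>n\<in>carrier (src g).
              h (utens A (src f) (src g) m n) = utens A (tgt f) (tgt g) (fn f m) (fn g n)),
       tgt = T\<rparr>)"

definition uunit :: "('k, 'a) module \<Rightarrow> ('k, 'a, 'u) bimodule" where
  "uunit A = bimodule_copy (regular_bimodule A)"

definition uassoc ::
  "('k, 'a) module \<Rightarrow> ('k, 'a, 'u) bimodule \<Rightarrow> ('k, 'a, 'u) bimodule \<Rightarrow> ('k, 'a, 'u) bimodule \<Rightarrow>
   ('k, 'a, 'u) bimod_arrow" where
  "uassoc A M N P =
     (let MN = utensor A M N; NP = utensor A N P; S = utensor A MN P; T = utensor A M NP in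
      \<lparr>src = S,
       fn = the_additive S T (\<lambda>h. \<forall>m\<in>carrier M. \<forall>n\<in>carrier N. \<forall>p\<in>carrier P.
              h (utens A MN P (utens A M N m n) p) = utens A M NP m (utens A N P n p)),
       tgt = T\<rparr>)"

definition ulunit :: "('k, 'a) module \<Rightarrow> ('k, 'a, 'u) bimodule \<Rightarrow> ('k, 'a, 'u) bimod_arrow" where
  "ulunit A M =
     (let I = uunit A; S = utensor A I M in
      \<lparr>src = S,
       fn = the_additive S M (\<lambda>h. \<forall>a\<in>carrier A. \<forall>m\<in>carrier M.
              h (utens A I M (emb (carrier (regular_bimodule A)) a) m) = a \<rightharpoonup>\<^bsub>M\<^esub> m),
       tgt = M\<rparr>)"

definition urunit :: "('k, 'a) module \<Rightarrow> ('k, 'a, 'u) bimodule \<Rightarrow> ('k, 'a, 'u) bimod_arrow" where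
  "urunit A M =
     (let I = uunit A; S = utensor A M I in
      \<lparr>src = S,
       fn = the_additive S M (\<lambda>h. \<forall>a\<in>carrier A. \<forall>m\<in>carrier M.
              h (utens A M I m (emb (carrier (regular_bimodule A)) a)) = m \<leftharpoonup>\<^bsub>M\<^esub> a),
       tgt = M\<rparr>)"

definition Bimod_cat ::
  "'u itself \<Rightarrow> ('k, 'x) ring_scheme \<Rightarrow> ('k, 'a) module \<Rightarrow>
   (('k, 'a, 'u) bimodule, ('k, 'a, 'u) bimod_arrow) monoidal_category" where
  "Bimod_cat _ k A =
     \<lparr>Ob = {M. bimodule k A M},
      Hom = (\<lambda>M N. {\<lparr>src = M, fn = f, tgt = N\<rparr> | f. f \<in> bimodule_maps k A M N}),
      idn = id_arrow, cmp = comp_arrow,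
      tob = utensor A, tar = utensor_arrow A, unit_ob = uunit A,
      assoc = uassoc A, lunit = ulunit A, runit = urunit A\<rparr>"


section \<open>The adjoint pair \<open>(F, G)\<close>\<close>

definition F_ob :: "('k, 'x) ring_scheme \<Rightarrow> ('k, 'a) module \<Rightarrow> ('k, 'u) module \<Rightarrow> ('k, 'a, 'u) bimodule" where
  "F_ob k A N = bimodule_copy (induced_bimodule k A N)"

text \<open>The copy of \<open>a \<otimes> n\<close> in \<open>F(N)\<close>\<close>
definition F_tens :: "('k, 'x) ring_scheme \<Rightarrow> ('k, 'a) module \<Rightarrow> ('k, 'u) module \<Rightarrow> 'a \<Rightarrow> 'u \<Rightarrow> 'u" where
  "F_tens k A N a n = emb (carrier (induced_bimodule k A N)) (ktens k A N a n)"

definition F_functor ::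
  "('k, 'x) ring_scheme \<Rightarrow> ('k, 'a) module \<Rightarrow>
   (('k, 'u) module, ('k, 'u) mod_arrow, ('k, 'a, 'u) bimodule, ('k, 'a, 'u) bimod_arrow) cfunctor" where
  "F_functor k A =
     \<lparr>fob = F_ob k A,
      far = (\<lambda>f. \<lparr>src = F_ob k A (src f),
                  fn = the_additive (F_ob k A (src f)) (F_ob k A (tgt f))
                    (\<lambda>h. \<forall>a\<in>carrier A. \<forall>n\<in>carrier (src f).
                       h (F_tens k A (src f) a n) = F_tens k A (tgt f) a (fn f n)),
                  tgt = F_ob k A (tgt f)\<rparr>)\<rparr>"

definition G_functor ::
  "('k, 'a) module \<Rightarrow>
   (('k, 'a, 'u) bimodule, ('k, 'a, 'u) bimod_arrow, ('k, 'u) module, ('k, 'u) mod_arrow) cfunctor" where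
  "G_functor A =
     \<lparr>fob = invariants A,
      far = (\<lambda>f. \<lparr>src = invariants A (src f),
                  fn = restrict (fn f) (carrier (invariants A (src f))),
                  tgt = invariants A (tgt f)\<rparr>)\<rparr>"

definition FG_unit :: "('k, 'x) ring_scheme \<Rightarrow> ('k, 'a) module \<Rightarrow> ('k, 'u) module \<Rightarrow> ('k, 'u) mod_arrow" where
  "FG_unit k A N =
     \<lparr>src = N, fn = (\<lambda>n\<in>carrier N. F_tens k A N \<one>\<^bsub>A\<^esub> n), tgt = invariants A (F_ob k A N)\<rparr>"

definition FG_counit ::
  "('k, 'x) ring_scheme \<Rightarrow> ('k, 'a) module \<Rightarrow> ('k, 'a, 'u) bimodule \<Rightarrow> ('k, 'a, 'u) bimod_arrow" where
  "FG_counit k A M =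
     (let S = F_ob k A (invariants A M) in
      \<lparr>src = S,
       fn = the_additive S M (\<lambda>h. \<forall>a\<in>carrier A. \<forall>m\<in>carrier (invariants A M).
              h (F_tens k A (invariants A M) a m) = a \<rightharpoonup>\<^bsub>M\<^esub> m),
       tgt = M\<rparr>)"


section \<open>Canonical R-matrices\<close>

text \<open>\<open>A \<otimes> (A \<otimes> A)\<^sup>A\<close>, identified with its image in \<open>A \<otimes> A \<otimes> A\<close>\<close>
definition A_inv_AA :: "('k, 'x) ring_scheme \<Rightarrow> ('k, 'a) module \<Rightarrow> 'a tensor3 set" where
  "A_inv_AA k A =
     (let W = invariants A (AA_bimodule k A)
      in ktensor_map k A W A (alg2 k A) (\<lambda>x. x) (\<lambda>w. w) ` carrier (ktensor k A W))"

text \<open>In the last two equations the bound \<open>u, v, w\<close> are the legs of the second copy \<open>r\<close> of \<open>R\<close>.\<close>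
definition canonical_R_matrix :: "('k, 'x) ring_scheme \<Rightarrow> ('k, 'a) module \<Rightarrow> 'a tensor3 \<Rightarrow> bool" where
  "canonical_R_matrix k A R \<longleftrightarrow>
     R \<in> Units (alg3 k A) \<and>
     (\<forall>a\<in>carrier A.
        sweedler3 k A (alg3 k A) (\<lambda>x y z. tens3 k A x y (a \<otimes>\<^bsub>A\<^esub> z)) R =
        sweedler3 k A (alg3 k A) (\<lambda>x y z. tens3 k A (x \<otimes>\<^bsub>A\<^esub> a) y z) R \<and>
        sweedler3 k A (alg3 k A) (\<lambda>x y z. tens3 k A (a \<otimes>\<^bsub>A\<^esub> x) y z) R =
        sweedler3 k A (alg3 k A) (\<lambda>x y z. tens3 k A x (y \<otimes>\<^bsub>A\<^esub> a) z) R \<and>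
        sweedler3 k A (alg3 k A) (\<lambda>x y z. tens3 k A x (a \<otimes>\<^bsub>A\<^esub> y) z) R =
        sweedler3 k A (alg3 k A) (\<lambda>x y z. tens3 k A x y (z \<otimes>\<^bsub>A\<^esub> a)) R) \<and>
     sweedler3 k A (alg4 k A) (\<lambda>x y z. tens4 k A x y \<one>\<^bsub>A\<^esub> z) R =
     sweedler3 k A (alg4 k A) (\<lambda>x y z.
       sweedler3 k A (alg4 k A) (\<lambda>u v w. tens4 k A (u \<otimes>\<^bsub>A\<^esub> x) v (w \<otimes>\<^bsub>A\<^esub> y) z) R) R \<and>
     sweedler3 k A (alg4 k A) (\<lambda>x y z. tens4 k A x \<one>\<^bsub>A\<^esub> y z) R =
     sweedler3 k A (alg4 k A) (\<lambda>x y z.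
       sweedler3 k A (alg4 k A) (\<lambda>u v w. tens4 k A x (y \<otimes>\<^bsub>A\<^esub> u) v (z \<otimes>\<^bsub>A\<^esub> w)) R) R"

end

theory Submission
 imports Defs
begin

text \<open>
  The whole theorem turns on normalized elements: \<open>R\<close> in \<open>A \<otimes> (A \<otimes> A)\<^sup>A\<close> with
  \<open>R\<^sup>1R\<^sup>2 \<otimes> R\<^sup>3 = 1 \<otimes> 1\<close>. Each of the conditions amounts to the existence of one, up to
  centrality of \<open>A\<close> in (1) and freeness of \<open>A\<close> in (6). They are presented by normalized families,
  lists of first legs together with representatives of the invariant last two legs.

  For \<open>m\<close> in a bimodule \<open>X\<close> one has \<open>m = R\<^sup>1(R\<^sup>2mR\<^sup>3)\<close>, and \<open>R\<^sup>2mR\<^sup>3\<close> is invariant. Therefore bimodule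
  maps are determined by their values on invariants, and \<open>m \<mapsto> R\<^sup>1 \<otimes> R\<^sup>2mR\<^sup>3\<close> inverts the counit at
  \<open>X\<close>; for this the two sides are compared in \<open>A \<otimes> X\<close>, which contains \<open>A \<otimes> X\<^sup>A\<close> by flatness. So \<open>G\<close> is
  fully faithful, hence separable. Conversely, a separable \<open>G\<close> splits the counit naturally, and the
  section at \<open>A \<otimes> A\<close> takes \<open>1 \<otimes> 1\<close> to a normalized element (\<open>counit_hits_one\<close>).

  A normalized \<open>R\<close> satisfies \<open>z \<otimes> 1 = 1 \<otimes> z\<close> for central \<open>z\<close>, and then \<open>R\<^sup>1 \<otimes> R\<^sup>2cR\<^sup>3 = c \<otimes> 1\<close>
  (\<open>sandwich\<close>). Inserting one normalized element into another by means of this identity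
  (\<open>normalized_exchange\<close>) gives at once that they are equal and that conjugation by \<open>R\<close> permutes the
  factors of \<open>A \<otimes> A \<otimes> A\<close> cyclically. The two hexagon identities and the inverse \<open>R\<^sup>1 \<otimes> R\<^sup>3 \<otimes> R\<^sup>2\<close> are
  further evaluations of the same kind, so \<open>R\<close> is a canonical R-matrix. In the opposite direction,
  cancelling the invertible \<open>R\<close> in a hexagon identity shows that a canonical R-matrix satisfies
  \<open>R\<^sup>1R\<^sup>2 \<otimes> R\<^sup>3 = 1 \<otimes> 1\<close>; that it lies in \<open>A \<otimes> (A \<otimes> A)\<^sup>A\<close> is read off in a basis of the first factor
  when \<open>A\<close> is free.

  Braidings and canonical R-matrices correspond because every element of a bimodule is the image of
  \<open>1 \<otimes> 1\<close> under a map from \<open>A \<otimes> A\<close>: by naturality a braiding is \<open>m \<otimes> n \<mapsto> R\<^sup>1nR\<^sup>2 \<otimes> mR\<^sup>3\<close> for the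
  element \<open>R\<close> given by its value at the generators (\<open>natural_family_braid_by\<close>), and the axioms of a
  braiding, evaluated at generators, are the identities for \<open>R\<close>. With the previous paragraph this
  gives uniqueness of the braiding for free \<open>A\<close>.

  Finally, (1) means that \<open>A\<close> is central and has a normalized \<open>R\<close>. If \<open>A\<close> is central then \<open>c \<mapsto> R\<^sup>2cR\<^sup>3\<close>
  has scalar values, so that \<open>c = R\<^sup>1(R\<^sup>2cR\<^sup>3)\<close> is a dual basis; since \<open>A\<close> is faithful, its trace ideal
  is \<open>k\<close>, whence a retraction \<open>A \<rightarrow> k\<close> which makes the unit \<open>N \<rightarrow> (A \<otimes> N)\<^sup>A\<close> bijective. The same
  dual basis makes \<open>A\<close> an Azumaya algebra, the inverse of \<open>A \<otimes> A\<^sup>o\<^sup>p \<rightarrow> End(A)\<close> being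
  \<open>f \<mapsto> f(R\<^sup>1)R\<^sup>2 \<otimes> R\<^sup>3\<close>. For an Azumaya algebra, the elements of \<open>A \<otimes> A\<close> that correspond to the
  functionals of a dual basis are the last two legs of a normalized \<open>R\<close>. Over a field,
  \<open>z \<otimes> 1 = 1 \<otimes> z\<close> forces \<open>z\<close> to be a scalar, so a nonzero \<open>A\<close> is central as soon as \<open>R\<close> exists.
\<close>

text \<open>Products in rings are written \<open>*\<close>, to leave \<open>\<otimes>\<close> for the tensor product of bimodules; an identifier set
  as a subscript serves as structure index.\<close>
syntax "_index" :: "logic => index"  ("\<^sub>_" [1000] 1000)
notation lact (infixl "|>\<index>" 70) and ract (infixl "<|\<index>" 70)
no_notation times (infixl "*" 70) and mult (infixl "\<otimes>\<index>" 70)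
notation mult (infixl "*\<index>" 70)

abbreviation carrier_mem :: "'a => ('a, 'b) partial_object_scheme => bool" (infix "\<in>:" 50) where
 "x \<in>: M \<equiv> x \<in> carrier M"
abbreviation "cmpa \<equiv> comp_arrow"
lemmas (in abelian_group) ab_gr = abelian_group_axioms

section \<open>Finite sums over lists\<close>

text \<open>A tensor is a sum of pure tensors, possibly with repetitions; lists record such sums.\<close>
primrec lsum :: "('g, 'z) ring_scheme => ('x => 'g) => 'x list => 'g" where
 "lsum G f [] = \<zero>\<^sub>G"
| "lsum G f (x # xs) = f x \<oplus>\<^sub>G lsum G f xs"

lemma lsum_cong: "(!!x. x \<in> set xs ==> f x = g x) ==> lsum G f xs = lsum G g xs"
 by (induction xs) auto

lemma lsum_map: "lsum G f (map h xs) = lsum G (%x. f (h x)) xs"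
 by (induction xs) auto

context abelian_group
begin

lemma lsum_closed [simp, intro]:
 "(!!x. x \<in> set xs ==> f x \<in>: G) ==> lsum G f xs \<in>: G"
 by (induction xs) auto

lemma lsum_append:
 "(!!x. x \<in> set xs \<union> set ys ==> f x \<in>: G) ==>
  lsum G f (xs @ ys) = lsum G f xs \<oplus> lsum G f ys"
 by (induction xs) (auto simp: a_assoc)

lemma lsum_zero: "lsum G (%x. \<zero>) xs = \<zero>"
 by (induction xs) auto

lemma lsum_add:
 "(!!x. x \<in> set xs ==> f x \<in>: G) ==> (!!x. x \<in> set xs ==> g x \<in>: G) ==>
  lsum G (%x. f x \<oplus> g x) xs = lsum G f xs \<oplus> lsum G g xs"
proof (induction xs)
 case (Cons x xs)
 then have "f x \<in>: G" "g x \<in>: G" "lsum G f xs \<in>: G" "lsum G g xs \<in>: G"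
  by auto
 with Cons show ?case by (simp add: a_ac)
qed simp

lemma lsum_minus:
 "(!!x. x \<in> set xs ==> f x \<in>: G) ==> lsum G (%x. \<ominus> f x) xs = \<ominus> lsum G f xs"
proof (induction xs)
 case Nil
 show ?case by (simp add: a_inv_def)
next
 case (Cons x xs)
 then have "f x \<in>: G" "lsum G f xs \<in>: G" by auto
 with Cons show ?case by (simp add: minus_add)
qed

lemma lsum_swap:
 "(!!x y. x \<in> set xs ==> y \<in> set ys ==> f x y \<in>: G) ==>
  lsum G (%x. lsum G (%y. f x y) ys) xs = lsum G (%y. lsum G (%x. f x y) xs) ys"
proof (induction xs)
 case Nil
 then show ?case by (simp add: lsum_zero)
next
 case (Cons x xs)
 have "lsum G (%y. f x y \<oplus> lsum G (%x. f x y) xs) ys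
   = lsum G (%y. f x y) ys \<oplus> lsum G (%y. lsum G (%x. f x y) xs) ys"
  using Cons.prems by (intro lsum_add) auto
 with Cons show ?case by simp
qed

lemma add_self_zero: "x \<in>: G ==> x \<oplus> x = x ==> x = \<zero>"
 by (metis add.r_cancel_one')

end

section \<open>Additive maps\<close>

text \<open>In contrast to \<open>additive_maps\<close>, the values outside the carrier are arbitrary.\<close>
definition additive_on :: "('m, 'y) ring_scheme => ('n, 'z) ring_scheme => ('m => 'n) => bool" where
 "additive_on M N f \<longleftrightarrow> f \<in> carrier M \<rightarrow> carrier N &
   (\<forall>x\<in>carrier M. \<forall>y\<in>carrier M. f (x \<oplus>\<^sub>M y) = f x \<oplus>\<^sub>N f y)"

lemma additive_maps_iff: "f \<in> additive_maps M N \<longleftrightarrow> additive_on M N f & f \<in> extensional (carrier M)"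
 unfolding additive_maps_def additive_on_def by (auto simp: PiE_def)

lemma additive_onD:
 assumes "additive_on M N f"
 shows "x \<in>: M ==> f x \<in>: N"
  and "x \<in>: M ==> y \<in>: M ==> f (x \<oplus>\<^sub>M y) = f x \<oplus>\<^sub>N f y"
 using assms unfolding additive_on_def by auto

lemma additive_on_restrict:
 "abelian_group M ==> additive_on M N f ==> restrict f (carrier M) \<in> additive_maps M N"
 unfolding additive_maps_iff additive_on_def
 by (auto simp: abelian_group.axioms abelian_monoid.a_closed abelian_group.axioms(1))

lemma additive_on_zero:
 assumes "abelian_group M" "abelian_group N" "additive_on M N f"
 shows "f \<zero>\<^sub>M = \<zero>\<^sub>N"
proof -
 interpret M: abelian_group M by fact
 interpret N: abelian_group N by fact
 have "f \<zero>\<^sub>M \<oplus>\<^sub>N f \<zero>\<^sub>M = f \<zero>\<^sub>M" "f \<zero>\<^sub>M \<in>: N"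
  using assms(3) unfolding additive_on_def by (force, force)
 then show ?thesis by (metis N.add_self_zero)
qed

lemma additive_on_minus:
 assumes "abelian_group M" "abelian_group N" "additive_on M N f" "x \<in>: M"
 shows "f (\<ominus>\<^sub>M x) = \<ominus>\<^sub>N f x"
proof -
 interpret M: abelian_group M by fact
 interpret N: abelian_group N by fact
 note f = additive_onD[OF assms(3)]
 have "f (\<ominus>\<^sub>M x) \<oplus>\<^sub>N f x = \<zero>\<^sub>N"
  using assms(4) f(2)[of "\<ominus>\<^sub>M x" x] additive_on_zero[OF assms(1-3)] by (simp add: M.l_neg)
 then show ?thesis using assms(4) f(1) by (metis M.a_inv_closed N.minus_equality)
qed

lemma additive_on_lsum:
 assumes "abelian_group M" "abelian_group N" "additive_on M N h"
  and "!!x. x \<in> set xs ==> f x \<in>: M"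
 shows "h (lsum M f xs) = lsum N (%x. h (f x)) xs"
proof -
 interpret M: abelian_group M by fact
 show ?thesis using assms(4)
 proof (induction xs)
  case Nil
  then show ?case using additive_on_zero[OF assms(1-3)] by simp
 next
  case (Cons x xs)
  then have "f x \<in>: M" "lsum M f xs \<in>: M" by auto
  with Cons show ?case by (simp add: additive_onD(2)[OF assms(3)])
 qed
qed

lemma additive_on_compose:
 "additive_on M N f ==> additive_on N P g ==> additive_on M P (%x. g (f x))"
 unfolding additive_on_def by (auto simp: Pi_iff)

lemma the_additive_eq:
 assumes "f \<in> additive_maps M N" "Q f" "!!g. g \<in> additive_maps M N ==> Q g ==> g = f"
 shows "the_additive M N Q = f"
 unfolding the_additive_def using assms by blast

section \<open>The universal property of tensor products\<close>

definition balanced_map ::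
 "('m, 'y) ring_scheme => ('n, 'z) ring_scheme => 's set => ('m => 's => 'm) => ('s => 'n => 'n) =>
  ('g, 'w) ring_scheme => ('m => 'n => 'g) => bool" where
 "balanced_map M N S r l G \<phi> \<longleftrightarrow>
   (\<forall>x\<in>carrier M. additive_on N G (\<phi> x)) &
   (\<forall>y\<in>carrier N. additive_on M G (%x. \<phi> x y)) &
   (\<forall>x\<in>carrier M. \<forall>s\<in>S. \<forall>y\<in>carrier N. \<phi> (r x s) y = \<phi> x (l s y))"

text \<open>
  All the tensor products that occur are groups isomorphic to the quotient \<open>tensor_group\<close>, be
  they modules, algebras, bimodules or copies in the universe. This predicate covers all of them,
  so that the universal property needs to be proved once.
\<close>
definition is_tensor ::
 "('m, 'y) ring_scheme => ('n, 'z) ring_scheme => 's set => ('m => 's => 'm) => ('s => 'n => 'n) =>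
  ('t, 'w) ring_scheme => ('m => 'n => 't) => bool" where
 "is_tensor M N S r l T t \<longleftrightarrow>
   abelian_group M & abelian_group N & abelian_group T &
   (\<forall>x\<in>carrier M. \<forall>s\<in>S. r x s \<in>: M) & (\<forall>s\<in>S. \<forall>y\<in>carrier N. l s y \<in>: N) &
   (\<exists>e. bij_betw e (carrier (tensor_group M N S r l)) (carrier T) &
     additive_on (tensor_group M N S r l) T e &
     (\<forall>x\<in>carrier M. \<forall>y\<in>carrier N. t x y = e (pure_tensor M N S r l x y)))"

locale tensor_setup = M: abelian_group M + N: abelian_group N
 for M :: "('m, 'y) ring_scheme" and N :: "('n, 'z) ring_scheme" +
 fixes S :: "'s set" and r :: "'m => 's => 'm" and l :: "'s => 'n => 'n"
 assumes r_closed: "!!x s. x \<in>: M ==> s \<in> S ==> r x s \<in>: M"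
  and l_closed: "!!s y. s \<in> S ==> y \<in>: N ==> l s y \<in>: N"
begin

abbreviation "F == free_Abelian_group (carrier M \<times> carrier N)"
abbreviation "Rel == tensor_relations M N S r l"
abbreviation "K == tensor_kernel M N S r l"
abbreviation "T == tensor_group M N S r l"
abbreviation "t == pure_tensor M N S r l"

lemma F_diff: "x \<in>: F ==> y \<in>: F ==> x - y \<in>: F"
 using keys_diff[of x y] by auto

lemma Rel_sub: "Rel \<subseteq> carrier F"
 unfolding tensor_relations_def
 using r_closed l_closed
 by (safe; intro F_diff; simp add: M.a_closed N.a_closed)

lemma K_normal: "K \<lhd> F"
proof -
 interpret F: comm_group F by (rule abelian_free_Abelian_group)
 have "subgroup K F" unfolding tensor_kernel_def by (rule F.generate_is_subgroup[OF Rel_sub])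
 then show ?thesis by (rule F.subgroup_imp_normal)
qed

lemma add_monoid_T: "add_monoid T = F Mod K"
 by (simp add: tensor_group_def FactGroup_def)

lemma T_abelian: "abelian_group T"
proof -
 interpret F: comm_group F by (rule abelian_free_Abelian_group)
 interpret K: normal K F by (rule K_normal)
 have "comm_group (F Mod K)" by (rule F.abelian_FactGroup) (rule K.is_subgroup)
 then have "comm_group (add_monoid T)" using add_monoid_T by simp
 then show ?thesis
  by (intro abelian_group.intro abelian_group_axioms.intro abelian_monoid.intro comm_group.axioms)
qed

lemma T_carrier: "carrier T = (%c. K #>\<^sub>F c) ` carrier F"
 by (auto simp: tensor_group_def FactGroup_def RCOSETS_def)

lemma T_add: "x \<in>: F ==> y \<in>: F ==>
  (K #>\<^sub>F x) \<oplus>\<^sub>T (K #>\<^sub>F y) = K #>\<^sub>F (x + y)"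
 using normal.rcos_sum[OF K_normal, of x y] by (simp add: tensor_group_def FactGroup_def)

lemma coset_eq: 
 assumes "x - y \<in> K" "x \<in>: F" "y \<in>: F"
 shows "K #>\<^sub>F x = K #>\<^sub>F y"
proof -
 interpret F: comm_group F by (rule abelian_free_Abelian_group)
 interpret K: normal K F by (rule K_normal)
 have "x \<in> K #>\<^sub>F y"
  using K.rcos_module[OF F.is_group, of y x] assms by simp
 then show ?thesis using F.repr_independence[of x K y] K.is_subgroup assms by simp
qed

lemma Rel_K: "x \<in> Rel ==> x \<in> K"
 unfolding tensor_kernel_def by (rule generate.incl)

lemma t_closed: "x \<in>: M ==> y \<in>: N ==> t x y \<in>: T"
 unfolding pure_tensor_def T_carrier by (rule imageI) simp

lemma t_add_left:
 assumes "x \<in>: M" "x' \<in>: M" "y \<in>: N"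
 shows "t (x \<oplus>\<^sub>M x') y = t x y \<oplus>\<^sub>T t x' y"
proof -
 have c: "frag_of (x, y) \<in>: F" "frag_of (x', y) \<in>: F" "frag_of (x \<oplus>\<^sub>M x', y) \<in>: F"
  using assms by auto
 have "frag_of (x \<oplus>\<^sub>M x', y) - frag_of (x, y) - frag_of (x', y) \<in> Rel"
  using assms unfolding tensor_relations_def by blast
 then have "frag_of (x \<oplus>\<^sub>M x', y) - (frag_of (x, y) + frag_of (x', y)) \<in> K"
  by (intro Rel_K) (simp add: algebra_simps)
 moreover have "frag_of (x, y) + frag_of (x', y) \<in>: F"
  using c keys_add[of "frag_of (x,y)" "frag_of (x',y)"] by auto
 ultimately show ?thesis unfolding pure_tensor_def using c by (simp only: T_add coset_eq)
qed

lemma t_add_right: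
 assumes "x \<in>: M" "y \<in>: N" "y' \<in>: N"
 shows "t x (y \<oplus>\<^sub>N y') = t x y \<oplus>\<^sub>T t x y'"
proof -
 have c: "frag_of (x, y) \<in>: F" "frag_of (x, y') \<in>: F" "frag_of (x, y \<oplus>\<^sub>N y') \<in>: F"
  using assms by auto
 have "frag_of (x, y \<oplus>\<^sub>N y') - frag_of (x, y) - frag_of (x, y') \<in> Rel"
  using assms unfolding tensor_relations_def by blast
 then have "frag_of (x, y \<oplus>\<^sub>N y') - (frag_of (x, y) + frag_of (x, y')) \<in> K"
  by (intro Rel_K) (simp add: algebra_simps)
 moreover have "frag_of (x, y) + frag_of (x, y') \<in>: F"
  using c keys_add[of "frag_of (x,y)" "frag_of (x,y')"] by auto
 ultimately show ?thesis unfolding pure_tensor_def using c by (simp only: T_add coset_eq)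
qed

lemma t_balanced:
 assumes "x \<in>: M" "s \<in> S" "y \<in>: N"
 shows "t (r x s) y = t x (l s y)"
proof -
 have "frag_of (r x s, y) - frag_of (x, l s y) \<in> Rel"
  using assms unfolding tensor_relations_def by blast
 then show ?thesis unfolding pure_tensor_def
  using assms r_closed l_closed by (intro coset_eq Rel_K) auto
qed

text \<open>A balanced map extends to the free abelian group and kills the relations.\<close>
lemma t_lift:
 assumes G: "abelian_group (G :: ('g, 'w) ring_scheme)" and \<phi>: "balanced_map M N S r l G \<phi>"
 shows "\<exists>f. additive_on T G f & (\<forall>x\<in>carrier M. \<forall>y\<in>carrier N. f (t x y) = \<phi> x y)"
proof -
 interpret F: comm_group F by (rule abelian_free_Abelian_group)
 interpret G: abelian_group G by (rule G)
 have cl: "\<phi> x y \<in>: G" if "x \<in>: M" "y \<in>: N" for x y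
  using \<phi> that unfolding balanced_map_def additive_on_def by blast
 have "(%(x, y). \<phi> x y) ` (carrier M \<times> carrier N) \<subseteq> carrier (add_monoid G)" using cl by auto
 then obtain h where h: "h \<in> hom F (add_monoid G)"
  and hf: "!!p. p \<in> carrier M \<times> carrier N ==> h (frag_of p) = (%(x, y). \<phi> x y) p"
  using comm_group.free_Abelian_group_universal[OF G.a_comm_group] by metis
 interpret h: group_hom F "add_monoid G" h
  using h by (simp add: group_hom_def group_hom_axioms_def G.a_group)
 have hdiff: "h (a - b) = h a \<oplus>\<^sub>G (\<ominus>\<^sub>G h b)" if "a \<in>: F" "b \<in>: F" for a b
 proof -
  have "h (a + (- b)) = h a \<oplus>\<^sub>G h (- b)"
   using h.hom_mult[of a "- b"] that by simp
  moreover have "h (- b) = \<ominus>\<^sub>G h b"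
   using h.hom_inv[of b] that by (simp add: a_inv_def)
  ultimately show ?thesis by simp
 qed
 have hc: "h a \<in>: G" if "a \<in>: F" for a using h.hom_closed that by simp
 have "h q = \<zero>\<^sub>G" if "q \<in> Rel" for q
  using that unfolding tensor_relations_def
 proof (elim UnE CollectE exE conjE)
  fix x x' y assume q: "q = frag_of (x \<oplus>\<^sub>M x', y) - frag_of (x, y) - frag_of (x', y)"
   and c: "x \<in>: M" "x' \<in>: M" "y \<in>: N"
  have "\<phi> (x \<oplus>\<^sub>M x') y = \<phi> x y \<oplus>\<^sub>G \<phi> x' y"
   using \<phi> c unfolding balanced_map_def additive_on_def by blast
  then show ?thesis unfolding q using c cl
   by (subst hdiff; (intro F_diff)?; simp add: hf hdiff M.a_closed)
     (metis G.add.inv_solve_right G.add.m_comm G.minus_closed G.r_neg G.minus_eq G.a_closed)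
 next
  fix x y y' assume q: "q = frag_of (x, y \<oplus>\<^sub>N y') - frag_of (x, y) - frag_of (x, y')"
   and c: "x \<in>: M" "y \<in>: N" "y' \<in>: N"
  have "\<phi> x (y \<oplus>\<^sub>N y') = \<phi> x y \<oplus>\<^sub>G \<phi> x y'"
   using \<phi> c unfolding balanced_map_def additive_on_def by blast
  then show ?thesis unfolding q using c cl
   by (subst hdiff; (intro F_diff)?; simp add: hf hdiff N.a_closed)
     (metis G.add.inv_solve_right G.add.m_comm G.minus_closed G.r_neg G.minus_eq G.a_closed)
 next
  fix x s y assume q: "q = frag_of (r x s, y) - frag_of (x, l s y)"
   and c: "x \<in>: M" "s \<in> S" "y \<in>: N"
  have "\<phi> (r x s) y = \<phi> x (l s y)"
   using \<phi> c unfolding balanced_map_def by blast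
  then show ?thesis unfolding q using c cl r_closed l_closed
   by (subst hdiff) (simp_all add: hf G.r_neg)
 qed
 then have hz: "h q = \<one>\<^bsub>add_monoid G\<^esub>" if "q \<in> Rel" for q using that by simp
 have "Rel \<subseteq> kernel F (add_monoid G) h"
  unfolding kernel_def by (intro subsetI CollectI conjI hz subsetD[OF Rel_sub])
 then have Kk: "K \<subseteq> kernel F (add_monoid G) h"
  unfolding tensor_kernel_def by (rule F.generate_subgroup_incl[OF _ h.subgroup_kernel])
 have "h x = h y" if "x \<in>: F" "y \<in>: F" "K #>\<^sub>F x = K #>\<^sub>F y" for x y
 proof -
  interpret K: normal K F by (rule K_normal)
  have "x \<in> K #>\<^sub>F y" using F.rcos_self[OF that(1) K.is_subgroup] that(3) by simp
  then have "x *\<^sub>F inv\<^bsub>F\<^esub> y \<in> K" using K.rcos_module[OF F.is_group, of y x] that by simp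
  then have "x - y \<in> K" using that by simp
  then have "h (x - y) = \<zero>\<^sub>G" using Kk by (auto simp: kernel_def)
  then have "h x \<oplus>\<^sub>G (\<ominus>\<^sub>G h y) = \<zero>\<^sub>G" using hdiff that by simp
  then show ?thesis using hc that by (metis G.add.inv_solve_right G.l_zero G.zero_closed)
 qed
 then obtain g where g: "g \<in> hom (F Mod K) (add_monoid G)"
   "!!x. x \<in>: F ==> g (K #>\<^sub>F x) = h x"
  using FactGroup_universal[OF h K_normal] by metis
 have "additive_on T G g"
  using g(1) unfolding add_monoid_T[symmetric] additive_on_def hom_def by auto
 moreover have "g (t x y) = \<phi> x y" if "x \<in>: M" "y \<in>: N" for x y
  unfolding pure_tensor_def using g(2) hf that by simp
 ultimately show ?thesis by blast
qed

text \<open>Signs are absorbed by a factor, so every element is a plain sum of pure tensors.\<close>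
lemma t_rep:
 assumes "X \<in>: T"
 shows "\<exists>xs. set xs \<subseteq> carrier M \<times> carrier N & X = lsum T (%(x, y). t x y) xs"
proof -
 interpret T: abelian_group T by (rule T_abelian)
 define P where "P X \<longleftrightarrow> X \<in>: T &
  (\<exists>xs. set xs \<subseteq> carrier M \<times> carrier N & X = lsum T (%(x, y). t x y) xs)" for X
 have pure: "P (t x y)" if "x \<in>: M" "y \<in>: N" for x y
  unfolding P_def using that t_closed[OF that] by (intro conjI exI[of _ "[(x, y)]"]) auto
 have zero: "P \<zero>\<^sub>T" unfolding P_def by (intro conjI exI[of _ "[]"]) auto
 have add: "P (X \<oplus>\<^sub>T Y)" if "P X" "P Y" for X Y
 proof -
  from that obtain xs ys where "set xs \<subseteq> carrier M \<times> carrier N" "set ys \<subseteq> carrier M \<times> carrier N"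
   "X = lsum T (%(x, y). t x y) xs" "Y = lsum T (%(x, y). t x y) ys" unfolding P_def by blast
  moreover then have "lsum T (%(x, y). t x y) (xs @ ys) = X \<oplus>\<^sub>T Y"
   by (subst T.lsum_append) (auto intro: t_closed)
  ultimately show ?thesis using that unfolding P_def
   by (intro conjI exI[of _ "xs @ ys"]) auto
 qed
 have tneg: "t (\<ominus>\<^sub>M x) y = \<ominus>\<^sub>T t x y" if "x \<in>: M" "y \<in>: N" for x y
 proof -
  have "additive_on M T (%x. t x y)" unfolding additive_on_def using that t_closed t_add_left by auto
  from additive_on_minus[OF M.ab_gr T_abelian this that(1)] show ?thesis .
 qed
 have neg: "P (\<ominus>\<^sub>T X)" if "P X" for X
 proof -
  from that obtain xs where xs: "set xs \<subseteq> carrier M \<times> carrier N"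
   "X = lsum T (%(x, y). t x y) xs" unfolding P_def by blast
  have "lsum T (%(x, y). t x y) (map (%(x, y). (\<ominus>\<^sub>M x, y)) xs) = lsum T (%p. \<ominus>\<^sub>T (case p of (x, y) => t x y)) xs"
   unfolding lsum_map using xs(1) by (intro lsum_cong) (auto simp: tneg)
  also have "... = \<ominus>\<^sub>T X"
   unfolding xs(2) using xs(1) by (intro T.lsum_minus) (auto intro: t_closed)
  finally have e: "\<ominus>\<^sub>T X = lsum T (%(x, y). t x y) (map (%(x, y). (\<ominus>\<^sub>M x, y)) xs)" by (rule sym)
  have c: "set (map (%(x, y). (\<ominus>\<^sub>M x, y)) xs) \<subseteq> carrier M \<times> carrier N"
   using xs(1) by auto
  have "\<ominus>\<^sub>T X \<in>: T" using that unfolding P_def by simp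
  then show ?thesis using c e unfolding P_def by blast
 qed
 obtain c where c: "c \<in>: F" "X = K #>\<^sub>F c" using assms T_carrier by auto
 have "K #>\<^sub>F 0 = \<zero>\<^sub>T"
 proof (rule T.add_self_zero)
  show "K #>\<^sub>F 0 \<in>: T" unfolding T_carrier by (rule imageI) simp
  show "(K #>\<^sub>F 0) \<oplus>\<^sub>T (K #>\<^sub>F 0) = K #>\<^sub>F 0"
   by (subst T_add) simp_all
 qed
 then have P0: "P (K #>\<^sub>F 0)" using zero by simp
 have Pdiff: "P (K #>\<^sub>F (x - y))"
  if "x \<in>: F" "y \<in>: F" "P (K #>\<^sub>F x)" "P (K #>\<^sub>F y)" for x y
 proof -
  have cl: "K #>\<^sub>F z \<in>: T" if "z \<in>: F" for z
   unfolding T_carrier using that by (rule imageI)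
  have "(K #>\<^sub>F (x - y)) \<oplus>\<^sub>T (K #>\<^sub>F y) = K #>\<^sub>F x"
   using T_add[OF F_diff[OF that(1,2)] that(2)] by simp
  then have "K #>\<^sub>F (x - y) = (K #>\<^sub>F x) \<oplus>\<^sub>T (\<ominus>\<^sub>T (K #>\<^sub>F y))"
   using cl[OF that(1)] cl[OF that(2)] cl[OF F_diff[OF that(1,2)]] by (metis T.add.inv_solve_right)
  then show ?thesis using add neg that by simp
 qed
 have Pfrag: "P (K #>\<^sub>F frag_of a)" if "a \<in> carrier M \<times> carrier N" for a
  using pure[of "fst a" "snd a"] that by (auto simp: pure_tensor_def)
 have "P (K #>\<^sub>F c)"
  by (rule free_Abelian_group_induct[of c "carrier M \<times> carrier N"])
    (use c(1) P0 Pdiff Pfrag in auto)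
 then show ?thesis using c(2) P_def by blast
qed

end

lemma is_tensorD:
 assumes "is_tensor M N S r l T t"
 shows "abelian_group M" "abelian_group N" "abelian_group T"
  and "!!x s. x \<in>: M ==> s \<in> S ==> r x s \<in>: M"
  and "!!s y. s \<in> S ==> y \<in>: N ==> l s y \<in>: N"
 using assms unfolding is_tensor_def by blast+

lemma is_tensor_balanced:
 assumes "is_tensor M N S r l T t"
 shows "balanced_map M N S r l T t"
proof -
 interpret M: abelian_group M by (rule is_tensorD[OF assms])
 interpret N: abelian_group N by (rule is_tensorD[OF assms])
 interpret tensor_setup M N S r l
  by unfold_locales (use is_tensorD[OF assms] in auto)
 obtain e where e: "additive_on (tensor_group M N S r l) T e"
  "!!x y. x \<in>: M ==> y \<in>: N ==> t x y = e (pure_tensor M N S r l x y)"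
  using assms unfolding is_tensor_def by blast
 show ?thesis
  unfolding balanced_map_def additive_on_def
  using is_tensorD(4,5)[OF assms]
  by (auto simp: e(2) t_add_left t_add_right t_balanced t_closed additive_onD[OF e(1)] M.a_closed N.a_closed)
qed

lemma is_tensor_simps:
 assumes "is_tensor M N S r l T t"
 shows "x \<in>: M ==> y \<in>: N ==> t x y \<in>: T"
  and "x \<in>: M ==> x' \<in>: M ==> y \<in>: N ==> t (x \<oplus>\<^sub>M x') y = t x y \<oplus>\<^sub>T t x' y"
  and "x \<in>: M ==> y \<in>: N ==> y' \<in>: N ==> t x (y \<oplus>\<^sub>N y') = t x y \<oplus>\<^sub>T t x y'"
  and "x \<in>: M ==> s \<in> S ==> y \<in>: N ==> t (r x s) y = t x (l s y)"
 using is_tensor_balanced[OF assms] unfolding balanced_map_def additive_on_def by blast+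

lemma is_tensor_rep:
 assumes "is_tensor M N S r l T t" "X \<in>: T"
 obtains xs where "set xs \<subseteq> carrier M \<times> carrier N" "X = lsum T (%(x, y). t x y) xs"
proof -
 interpret M: abelian_group M by (rule is_tensorD[OF assms(1)])
 interpret N: abelian_group N by (rule is_tensorD[OF assms(1)])
 interpret tensor_setup M N S r l
  by unfold_locales (use is_tensorD[OF assms(1)] in auto)
 obtain e where e: "additive_on (tensor_group M N S r l) T e"
  "!!x y. x \<in>: M ==> y \<in>: N ==> t x y = e (pure_tensor M N S r l x y)"
  "bij_betw e (carrier (tensor_group M N S r l)) (carrier T)"
  using assms unfolding is_tensor_def by blast
 obtain Y where Y: "Y \<in>: (tensor_group M N S r l)" "X = e Y"
  using e(3) assms(2) by (metis bij_betw_imp_surj_on imageE)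
 from t_rep[OF Y(1)] obtain xs where xs: "set xs \<subseteq> carrier M \<times> carrier N"
  "Y = lsum (tensor_group M N S r l) (%(x, y). pure_tensor M N S r l x y) xs" by blast
 have "X = lsum T (%p. e (case p of (x, y) => pure_tensor M N S r l x y)) xs"
  unfolding Y(2) xs(2)
  by (rule additive_on_lsum[OF T_abelian is_tensorD(3)[OF assms(1)] e(1)])
    (use xs(1) t_closed in auto)
 also have "... = lsum T (%(x, y). t x y) xs"
  using xs(1) e(2) by (intro lsum_cong) auto
 finally show thesis using that xs(1) by blast
qed

lemma is_tensor_induct [consumes 2, case_names pure add]:
 assumes "is_tensor M N S r l T t" "X \<in>: T"
  and pure: "!!x y. x \<in>: M ==> y \<in>: N ==> P (t x y)"
  and add: "!!X Y. X \<in>: T ==> Y \<in>: T ==> P X ==> P Y ==> P (X \<oplus>\<^sub>T Y)"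
 shows "P X"
proof -
 note t = is_tensor_simps[OF assms(1)]
 interpret M: abelian_group M by (rule is_tensorD[OF assms(1)])
 interpret N: abelian_group N by (rule is_tensorD[OF assms(1)])
 interpret T: abelian_group T by (rule is_tensorD[OF assms(1)])
 have "t \<zero>\<^sub>M \<zero>\<^sub>N = \<zero>\<^sub>T"
  using t(2)[of "\<zero>\<^sub>M" "\<zero>\<^sub>M" "\<zero>\<^sub>N"] t(1)[of "\<zero>\<^sub>M" "\<zero>\<^sub>N"]
  by (metis M.r_zero M.zero_closed N.zero_closed T.add_self_zero)
 then have zero: "P \<zero>\<^sub>T" using pure[of "\<zero>\<^sub>M" "\<zero>\<^sub>N"] by simp
 obtain xs where xs: "set xs \<subseteq> carrier M \<times> carrier N" "X = lsum T (%(x, y). t x y) xs"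
  using is_tensor_rep[OF assms(1,2)] .
 have "lsum T (%(x, y). t x y) xs \<in>: T & P (lsum T (%(x, y). t x y) xs)"
  using xs(1) by (induction xs) (auto simp: zero intro!: add pure t(1))
 then show ?thesis using xs(2) by simp
qed

lemma is_tensor_ext:
 assumes "is_tensor M N S r l T t" "additive_on T G f" "additive_on T G g"
  and "!!x y. x \<in>: M ==> y \<in>: N ==> f (t x y) = g (t x y)" "X \<in>: T"
 shows "f X = g X"
 using assms(1,5)
 by (induction rule: is_tensor_induct) (simp_all add: assms(4) additive_onD[OF assms(2)] additive_onD[OF assms(3)])

lemma is_tensor_lift:
 assumes "is_tensor M N S r l T t" "abelian_group G" "balanced_map M N S r l G \<phi>"
 obtains f where "f \<in> additive_maps T G" "!!x y. x \<in>: M ==> y \<in>: N ==> f (t x y) = \<phi> x y"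
proof -
 interpret M: abelian_group M by (rule is_tensorD[OF assms(1)])
 interpret N: abelian_group N by (rule is_tensorD[OF assms(1)])
 interpret T: abelian_group T by (rule is_tensorD[OF assms(1)])
 interpret s: tensor_setup M N S r l
  by unfold_locales (use is_tensorD[OF assms(1)] in auto)
 obtain e where e: "additive_on (tensor_group M N S r l) T e"
  "!!x y. x \<in>: M ==> y \<in>: N ==> t x y = e (pure_tensor M N S r l x y)"
  "bij_betw e (carrier (tensor_group M N S r l)) (carrier T)"
  using assms(1) unfolding is_tensor_def by blast
 define d where "d = inv_into (carrier s.T) e"
 have ed: "e (d X) = X" "d X \<in>: s.T" if "X \<in>: T" for X
  using e(3) that unfolding d_def
  by (auto simp: bij_betw_inv_into_right dest: bij_betw_inv_into[THEN bij_betw_apply])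
 have de: "d (e Y) = Y" if "Y \<in>: s.T" for Y
  using e(3) that unfolding d_def by (simp add: bij_betw_inv_into_left)
 interpret sT: abelian_group "s.T" by (rule s.T_abelian)
 have "additive_on T s.T d"
  unfolding additive_on_def
 proof (intro conjI ballI funcsetI)
  fix X Y assume XY: "X \<in>: T" "Y \<in>: T"
  have "X \<oplus>\<^sub>T Y = e (d X \<oplus>\<^bsub>s.T\<^esub> d Y)"
   using XY ed additive_onD(2)[OF e(1)] by simp
  then show "d (X \<oplus>\<^sub>T Y) = d X \<oplus>\<^bsub>s.T\<^esub> d Y" using de ed XY by simp
 qed (use ed in auto)
 moreover from s.t_lift[OF assms(2,3)] obtain f where f: "additive_on s.T G f"
  "!!x y. x \<in>: M ==> y \<in>: N ==> f (s.t x y) = \<phi> x y" by blast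
 ultimately have "additive_on T G (%X. f (d X))" by (blast intro: additive_on_compose)
 then have "restrict (%X. f (d X)) (carrier T) \<in> additive_maps T G"
  by (rule additive_on_restrict[OF T.ab_gr])
 moreover have "restrict (%X. f (d X)) (carrier T) (t x y) = \<phi> x y" if "x \<in>: M" "y \<in>: N" for x y
  using that is_tensor_simps(1)[OF assms(1)] e(2) de s.t_closed f(2) by simp
 ultimately show thesis using that by blast
qed

lemma is_tensor_unique:
 assumes "is_tensor M N S r l T t" "f \<in> additive_maps T G" "g \<in> additive_maps T G"
  and "!!x y. x \<in>: M ==> y \<in>: N ==> f (t x y) = g (t x y)"
 shows "f = g"
 using assms is_tensor_ext[OF assms(1), of G f g]
 unfolding additive_maps_iff by (metis extensionalityI)

text \<open>The values on pure tensors determine the map that \<open>the_additive\<close> picks.\<close>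
lemma is_tensor_the_additive:
 assumes "is_tensor M N S r l T t" "abelian_group G" "balanced_map M N S r l G \<phi>"
 defines "f == the_additive T G (%f. \<forall>x\<in>carrier M. \<forall>y\<in>carrier N. f (t x y) = \<phi> x y)"
 shows "f \<in> additive_maps T G" "!!x y. x \<in>: M ==> y \<in>: N ==> f (t x y) = \<phi> x y"
proof -
 obtain h where h: "h \<in> additive_maps T G" "!!x y. x \<in>: M ==> y \<in>: N ==> h (t x y) = \<phi> x y"
  using is_tensor_lift[OF assms(1-3)] by blast
 have "f = h" unfolding f_def
 proof (rule the_additive_eq)
  fix g assume "g \<in> additive_maps T G" "\<forall>x\<in>carrier M. \<forall>y\<in>carrier N. g (t x y) = \<phi> x y"
  then show "g = h" using h by (intro is_tensor_unique[OF assms(1)]) auto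
 qed (use h in auto)
 then show "f \<in> additive_maps T G" "!!x y. x \<in>: M ==> y \<in>: N ==> f (t x y) = \<phi> x y"
  using h by auto
qed

lemma is_tensor_tensor_group:
 assumes "abelian_group M" "abelian_group N"
  and "!!x s. x \<in>: M ==> s \<in> S ==> r x s \<in>: M"
  and "!!s y. s \<in> S ==> y \<in>: N ==> l s y \<in>: N"
 shows "is_tensor M N S r l (tensor_group M N S r l) (pure_tensor M N S r l)"
proof -
 interpret M: abelian_group M by fact
 interpret N: abelian_group N by fact
 interpret tensor_setup M N S r l by unfold_locales (use assms in auto)
 show ?thesis unfolding is_tensor_def
  using assms T_abelian abelian_group.axioms(1)[OF T_abelian, THEN abelian_monoid.a_closed]
  by (auto simp: additive_on_def bij_betw_def intro!: exI[of _ "%x. x"])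
qed

lemma is_tensor_transport:
 assumes "is_tensor M N S r l T t" "abelian_group T'"
  and "bij_betw e (carrier T) (carrier T')" "additive_on T T' e"
  and "!!x y. x \<in>: M ==> y \<in>: N ==> t' x y = e (t x y)"
 shows "is_tensor M N S r l T' t'"
proof -
 obtain e0 where e0: "bij_betw e0 (carrier (tensor_group M N S r l)) (carrier T)"
  "additive_on (tensor_group M N S r l) T e0"
  "!!x y. x \<in>: M ==> y \<in>: N ==> t x y = e0 (pure_tensor M N S r l x y)"
  using assms(1) unfolding is_tensor_def by blast
 have "bij_betw (%x. e (e0 x)) (carrier (tensor_group M N S r l)) (carrier T')"
  using bij_betw_trans[OF e0(1) assms(3)] by (simp add: comp_def)
 then show ?thesis
  using assms additive_on_compose[OF e0(2) assms(4)] e0(3)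
  unfolding is_tensor_def by (intro conjI exI[of _ "%x. e (e0 x)"]) auto
qed

lemma abelian_group_cong:
 assumes "abelian_group M" "carrier M' = carrier M" "add M' = add M" "zero M' = zero M"
 shows "abelian_group M'"
proof -
 interpret M: abelian_group M by fact
 show ?thesis
  by (rule abelian_groupI)
    (use assms M.l_neg in \<open>auto simp: M.a_ac intro!: bexI[of _ "\<ominus>\<^sub>M x" for x]\<close>)
qed

lemma is_tensor_cong:
 assumes "is_tensor M N S r l T t" "carrier T' = carrier T" "add T' = add T" "zero T' = zero T"
 shows "is_tensor M N S r l T' t"
proof (rule is_tensor_transport[OF assms(1), of _ "%x. x"])
 show "abelian_group T'" using abelian_group_cong[OF is_tensorD(3)[OF assms(1)]] assms by blast
 show "additive_on T T' (%x. x)" using assms by (auto simp: additive_on_def)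
qed (use assms in "auto simp: bij_betw_def")

section \<open>Linear and bilinear maps\<close>

definition klin ::
 "('k, 'x) ring_scheme => ('k, 'm, 'y) module_scheme => ('k, 'n, 'z) module_scheme => ('m => 'n) => bool" where
 "klin k M N f \<longleftrightarrow> additive_on M N f &
   (\<forall>c\<in>carrier k. \<forall>x\<in>carrier M. f (c \<odot>\<^sub>M x) = c \<odot>\<^sub>N f x)"

definition bilin ::
 "('k, 'x) ring_scheme => ('k, 'm, 'y) module_scheme => ('k, 'n, 'z) module_scheme =>
  ('k, 'g, 'w) module_scheme => ('m => 'n => 'g) => bool" where
 "bilin k M N G \<phi> \<longleftrightarrow>
   (\<forall>x\<in>carrier M. klin k N G (\<phi> x)) & (\<forall>y\<in>carrier N. klin k M G (%x. \<phi> x y))"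

lemma linear_maps_iff: "f \<in> linear_maps k M N \<longleftrightarrow> klin k M N f & f \<in> extensional (carrier M)"
 unfolding linear_maps_def klin_def additive_maps_iff by auto

lemma klinD:
 assumes "klin k M N f"
 shows "x \<in>: M ==> f x \<in>: N"
  and "x \<in>: M ==> y \<in>: M ==> f (x \<oplus>\<^sub>M y) = f x \<oplus>\<^sub>N f y"
  and "c \<in>: k ==> x \<in>: M ==> f (c \<odot>\<^sub>M x) = c \<odot>\<^sub>N f x"
  and "additive_on M N f"
 using assms unfolding klin_def additive_on_def by auto

lemma klinI:
 assumes "!!x. x \<in>: M ==> f x \<in>: N"
  and "!!x y. x \<in>: M ==> y \<in>: M ==> f (x \<oplus>\<^sub>M y) = f x \<oplus>\<^sub>N f y"
  and "!!c x. c \<in>: k ==> x \<in>: M ==> f (c \<odot>\<^sub>M x) = c \<odot>\<^sub>N f x"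
 shows "klin k M N f"
 using assms unfolding klin_def additive_on_def by auto

lemma bilinD:
 assumes "bilin k M N G \<phi>"
 shows "x \<in>: M ==> y \<in>: N ==> \<phi> x y \<in>: G"
  and "x \<in>: M ==> x' \<in>: M ==> y \<in>: N ==> \<phi> (x \<oplus>\<^sub>M x') y = \<phi> x y \<oplus>\<^sub>G \<phi> x' y"
  and "x \<in>: M ==> y \<in>: N ==> y' \<in>: N ==> \<phi> x (y \<oplus>\<^sub>N y') = \<phi> x y \<oplus>\<^sub>G \<phi> x y'"
  and "c \<in>: k ==> x \<in>: M ==> y \<in>: N ==> \<phi> (c \<odot>\<^sub>M x) y = c \<odot>\<^sub>G \<phi> x y"
  and "c \<in>: k ==> x \<in>: M ==> y \<in>: N ==> \<phi> x (c \<odot>\<^sub>N y) = c \<odot>\<^sub>G \<phi> x y"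
 using assms unfolding bilin_def klin_def additive_on_def by blast+

lemma bilinI:
 assumes "!!x y. x \<in>: M ==> y \<in>: N ==> \<phi> x y \<in>: G"
  and "!!x x' y. x \<in>: M ==> x' \<in>: M ==> y \<in>: N ==> \<phi> (x \<oplus>\<^sub>M x') y = \<phi> x y \<oplus>\<^sub>G \<phi> x' y"
  and "!!x y y'. x \<in>: M ==> y \<in>: N ==> y' \<in>: N ==> \<phi> x (y \<oplus>\<^sub>N y') = \<phi> x y \<oplus>\<^sub>G \<phi> x y'"
  and "!!c x y. c \<in>: k ==> x \<in>: M ==> y \<in>: N ==> \<phi> (c \<odot>\<^sub>M x) y = c \<odot>\<^sub>G \<phi> x y"
  and "!!c x y. c \<in>: k ==> x \<in>: M ==> y \<in>: N ==> \<phi> x (c \<odot>\<^sub>N y) = c \<odot>\<^sub>G \<phi> x y"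
 shows "bilin k M N G \<phi>"
 using assms unfolding bilin_def klin_def additive_on_def by auto

lemma bilin_balanced:
 "bilin k M N G \<phi> ==> balanced_map M N (carrier k) (%x c. c \<odot>\<^sub>M x) (%c y. c \<odot>\<^sub>N y) G \<phi>"
 unfolding balanced_map_def bilin_def klin_def by auto

lemma klin_lsum:
 assumes "module k M" "module k N" "klin k M N h" "!!x. x \<in> set xs ==> f x \<in>: M"
 shows "h (lsum M f xs) = lsum N (%x. h (f x)) xs"
 using additive_on_lsum[OF _ _ klinD(4)[OF assms(3)]] assms unfolding module_def by blast

lemma module_cong:
 assumes "module k M" "carrier M' = carrier M" "add M' = add M" "zero M' = zero M" "smult M' = smult M"
 shows "module k M'"
proof -
 interpret module k M by fact
 show ?thesis
  by (rule moduleI)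
    (use abelian_group_cong[OF ab_gr] assms is_cring in
     \<open>auto simp: smult_l_distr smult_r_distr smult_assoc1\<close>)
qed

section \<open>Tensor products over the base ring\<close>

definition is_ktens ::
 "('k, 'x) ring_scheme => ('k, 'm, 'y) module_scheme => ('k, 'n, 'z) module_scheme =>
  ('k, 't, 'w) module_scheme => ('m => 'n => 't) => bool" where
 "is_ktens k M N T t \<longleftrightarrow> module k M & module k N & module k T &
   is_tensor M N (carrier k) (%x c. c \<odot>\<^sub>M x) (%c y. c \<odot>\<^sub>N y) T t &
   (\<forall>c\<in>carrier k. \<forall>x\<in>carrier M. \<forall>y\<in>carrier N. t (c \<odot>\<^sub>M x) y = c \<odot>\<^sub>T t x y)"

lemma is_ktensD:
 assumes "is_ktens k M N T t"
 shows "module k M" "module k N" "module k T"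
  and "is_tensor M N (carrier k) (%x c. c \<odot>\<^sub>M x) (%c y. c \<odot>\<^sub>N y) T t"
 using assms unfolding is_ktens_def by blast+

lemma is_ktens_bilin:
 assumes "is_ktens k M N T t"
 shows "bilin k M N T t"
proof (rule bilinI)
 note t = is_tensor_simps[OF is_ktensD(4)[OF assms]]
 fix c x y assume c: "c \<in>: k" "x \<in>: M" "y \<in>: N"
 show *: "t (c \<odot>\<^sub>M x) y = c \<odot>\<^sub>T t x y" using assms c unfolding is_ktens_def by blast
 show "t x (c \<odot>\<^sub>N y) = c \<odot>\<^sub>T t x y" using t(4)[of x c y] c * by simp
qed (use is_tensor_simps[OF is_ktensD(4)[OF assms]] in auto)

lemmas is_ktens_simps = bilinD[OF is_ktens_bilin]
lemmas is_ktens_rep = is_tensor_rep[OF is_ktensD(4)]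
lemmas is_ktens_induct = is_tensor_induct[OF is_ktensD(4), consumes 2, case_names pure add]

lemma is_ktens_homogeneous:
 assumes T: "is_ktens k M N T t" and G: "module k G" and \<phi>: "bilin k M N G \<phi>"
  and f: "additive_on T G f" "!!x y. x \<in>: M ==> y \<in>: N ==> f (t x y) = \<phi> x y"
 shows "klin k T G f"
proof -
 interpret T: module k T by (rule is_ktensD[OF T])
 interpret M: module k M by (rule is_ktensD[OF T])
 interpret G: module k G by fact
 have "f (c \<odot>\<^sub>T X) = c \<odot>\<^sub>G f X" if c: "c \<in>: k" and "X \<in>: T" for c X
  using T that(2)
 proof (induction rule: is_ktens_induct)
  case (pure x y)
  then show ?case using c f(2)[of "c \<odot>\<^sub>M x" y]
   by (simp add: is_ktens_simps(4)[OF T, symmetric] f(2) bilinD[OF \<phi>])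
 next
  case (add X Y)
  then show ?case using c by (simp add: T.smult_r_distr G.smult_r_distr additive_onD[OF f(1)])
 qed
 with f(1) show ?thesis unfolding klin_def by blast
qed

lemma is_ktens_lift:
 assumes "is_ktens k M N T t" "module k G" "bilin k M N G \<phi>"
 obtains f where "f \<in> linear_maps k T G" "!!x y. x \<in>: M ==> y \<in>: N ==> f (t x y) = \<phi> x y"
proof -
 obtain f where f: "f \<in> additive_maps T G" "!!x y. x \<in>: M ==> y \<in>: N ==> f (t x y) = \<phi> x y"
  using is_tensor_lift[OF is_ktensD(4)[OF assms(1)] _ bilin_balanced[OF assms(3)]] assms(2)
  unfolding module_def by blast
 then have "klin k T G f" using is_ktens_homogeneous[OF assms] unfolding additive_maps_iff by blast
 then show thesis using that f unfolding linear_maps_iff additive_maps_iff by blast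
qed

lemma is_ktens_the_additive:
 assumes "is_ktens k M N T t" "module k G" "bilin k M N G \<phi>"
 defines "f == the_additive T G (%f. \<forall>x\<in>carrier M. \<forall>y\<in>carrier N. f (t x y) = \<phi> x y)"
 shows "f \<in> linear_maps k T G" "!!x y. x \<in>: M ==> y \<in>: N ==> f (t x y) = \<phi> x y" (is "PROP ?p1")
proof -
 have G: "abelian_group G" using assms(2) unfolding module_def by blast
 note f = is_tensor_the_additive[OF is_ktensD(4)[OF assms(1)] G bilin_balanced[OF assms(3)], folded f_def]
 show "PROP ?p1" by (rule f(2))
 show "f \<in> linear_maps k T G"
  using f is_ktens_homogeneous[OF assms(1-3), of f] unfolding linear_maps_iff additive_maps_iff by blast
qed

lemma is_ktens_cong:
 assumes "is_ktens k M N T t" "carrier T' = carrier T" "add T' = add T" "zero T' = zero T" "smult T' = smult T"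
 shows "is_ktens k M N T' t"
 using assms module_cong[of k T T'] is_tensor_cong[OF is_ktensD(4)[OF assms(1)], of T']
 unfolding is_ktens_def by auto

lemma is_ktens_ktensor:
 assumes "module k M" "module k N"
 shows "is_ktens k M N (ktensor k M N) (ktens k M N)"
proof -
 interpret M: module k M by fact
 interpret N: module k N by fact
 let ?T = "ktensor k M N" and ?t = "ktens k M N"
 let ?Q = "tensor_group M N (carrier k) (%x c. c \<odot>\<^sub>M x) (%c y. c \<odot>\<^sub>N y)"
 have T0: "is_tensor M N (carrier k) (%x c. c \<odot>\<^sub>M x) (%c y. c \<odot>\<^sub>N y) ?Q ?t"
  unfolding ktens_def by (rule is_tensor_tensor_group) (auto intro: M.ab_gr N.ab_gr)
 have same: "carrier ?T = carrier ?Q" "add ?T = add ?Q" "zero ?T = zero ?Q"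
  by (simp_all add: ktensor_def Let_def ring.defs module.defs)
 have T: "is_tensor M N (carrier k) (%x c. c \<odot>\<^sub>M x) (%c y. c \<odot>\<^sub>N y) ?T ?t"
  using is_tensor_cong[OF T0] same by blast
 note t = is_tensor_simps[OF T]
 interpret T: abelian_group ?T by (rule is_tensorD[OF T])
 have bal: "balanced_map M N (carrier k) (%x c. c \<odot>\<^sub>M x) (%c y. c \<odot>\<^sub>N y) ?Q (%x y. ?t (c \<odot>\<^sub>M x) y)"
  if "c \<in>: k" for c
  unfolding balanced_map_def additive_on_def
 proof (intro conjI ballI funcsetI)
  fix x d y assume d: "x \<in>: M" "d \<in>: k" "y \<in>: N"
  have "c \<odot>\<^sub>M (d \<odot>\<^sub>M x) = d \<odot>\<^sub>M (c \<odot>\<^sub>M x)"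
   using that d by (simp add: M.smult_assoc1[symmetric] M.m_comm)
  then show "?t (c \<odot>\<^sub>M (d \<odot>\<^sub>M x)) y = ?t (c \<odot>\<^sub>M x) (d \<odot>\<^sub>N y)"
   using that d t(4)[of "c \<odot>\<^sub>M x" d y] by simp
 qed (use that t same in "simp_all add: M.smult_r_distr")
 have sm: "additive_on ?T ?T (%X. c \<odot>\<^sub>?T X)"
  "!!x y. x \<in>: M ==> y \<in>: N ==> c \<odot>\<^sub>?T ?t x y = ?t (c \<odot>\<^sub>M x) y"
  if "c \<in>: k" for c
 proof -
  have eq: "(%X. c \<odot>\<^sub>?T X) = the_additive ?Q ?Q (%f. \<forall>x\<in>carrier M. \<forall>y\<in>carrier N. f (?t x y) = ?t (c \<odot>\<^sub>M x) y)"
   by (simp add: ktensor_def Let_def ring.defs module.defs)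
  note * = is_tensor_the_additive[OF T0 is_tensorD(3)[OF T0] bal[OF that]]
  show "additive_on ?T ?T (%X. c \<odot>\<^sub>?T X)"
   using *(1) unfolding eq additive_maps_iff additive_on_def same by blast
  show "!!x y. x \<in>: M ==> y \<in>: N ==> c \<odot>\<^sub>?T ?t x y = ?t (c \<odot>\<^sub>M x) y"
   using *(2) by (simp only: fun_cong[OF eq])
 qed
 note s = additive_onD[OF sm(1)]
 have "module k ?T"
 proof (rule moduleI)
  fix a b X assume ab: "a \<in>: k" "b \<in>: k" and X: "X \<in>: ?T"
  show "(a \<oplus>\<^sub>k b) \<odot>\<^sub>?T X = a \<odot>\<^sub>?T X \<oplus>\<^sub>?T b \<odot>\<^sub>?T X"
   using T X
  proof (induction rule: is_tensor_induct)
   case (pure x y)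
   then show ?case using ab by (simp add: sm(2) M.smult_l_distr t(1-3))
  next
   case (add X Y)
   then show ?case using ab s(1)[OF ab(1)] s(1)[OF ab(2)] by (simp add: s(2) T.a_ac)
  qed
  show "(a *\<^sub>k b) \<odot>\<^sub>?T X = a \<odot>\<^sub>?T (b \<odot>\<^sub>?T X)"
   using T X
  proof (induction rule: is_tensor_induct)
   case (pure x y)
   then show ?case using ab by (simp add: sm(2) M.smult_assoc1)
  next
   case (add X Y)
   then show ?case using ab s(1)[OF ab(1)] s(1)[OF ab(2)] by (simp add: s(2))
  qed
 next
  fix X assume X: "X \<in>: ?T"
  show "\<one>\<^sub>k \<odot>\<^sub>?T X = X"
   using T X by (induction rule: is_tensor_induct) (simp_all add: sm(2) s(2))
 qed (auto simp: s M.is_cring T.ab_gr)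
 then show ?thesis unfolding is_ktens_def using T sm assms by auto
qed

section \<open>Tensor product algebras\<close>

lemma is_ktens_tensor_alg:
 assumes "module k A" "module k B"
 shows "is_ktens k A B (tensor_alg k A B) (ktens k A B)"
 by (rule is_ktens_cong[OF is_ktens_ktensor[OF assms]]) (simp_all add: tensor_alg_def Let_def)

lemma tensor_alg_mult:
 assumes A: "module k A" "bilin k A A A (monoid.mult A)" and B: "module k B" "bilin k B B B (monoid.mult B)"
 defines "T == tensor_alg k A B" and "t == ktens k A B"
 shows "bilin k T T T (monoid.mult T)"
  and "!!a b a' b'. a \<in> carrier A ==> b \<in>: B ==> a' \<in> carrier A ==> b' \<in>: B ==>
   t a b *\<^sub>T t a' b' = t (a *\<^sub>A a') (b *\<^sub>B b')"
proof -
 let ?K = "ktensor k A B"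
 have K: "is_ktens k A B ?K t" unfolding t_def by (rule is_ktens_ktensor[OF A(1) B(1)])
 note t = is_ktens_simps[OF K]
 interpret K: module k ?K by (rule is_ktensD[OF K])
 interpret A: module k A by (rule A)
 interpret B: module k B by (rule B)
 note mA = bilinD[OF A(2)] and mB = bilinD[OF B(2)]
 define g where "g a b = the_additive ?K ?K (%g. \<forall>a'\<in>carrier A. \<forall>b'\<in>carrier B.
        g (t a' b') = t (a *\<^sub>A a') (b *\<^sub>B b'))" for a b
 have bg: "bilin k A B ?K (%a' b'. t (a *\<^sub>A a') (b *\<^sub>B b'))"
  if "a \<in> carrier A" "b \<in>: B" for a b
  using that by (intro bilinI) (simp_all add: mA mB t)
 have g: "klin k ?K ?K (g a b)" 
  "!!a' b'. a' \<in> carrier A ==> b' \<in>: B ==> g a b (t a' b') = t (a *\<^sub>A a') (b *\<^sub>B b')"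
  if "a \<in> carrier A" "b \<in>: B" for a b
  using is_ktens_the_additive[OF K K.module_axioms bg[OF that]] unfolding g_def linear_maps_iff by blast+
 note gl = klinD[OF g(1)]
 have gadd1: "g (a \<oplus>\<^sub>A a') b Y = g a b Y \<oplus>\<^sub>?K g a' b Y"
  if c: "a \<in> carrier A" "a' \<in> carrier A" "b \<in>: B" and "Y \<in>: ?K" for a a' b Y
  using K that(4)
 proof (induction rule: is_ktens_induct)
  case (add X Y)
  have "g a b X \<in>: ?K" "g a' b X \<in>: ?K" "g a b Y \<in>: ?K" "g a' b Y \<in>: ?K"
   using c add gl(1) by auto
  with add c show ?case by (simp add: gl(2) K.a_ac)
 qed (use c in "simp add: g t mA mB")
 have gadd2: "g a (b \<oplus>\<^sub>B b') Y = g a b Y \<oplus>\<^sub>?K g a b' Y"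
  if c: "a \<in> carrier A" "b' \<in>: B" "b \<in>: B" and "Y \<in>: ?K" for a b' b Y
  using K that(4)
 proof (induction rule: is_ktens_induct)
  case (add X Y)
  have "g a b X \<in>: ?K" "g a b' X \<in>: ?K" "g a b Y \<in>: ?K" "g a b' Y \<in>: ?K"
   using c add gl(1) by auto
  with add c show ?case by (simp add: gl(2) K.a_ac)
 qed (use c in "simp add: g t mA mB")
 have gs1: "g (d \<odot>\<^sub>A a) b Y = d \<odot>\<^sub>?K g a b Y"
  if c: "a \<in> carrier A" "d \<in>: k" "b \<in>: B" and "Y \<in>: ?K" for a d b Y
  using K that(4)
  by (induction rule: is_ktens_induct) (use c in "simp_all add: g t mA mB gl K.smult_r_distr")
 have gs2: "g a (d \<odot>\<^sub>B b) Y = d \<odot>\<^sub>?K g a b Y"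
  if c: "a \<in> carrier A" "d \<in>: k" "b \<in>: B" and "Y \<in>: ?K" for a d b Y
  using K that(4)
  by (induction rule: is_ktens_induct) (use c in "simp_all add: g t mA mB gl K.smult_r_distr")
 have bY: "bilin k A B ?K (%a b. g a b Y)" if "Y \<in>: ?K" for Y
  using that by (intro bilinI) (simp_all add: gl gadd1 gadd2 gs1 gs2)
 define m where "m X Y = the_additive ?K ?K (%f. \<forall>a\<in>carrier A. \<forall>b\<in>carrier B. f (t a b) = g a b Y) X" for X Y
 have m: "klin k ?K ?K (%X. m X Y)"
  "!!a b. a \<in> carrier A ==> b \<in>: B ==> m (t a b) Y = g a b Y" if "Y \<in>: ?K" for Y
  using is_ktens_the_additive[OF K K.module_axioms bY[OF that]] unfolding m_def linear_maps_iff by blast+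
 note ml = klinD[OF m(1)]
 have T: "monoid.mult T = m" "carrier T = carrier ?K" "add T = add ?K" "smult T = smult ?K"
  by (simp_all add: T_def t_def tensor_alg_def Let_def m_def g_def fun_eq_iff)
 have madd: "m X (Y \<oplus>\<^sub>?K Z) = m X Y \<oplus>\<^sub>?K m X Z"
  if c: "X \<in>: ?K" "Y \<in>: ?K" "Z \<in>: ?K" for X Y Z
  using K that(1)
 proof (induction rule: is_ktens_induct)
  case (add X X')
  have "m X Y \<in>: ?K" "m X Z \<in>: ?K" "m X' Y \<in>: ?K" "m X' Z \<in>: ?K"
   using c add ml(1) by auto
  with add c show ?case by (simp add: ml(2) K.a_ac)
 qed (use c in "simp add: m gl")
 have ms: "m X (d \<odot>\<^sub>?K Y) = d \<odot>\<^sub>?K m X Y"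
  if c: "X \<in>: ?K" "Y \<in>: ?K" "d \<in>: k" for X Y d
  using K that(1)
  by (induction rule: is_ktens_induct) (use c in "simp_all add: m gl ml K.smult_r_distr")
 show "bilin k T T T (monoid.mult T)"
  by (rule bilinI) (simp_all add: T ml madd ms)
 show "t a b *\<^sub>T t a' b' = t (a *\<^sub>A a') (b *\<^sub>B b')"
  if "a \<in> carrier A" "b \<in>: B" "a' \<in> carrier A" "b' \<in>: B" for a b a' b'
  using that by (simp add: T m g t)
qed

lemma tensor_alg_one: "\<one>\<^bsub>tensor_alg k A B\<^esub> = ktens k A B \<one>\<^sub>A \<one>\<^sub>B"
 by (simp add: tensor_alg_def Let_def)

section \<open>Trilinear maps and Sweedler notation\<close>

definition trilin ::
 "('k, 'x) ring_scheme => ('k, 'a, 'y) module_scheme => ('k, 'g, 'w) module_scheme =>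
  ('a => 'a => 'a => 'g) => bool" where
 "trilin k A G \<phi> \<longleftrightarrow>
   (\<forall>y\<in>carrier A. \<forall>z\<in>carrier A. klin k A G (%x. \<phi> x y z)) &
   (\<forall>x\<in>carrier A. \<forall>z\<in>carrier A. klin k A G (%y. \<phi> x y z)) &
   (\<forall>x\<in>carrier A. \<forall>y\<in>carrier A. klin k A G (%z. \<phi> x y z))"

definition quadlin ::
 "('k, 'x) ring_scheme => ('k, 'a, 'y) module_scheme => ('k, 'g, 'w) module_scheme =>
  ('a => 'a => 'a => 'a => 'g) => bool" where
 "quadlin k A G \<phi> \<longleftrightarrow>
   (\<forall>x\<in>carrier A. trilin k A G (\<phi> x)) &
   (\<forall>y\<in>carrier A. \<forall>z\<in>carrier A. \<forall>w\<in>carrier A. klin k A G (%x. \<phi> x y z w))"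

text \<open>An element \<open>R\<^sup>1 \<otimes> R\<^sup>2 \<otimes> R\<^sup>3\<close> is handled through a list of triples whose pure tensors sum to it;
  \<open>tsum G L \<phi>\<close> is then \<open>\<phi> R\<^sup>1 R\<^sup>2 R\<^sup>3\<close> with the summation carried out in \<open>G\<close>.\<close>
definition tsum :: "('g, 'z) ring_scheme => ('x \<times> 'y \<times> 'w) list => ('x => 'y => 'w => 'g) => 'g" where
 "tsum G L \<phi> = lsum G (%(x, y, z). \<phi> x y z) L"

locale kalg = k_algebra k A for k :: "'k ring" and A :: "('k, 'a) module" (structure)
begin

abbreviation "\<A> \<equiv> carrier A"

definition triples :: "('a \<times> 'a \<times> 'a) list => bool" where
 "triples L \<longleftrightarrow> set L \<subseteq> \<A> \<times> \<A> \<times> \<A>"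

abbreviation "t2 == tens2 k A"
abbreviation "t3 == tens3 k A"
abbreviation "t4 == tens4 k A"
abbreviation "A2 == alg2 k A"
abbreviation "A3 == alg3 k A"
abbreviation "A4 == alg4 k A"

lemma modA: "module k A" by (rule module_axioms)

lemma mult_bilin: "bilin k A A A (monoid.mult A)"
 by (rule bilinI)
   (simp_all add: A.l_distr A.r_distr smult_mult_left smult_mult_right)

lemma ktens2: "is_ktens k A A A2 t2"
 unfolding tens2_def[abs_def] alg2_def by (rule is_ktens_tensor_alg[OF modA modA, unfolded eta_contract_eq])

lemma mod2: "module k A2" by (rule is_ktensD(3)[OF ktens2])

lemma mult2: "bilin k A2 A2 A2 (monoid.mult A2)"
 unfolding alg2_def by (rule tensor_alg_mult[OF modA mult_bilin modA mult_bilin])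

lemma ktens3: "is_ktens k A A2 A3 (ktens k A A2)"
 unfolding alg3_def by (rule is_ktens_tensor_alg[OF modA mod2])

lemma mod3: "module k A3" by (rule is_ktensD(3)[OF ktens3])

lemma mult3: "bilin k A3 A3 A3 (monoid.mult A3)"
 unfolding alg3_def by (rule tensor_alg_mult[OF modA mult_bilin mod2 mult2])

lemma ktens4: "is_ktens k A A3 A4 (ktens k A A3)"
 unfolding alg4_def by (rule is_ktens_tensor_alg[OF modA mod3])

lemma mod4: "module k A4" by (rule is_ktensD(3)[OF ktens4])

sublocale A2: module k A2 by (rule mod2)
sublocale A3: module k A3 by (rule mod3)
sublocale A4: module k A4 by (rule mod4)

lemma t3_trilin: "trilin k A A3 t3"
 unfolding trilin_def tens3_def
 by (intro conjI ballI klinI) (simp_all add: is_ktens_simps[OF ktens2] is_ktens_simps[OF ktens3])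

lemma trilinD:
 assumes "trilin k A G \<phi>" and "x \<in>: A" "y \<in>: A" "z \<in>: A"
 shows "\<phi> x y z \<in>: G"
  and "x' \<in>: A ==> \<phi> (x \<oplus> x') y z = \<phi> x y z \<oplus>\<^sub>G \<phi> x' y z" (is "PROP ?p1")
  and "x' \<in>: A ==> \<phi> x (y \<oplus> x') z = \<phi> x y z \<oplus>\<^sub>G \<phi> x x' z" (is "PROP ?p2")
  and "x' \<in>: A ==> \<phi> x y (z \<oplus> x') = \<phi> x y z \<oplus>\<^sub>G \<phi> x y x'" (is "PROP ?p3")
  and "c \<in>: k ==> \<phi> (c \<odot> x) y z = c \<odot>\<^sub>G \<phi> x y z" (is "PROP ?p4")
  and "c \<in>: k ==> \<phi> x (c \<odot> y) z = c \<odot>\<^sub>G \<phi> x y z" (is "PROP ?p5")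
  and "c \<in>: k ==> \<phi> x y (c \<odot> z) = c \<odot>\<^sub>G \<phi> x y z" (is "PROP ?p6")
proof -
 from assms have x: "klin k A G (%x. \<phi> x y z)" and y: "klin k A G (%y. \<phi> x y z)" and z: "klin k A G (%z. \<phi> x y z)"
  unfolding trilin_def by blast+
 show "\<phi> x y z \<in>: G"
  "PROP ?p1"
  "PROP ?p2"
  "PROP ?p3"
  "PROP ?p4"
  "PROP ?p5"
  "PROP ?p6"
  using assms(2-4)
  by (simp_all add: klinD(1)[OF x] klinD(2)[OF x] klinD(2)[OF y] klinD(2)[OF z]
    klinD(3)[OF x] klinD(3)[OF y] klinD(3)[OF z])
qed

lemmas t3_simps = trilinD[OF t3_trilin]

lemma t3_lift:
 assumes G: "module k G" and \<phi>: "trilin k A G \<phi>"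
 obtains f where "f \<in> linear_maps k A3 G"
  "!!x y z. x \<in>: A ==> y \<in>: A ==> z \<in>: A ==> f (t3 x y z) = \<phi> x y z"
proof -
 interpret G: module k G by fact
 note p = trilinD[OF \<phi>]
 have b: "bilin k A A G (\<phi> x)" if "x \<in>: A" for x
  using that by (intro bilinI) (simp_all add: p)
 have "\<exists>f. klin k A2 G f & (\<forall>y\<in>\<A>. \<forall>z\<in>\<A>. f (t2 y z) = \<phi> x y z)" if x: "x \<in>: A" for x
  using is_ktens_lift[OF ktens2 G b[OF x]] unfolding linear_maps_iff by metis
 then have "\<forall>x\<in>\<A>. \<exists>f. klin k A2 G f & (\<forall>y\<in>\<A>. \<forall>z\<in>\<A>. f (t2 y z) = \<phi> x y z)"
  by (rule ballI)
 from bchoice[OF this] obtain f where f0: "\<forall>x\<in>\<A>. klin k A2 G (f x) &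
  (\<forall>y\<in>\<A>. \<forall>z\<in>\<A>. f x (t2 y z) = \<phi> x y z)" ..
 have f: "!!x. x \<in>: A ==> klin k A2 G (f x)"
  "!!x y z. x \<in>: A ==> y \<in>: A ==> z \<in>: A ==> f x (t2 y z) = \<phi> x y z"
  using f0 by simp_all
 note fl = klinD[OF f(1)]
 have "bilin k A A2 G f"
 proof (rule bilinI)
  fix x x' Y assume x: "x \<in>: A" "x' \<in>: A" and Y: "Y \<in>: A2"
  show "f (x \<oplus> x') Y = f x Y \<oplus>\<^sub>G f x' Y"
   using ktens2 Y
  proof (induction rule: is_ktens_induct)
   case (add X Y)
   have "f x X \<in>: G" "f x' X \<in>: G" "f x Y \<in>: G" "f x' Y \<in>: G"
    using x add fl(1) by auto
   with add x show ?case by (simp add: fl(2) G.a_ac)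
  qed (use x in "simp add: f p")
 next
  fix c x Y assume x: "c \<in>: k" "x \<in>: A" and Y: "Y \<in>: A2"
  show "f (c \<odot> x) Y = c \<odot>\<^sub>G f x Y"
   using ktens2 Y
   by (induction rule: is_ktens_induct) (use x in "simp_all add: f p fl G.smult_r_distr")
 qed (simp_all add: fl)
 then obtain h where h: "h \<in> linear_maps k A3 G"
  "!!x Y. x \<in>: A ==> Y \<in>: A2 ==> h (ktens k A A2 x Y) = f x Y"
  using is_ktens_lift[OF ktens3 G] by metis
 then have "h (t3 x y z) = \<phi> x y z" if "x \<in>: A" "y \<in>: A" "z \<in>: A" for x y z
  using that by (simp add: tens3_def is_ktens_simps[OF ktens2] f)
 with h(1) show thesis using that by blast
qed

lemma t3_rep:
 assumes "R \<in>: A3"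
 obtains L where "triples L" "R = tsum A3 L t3"
proof -
 have "\<exists>L. triples L & R = tsum A3 L t3"
  using ktens3 assms
 proof (induction rule: is_ktens_induct)
  case (pure x Y)
  obtain ys where ys: "set ys \<subseteq> \<A> \<times> \<A>" "Y = lsum A2 (%(y, z). t2 y z) ys"
   using is_ktens_rep[OF ktens2 pure(2)] by blast
  have lin: "additive_on A2 A3 (ktens k A A2 x)"
   using is_ktens_bilin[OF ktens3] pure(1) unfolding bilin_def klin_def by blast
  have "ktens k A A2 x Y = lsum A3 (%p. ktens k A A2 x (case p of (y, z) => t2 y z)) ys"
   unfolding ys(2)
   by (rule additive_on_lsum[OF A2.ab_gr A3.ab_gr lin])
     (use ys(1) is_ktens_simps(1)[OF ktens2] in auto)
  also have "... = tsum A3 (map (%p. (x, p)) ys) t3"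
   unfolding tsum_def lsum_map by (rule lsum_cong) (auto simp: tens3_def)
  finally show ?case using pure ys(1) unfolding triples_def
   by (intro exI[of _ "map (%p. (x, p)) ys"]) auto
 next
  case (add X Y)
  then obtain L L' where L: "triples L" "X = tsum A3 L t3" "triples L'" "Y = tsum A3 L' t3" by blast
  have "X \<oplus>\<^sub>A3 Y = tsum A3 (L @ L') t3"
   unfolding L(2,4) tsum_def
   by (rule A3.lsum_append[symmetric]) (use L(1,3) in "auto simp: triples_def t3_simps(1)")
  moreover have "triples (L @ L')" using L(1,3) by (simp add: triples_def)
  ultimately show ?case by blast
 qed
 then show thesis using that by blast
qed

lemma tsum_cong:
 "triples L ==> (!!x y z. x \<in>: A ==> y \<in>: A ==> z \<in>: A ==> \<phi> x y z = \<psi> x y z) ==>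
  tsum G L \<phi> = tsum G L \<psi>"
 unfolding tsum_def by (rule lsum_cong) (auto simp: triples_def)

lemma tsum_closed:
 "abelian_group G ==> triples L ==>
  (!!x y z. x \<in>: A ==> y \<in>: A ==> z \<in>: A ==> \<phi> x y z \<in>: G) ==>
  tsum G L \<phi> \<in>: G"
 unfolding tsum_def by (rule abelian_group.lsum_closed) (auto simp: triples_def)

lemma tsum_swap:
 "abelian_group G ==> triples L ==> triples L' ==>
  (!!x y z u v w. x \<in>: A ==> y \<in>: A ==> z \<in>: A ==>
    u \<in>: A ==> v \<in>: A ==> w \<in>: A ==> \<phi> x y z u v w \<in>: G) ==>
  tsum G L (%x y z. tsum G L' (%u v w. \<phi> x y z u v w)) = tsum G L' (%u v w. tsum G L (%x y z. \<phi> x y z u v w))"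
 unfolding tsum_def case_prod_unfold
 by (rule abelian_group.lsum_swap) (auto simp: triples_def subset_iff)

lemma tsum_additive:
 assumes "abelian_group M" "abelian_group N" "additive_on M N h" "triples L"
  and "!!x y z. x \<in>: A ==> y \<in>: A ==> z \<in>: A ==> \<phi> x y z \<in>: M"
 shows "h (tsum M L \<phi>) = tsum N L (%x y z. h (\<phi> x y z))"
 unfolding tsum_def using additive_on_lsum[OF assms(1-3), of L "%(x, y, z). \<phi> x y z"] assms(4,5)
 by (auto simp: triples_def case_prod_unfold subset_iff)

lemma tsum_add:
 "abelian_group G ==> triples L ==>
  (!!x y z. x \<in>: A ==> y \<in>: A ==> z \<in>: A ==> \<phi> x y z \<in>: G) ==>
  (!!x y z. x \<in>: A ==> y \<in>: A ==> z \<in>: A ==> \<psi> x y z \<in>: G) ==>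
  tsum G L (%x y z. \<phi> x y z \<oplus>\<^sub>G \<psi> x y z) = tsum G L \<phi> \<oplus>\<^sub>G tsum G L \<psi>"
 unfolding tsum_def case_prod_unfold
 by (rule abelian_group.lsum_add) (auto simp: triples_def subset_iff)

lemma sweedler3_lift:
 assumes G: "module k G" and \<phi>: "trilin k A G \<phi>"
 shows "klin k A3 G (sweedler3 k A G \<phi>)"
  and "!!x y z. x \<in>: A ==> y \<in>: A ==> z \<in>: A ==> sweedler3 k A G \<phi> (t3 x y z) = \<phi> x y z" (is "PROP ?p1")
proof -
 interpret G: module k G by fact
 obtain f where f: "f \<in> linear_maps k A3 G"
  "!!x y z. x \<in>: A ==> y \<in>: A ==> z \<in>: A ==> f (t3 x y z) = \<phi> x y z"
  using t3_lift[OF assms] by blast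
 have fa: "additive_on A3 G f" "f \<in> extensional (carrier A3)" using f(1) unfolding linear_maps_iff klin_def by auto
 have "sweedler3 k A G \<phi> = f"
  unfolding sweedler3_def
 proof (rule ext, rule fun_cong[of _ f], rule the_additive_eq)
  show "f \<in> additive_maps A3 G" using fa unfolding additive_maps_iff by blast
  fix g assume g: "g \<in> additive_maps A3 G"
   "\<forall>a\<in>\<A>. \<forall>b\<in>\<A>. \<forall>c\<in>\<A>. g (t3 a b c) = \<phi> a b c"
  show "g = f"
  proof (rule extensionalityI[of _ "carrier A3"])
   fix R assume "R \<in>: A3"
   then obtain L where L: "triples L" "R = tsum A3 L t3" using t3_rep by blast
   have "h R = tsum G L (%x y z. h (t3 x y z))" if "additive_on A3 G h" for h
    unfolding L(2) by (rule tsum_additive[OF A3.ab_gr G.ab_gr that L(1)]) (rule t3_simps)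
   then show "g R = f R"
    using g fa(1) f(2) tsum_cong[OF L(1), of "%x y z. g (t3 x y z)" "%x y z. f (t3 x y z)" G]
    unfolding additive_maps_iff by simp
  qed (use g fa in "auto simp: additive_maps_iff")
 qed (use f in auto)
 with f show "klin k A3 G (sweedler3 k A G \<phi>)" 
  "PROP ?p1"
  by (simp_all add: linear_maps_iff)
qed

lemma sweedler3_tsum:
 assumes G: "module k G" and \<phi>: "trilin k A G \<phi>" and L: "triples L"
 shows "sweedler3 k A G \<phi> (tsum A3 L t3) = tsum G L \<phi>"
proof -
 note s = sweedler3_lift[OF G \<phi>]
 have "sweedler3 k A G \<phi> (tsum A3 L t3) = tsum G L (%x y z. sweedler3 k A G \<phi> (t3 x y z))"
  by (rule tsum_additive[OF A3.ab_gr _ klinD(4)[OF s(1)] L])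
    (use G t3_simps(1) in "auto simp: module_def")
 also have "... = tsum G L \<phi>" by (rule tsum_cong[OF L]) (rule s(2))
 finally show ?thesis .
qed

lemma t4_lift:
 assumes G: "module k G" and \<phi>: "quadlin k A G \<phi>"
 obtains f where "klin k A4 G f"
  "!!x y z w. x \<in>: A ==> y \<in>: A ==> z \<in>: A ==> w \<in>: A ==> f (t4 x y z w) = \<phi> x y z w"
proof -
 interpret G: module k G by fact
 have b: "trilin k A G (\<phi> x)" if "x \<in>: A" for x
  using that \<phi> unfolding quadlin_def by blast
 have l: "klin k A G (%x. \<phi> x y z w)" if "y \<in>: A" "z \<in>: A" "w \<in>: A" for y z w
  using that \<phi> unfolding quadlin_def by blast
 define f where "f x = sweedler3 k A G (\<phi> x)" for x
 have f: "klin k A3 G (f x)" if "x \<in>: A" for x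
  unfolding f_def using sweedler3_lift[OF G b[OF that]] by blast
 note fl = klinD[OF f]
 have fs: "f x (tsum A3 L t3) = tsum G L (\<phi> x)" if "x \<in>: A" "triples L" for x L
  unfolding f_def by (rule sweedler3_tsum[OF G b[OF that(1)] that(2)])
 have "bilin k A A3 G f"
 proof (rule bilinI)
  fix x x' Y assume x: "x \<in>: A" "x' \<in>: A" and Y: "Y \<in>: A3"
  from t3_rep[OF Y] obtain L where L: "triples L" "Y = tsum A3 L t3" .
  show "f (x \<oplus> x') Y = f x Y \<oplus>\<^sub>G f x' Y"
   unfolding L(2) using x L(1) trilinD(1)[OF b]
   by (simp add: fs tsum_add[OF G.ab_gr, symmetric] klinD(2)[OF l] cong: tsum_cong)
 next
  fix c x Y assume x: "c \<in>: k" "x \<in>: A" and Y: "Y \<in>: A3"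
  from t3_rep[OF Y] obtain L where L: "triples L" "Y = tsum A3 L t3" .
  have "additive_on G G (%u. c \<odot>\<^sub>G u)" using x(1) by (auto simp: additive_on_def G.smult_r_distr)
  from tsum_additive[OF G.ab_gr G.ab_gr this L(1), of "\<phi> x"]
  show "f (c \<odot> x) Y = c \<odot>\<^sub>G f x Y"
   unfolding L(2) using x L(1) trilinD(1)[OF b]
   by (simp add: fs klinD(3)[OF l] cong: tsum_cong)
 qed (simp_all add: fl)
 then obtain h where h: "h \<in> linear_maps k A4 G"
  "!!x Y. x \<in>: A ==> Y \<in>: A3 ==> h (ktens k A A3 x Y) = f x Y"
  using is_ktens_lift[OF ktens4 G] by metis
 then have "h (t4 x y z w) = \<phi> x y z w" if "x \<in>: A" "y \<in>: A" "z \<in>: A" "w \<in>: A" for x y z w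
  using that sweedler3_lift(2)[OF G b[OF that(1)]] by (simp add: tens4_def t3_simps f_def)
 with h(1) show thesis using that unfolding linear_maps_iff by blast
qed

end

section \<open>Bimodules\<close>

lemma invariants_simps [simp]:
 "carrier (invariants A M) = {m \<in> carrier M. \<forall>a\<in>carrier A. a |>\<^sub>M m = m <|\<^sub>M a}"
 "add (invariants A M) = add M" "zero (invariants A M) = zero M" "smult (invariants A M) = smult M"
 by (simp_all add: invariants_def module.defs)

lemma truncate_simps [simp]:
 "carrier (module.truncate M) = carrier M" "add (module.truncate M) = add M"
 "zero (module.truncate M) = zero M" "smult (module.truncate M) = smult M"
 by (simp_all add: module.defs)

context kalg
begin

lemma bimoduleD:
 assumes "bimodule k A M"
 shows "module k M" "abelian_group M"
  and "!!a. a \<in>: A ==> klin k M M (%m. a |>\<^sub>M m)"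
  and "!!a. a \<in>: A ==> klin k M M (%m. m <|\<^sub>M a)"
  and "!!c a m. c \<in>: k ==> a \<in>: A ==> m \<in>: M ==> (c \<odot> a) |>\<^sub>M m = c \<odot>\<^sub>M (a |>\<^sub>M m)"
  and "!!c a m. c \<in>: k ==> a \<in>: A ==> m \<in>: M ==> m <|\<^sub>M (c \<odot> a) = c \<odot>\<^sub>M (m <|\<^sub>M a)"
proof -
 interpret M: bimodule k A M by fact
 show "module k M" "abelian_group M" by (rule M.module_axioms, rule M.ab_gr)
 have e: "(c \<odot> \<one>) * a = c \<odot> a" "a * (c \<odot> \<one>) = c \<odot> a"
  if "c \<in>: k" "a \<in>: A" for c a
  using that by (simp_all add: smult_mult_left smult_mult_right)
 show l: "(c \<odot> a) |>\<^sub>M m = c \<odot>\<^sub>M (a |>\<^sub>M m)"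
  if "c \<in>: k" "a \<in>: A" "m \<in>: M" for c a m
  using that M.lact_assoc[of "c \<odot> \<one>" a m] by (simp add: e M.lact_scalar M.lact_closed)
 show r: "m <|\<^sub>M (c \<odot> a) = c \<odot>\<^sub>M (m <|\<^sub>M a)"
  if "c \<in>: k" "a \<in>: A" "m \<in>: M" for c a m
  using that M.ract_assoc[of a "c \<odot> \<one>" m] by (simp add: e M.ract_scalar M.ract_closed)
 fix a assume a: "a \<in>: A"
 show "klin k M M (%m. a |>\<^sub>M m)"
 proof (rule klinI)
  fix c x assume c: "c \<in>: k" "x \<in>: M"
  have "a |>\<^sub>M (c \<odot>\<^sub>M x) = (a * (c \<odot> \<one>)) |>\<^sub>M x"
   using a c M.lact_assoc[of a "c \<odot> \<one>" x] M.lact_scalar[of c x] by simp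
  then show "a |>\<^sub>M (c \<odot>\<^sub>M x) = c \<odot>\<^sub>M (a |>\<^sub>M x)" using a c e l by simp
 qed (use a in "simp_all add: M.lact_closed M.lact_r_distr")
 show "klin k M M (%m. m <|\<^sub>M a)"
 proof (rule klinI)
  fix c x assume c: "c \<in>: k" "x \<in>: M"
  have "(c \<odot>\<^sub>M x) <|\<^sub>M a = x <|\<^sub>M ((c \<odot> \<one>) * a)"
   using a c M.ract_assoc[of "c \<odot> \<one>" a x] M.ract_scalar[of c x] by simp
  then show "(c \<odot>\<^sub>M x) <|\<^sub>M a = c \<odot>\<^sub>M (x <|\<^sub>M a)" using a c e r by simp
 qed (use a in "simp_all add: M.ract_closed M.ract_l_distr")
qed

text \<open>Closure and linearity rules that make the simplifier prove multilinearity of expressions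
  built from the actions on a bimodule.\<close>
lemma bim_simps:
 assumes "bimodule k A M"
 shows "!!a m. a \<in>: A ==> m \<in>: M ==> a |>\<^sub>M m \<in>: M"
  and "!!a m. a \<in>: A ==> m \<in>: M ==> m <|\<^sub>M a \<in>: M"
  and "!!a b m. a \<in>: A ==> b \<in>: A ==> m \<in>: M ==>
   (a \<oplus> b) |>\<^sub>M m = (a |>\<^sub>M m) \<oplus>\<^sub>M (b |>\<^sub>M m)"
  and "!!a m n. a \<in>: A ==> m \<in>: M ==> n \<in>: M ==>
   a |>\<^sub>M (m \<oplus>\<^sub>M n) = (a |>\<^sub>M m) \<oplus>\<^sub>M (a |>\<^sub>M n)"
  and "!!a m n. a \<in>: A ==> m \<in>: M ==> n \<in>: M ==>
   (m \<oplus>\<^sub>M n) <|\<^sub>M a = (m <|\<^sub>M a) \<oplus>\<^sub>M (n <|\<^sub>M a)"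
  and "!!a b m. a \<in>: A ==> b \<in>: A ==> m \<in>: M ==>
   m <|\<^sub>M (a \<oplus> b) = (m <|\<^sub>M a) \<oplus>\<^sub>M (m <|\<^sub>M b)"
  and "!!c a m. c \<in>: k ==> a \<in>: A ==> m \<in>: M ==> (c \<odot> a) |>\<^sub>M m = c \<odot>\<^sub>M (a |>\<^sub>M m)"
  and "!!c a m. c \<in>: k ==> a \<in>: A ==> m \<in>: M ==> m <|\<^sub>M (c \<odot> a) = c \<odot>\<^sub>M (m <|\<^sub>M a)"
  and "!!c a m. c \<in>: k ==> a \<in>: A ==> m \<in>: M ==> a |>\<^sub>M (c \<odot>\<^sub>M m) = c \<odot>\<^sub>M (a |>\<^sub>M m)"
  and "!!c a m. c \<in>: k ==> a \<in>: A ==> m \<in>: M ==> (c \<odot>\<^sub>M m) <|\<^sub>M a = c \<odot>\<^sub>M (m <|\<^sub>M a)"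
  and "!!m. m \<in>: M ==> \<one> |>\<^sub>M m = m"
  and "!!m. m \<in>: M ==> m <|\<^sub>M \<one> = m"
 using assms bimodule.lact_closed[OF assms] bimodule.ract_closed[OF assms]
  bimodule.lact_l_distr[OF assms] bimodule.lact_r_distr[OF assms]
  bimodule.ract_l_distr[OF assms] bimodule.ract_r_distr[OF assms]
  bimodule.lact_one[OF assms] bimodule.ract_one[OF assms]
  bimoduleD(5,6)[OF assms] klinD(3)[OF bimoduleD(3)[OF assms]] klinD(3)[OF bimoduleD(4)[OF assms]]
 by simp_all

lemma bimodule_assoc:
 assumes "bimodule k A M"
 shows "!!a b m. a \<in>: A ==> b \<in>: A ==> m \<in>: M ==> a |>\<^sub>M (b |>\<^sub>M m) = (a * b) |>\<^sub>M m"
  and "!!a b m. a \<in>: A ==> b \<in>: A ==> m \<in>: M ==> (m <|\<^sub>M a) <|\<^sub>M b = m <|\<^sub>M (a * b)"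
  and "!!a b m. a \<in>: A ==> b \<in>: A ==> m \<in>: M ==> (a |>\<^sub>M m) <|\<^sub>M b = a |>\<^sub>M (m <|\<^sub>M b)"
 using bimodule.lact_assoc[OF assms] bimodule.ract_assoc[OF assms] bimodule.lact_ract[OF assms] by simp_all

lemma module_truncate: "bimodule k A M ==> module k (module.truncate M)"
 by (rule module_cong[OF bimoduleD(1)]) simp_all

lemma module_invariants:
 assumes "bimodule k A M"
 shows "module k (invariants A M)"
proof -
 interpret M: module k M by (rule bimoduleD[OF assms])
 note s = bim_simps[OF assms]
 have z: "a |>\<^sub>M \<zero>\<^sub>M = \<zero>\<^sub>M" "\<zero>\<^sub>M <|\<^sub>M a = \<zero>\<^sub>M" if "a \<in>: A" for a
  using additive_on_zero[OF M.ab_gr M.ab_gr klinD(4)]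
   bimoduleD(3,4)[OF assms that] by blast+
 have n: "a |>\<^sub>M (\<ominus>\<^sub>M m) = \<ominus>\<^sub>M (a |>\<^sub>M m)" "(\<ominus>\<^sub>M m) <|\<^sub>M a = \<ominus>\<^sub>M (m <|\<^sub>M a)"
  if "a \<in>: A" "m \<in>: M" for a m
  using additive_on_minus[OF M.ab_gr M.ab_gr klinD(4)[OF bimoduleD(3)[OF assms that(1)]] that(2)]
   additive_on_minus[OF M.ab_gr M.ab_gr klinD(4)[OF bimoduleD(4)[OF assms that(1)]] that(2)]
  by simp_all
 have "abelian_group (invariants A M)"
 proof (rule abelian_groupI)
  fix x assume "x \<in>: (invariants A M)"
  then show "\<exists>y\<in>carrier (invariants A M). y \<oplus>\<^bsub>invariants A M\<^esub> x = \<zero>\<^bsub>invariants A M\<^esub>"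
   by (intro bexI[of _ "\<ominus>\<^sub>M x"]) (simp_all add: M.l_neg n)
 qed (simp_all add: s z M.a_ac)
 then show ?thesis
  by (intro moduleI)
    (simp_all add: s is_cring M.smult_l_distr M.smult_r_distr M.smult_assoc1)
qed

text \<open>A bimodule structure on a tensor product only needs to be checked on pure tensors.\<close>
definition bimodule_laws :: "('k, 'a, 't) bimodule => 'k => 'k => 'a => 'a => 't => bool" where
 "bimodule_laws T c d a b X \<longleftrightarrow>
    (c \<oplus>\<^sub>k d) \<odot>\<^sub>T X = c \<odot>\<^sub>T X \<oplus>\<^sub>T d \<odot>\<^sub>T X &
    (c *\<^sub>k d) \<odot>\<^sub>T X = c \<odot>\<^sub>T (d \<odot>\<^sub>T X) &
    \<one>\<^sub>k \<odot>\<^sub>T X = X &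
    (a \<oplus> b) |>\<^sub>T X = (a |>\<^sub>T X) \<oplus>\<^sub>T (b |>\<^sub>T X) &
    X <|\<^sub>T (a \<oplus> b) = (X <|\<^sub>T a) \<oplus>\<^sub>T (X <|\<^sub>T b) &
    (a * b) |>\<^sub>T X = a |>\<^sub>T (b |>\<^sub>T X) &
    X <|\<^sub>T (a * b) = (X <|\<^sub>T a) <|\<^sub>T b &
    \<one> |>\<^sub>T X = X & X <|\<^sub>T \<one> = X &
    (a |>\<^sub>T X) <|\<^sub>T b = a |>\<^sub>T (X <|\<^sub>T b) &
    (c \<odot> \<one>) |>\<^sub>T X = c \<odot>\<^sub>T X & X <|\<^sub>T (c \<odot> \<one>) = c \<odot>\<^sub>T X"

lemma bimodule_on_generators:
 assumes T: "is_tensor M N S r l T t"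
  and sm: "!!c. c \<in>: k ==> additive_on T T (%X. c \<odot>\<^sub>T X)"
  and la: "!!a. a \<in>: A ==> additive_on T T (%X. a |>\<^sub>T X)"
  and ra: "!!a. a \<in>: A ==> additive_on T T (%X. X <|\<^sub>T a)"
  and pure: "!!c d a b m n. [|c \<in>: k; d \<in>: k; a \<in>: A; b \<in>: A; m \<in>: M; n \<in>: N|] ==>
    bimodule_laws T c d a b (t m n)"
 shows "bimodule k A T"
proof -
 interpret T: abelian_group T by (rule is_tensorD[OF T])
 note c = additive_onD(1)[OF sm] additive_onD(1)[OF la] additive_onD(1)[OF ra]
 note d = additive_onD(2)[OF sm] additive_onD(2)[OF la] additive_onD(2)[OF ra]
 have all: "bimodule_laws T c d a b X"
  if s: "c \<in>: k" "d \<in>: k" "a \<in>: A" "b \<in>: A" and X: "X \<in>: T" for c d a b X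
  using T X
 proof (induction rule: is_tensor_induct)
  case (pure x y)
  show ?case by (rule assms(5)[OF s pure])
 next
  case (add X Y)
  have "c \<odot>\<^sub>T X \<in>: T" "d \<odot>\<^sub>T X \<in>: T" "c \<odot>\<^sub>T Y \<in>: T" "d \<odot>\<^sub>T Y \<in>: T"
   "a |>\<^sub>T X \<in>: T" "b |>\<^sub>T X \<in>: T" "a |>\<^sub>T Y \<in>: T" "b |>\<^sub>T Y \<in>: T"
   "X <|\<^sub>T a \<in>: T" "X <|\<^sub>T b \<in>: T" "Y <|\<^sub>T a \<in>: T" "Y <|\<^sub>T b \<in>: T"
   using s add(1,2) by (simp_all add: c)
  with add s show ?case
   unfolding bimodule_laws_def by (simp add: d T.a_ac)
 qed
 note all = all[unfolded bimodule_laws_def]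
 have K: "(c \<oplus>\<^sub>k d) \<odot>\<^sub>T X = c \<odot>\<^sub>T X \<oplus>\<^sub>T d \<odot>\<^sub>T X"
  "(c *\<^sub>k d) \<odot>\<^sub>T X = c \<odot>\<^sub>T (d \<odot>\<^sub>T X)" "\<one>\<^sub>k \<odot>\<^sub>T X = X"
  "(c \<odot> \<one>) |>\<^sub>T X = c \<odot>\<^sub>T X" "X <|\<^sub>T (c \<odot> \<one>) = c \<odot>\<^sub>T X"
  if "c \<in>: k" "d \<in>: k" "X \<in>: T" for c d X
  using all[OF that(1,2) zero_closed zero_closed that(3)] by blast+
 have L: "(a \<oplus> b) |>\<^sub>T X = (a |>\<^sub>T X) \<oplus>\<^sub>T (b |>\<^sub>T X)"
  "X <|\<^sub>T (a \<oplus> b) = (X <|\<^sub>T a) \<oplus>\<^sub>T (X <|\<^sub>T b)"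
  "(a * b) |>\<^sub>T X = a |>\<^sub>T (b |>\<^sub>T X)"
  "X <|\<^sub>T (a * b) = (X <|\<^sub>T a) <|\<^sub>T b"
  "\<one> |>\<^sub>T X = X" "X <|\<^sub>T \<one> = X"
  "(a |>\<^sub>T X) <|\<^sub>T b = a |>\<^sub>T (X <|\<^sub>T b)"
  if "a \<in>: A" "b \<in>: A" "X \<in>: T" for a b X
  using all[OF R.zero_closed R.zero_closed that] by blast+
 have "module k T"
  by (rule moduleI)
    (simp_all add: is_cring T.ab_gr c d K(1,2) K(3)[OF R.zero_closed R.zero_closed])
 moreover have "bimodule_axioms k A T"
  unfolding bimodule_axioms_def
  by (simp add: c d L(1-4,7) L(5,6)[OF zero_closed zero_closed] K(4,5)[OF _ R.zero_closed])
 ultimately show ?thesis by (rule bimodule.intro)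
qed

lemma tens2_eq: "tens2 k A = ktens k A A"
 by (simp add: fun_eq_iff tens2_def)

lemma ktens_AA: "is_ktens k A A (AA_bimodule k A) t2"
 by (rule is_ktens_cong[OF is_ktens_ktensor[OF modA modA, folded tens2_eq]])
   (simp_all add: AA_bimodule_def Let_def module.defs bimodule.defs)

text \<open>The actions on a tensor product are defined as the additive maps with given values on pure
  tensors; a well-defined formula on pure tensors gives the action.\<close>
lemma tensor_action:
 assumes K: "is_tensor M N S r l K t" and T: "carrier T = carrier K" "add T = add K"
  and b: "balanced_map M N S r l K \<phi>"
  and f: "f = the_additive K K (%f. \<forall>m\<in>carrier M. \<forall>n\<in>carrier N. f (t m n) = \<phi> m n)"
 shows "additive_on T T f" "!!m n. m \<in>: M ==> n \<in>: N ==> f (t m n) = \<phi> m n"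
 using is_tensor_the_additive[OF K is_tensorD(3)[OF K] b, folded f] T
 unfolding additive_maps_iff additive_on_def by auto

lemma ktens_action:
 assumes K: "is_ktens k M N K t" and B: "carrier B = carrier K" "add B = add K" "smult B = smult K"
  and b: "bilin k M N K \<phi>"
  and f: "f = the_additive K K (%f. \<forall>m\<in>carrier M. \<forall>n\<in>carrier N. f (t m n) = \<phi> m n)"
 shows "klin k B B f" "!!m n. m \<in>: M ==> n \<in>: N ==> f (t m n) = \<phi> m n"
 using is_ktens_the_additive[OF K is_ktensD(3)[OF K] b, folded f] B
 unfolding linear_maps_iff klin_def additive_on_def by auto

lemma AA_act:
 assumes "a \<in>: A"
 defines "B == AA_bimodule k A"
 shows "klin k B B (%X. a |>\<^sub>B X)" (is ?l)
  and "!!x y. x \<in>: A ==> y \<in>: A ==> a |>\<^sub>B t2 x y = t2 (a * x) y" (is "PROP ?lv")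
  and "klin k B B (%X. X <|\<^sub>B a)" (is ?r)
  and "!!x y. x \<in>: A ==> y \<in>: A ==> t2 x y <|\<^sub>B a = t2 x (y * a)" (is "PROP ?rv")
proof -
 let ?K = "ktensor k A A"
 note B = B_def AA_bimodule_def Let_def module.defs bimodule.defs
 have K: "is_ktens k A A ?K t2" using is_ktens_ktensor[OF modA modA] by (simp add: tens2_eq)
 note act = ktens_action[OF K, of B]
 have l: "bilin k A A ?K (%x y. t2 (a * x) y)" and r: "bilin k A A ?K (%x y. t2 x (y * a))"
  using assms(1) by (auto intro!: bilinI simp: is_ktens_simps[OF K] bilinD[OF mult_bilin])
 show ?l "PROP ?lv" by (rule act[OF _ _ _ l, of "%X. a |>\<^sub>B X"]; simp add: B)+
 show ?r "PROP ?rv" by (rule act[OF _ _ _ r, of "%X. X <|\<^sub>B a"]; simp add: B)+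
qed

lemma bimodule_AA: "bimodule k A (AA_bimodule k A)"
proof (rule bimodule_on_generators[OF is_ktensD(4)[OF ktens_AA]])
 let ?B = "AA_bimodule k A"
 interpret B: module k ?B by (rule is_ktensD(3)[OF ktens_AA])
 note t = is_ktens_simps[OF ktens_AA] and m = bilinD[OF mult_bilin] and a = AA_act
 show "additive_on ?B ?B (%X. c \<odot>\<^sub>?B X)" if "c \<in>: k" for c
  using that by (auto simp: additive_on_def B.smult_r_distr)
qed (use is_ktens_simps[OF ktens_AA] is_ktensD(3)[OF ktens_AA] in
 \<open>auto simp: bimodule_laws_def AA_act klinD(4)[OF AA_act(1)] klinD(4)[OF AA_act(3)] A.m_assoc A.l_distr A.r_distr
   smult_mult_left smult_mult_right module.smult_l_distr module.smult_assoc1 module.smult_one\<close>)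

lemma ktens_induced: "module k N ==> is_ktens k A N (induced_bimodule k A N) (ktens k A N)"
 by (rule is_ktens_cong[OF is_ktens_ktensor[OF modA]])
   (simp_all add: induced_bimodule_def Let_def module.defs bimodule.defs)

lemma induced_act:
 fixes N :: "('k, 'n) module"
 assumes N: "module k N" and a: "a \<in>: A"
 defines "B == induced_bimodule k A N" and "t == ktens k A N"
 shows "klin k B B (%X. a |>\<^sub>B X)" (is ?l)
  and "!!x y. x \<in>: A ==> y \<in>: N ==> a |>\<^sub>B t x y = t (a * x) y" (is "PROP ?lv")
  and "klin k B B (%X. X <|\<^sub>B a)" (is ?r)
  and "!!x y. x \<in>: A ==> y \<in>: N ==> t x y <|\<^sub>B a = t (x * a) y" (is "PROP ?rv")
proof -
 let ?K = "ktensor k A N"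
 note B = B_def t_def induced_bimodule_def Let_def module.defs bimodule.defs
 have K: "is_ktens k A N ?K t" unfolding t_def by (rule is_ktens_ktensor[OF modA N])
 note act = ktens_action[OF K, of B]
 have l: "bilin k A N ?K (%x y. t (a * x) y)" and r: "bilin k A N ?K (%x y. t (x * a) y)"
  using a by (auto intro!: bilinI simp: is_ktens_simps[OF K] bilinD[OF mult_bilin])
 show ?l "PROP ?lv" by (rule act[OF _ _ _ l, of "%X. a |>\<^sub>B X"]; simp add: B)+
 show ?r "PROP ?rv" by (rule act[OF _ _ _ r, of "%X. X <|\<^sub>B a"]; simp add: B)+
qed

lemma bimodule_induced:
 fixes N :: "('k, 'n) module"
 assumes "module k N"
 shows "bimodule k A (induced_bimodule k A N)"
proof (rule bimodule_on_generators[OF is_ktensD(4)[OF ktens_induced[OF assms]]])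
 let ?B = "induced_bimodule k A N"
 interpret B: module k ?B by (rule is_ktensD(3)[OF ktens_induced[OF assms]])
 show "additive_on ?B ?B (%X. c \<odot>\<^sub>?B X)" if "c \<in>: k" for c
  using that by (auto simp: additive_on_def B.smult_r_distr)
qed (use is_ktens_simps[OF ktens_induced[OF assms]] is_ktensD(3)[OF ktens_induced[OF assms]] in
 \<open>auto simp: bimodule_laws_def induced_act[OF assms] klinD(4)[OF induced_act(1)[OF assms]] klinD(4)[OF induced_act(3)[OF assms]]
   A.m_assoc A.l_distr A.r_distr
   smult_mult_left smult_mult_right module.smult_l_distr module.smult_assoc1 module.smult_one\<close>)

lemma is_tensor_tensor_group_act:
 assumes M: "bimodule k A M" and N: "bimodule k A N"
 shows "is_tensor M N \<A> (%m a. m <|\<^sub>M a) (%a n. a |>\<^sub>N n)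
  (tensor_group M N \<A> (%m a. m <|\<^sub>M a) (%a n. a |>\<^sub>N n))
  (pure_tensor M N \<A> (%m a. m <|\<^sub>M a) (%a n. a |>\<^sub>N n))"
 by (rule is_tensor_tensor_group)
   (simp_all add: bimoduleD(2)[OF M] bimoduleD(2)[OF N] bimodule.ract_closed[OF M] bimodule.lact_closed[OF N])

lemma is_tensor_atensor:
 assumes M: "bimodule k A M" and N: "bimodule k A N"
 shows "is_tensor M N \<A> (%m a. m <|\<^sub>M a) (%a n. a |>\<^sub>N n) (atensor A M N) (atens A M N)"
 unfolding atens_def
 by (rule is_tensor_cong[OF is_tensor_tensor_group_act[OF M N]]) (simp_all add: atensor_def Let_def)

lemma atensor_act:
 assumes M: "bimodule k A M" and N: "bimodule k A N"
 defines "T == atensor A M N" and "t == atens A M N"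
 shows "c \<in>: k ==> additive_on T T (%X. c \<odot>\<^sub>T X)" (is "PROP ?c")
  and "!!m n. c \<in>: k ==> m \<in>: M ==> n \<in>: N ==> c \<odot>\<^sub>T t m n = t (c \<odot>\<^sub>M m) n" (is "PROP ?cv")
  and "a \<in>: A ==> additive_on T T (%X. a |>\<^sub>T X)" (is "PROP ?l")
  and "!!m n. a \<in>: A ==> m \<in>: M ==> n \<in>: N ==> a |>\<^sub>T t m n = t (a |>\<^sub>M m) n" (is "PROP ?lv")
  and "a \<in>: A ==> additive_on T T (%X. X <|\<^sub>T a)" (is "PROP ?r")
  and "!!m n. a \<in>: A ==> m \<in>: M ==> n \<in>: N ==> t m n <|\<^sub>T a = t m (n <|\<^sub>N a)" (is "PROP ?rv")
proof -
 let ?T = "tensor_group M N \<A> (%m a. m <|\<^sub>M a) (%a n. a |>\<^sub>N n)"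
 have K: "is_tensor M N \<A> (%m a. m <|\<^sub>M a) (%a n. a |>\<^sub>N n) ?T t"
  unfolding t_def atens_def by (rule is_tensor_tensor_group_act[OF assms(1,2)])
 interpret M: module k M by (rule bimoduleD[OF M])
 note T = T_def t_def atensor_def Let_def and act = tensor_action[OF K, of T]
 note bal = balanced_map_def additive_on_def is_tensor_simps(1-3)[OF K] is_tensor_simps(4)[OF K, symmetric]
  bim_simps[OF M] bim_simps[OF N] M.smult_r_distr
 let ?b = "balanced_map M N \<A> (%m a. m <|\<^sub>M a) (%a n. a |>\<^sub>N n) ?T"
 have c: "?b (%m n. t (c \<odot>\<^sub>M m) n)" if "c \<in>: k"
  using that by (auto simp: bal)
 show "PROP ?c" "PROP ?cv" by (rule act[OF _ _ c, of "%X. c \<odot>\<^sub>T X"]; simp add: T)+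
 have l: "?b (%m n. t (a |>\<^sub>M m) n)" if "a \<in>: A"
  using that by (auto simp: bal bimodule_assoc(3)[OF M, symmetric])
 show "PROP ?l" "PROP ?lv" by (rule act[OF _ _ l, of "%X. a |>\<^sub>T X"]; simp add: T)+
 have r: "?b (%m n. t m (n <|\<^sub>N a))" if "a \<in>: A"
  using that by (auto simp: bal bimodule_assoc(3)[OF N])
 show "PROP ?r" "PROP ?rv" by (rule act[OF _ _ r, of "%X. X <|\<^sub>T a"]; simp add: T)+
qed

lemma bimodule_atensor:
 assumes M: "bimodule k A M" and N: "bimodule k A N"
 shows "bimodule k A (atensor A M N)"
proof (rule bimodule_on_generators[OF is_tensor_atensor[OF assms]])
 let ?T = "atensor A M N" and ?t = "atens A M N"
 interpret M: bimodule k A M by fact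
 interpret N: bimodule k A N by fact
 note K = is_tensor_atensor[OF assms]
 note s = is_tensor_simps(1-3)[OF K] bim_simps[OF M] bim_simps[OF N] atensor_act[OF M N]
 have e: "?t (c \<odot>\<^sub>M m) n = ?t m (c \<odot>\<^sub>N n)" if "c \<in>: k" "m \<in>: M" "n \<in>: N" for c m n
  using is_tensor_simps(4)[OF K, of m "c \<odot> \<one>" n] that by (simp add: M.ract_scalar N.lact_scalar)
 fix c d a b m n assume [simp]: "c \<in>: k" "d \<in>: k" "a \<in>: A" "b \<in>: A"
  "m \<in>: M" "n \<in>: N"
 show "bimodule_laws ?T c d a b (?t m n)"
  unfolding bimodule_laws_def
  by (simp add: s e[symmetric] M.smult_l_distr M.smult_assoc1 M.lact_assoc N.ract_assoc)
qed (use atensor_act[OF assms] in auto)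

end

section \<open>Copies in the universe\<close>

text \<open>Elements of tensor products are given by lists of pairs, so tensor products of modules of the size
  of the universe have isomorphic copies in it.\<close>
lemma infinite_lists_lepoll:
 assumes "infinite (UNIV :: 'u set)"
 shows "(UNIV :: 'u list set) \<lesssim> (UNIV :: 'u set)"
proof -
 obtain j :: "nat => 'u" where j: "inj j" using assms infinite_countable_subset by blast
 have "(UNIV :: 'u set) \<times> (UNIV :: 'u set) \<approx> (UNIV :: 'u set)"
  using card_of_Times_same_infinite[OF assms] unfolding eqpoll_iff_card_of_ordIso .
 then obtain p :: "'u \<times> 'u => 'u" where p: "inj p"
  unfolding eqpoll_def bij_betw_def by auto
 define g where "g xs = foldr (%x s. p (x, s)) xs (j 0)" for xs
 have gi: "length xs = length ys ==> g xs = g ys ==> xs = ys" for xs ys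
  by (induction xs ys rule: list_induct2) (auto simp: g_def inj_eq[OF p])
 have "inj (%xs. p (j (length xs), g xs))"
  by (rule injI) (auto simp: inj_eq[OF p] inj_eq[OF j] intro: gi)
 then show ?thesis unfolding lepoll_def by blast
qed

lemma tensor_lepoll:
 fixes T :: "('t, 'w) ring_scheme"
 assumes "infinite (UNIV :: 'u set)" "is_tensor M N S r l T t"
  and "carrier M \<lesssim> (UNIV :: 'u set)" "carrier N \<lesssim> (UNIV :: 'u set)"
 shows "carrier T \<lesssim> (UNIV :: 'u set)"
proof -
 obtain f g where f: "inj_on f (carrier M)" "f ` carrier M \<subseteq> (UNIV :: 'u set)" and g: "inj_on g (carrier N)" "g ` carrier N \<subseteq> (UNIV :: 'u set)"
  using assms(3,4) unfolding lepoll_def by blast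
 have "\<forall>X\<in>carrier T. \<exists>xs. set xs \<subseteq> carrier M \<times> carrier N & X = lsum T (%(x, y). t x y) xs"
  using is_tensor_rep[OF assms(2)] by (intro ballI) blast
 from bchoice[OF this] obtain rep where r0: "\<forall>X\<in>carrier T. set (rep X) \<subseteq> carrier M \<times> carrier N &
  X = lsum T (%(x, y). t x y) (rep X)" ..
 have rep: "!!X. X \<in>: T ==> set (rep X) \<subseteq> carrier M \<times> carrier N"
  "!!X. X \<in>: T ==> X = lsum T (%(x, y). t x y) (rep X)" using r0 by blast+
 have "inj_on (%X. (map (f \<circ> fst) (rep X), map (g \<circ> snd) (rep X))) (carrier T)"
 proof (rule inj_onI)
  fix X Y assume XY: "X \<in>: T" "Y \<in>: T"
   "(map (f \<circ> fst) (rep X), map (g \<circ> snd) (rep X)) = (map (f \<circ> fst) (rep Y), map (g \<circ> snd) (rep Y))"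
  have "map (map_prod f g) (rep X) = zip (map (f \<circ> fst) (rep X)) (map (g \<circ> snd) (rep X))" for X
   by (simp add: zip_map_map zip_same_conv_map map_prod_def case_prod_unfold comp_def)
  then have "map (map_prod f g) (rep X) = map (map_prod f g) (rep Y)" using XY(3) by simp
  moreover have "inj_on (map_prod f g) (set (rep X) \<union> set (rep Y))"
   using map_prod_inj_on[OF f(1) g(1)] rep(1)[OF XY(1)] rep(1)[OF XY(2)] by (meson inj_on_subset Un_least)
  ultimately have "rep X = rep Y" by (simp add: inj_on_map_eq_map)
  then show "X = Y" using rep(2) XY by metis
 qed
 then have "carrier T \<lesssim> (UNIV :: 'u list set) \<times> (UNIV :: 'u list set)"
  unfolding lepoll_def by (intro exI conjI) auto
 also have "... \<lesssim> (UNIV :: 'u set) \<times> (UNIV :: 'u set)"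
  by (rule times_lepoll_mono[OF infinite_lists_lepoll[OF assms(1)] infinite_lists_lepoll[OF assms(1)]])
 also have "... \<approx> (UNIV :: 'u set)"
  using card_of_Times_same_infinite[OF assms(1)] unfolding eqpoll_iff_card_of_ordIso .
 finally show ?thesis .
qed

lemma inj_on_emb: "S \<lesssim> (UNIV :: 'u set) ==> inj_on (emb S :: _ => 'u) S"
 unfolding emb_def lepoll_def using someI[of "%e :: _ => 'u. inj_on e S"] by blast

lemma bimodule_copy_iso:
 fixes M :: "('k, 'a, 'x) bimodule"
 assumes "carrier M \<lesssim> (UNIV :: 'u set)"
 defines "C == (bimodule_copy M :: ('k, 'a, 'u) bimodule)" and "e == (emb (carrier M) :: 'x => 'u)"
 shows "bij_betw e (carrier M) (carrier C)" "zero C = e (zero M)"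
  "!!x y. x \<in>: M ==> y \<in>: M ==> e x \<oplus>\<^sub>C e y = e (x \<oplus>\<^sub>M y)"
  "!!c x. x \<in>: M ==> c \<odot>\<^sub>C e x = e (c \<odot>\<^sub>M x)"
  "!!a x. x \<in>: M ==> a |>\<^sub>C e x = e (a |>\<^sub>M x)"
  "!!a x. x \<in>: M ==> e x <|\<^sub>C a = e (x <|\<^sub>M a)"
 using inj_on_emb[OF assms(1)]
 by (simp_all add: C_def e_def bimodule_copy_def Let_def bij_betw_def inv_into_f_f)

lemma bimodule_copy_bimodule:
 fixes M :: "('k, 'a, 'x) bimodule"
 assumes kA: "kalg k A" and M: "bimodule k A M" and le: "carrier M \<lesssim> (UNIV :: 'u set)"
 shows "bimodule k A (bimodule_copy M :: ('k, 'a, 'u) bimodule)"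
proof -
 interpret kalg k A by fact
 interpret M: bimodule k A M by fact
 let ?C = "bimodule_copy M :: ('k, 'a, 'u) bimodule" and ?e = "emb (carrier M) :: 'x => 'u"
 note c = bimodule_copy_iso[OF le]
 have C: "carrier ?C = ?e ` carrier M" using c(1) by (simp add: bij_betw_def)
 note s = bim_simps[OF M]
 have ag: "abelian_group ?C"
 proof (rule abelian_groupI)
  fix x assume "x \<in>: ?C"
  then obtain m where m: "m \<in>: M" "x = ?e m" using C by auto
  then show "\<exists>y\<in>carrier ?C. y \<oplus>\<^sub>?C x = \<zero>\<^sub>?C"
   by (intro bexI[of _ "?e (\<ominus>\<^sub>M m)"]) (simp_all add: c M.l_neg C)
 qed (use C in "auto simp: c M.a_ac")
 have "module k ?C"
  by (rule moduleI) (use C ag in "auto simp: c is_cring M.smult_l_distr M.smult_r_distr M.smult_assoc1")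
 moreover have "bimodule_axioms k A ?C"
  unfolding bimodule_axioms_def using C
  by (auto simp: c s M.lact_assoc M.ract_assoc M.lact_ract)
 ultimately show ?thesis by (rule bimodule.intro)
qed

section \<open>Canonical R-matrices in Sweedler notation\<close>

definition psum :: "('g, 'z) ring_scheme => ('x \<times> 'y) list => ('x => 'y => 'g) => 'g" where
 "psum G ws \<phi> = lsum G (%(y, z). \<phi> y z) ws"

definition flat :: "('x \<times> ('y \<times> 'z) list) list => ('x \<times> 'y \<times> 'z) list" where
 "flat P = concat (map (%(x, ws). map (%(y, z). (x, y, z)) ws) P)"

context kalg
begin

definition pairs :: "('a \<times> 'a) list => bool" where
 "pairs ws \<longleftrightarrow> set ws \<subseteq> \<A> \<times> \<A>"

lemmas t2_simps = is_ktens_simps[OF ktens2]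

lemma t4_quadlin: "quadlin k A A4 t4"
 unfolding quadlin_def trilin_def tens4_def
 by (intro conjI ballI klinI) (simp_all add: t3_simps is_ktens_simps[OF ktens4])

lemma quadlinD:
 assumes "quadlin k A G \<phi>" and "x \<in>: A" "y \<in>: A" "z \<in>: A" "w \<in>: A"
 shows "\<phi> x y z w \<in>: G"
  and "x' \<in>: A ==> \<phi> (x \<oplus> x') y z w = \<phi> x y z w \<oplus>\<^sub>G \<phi> x' y z w" (is "PROP ?p1")
  and "x' \<in>: A ==> \<phi> x (y \<oplus> x') z w = \<phi> x y z w \<oplus>\<^sub>G \<phi> x x' z w" (is "PROP ?p2")
  and "x' \<in>: A ==> \<phi> x y (z \<oplus> x') w = \<phi> x y z w \<oplus>\<^sub>G \<phi> x y x' w" (is "PROP ?p3")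
  and "x' \<in>: A ==> \<phi> x y z (w \<oplus> x') = \<phi> x y z w \<oplus>\<^sub>G \<phi> x y z x'" (is "PROP ?p4")
  and "c \<in>: k ==> \<phi> (c \<odot> x) y z w = c \<odot>\<^sub>G \<phi> x y z w" (is "PROP ?p5")
  and "c \<in>: k ==> \<phi> x (c \<odot> y) z w = c \<odot>\<^sub>G \<phi> x y z w" (is "PROP ?p6")
  and "c \<in>: k ==> \<phi> x y (c \<odot> z) w = c \<odot>\<^sub>G \<phi> x y z w" (is "PROP ?p7")
  and "c \<in>: k ==> \<phi> x y z (c \<odot> w) = c \<odot>\<^sub>G \<phi> x y z w" (is "PROP ?p8")
proof -
 from assms have t: "trilin k A G (\<phi> x)" and l: "klin k A G (%x. \<phi> x y z w)"
  unfolding quadlin_def by blast+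
 show "\<phi> x y z w \<in>: G"
  "PROP ?p1"
  "PROP ?p2"
  "PROP ?p3"
  "PROP ?p4"
  "PROP ?p5"
  "PROP ?p6"
  "PROP ?p7"
  "PROP ?p8"
  using assms(2-5) by (simp_all add: trilinD[OF t] klinD(2,3)[OF l])
qed

lemmas t4_simps = quadlinD[OF t4_quadlin]

lemmas mult_simps = A.l_distr A.r_distr smult_mult_left smult_mult_right
lemmas multilinear_simps = t2_simps t3_simps t4_simps mult_simps

lemma trilinI:
 assumes "!!x y z. x \<in>: A ==> y \<in>: A ==> z \<in>: A ==> \<phi> x y z \<in>: G"
  and "!!x x' y z. x \<in>: A ==> x' \<in>: A ==> y \<in>: A ==> z \<in>: A ==>
   \<phi> (x \<oplus> x') y z = \<phi> x y z \<oplus>\<^sub>G \<phi> x' y z"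
  and "!!x x' y z. x \<in>: A ==> x' \<in>: A ==> y \<in>: A ==> z \<in>: A ==>
   \<phi> x (y \<oplus> x') z = \<phi> x y z \<oplus>\<^sub>G \<phi> x x' z"
  and "!!x x' y z. x \<in>: A ==> x' \<in>: A ==> y \<in>: A ==> z \<in>: A ==>
   \<phi> x y (z \<oplus> x') = \<phi> x y z \<oplus>\<^sub>G \<phi> x y x'"
  and "!!c x y z. c \<in>: k ==> x \<in>: A ==> y \<in>: A ==> z \<in>: A ==>
   \<phi> (c \<odot> x) y z = c \<odot>\<^sub>G \<phi> x y z & \<phi> x (c \<odot> y) z = c \<odot>\<^sub>G \<phi> x y z &
   \<phi> x y (c \<odot> z) = c \<odot>\<^sub>G \<phi> x y z"
 shows "trilin k A G \<phi>"
 unfolding trilin_def using assms by (auto intro!: klinI)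

text \<open>An identity between sums of pure tensors may be evaluated under any multilinear map.\<close>

lemma t2_transfer:
 assumes G: "module k G" and \<phi>: "bilin k A A G \<phi>"
  and c: "!!i. i \<in> set I ==> p i \<in>: A & q i \<in>: A" "!!j. j \<in> set J ==> p' j \<in>: A & q' j \<in>: A"
  and eq: "lsum A2 (%i. t2 (p i) (q i)) I = lsum A2 (%j. t2 (p' j) (q' j)) J"
 shows "lsum G (%i. \<phi> (p i) (q i)) I = lsum G (%j. \<phi> (p' j) (q' j)) J"
proof -
 obtain f where f: "f \<in> linear_maps k A2 G"
  "!!x y. x \<in>: A ==> y \<in>: A ==> f (t2 x y) = \<phi> x y"
  using is_ktens_lift[OF ktens2 G \<phi>] by blast
 have fl: "klin k A2 G f" using f(1) unfolding linear_maps_iff by blast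
 have "lsum G (%i. \<phi> (p i) (q i)) I = f (lsum A2 (%i. t2 (p i) (q i)) I)"
  by (subst klin_lsum[OF mod2 G fl]) (use c f(2) t2_simps(1) in "auto intro: lsum_cong")
 also have "... = lsum G (%j. \<phi> (p' j) (q' j)) J"
  unfolding eq by (subst klin_lsum[OF mod2 G fl]) (use c f(2) t2_simps(1) in "auto intro: lsum_cong")
 finally show ?thesis .
qed

lemma t3_transfer:
 assumes G: "module k G" and \<phi>: "trilin k A G \<phi>"
  and c: "!!i. i \<in> set I ==> p i \<in>: A & q i \<in>: A & o' i \<in>: A"
   "!!j. j \<in> set J ==> p' j \<in>: A & q' j \<in>: A & o'' j \<in>: A"
  and eq: "lsum A3 (%i. t3 (p i) (q i) (o' i)) I = lsum A3 (%j. t3 (p' j) (q' j) (o'' j)) J"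
 shows "lsum G (%i. \<phi> (p i) (q i) (o' i)) I = lsum G (%j. \<phi> (p' j) (q' j) (o'' j)) J"
proof -
 obtain f where f: "f \<in> linear_maps k A3 G"
  "!!x y z. x \<in>: A ==> y \<in>: A ==> z \<in>: A ==> f (t3 x y z) = \<phi> x y z"
  using t3_lift[OF G \<phi>] by blast
 have fl: "klin k A3 G f" using f(1) unfolding linear_maps_iff by blast
 have "lsum G (%i. \<phi> (p i) (q i) (o' i)) I = f (lsum A3 (%i. t3 (p i) (q i) (o' i)) I)"
  by (subst klin_lsum[OF mod3 G fl]) (use c f(2) t3_simps(1) in "auto intro: lsum_cong")
 also have "... = lsum G (%j. \<phi> (p' j) (q' j) (o'' j)) J"
  unfolding eq by (subst klin_lsum[OF mod3 G fl]) (use c f(2) t3_simps(1) in "auto intro: lsum_cong")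
 finally show ?thesis .
qed

definition normalized_list :: "('a \<times> 'a \<times> 'a) list => bool" where
 "normalized_list L \<longleftrightarrow> tsum A2 L (%x y z. t2 (x * y) z) = t2 \<one> \<one>"

lemma normalized_app:
 assumes L: "triples L" "normalized_list L" and G: "module k G" and \<phi>: "bilin k A A G \<phi>"
 shows "tsum G L (%x y z. \<phi> (x * y) z) = \<phi> \<one> \<one>"
proof -
 interpret G: module k G by fact
 have "lsum G (%i. \<phi> (fst i * fst (snd i)) (snd (snd i))) L = lsum G (%j. \<phi> \<one> \<one>) [()]"
  by (rule t2_transfer[OF G \<phi>])
    (use L t2_simps(1)[of "\<one>" "\<one>"] in "auto simp: triples_def normalized_list_def tsum_def case_prod_unfold")
 then show ?thesis using bilinD(1)[OF \<phi>] by (simp add: tsum_def case_prod_unfold)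
qed

text \<open>
  The conditions \<open>a\<^sub>3 R = R a\<^sub>1\<close>, \<open>a\<^sub>1 R = R a\<^sub>2\<close> and \<open>a\<^sub>2 R = R a\<^sub>3\<close>: conjugation by \<open>R\<close> permutes
  the three tensor factors cyclically.
\<close>
definition cyc :: "('a \<times> 'a \<times> 'a) list => bool" where
 "cyc L \<longleftrightarrow> triples L & (\<forall>a\<in>\<A>.
   tsum A3 L (%x y z. t3 x y (a * z)) = tsum A3 L (%x y z. t3 (x * a) y z) &
   tsum A3 L (%x y z. t3 (a * x) y z) = tsum A3 L (%x y z. t3 x (y * a) z) &
   tsum A3 L (%x y z. t3 x (a * y) z) = tsum A3 L (%x y z. t3 x y (z * a)))"

lemma cyc_app:
 assumes L: "cyc L" and a: "a \<in>: A" and G: "module k G" and \<phi>: "trilin k A G \<phi>"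
 shows "tsum G L (%x y z. \<phi> x y (a * z)) = tsum G L (%x y z. \<phi> (x * a) y z)" (is "PROP ?p1")
  and "tsum G L (%x y z. \<phi> (a * x) y z) = tsum G L (%x y z. \<phi> x (y * a) z)" (is "PROP ?p2")
  and "tsum G L (%x y z. \<phi> x (a * y) z) = tsum G L (%x y z. \<phi> x y (z * a))" (is "PROP ?p3")
proof -
 have c: "fst i \<in>: A & fst (snd i) \<in>: A & snd (snd i) \<in>: A" if "i \<in> set L" for i
  using L that unfolding cyc_def triples_def by auto
 have e: "lsum A3 (%i. t3 (fst i) (fst (snd i)) (a * snd (snd i))) L =
   lsum A3 (%i. t3 (fst i * a) (fst (snd i)) (snd (snd i))) L"
  "lsum A3 (%i. t3 (a * fst i) (fst (snd i)) (snd (snd i))) L =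
   lsum A3 (%i. t3 (fst i) (fst (snd i) * a) (snd (snd i))) L"
  "lsum A3 (%i. t3 (fst i) (a * fst (snd i)) (snd (snd i))) L =
   lsum A3 (%i. t3 (fst i) (fst (snd i)) (snd (snd i) * a)) L"
  using L a unfolding cyc_def tsum_def case_prod_unfold by blast+
 show "PROP ?p1"
  unfolding tsum_def case_prod_unfold by (rule t3_transfer[OF G \<phi> _ _ e(1)]) (use c a in auto)
 show "PROP ?p2"
  unfolding tsum_def case_prod_unfold by (rule t3_transfer[OF G \<phi> _ _ e(2)]) (use c a in auto)
 show "PROP ?p3"
  unfolding tsum_def case_prod_unfold by (rule t3_transfer[OF G \<phi> _ _ e(3)]) (use c a in auto)
qed

subsection \<open>Families of invariant elements\<close>

text \<open>
  A list of pairs \<open>(x, ws)\<close>, in which \<open>ws\<close> lists the summands of an element of \<open>(A \<otimes> A)\<^sup>A\<close>,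
  presents an element of \<open>A \<otimes> (A \<otimes> A)\<^sup>A\<close>.
\<close>
definition inv_family :: "('a \<times> ('a \<times> 'a) list) list => bool" where
 "inv_family P \<longleftrightarrow> (\<forall>(x, ws)\<in>set P. x \<in>: A & pairs ws &
   (\<forall>a\<in>\<A>. psum A2 ws (%y z. t2 (a * y) z) = psum A2 ws (%y z. t2 y (z * a))))"

lemma inv_family_triples: "inv_family P ==> triples (flat P)"
 unfolding inv_family_def triples_def flat_def pairs_def by fastforce

lemma tsum_flat:
 assumes G: "abelian_group G" and P: "inv_family P"
  and c: "!!x y z. x \<in>: A ==> y \<in>: A ==> z \<in>: A ==> \<phi> x y z \<in>: G"
 shows "tsum G (flat P) \<phi> = lsum G (%(x, ws). psum G ws (\<phi> x)) P"
 using P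
proof (induction P)
 case Nil
 then show ?case by (simp add: tsum_def flat_def)
next
 case (Cons p P)
 obtain x ws where p: "p = (x, ws)" by fastforce
 interpret G: abelian_group G by fact
 have P: "inv_family P" "x \<in>: A" "pairs ws" using Cons.prems unfolding p inv_family_def by auto
 have fl: "flat (p # P) = map (%(y, z). (x, y, z)) ws @ flat P" by (simp add: flat_def p)
 have "tsum G (flat (p # P)) \<phi> = tsum G (map (%(y, z). (x, y, z)) ws) \<phi> \<oplus>\<^sub>G tsum G (flat P) \<phi>"
  unfolding tsum_def fl
  by (rule G.lsum_append)
    (use P(2,3) c inv_family_triples[OF P(1)] in "auto simp: pairs_def triples_def")
 moreover have "tsum G (map (%(y, z). (x, y, z)) ws) \<phi> = psum G ws (\<phi> x)"
  unfolding tsum_def psum_def lsum_map by (rule lsum_cong) auto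
 ultimately show ?case using Cons.IH[OF P(1)] by (simp add: p)
qed

lemma psum_closed:
 "abelian_group G ==> pairs ws ==> (!!y z. y \<in>: A ==> z \<in>: A ==> \<phi> y z \<in>: G) ==>
  psum G ws \<phi> \<in>: G"
 unfolding psum_def by (rule abelian_group.lsum_closed) (auto simp: pairs_def)

lemma psum_additive:
 assumes "abelian_group M" "abelian_group N" "additive_on M N h" "pairs ws"
  and "!!y z. y \<in>: A ==> z \<in>: A ==> \<phi> y z \<in>: M"
 shows "h (psum M ws \<phi>) = psum N ws (%y z. h (\<phi> y z))"
 unfolding psum_def using additive_on_lsum[OF assms(1-3), of ws "%(y, z). \<phi> y z"] assms(4,5)
 by (auto simp: pairs_def case_prod_unfold subset_iff)

lemma psum_cong:
 "pairs ws ==> (!!y z. y \<in>: A ==> z \<in>: A ==> \<phi> y z = \<psi> y z) ==>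
  psum G ws \<phi> = psum G ws \<psi>"
 unfolding psum_def by (rule lsum_cong) (auto simp: pairs_def)

lemma inv_app:
 assumes P: "inv_family P" "(x, ws) \<in> set P" and a: "a \<in>: A" and G: "module k G" and \<phi>: "bilin k A A G \<phi>"
 shows "psum G ws (%y z. \<phi> (a * y) z) = psum G ws (%y z. \<phi> y (z * a))"
proof -
 have w: "pairs ws" "psum A2 ws (%y z. t2 (a * y) z) = psum A2 ws (%y z. t2 y (z * a))"
  using P a unfolding inv_family_def by auto
 show ?thesis unfolding psum_def case_prod_unfold
  by (rule t2_transfer[OF G \<phi>])
    (use w a in "auto simp: pairs_def psum_def case_prod_unfold")
qed

text \<open>The invariance is used separately for each first leg, so the element moved across may depend
  on it.\<close>
lemma inv_family_app:
 assumes P: "inv_family P" and \<beta>: "!!x. x \<in>: A ==> \<beta> x \<in>: A" and G: "module k G"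
  and \<phi>: "!!x. x \<in>: A ==> bilin k A A G (\<phi> x)"
 shows "tsum G (flat P) (%x y z. \<phi> x (\<beta> x * y) z) = tsum G (flat P) (%x y z. \<phi> x y (z * \<beta> x))"
proof -
 interpret G: module k G by fact
 note b = bilinD(1)[OF \<phi>]
 have "tsum G (flat P) (%x y z. \<phi> x (\<beta> x * y) z) =
   lsum G (%(x, ws). psum G ws (%y z. \<phi> x (\<beta> x * y) z)) P"
  by (rule tsum_flat[OF G.ab_gr P]) (use b \<beta> in auto)
 also have "... = lsum G (%(x, ws). psum G ws (%y z. \<phi> x y (z * \<beta> x))) P"
 proof (rule lsum_cong, clarify)
  fix x ws assume i: "(x, ws) \<in> set P"
  then have x: "x \<in>: A" using P unfolding inv_family_def by auto
  show "psum G ws (%y z. \<phi> x (\<beta> x * y) z) = psum G ws (%y z. \<phi> x y (z * \<beta> x))"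
   by (rule inv_app[OF P i \<beta>[OF x] G \<phi>[OF x]])
 qed
 also have "... = tsum G (flat P) (%x y z. \<phi> x y (z * \<beta> x))"
  by (rule tsum_flat[OF G.ab_gr P, symmetric]) (use b \<beta> in auto)
 finally show ?thesis .
qed

lemma center_iff: "z \<in> center A \<longleftrightarrow> z \<in>: A & (\<forall>a\<in>\<A>. z * a = a * z)"
 by (simp add: center_def)

text \<open>The map \<open>c \<mapsto> w\<^sup>1 c w\<^sup>2\<close> given by an invariant \<open>w\<close> takes central values.\<close>
lemma inv_family_central:
 assumes P: "inv_family P" "(x, ws) \<in> set P" and c: "c \<in>: A"
 shows "psum A ws (%y z. y * c * z) \<in> center A"
 unfolding center_iff
proof (intro conjI ballI)
 have ws: "pairs ws" using P unfolding inv_family_def by auto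
 show cl: "psum A ws (%y z. y * c * z) \<in>: A"
  by (rule psum_closed[OF ab_gr ws]) (use c in simp)
 fix a assume a: "a \<in>: A"
 have l: "additive_on A A (%b. a * b)" and r: "additive_on A A (%b. b * a)"
  using a by (auto simp: additive_on_def mult_simps)
 have b: "bilin k A A A (%y z. y * c * z)"
  using c by (intro bilinI) (simp_all add: mult_simps)
 have "a * psum A ws (%y z. y * c * z) = psum A ws (%y z. a * (y * c * z))"
  by (rule psum_additive[OF ab_gr ab_gr l ws]) (use c in simp)
 also have "... = psum A ws (%y z. (a * y) * c * z)"
  by (rule psum_cong[OF ws]) (use a c in "simp add: A.m_assoc")
 also have "... = psum A ws (%y z. y * c * (z * a))"
  by (rule inv_app[OF P a modA b])
 also have "... = psum A ws (%y z. (y * c * z) * a)"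
  by (rule psum_cong[OF ws]) (use a c in "simp add: A.m_assoc")
 also have "... = psum A ws (%y z. y * c * z) * a"
  by (rule psum_additive[OF ab_gr ab_gr r ws, symmetric]) (use c in simp)
 finally show "psum A ws (%y z. y * c * z) * a = a * psum A ws (%y z. y * c * z)" ..
qed

definition normalized_family :: "('a \<times> ('a \<times> 'a) list) list => bool" where
 "normalized_family P \<longleftrightarrow> inv_family P & normalized_list (flat P)"

lemma normalized_familyD:
 assumes "normalized_family P"
 shows "inv_family P" "normalized_list (flat P)" "triples (flat P)"
 using assms inv_family_triples unfolding normalized_family_def by auto

text \<open>Compute \<open>R\<^sup>1zR\<^sup>2 \<otimes> R\<^sup>3 = R\<^sup>1R\<^sup>2 \<otimes> R\<^sup>3z\<close> in both ways.\<close>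
lemma central_tensor_one:
 assumes P: "normalized_family P" and z: "z \<in> center A"
 shows "t2 z \<one> = t2 \<one> z"
proof -
 note P' = normalized_familyD[OF P]
 have zc: "z \<in>: A" and zm: "!!a. a \<in>: A ==> z * a = a * z" using z by (auto simp: center_iff)
 have zx: "x * (z * y) = z * (x * y)" if "x \<in>: A" "y \<in>: A" for x y
  using that zm zc by (metis A.m_assoc)
 have "t2 z \<one> = tsum A2 (flat P) (%x y w. t2 (z * (x * y)) w)"
  by (subst normalized_app[OF P'(3,2) mod2, of "%p q. t2 (z * p) q"])
    (use zc in "auto intro!: bilinI simp: multilinear_simps")
 also have "... = tsum A2 (flat P) (%x y w. t2 (x * (z * y)) w)"
  by (rule tsum_cong[OF P'(3)]) (simp add: zx)
 also have "... = tsum A2 (flat P) (%x y w. t2 (x * y) (w * z))"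
  by (rule inv_family_app[OF P'(1) _ mod2]) (use zc in "auto intro!: bilinI simp: multilinear_simps")
 also have "... = t2 \<one> z"
  by (subst normalized_app[OF P'(3,2) mod2, of "%p q. t2 p (q * z)"])
    (use zc in "auto intro!: bilinI simp: multilinear_simps")
 finally show ?thesis .
qed

text \<open>
  \<open>R\<^sup>1 \<otimes> R\<^sup>2 c R\<^sup>3\<close> lies in \<open>A \<otimes> Z(A)\<close>, so that the second leg may be moved to the first; there
  the normalization gives \<open>c \<otimes> 1\<close>.
\<close>
lemma sandwich:
 assumes P: "normalized_family P" and c: "c \<in>: A"
 shows "tsum A2 (flat P) (%x y z. t2 x (y * c * z)) = t2 c \<one>"
proof -
 note P' = normalized_familyD[OF P]
 define \<mu> where "\<mu> ws = psum A ws (%y z. y * c * z)" for ws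
 have move: "t2 x z = t2 (x * z) \<one>" if "x \<in>: A" "z \<in> center A" for x z
  using arg_cong[OF central_tensor_one[OF P that(2)], of "%X. x |>\<^bsub>AA_bimodule k A\<^esub> X"] that
  by (simp add: AA_act center_iff)
 have P1: "x \<in>: A" "pairs ws" if "(x, ws) \<in> set P" for x ws
  using P'(1) that unfolding inv_family_def by auto
 have "tsum A2 (flat P) (%x y z. t2 x (y * c * z)) =
   lsum A2 (%(x, ws). psum A2 ws (%y z. t2 x (y * c * z))) P"
  by (rule tsum_flat[OF A2.ab_gr P'(1)]) (use c in "simp add: t2_simps")
 also have "... = lsum A2 (%(x, ws). t2 (x * \<mu> ws) \<one>) P"
 proof (rule lsum_cong, clarify)
  fix x ws assume i: "(x, ws) \<in> set P"
  have "additive_on A A2 (%b. t2 x b)" using P1[OF i] by (auto simp: additive_on_def t2_simps)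
  from psum_additive[OF ab_gr A2.ab_gr this P1(2)[OF i], of "%y z. y * c * z"]
  have "psum A2 ws (%y z. t2 x (y * c * z)) = t2 x (\<mu> ws)" using c by (simp add: \<mu>_def)
  also have "... = t2 (x * \<mu> ws) \<one>"
   by (rule move[OF P1(1)[OF i]]) (use inv_family_central[OF P'(1) i c] in "simp add: \<mu>_def")
  finally show "psum A2 ws (%y z. t2 x (y * c * z)) = t2 (x * \<mu> ws) \<one>" .
 qed
 also have "... = lsum A2 (%(x, ws). psum A2 ws (%y z. t2 (x * y * c * z) \<one>)) P"
 proof (rule lsum_cong, clarify)
  fix x ws assume i: "(x, ws) \<in> set P"
  have "additive_on A A2 (%b. t2 (x * b) \<one>)" using P1[OF i] by (auto simp: additive_on_def multilinear_simps)
  from psum_additive[OF ab_gr A2.ab_gr this P1(2)[OF i], of "%y z. y * c * z"]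
  have "t2 (x * \<mu> ws) \<one> = psum A2 ws (%y z. t2 (x * (y * c * z)) \<one>)" using c by (simp add: \<mu>_def)
  also have "... = psum A2 ws (%y z. t2 (x * y * c * z) \<one>)"
   by (rule psum_cong[OF P1(2)[OF i]]) (use c P1(1)[OF i] in "simp add: A.m_assoc")
  finally show "t2 (x * \<mu> ws) \<one> = psum A2 ws (%y z. t2 (x * y * c * z) \<one>)" .
 qed
 also have "... = tsum A2 (flat P) (%x y z. t2 (x * y * c * z) \<one>)"
  by (rule tsum_flat[OF A2.ab_gr P'(1), symmetric]) (use c in "simp add: t2_simps")
 also have "... = t2 c \<one>"
  by (subst normalized_app[OF P'(3,2) mod2, of "%p q. t2 (p * c * q) \<one>"])
    (use c in "auto intro!: bilinI simp: multilinear_simps")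
 finally show ?thesis .
qed

lemma sandwich_app:
 assumes P: "normalized_family P" and c: "c \<in>: A" and G: "module k G" and \<phi>: "bilin k A A G \<phi>"
 shows "tsum G (flat P) (%x y z. \<phi> x (y * c * z)) = \<phi> c \<one>"
proof -
 interpret G: module k G by fact
 note P' = normalized_familyD[OF P]
 have "lsum G (%i. \<phi> (fst i) (fst (snd i) * c * snd (snd i))) (flat P) = lsum G (%j. \<phi> c \<one>) [()]"
  by (rule t2_transfer[OF G \<phi>])
    (use P'(3) c t2_simps(1)[OF c A.one_closed] sandwich[OF P c] in "auto simp: triples_def tsum_def case_prod_unfold")
 then show ?thesis using bilinD(1)[OF \<phi>] c by (simp add: tsum_def case_prod_unfold)
qed

lemma tsum_split:
 assumes P: "normalized_family P" and L: "triples L" and G: "module k G"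
  and \<phi>: "!!x y z. x \<in>: A ==> y \<in>: A ==> z \<in>: A ==> bilin k A A G (\<phi> x y z)"
 shows "tsum G L (%x y z. \<phi> x y z \<one> \<one>) =
  tsum G L (%x y z. tsum G (flat P) (%u v w. \<phi> x y z (u * v) w))"
 by (rule tsum_cong[OF L]) (rule normalized_app[OF normalized_familyD(3,2)[OF P] G \<phi>, symmetric])

text \<open>
  Inserting the normalization of \<open>P'\<close> between the last two legs of \<open>P\<close> and moving the legs of \<open>P'\<close>
  across the invariants of \<open>P\<close> turns \<open>P\<close> into \<open>P'\<close>.
\<close>
lemma normalized_exchange:
 assumes P: "normalized_family P" and P': "normalized_family P'" and a [simp]: "a \<in>: A" "b \<in>: A"
 shows "tsum A3 (flat P) (%x y z. t3 x (y * a) (b * z)) = tsum A3 (flat P') (%u v w. t3 (a * u * b) v w)"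
proof -
 let ?S = "tsum A3 (flat P)" and ?S' = "tsum A3 (flat P')"
 note L = normalized_familyD(3)[OF P] and L' = normalized_familyD(3)[OF P']
 note [simp] = multilinear_simps and [intro!] = bilinI
 have "?S (%x y z. t3 x (y * a) (b * z)) = ?S (%x y z. t3 x (y * a * \<one>) (\<one> * (b * z)))"
  by (rule tsum_cong[OF L]) simp
 also have "... = ?S (%x y z. ?S' (%u v w. t3 x (y * a * (u * v)) (w * (b * z))))"
  by (rule tsum_split[OF P' L mod3]) auto
 also have "... = ?S (%x y z. ?S' (%u v w. t3 x ((y * a * u) * v) (w * (b * z))))"
  by (intro tsum_cong[OF L] tsum_cong[OF L']) (simp add: A.m_assoc)
 also have "... = ?S (%x y z. ?S' (%u v w. t3 x v ((w * (y * a * u)) * (b * z))))"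
  by (rule tsum_cong[OF L], rule inv_family_app[OF normalized_familyD(1)[OF P'] _ mod3]) auto
 also have "... = ?S (%x y z. ?S' (%u v w. t3 x v (w * (y * (a * u * b) * z))))"
  by (intro tsum_cong[OF L] tsum_cong[OF L']) (simp add: A.m_assoc)
 also have "... = ?S' (%u v w. ?S (%x y z. t3 x v (w * (y * (a * u * b) * z))))"
  by (rule tsum_swap[OF A3.ab_gr L L']) simp
 also have "... = ?S' (%u v w. t3 (a * u * b) v (w * \<one>))"
  by (rule tsum_cong[OF L'], rule sandwich_app[OF P _ mod3]) auto
 also have "... = ?S' (%u v w. t3 (a * u * b) v w)"
  by (rule tsum_cong[OF L']) simp
 finally show ?thesis .
qed

lemma normalized_unique:
 assumes P: "normalized_family P" "normalized_family P'"
 shows "tsum A3 (flat P) t3 = tsum A3 (flat P') t3"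
 using normalized_exchange[OF P A.one_closed A.one_closed]
 by (simp cong: tsum_cong add: normalized_familyD(3)[OF P(1)] normalized_familyD(3)[OF P(2)])

text \<open>The first two relations exchange \<open>R\<close> with itself; the third is the invariance of the last two legs.\<close>
lemma normalized_cyc:
 assumes P: "normalized_family P"
 shows "cyc (flat P)"
 unfolding cyc_def
proof (intro conjI ballI)
 let ?S = "tsum A3 (flat P)"
 note P' = normalized_familyD[OF P]
 show L: "triples (flat P)" by (rule P'(3))
 fix a assume a: "a \<in>: A"
 note e = normalized_exchange[OF P P]
 show "?S (%x y z. t3 x y (a * z)) = ?S (%x y z. t3 (x * a) y z)"
  using e[OF A.one_closed a] by (simp cong: tsum_cong add: L)
 show "?S (%x y z. t3 (a * x) y z) = ?S (%x y z. t3 x (y * a) z)"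
  using e[OF a A.one_closed] a by (simp cong: tsum_cong add: L)
 show "?S (%x y z. t3 x (a * y) z) = ?S (%x y z. t3 x y (z * a))"
  by (rule inv_family_app[OF P'(1) _ mod3]) (use a in "auto intro!: bilinI simp: multilinear_simps")
qed

definition hexagon1 :: "('a \<times> 'a \<times> 'a) list => bool" where
 "hexagon1 L \<longleftrightarrow> tsum A4 L (%x y z. t4 x y \<one> z) =
   tsum A4 L (%x y z. tsum A4 L (%u v w. t4 (u * x) v (w * y) z))"

definition hexagon2 :: "('a \<times> 'a \<times> 'a) list => bool" where
 "hexagon2 L \<longleftrightarrow> tsum A4 L (%x y z. t4 x \<one> y z) =
   tsum A4 L (%x y z. tsum A4 L (%u v w. t4 x (y * u) v (z * w)))"

text \<open>The product of the presented elements in \<open>A \<otimes> A \<otimes> A\<close> is \<open>1\<close>.\<close>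
definition prod_one :: "('a \<times> 'a \<times> 'a) list => ('a \<times> 'a \<times> 'a) list => bool" where
 "prod_one L L' \<longleftrightarrow> tsum A3 L (%x y z. tsum A3 L' (%u v w.
   t3 (x * u) (y * v) (z * w))) = t3 \<one> \<one> \<one>"

text \<open>The cyclic relations separate the two copies of \<open>R\<close>: one of them is left with \<open>R\<^sup>1R\<^sup>2 \<otimes> R\<^sup>3\<close>, to
  which the normalization applies.\<close>
lemma cyc_hexagon1_rhs:
 assumes c: "cyc L"
 shows "tsum A4 L (%x y z. tsum A4 L (%u v w. t4 (u * x) v (w * y) z)) =
  tsum A4 L (%u v w. tsum A4 L (%x y z. t4 u v (x * y) (z * w)))"
proof -
 from c have L: "triples L" by (simp add: cyc_def)
 have "tsum A4 L (%x y z. tsum A4 L (%u v w. t4 (u * x) v (w * y) z)) =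
  tsum A4 L (%x y z. tsum A4 L (%u v w. t4 u v ((x * w) * y) z))"
 proof (rule tsum_cong[OF L])
  fix x y z assume [simp]: "x \<in>: A" "y \<in>: A" "z \<in>: A"
  have "trilin k A A4 (%u v w. t4 u v (w * y) z)" by (intro trilinI) (simp_all add: multilinear_simps)
  from cyc_app(1)[OF c _ mod4 this, of x]
  show "tsum A4 L (%u v w. t4 (u * x) v (w * y) z) = tsum A4 L (%u v w. t4 u v ((x * w) * y) z)"
   by simp
 qed
 also have "... = tsum A4 L (%u v w. tsum A4 L (%x y z. t4 u v ((x * w) * y) z))"
  by (rule tsum_swap[OF A4.ab_gr L L]) (simp add: t4_simps)
 also have "... = tsum A4 L (%u v w. tsum A4 L (%x y z. t4 u v (x * (w * y)) z))"
  by (intro tsum_cong[OF L]) (simp add: A.m_assoc)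
 also have "... = tsum A4 L (%u v w. tsum A4 L (%x y z. t4 u v (x * y) (z * w)))"
 proof (rule tsum_cong[OF L])
  fix u v w assume [simp]: "u \<in>: A" "v \<in>: A" "w \<in>: A"
  have "trilin k A A4 (%x y z. t4 u v (x * y) z)" by (intro trilinI) (simp_all add: multilinear_simps)
  from cyc_app(3)[OF c _ mod4 this, of w]
  show "tsum A4 L (%x y z. t4 u v (x * (w * y)) z) = tsum A4 L (%x y z. t4 u v (x * y) (z * w))"
   by simp
 qed
 finally show ?thesis .
qed

lemma normalized_hexagon1:
 assumes P: "normalized_family P"
 shows "hexagon1 (flat P)"
proof -
 note P' = normalized_familyD[OF P]
 have "tsum A4 (flat P) (%u v w. tsum A4 (flat P) (%x y z. t4 u v (x * y) (z * w))) =
  tsum A4 (flat P) (%u v w. t4 u v \<one> (\<one> * w))"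
  by (rule tsum_cong[OF P'(3)], rule normalized_app[OF P'(3,2) mod4])
    (auto intro!: bilinI simp: multilinear_simps)
 also have "... = tsum A4 (flat P) (%u v w. t4 u v \<one> w)" by (rule tsum_cong[OF P'(3)]) simp
 finally show ?thesis unfolding hexagon1_def cyc_hexagon1_rhs[OF normalized_cyc[OF P]] by simp
qed

text \<open>Here the two copies meet in a sandwich \<open>R\<^sup>2uR\<^sup>3\<close>.\<close>
lemma normalized_hexagon2:
 assumes P: "normalized_family P"
 shows "hexagon2 (flat P)"
 unfolding hexagon2_def
proof -
 let ?L = "flat P"
 note P' = normalized_familyD[OF P]
 note L = P'(3) and c = normalized_cyc[OF P]
 have "tsum A4 ?L (%x y z. tsum A4 ?L (%u v w. t4 x (y * u) v (z * w))) =
  tsum A4 ?L (%x y z. tsum A4 ?L (%u v w. t4 x (y * (u * z)) v w))"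
 proof (rule tsum_cong[OF L])
  fix x y z assume [simp]: "x \<in>: A" "y \<in>: A" "z \<in>: A"
  have "trilin k A A4 (%u v w. t4 x (y * u) v w)" by (intro trilinI) (simp_all add: multilinear_simps)
  from cyc_app(1)[OF c _ mod4 this, of z]
  show "tsum A4 ?L (%u v w. t4 x (y * u) v (z * w)) = tsum A4 ?L (%u v w. t4 x (y * (u * z)) v w)"
   by simp
 qed
 also have "... = tsum A4 ?L (%u v w. tsum A4 ?L (%x y z. t4 x (y * (u * z)) v w))"
  by (rule tsum_swap[OF A4.ab_gr L L]) (simp add: t4_simps)
 also have "... = tsum A4 ?L (%u v w. tsum A4 ?L (%x y z. t4 x (y * u * z) v w))"
  by (intro tsum_cong[OF L]) (simp add: A.m_assoc)
 also have "... = tsum A4 ?L (%u v w. t4 u \<one> v w)"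
  by (rule tsum_cong[OF L], rule sandwich_app[OF P _ mod4])
    (auto intro!: bilinI simp: multilinear_simps)
 finally show "tsum A4 ?L (%u v w. t4 u \<one> v w) =
  tsum A4 ?L (%x y z. tsum A4 ?L (%u v w. t4 x (y * u) v (z * w)))" ..
qed

definition swap23 :: "('a \<times> 'a \<times> 'a) list => ('a \<times> 'a \<times> 'a) list" where
 "swap23 L = map (%(x, y, z). (x, z, y)) L"

lemma swap23_swap23 [simp]: "swap23 (swap23 L) = L"
 unfolding swap23_def by (induction L) auto

lemma swap23_triples: "triples L ==> triples (swap23 L)"
 unfolding swap23_def triples_def by auto

lemma tsum_swap23: "tsum G (swap23 L) \<phi> = tsum G L (%x y z. \<phi> x z y)"
 unfolding swap23_def tsum_def lsum_map by (rule lsum_cong) auto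

text \<open>Exchanging the last two factors is an algebra automorphism of \<open>A \<otimes> A \<otimes> A\<close>.\<close>
lemma prod_one_swap23:
 assumes L: "triples L" "triples L'" and p: "prod_one L L'"
 shows "prod_one (swap23 L) (swap23 L')"
proof -
 have t: "trilin k A A3 (%x y z. t3 x z y)" by (rule trilinI) (simp_all add: t3_simps)
 obtain f where f: "f \<in> linear_maps k A3 A3"
  "!!x y z. x \<in>: A ==> y \<in>: A ==> z \<in>: A ==> f (t3 x y z) = t3 x z y"
  using t3_lift[OF mod3 t] by blast
 have fl: "additive_on A3 A3 f" using f(1) unfolding linear_maps_iff klin_def by blast
 note ag = A3.ab_gr
 have c: "t3 x y z \<in>: A3" if "x \<in>: A" "y \<in>: A" "z \<in>: A" for x y z
  using that by (simp add: t3_simps)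
 have "f (tsum A3 L (%x y z. tsum A3 L' (%u v w. t3 (x * u) (y * v) (z * w)))) =
  tsum A3 L (%x y z. f (tsum A3 L' (%u v w. t3 (x * u) (y * v) (z * w))))"
  by (rule tsum_additive[OF ag ag fl L(1)]) (intro tsum_closed[OF ag L(2)] c, simp_all)
 also have "... = tsum A3 L (%x y z. tsum A3 L' (%u v w. f (t3 (x * u) (y * v) (z * w))))"
  by (rule tsum_cong[OF L(1)], rule tsum_additive[OF ag ag fl L(2)]) (simp add: c)
 also have "... = tsum A3 L (%x y z. tsum A3 L' (%u v w. t3 (x * u) (z * w) (y * v)))"
  by (intro tsum_cong[OF L(1)] tsum_cong[OF L(2)]) (simp add: f(2))
 finally show ?thesis
  using p unfolding prod_one_def tsum_swap23 by (simp add: f(2))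
qed

lemma cyc_prod_swap23:
 assumes c: "cyc L" and L': "triples L'"
 shows "tsum A3 (swap23 L') (%x y z. tsum A3 L (%u v w. t3 (x * u) (y * v) (z * w))) =
  tsum A3 L' (%x y z. tsum A3 L (%u v w. t3 u (z * (v * x)) (y * w)))"
 unfolding tsum_swap23
proof (rule tsum_cong[OF L'])
 fix x y z assume [simp]: "x \<in>: A" "y \<in>: A" "z \<in>: A"
 have "trilin k A A3 (%u v w. t3 u (z * v) (y * w))" by (intro trilinI) (simp_all add: multilinear_simps)
 from cyc_app(2)[OF c _ mod3 this, of x]
 show "tsum A3 L (%u v w. t3 (x * u) (z * v) (y * w)) =
  tsum A3 L (%u v w. t3 u (z * (v * x)) (y * w))"
  by simp
qed

text \<open>The inverse is \<open>R\<^sup>1 \<otimes> R\<^sup>3 \<otimes> R\<^sup>2\<close>: the cyclic relations turn the product into two nested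
  sandwiches.\<close>
lemma normalized_prod_one:
 assumes P: "normalized_family P"
 shows "prod_one (swap23 (flat P)) (flat P)"
 unfolding prod_one_def
proof -
 let ?L = "flat P"
 note P' = normalized_familyD[OF P]
 note L = P'(3) and c = normalized_cyc[OF P]
 have "tsum A3 (swap23 ?L) (%x y z. tsum A3 ?L (%u v w. t3 (x * u) (y * v) (z * w))) =
  tsum A3 ?L (%x y z. tsum A3 ?L (%u v w. t3 u (z * (v * x)) (y * w)))"
  by (rule cyc_prod_swap23[OF c L])
 also have "... = tsum A3 ?L (%x y z. tsum A3 ?L (%u v w. t3 u ((z * v) * x) (y * w)))"
  by (intro tsum_cong[OF L]) (simp add: A.m_assoc)
 also have "... = tsum A3 ?L (%x y z. tsum A3 ?L (%u v w. t3 u (v * x) (y * (w * z))))"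
 proof (rule tsum_cong[OF L])
  fix x y z assume [simp]: "x \<in>: A" "y \<in>: A" "z \<in>: A"
  have "trilin k A A3 (%u v w. t3 u (v * x) (y * w))" by (intro trilinI) (simp_all add: multilinear_simps)
  from cyc_app(3)[OF c _ mod3 this, of z]
  show "tsum A3 ?L (%u v w. t3 u ((z * v) * x) (y * w)) =
   tsum A3 ?L (%u v w. t3 u (v * x) (y * (w * z)))"
   by simp
 qed
 also have "... = tsum A3 ?L (%u v w. tsum A3 ?L (%x y z. t3 u (v * x) (y * (w * z))))"
  by (rule tsum_swap[OF A3.ab_gr L L]) (simp add: t3_simps)
 also have "... = tsum A3 ?L (%u v w. tsum A3 ?L (%x y z. t3 u (v * x) (y * w * z)))"
  by (intro tsum_cong[OF L]) (simp add: A.m_assoc)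
 also have "... = tsum A3 ?L (%u v w. t3 u (v * w) \<one>)"
  by (rule tsum_cong[OF L], rule sandwich_app[OF P _ mod3])
    (auto intro!: bilinI simp: multilinear_simps)
 also have "... = tsum A3 ?L (%u v w. t3 u (v * \<one> * w) \<one>)"
  by (rule tsum_cong[OF L]) simp
 also have "... = t3 \<one> \<one> \<one>"
  by (rule sandwich_app[OF P _ mod3]) (auto intro!: bilinI simp: multilinear_simps)
 finally show "tsum A3 (swap23 ?L) (%x y z. tsum A3 ?L (%u v w. t3 (x * u) (y * v) (z * w))) =
  t3 \<one> \<one> \<one>" .
qed

lemma prod_one_app:
 assumes L: "triples L" "triples L'" "prod_one L L'" and G: "module k G" and \<phi>: "trilin k A G \<phi>"
 shows "tsum G L (%x y z. tsum G L' (%u v w. \<phi> (x * u) (y * v) (z * w))) = \<phi> \<one> \<one> \<one>"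
proof -
 obtain f where f: "f \<in> linear_maps k A3 G"
  "!!x y z. x \<in>: A ==> y \<in>: A ==> z \<in>: A ==> f (t3 x y z) = \<phi> x y z"
  using t3_lift[OF G \<phi>] by blast
 have fl: "additive_on A3 G f" using f(1) unfolding linear_maps_iff klin_def by blast
 have ag: "abelian_group A3" "abelian_group G" using mod3 G unfolding module_def by blast+
 have cl: "t3 x y z \<in>: A3" if "x \<in>: A" "y \<in>: A" "z \<in>: A" for x y z
  using that by (simp add: t3_simps)
 have "\<phi> \<one> \<one> \<one> = f (tsum A3 L (%x y z. tsum A3 L' (%u v w. t3 (x * u) (y * v) (z * w))))"
  using L(3) f(2) by (simp add: prod_one_def)
 also have "... = tsum G L (%x y z. f (tsum A3 L' (%u v w. t3 (x * u) (y * v) (z * w))))"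
  by (rule tsum_additive[OF ag fl L(1)]) (intro tsum_closed[OF ag(1) L(2)] cl, simp_all)
 also have "... = tsum G L (%x y z. tsum G L' (%u v w. f (t3 (x * u) (y * v) (z * w))))"
  by (rule tsum_cong[OF L(1)], rule tsum_additive[OF ag fl L(2)]) (simp add: cl)
 also have "... = tsum G L (%x y z. tsum G L' (%u v w. \<phi> (x * u) (y * v) (z * w)))"
  by (intro tsum_cong[OF L(1)] tsum_cong[OF L(2)]) (simp add: f(2))
 finally show ?thesis ..
qed

text \<open>An identity between sums of pure tensors in \<open>A \<otimes> A \<otimes> A \<otimes> A\<close> may be evaluated under any
  quadrilinear map.\<close>
lemma hexagon_app:
 assumes L: "triples L" and G: "module k G" and \<phi>: "quadlin k A G \<phi>"
  and p: "!!x y z. x \<in>: A ==> y \<in>: A ==> z \<in>: A ==>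
    p1 x y z \<in>: A & p2 x y z \<in>: A & p3 x y z \<in>: A & p4 x y z \<in>: A"
  and q: "!!x y z u v w. x \<in>: A ==> y \<in>: A ==> z \<in>: A ==> u \<in>: A ==> v \<in>: A ==> w \<in>: A ==>
    q1 x y z u v w \<in>: A & q2 x y z u v w \<in>: A & q3 x y z u v w \<in>: A & q4 x y z u v w \<in>: A"
  and e: "tsum A4 L (%x y z. t4 (p1 x y z) (p2 x y z) (p3 x y z) (p4 x y z)) = tsum A4 L (%x y z. tsum A4 L (%u v w.
    t4 (q1 x y z u v w) (q2 x y z u v w) (q3 x y z u v w) (q4 x y z u v w)))" (is "tsum _ _ ?P = tsum _ _ ?Q")
 shows "tsum G L (%x y z. \<phi> (p1 x y z) (p2 x y z) (p3 x y z) (p4 x y z)) = tsum G L (%x y z. tsum G L (%u v w.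
    \<phi> (q1 x y z u v w) (q2 x y z u v w) (q3 x y z u v w) (q4 x y z u v w)))" (is "tsum _ _ ?p = tsum _ _ ?q")
proof -
 obtain f where f: "klin k A4 G f" "!!x y z w. x \<in>: A ==> y \<in>: A ==> z \<in>: A ==> w \<in>: A ==> f (t4 x y z w) = \<phi> x y z w"
  using t4_lift[OF G \<phi>] by blast
 note fl = klinD(4)[OF f(1)]
 have ag: "abelian_group A4" "abelian_group G" using mod4 G unfolding module_def by blast+
 have cl: "t4 x y z w \<in>: A4" if "x \<in>: A" "y \<in>: A" "z \<in>: A" "w \<in>: A" for x y z w
  using that by (simp add: t4_simps)
 have "tsum G L ?p = tsum G L (%x y z. f (?P x y z))"
  by (rule tsum_cong[OF L]) (simp add: f(2) p)
 also have "... = f (tsum A4 L ?P)"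
  by (rule tsum_additive[OF ag fl L, symmetric]) (simp add: cl p)
 also have "... = tsum G L (%x y z. f (?Q x y z))"
  unfolding e by (rule tsum_additive[OF ag fl L]) (intro tsum_closed[OF ag(1) L], simp add: cl q)
 also have "... = tsum G L (%x y z. tsum G L (%u v w. f (t4 (q1 x y z u v w) (q2 x y z u v w) (q3 x y z u v w) (q4 x y z u v w))))"
  by (rule tsum_cong[OF L], rule tsum_additive[OF ag fl L]) (simp add: cl q)
 also have "... = tsum G L ?q"
  by (intro tsum_cong[OF L]) (simp add: f(2) q)
 finally show ?thesis .
qed

text \<open>With \<open>R\<^sub>1\<^sub>2\<^sub>4\<close> for \<open>R\<^sup>1 \<otimes> R\<^sup>2 \<otimes> 1 \<otimes> R\<^sup>3\<close>, the first hexagon reads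
  \<open>R\<^sub>1\<^sub>2\<^sub>4 = (1 \<otimes> 1 \<otimes> R\<^sup>1R\<^sup>2 \<otimes> R\<^sup>3) R\<^sub>1\<^sub>2\<^sub>4\<close>. Cancel the invertible \<open>R\<^sub>1\<^sub>2\<^sub>4\<close>, and multiply the first
  three factors.\<close>
lemma canonical_normalized:
 assumes c: "cyc L" and h: "hexagon1 L" and L': "triples L'" and p: "prod_one L L'"
 shows "normalized_list L"
proof -
 let ?S = "tsum A2 L" and ?S' = "tsum A2 L'"
 from c have L: "triples L" by (simp add: cyc_def)
 note one = prod_one_app[OF L L' p] and ag = A2.ab_gr
 note [simp] = multilinear_simps
 define \<psi> where "\<psi> p q s x y z w = t2 ((x * p) * (y * q) * z) (w * s)" for p q s x y z w
 have cl: "\<psi> p q s x y z w \<in>: A2" if "{p, q, s, x, y, z, w} \<subseteq> \<A>" for p q s x y z w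
  using that by (simp add: \<psi>_def)
 have key: "?S (%x y z. \<psi> p q s x y \<one> z) = ?S (%u v w. ?S (%x y z. \<psi> p q s u v (x * y) (z * w)))"
  if [simp]: "p \<in>: A" "q \<in>: A" "s \<in>: A" for p q s
 proof (rule hexagon_app[OF L mod2])
  show "quadlin k A A2 (\<psi> p q s)"
   unfolding quadlin_def \<psi>_def by (intro conjI ballI trilinI klinI) simp_all
  show "tsum A4 L (%x y z. t4 x y \<one> z) = tsum A4 L (%u v w. tsum A4 L (%x y z. t4 u v (x * y) (z * w)))"
   using h unfolding hexagon1_def cyc_hexagon1_rhs[OF c] .
 qed simp_all
 have "t2 \<one> \<one> = ?S (%x y z. ?S' (%p q s. t2 ((x * p) * (y * q)) (z * s)))"
  by (subst one[OF mod2, of "%a b c. t2 (a * b) c"]) (auto intro!: trilinI)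
 also have "... = ?S (%x y z. ?S' (%p q s. \<psi> p q s x y \<one> z))"
  by (intro tsum_cong[OF L] tsum_cong[OF L']) (simp add: \<psi>_def)
 also have "... = ?S' (%p q s. ?S (%x y z. \<psi> p q s x y \<one> z))"
  by (rule tsum_swap[OF ag L L']) (simp add: cl)
 also have "... = ?S' (%p q s. ?S (%u v w. ?S (%x y z. \<psi> p q s u v (x * y) (z * w))))"
  by (rule tsum_cong[OF L'], rule key)
 also have "... = ?S (%u v w. ?S' (%p q s. ?S (%x y z. \<psi> p q s u v (x * y) (z * w))))"
  by (rule tsum_swap[OF ag L' L]) (intro tsum_closed[OF ag L], simp add: cl)
 also have "... = ?S (%u v w. ?S (%x y z. ?S' (%p q s. \<psi> p q s u v (x * y) (z * w))))"
  by (rule tsum_cong[OF L], rule tsum_swap[OF ag L' L]) (simp add: cl)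
 also have "... = ?S (%x y z. ?S (%u v w. ?S' (%p q s. \<psi> p q s u v (x * y) (z * w))))"
  by (rule tsum_swap[OF ag L L]) (intro tsum_closed[OF ag L'], simp add: cl)
 also have "... = ?S (%x y z. t2 (x * y) z)"
 proof (rule tsum_cong[OF L])
  fix x y z assume [simp]: "x \<in>: A" "y \<in>: A" "z \<in>: A"
  have "trilin k A A2 (%a b c. t2 (a * b * (x * y)) (z * c))" by (intro trilinI) simp_all
  from one[OF mod2 this] show "?S (%u v w. ?S' (%p q s. \<psi> p q s u v (x * y) (z * w))) = t2 (x * y) z"
   by (simp cong: tsum_cong add: L L' \<psi>_def A.m_assoc)
 qed
 finally show ?thesis unfolding normalized_list_def ..
qed

end

lemma lsum_same: "add G = add H ==> zero G = zero H ==> lsum G f xs = lsum H f xs"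
 by (induction xs) simp_all

context kalg
begin

lemma t3_mult:
 assumes "x \<in>: A" "y \<in>: A" "z \<in>: A" "u \<in>: A" "v \<in>: A" "w \<in>: A"
 shows "t3 x y z *\<^sub>A3 t3 u v w = t3 (x * u) (y * v) (z * w)"
 using assms tensor_alg_mult(2)[OF modA mult_bilin modA mult_bilin, folded alg2_def tens2_eq]
  tensor_alg_mult(2)[OF modA mult_bilin mod2 mult2, folded alg3_def]
 by (simp add: tens3_def t2_simps)

lemma t3_one: "\<one>\<^sub>A3 = t3 \<one> \<one> \<one>"
 unfolding alg3_def tensor_alg_one tens3_def tens2_def
 by (simp add: alg2_def tensor_alg_one)

lemma tsum_mult:
 assumes L: "triples L" "triples L'"
 shows "tsum A3 L t3 *\<^sub>A3 tsum A3 L' t3 =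
  tsum A3 L (%x y z. tsum A3 L' (%u v w. t3 (x * u) (y * v) (z * w)))"
proof -
 note ag = A3.ab_gr
 have c: "t3 x y z \<in>: A3" if "x \<in>: A" "y \<in>: A" "z \<in>: A" for x y z
  using that by (simp add: t3_simps)
 have R': "tsum A3 L' t3 \<in>: A3" by (rule tsum_closed[OF ag L(2) c])
 have l: "additive_on A3 A3 (%X. X *\<^sub>A3 tsum A3 L' t3)"
  using R' mult3 unfolding bilin_def klin_def by blast
 have r: "additive_on A3 A3 (%Y. X *\<^sub>A3 Y)" if "X \<in>: A3" for X
  using that mult3 unfolding bilin_def klin_def by blast
 have "tsum A3 L t3 *\<^sub>A3 tsum A3 L' t3 = tsum A3 L (%x y z. t3 x y z *\<^sub>A3 tsum A3 L' t3)"
  by (rule tsum_additive[OF ag ag l L(1) c])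
 also have "... = tsum A3 L (%x y z. tsum A3 L' (%u v w. t3 x y z *\<^sub>A3 t3 u v w))"
  by (rule tsum_cong[OF L(1)], rule tsum_additive[OF ag ag r L(2) c]) (rule c)
 also have "... = tsum A3 L (%x y z. tsum A3 L' (%u v w. t3 (x * u) (y * v) (z * w)))"
  by (intro tsum_cong[OF L(1)] tsum_cong[OF L(2)]) (simp add: t3_mult)
 finally show ?thesis .
qed

lemma tsum_t3_closed: "triples L ==> tsum A3 L t3 \<in>: A3"
 by (rule tsum_closed[OF A3.ab_gr]) (simp_all add: t3_simps)

lemma Units_iff:
 assumes "triples L"
 shows "tsum A3 L t3 \<in> Units A3 \<longleftrightarrow> (\<exists>L'. triples L' & prod_one L L' & prod_one L' L)"
proof
 assume "tsum A3 L t3 \<in> Units A3"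
 then obtain Y where Y: "Y \<in>: A3" "Y *\<^sub>A3 tsum A3 L t3 = \<one>\<^sub>A3" "tsum A3 L t3 *\<^sub>A3 Y = \<one>\<^sub>A3"
  unfolding Units_def by blast
 from t3_rep[OF Y(1)] obtain L' where L': "triples L'" "Y = tsum A3 L' t3" .
 then show "\<exists>L'. triples L' & prod_one L L' & prod_one L' L"
  using Y(2,3) tsum_mult[OF assms L'(1)] tsum_mult[OF L'(1) assms]
  unfolding prod_one_def t3_one by auto
next
 assume "\<exists>L'. triples L' & prod_one L L' & prod_one L' L"
 then obtain L' where L': "triples L'" "prod_one L L'" "prod_one L' L" by blast
 then show "tsum A3 L t3 \<in> Units A3"
  using tsum_mult[OF assms L'(1)] tsum_mult[OF L'(1) assms] tsum_t3_closed[OF assms] tsum_t3_closed[OF L'(1)]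
  unfolding Units_def prod_one_def t3_one[symmetric] by auto
qed

lemma trilin_cong:
 assumes "trilin k A G \<phi>"
  and "!!x y z. x \<in>: A ==> y \<in>: A ==> z \<in>: A ==> \<psi> x y z = \<phi> x y z"
 shows "trilin k A G \<psi>"
 by (rule trilinI) (simp_all add: assms(2) trilinD[OF assms(1)])

lemma trilin_tsum:
 assumes G: "module k G" and L: "triples L"
  and \<phi>: "!!u v w. u \<in>: A ==> v \<in>: A ==> w \<in>: A ==> trilin k A G (%x y z. \<phi> x y z u v w)"
 shows "trilin k A G (%x y z. tsum G L (\<phi> x y z))"
proof -
 interpret G: module k G by fact
 note ag = G.ab_gr
 note p = trilinD[OF \<phi>]
 have sm: "tsum G L (%u v w. c \<odot>\<^sub>G \<phi> x y z u v w) = c \<odot>\<^sub>G tsum G L (\<phi> x y z)"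
  if "c \<in>: k" "x \<in>: A" "y \<in>: A" "z \<in>: A" for c x y z
  by (rule tsum_additive[OF ag ag _ L, of "%X. c \<odot>\<^sub>G X", symmetric])
    (use that p(1) in "auto simp: additive_on_def G.smult_r_distr")
 show ?thesis
 proof (rule trilinI)
  fix x y z assume c: "x \<in>: A" "y \<in>: A" "z \<in>: A"
  show "tsum G L (\<phi> x y z) \<in>: G" by (rule tsum_closed[OF ag L]) (use c p(1) in auto)
  fix x' assume c': "x' \<in>: A"
  show "tsum G L (\<phi> (x \<oplus> x') y z) = tsum G L (\<phi> x y z) \<oplus>\<^sub>G tsum G L (\<phi> x' y z)"
   by (subst tsum_add[OF ag L, symmetric]) (use c c' p in "auto intro!: tsum_cong[OF L]")
 next
  fix x x' y z assume c: "x \<in>: A" "y \<in>: A" "z \<in>: A" and c': "x' \<in>: A"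
  show "tsum G L (\<phi> x (y \<oplus> x') z) = tsum G L (\<phi> x y z) \<oplus>\<^sub>G tsum G L (\<phi> x x' z)"
   by (subst tsum_add[OF ag L, symmetric]) (use c c' p in "auto intro!: tsum_cong[OF L]")
  show "tsum G L (\<phi> x y (z \<oplus> x')) = tsum G L (\<phi> x y z) \<oplus>\<^sub>G tsum G L (\<phi> x y x')"
   by (subst tsum_add[OF ag L, symmetric]) (use c c' p in "auto intro!: tsum_cong[OF L]")
 next
  fix c x y z assume c: "c \<in>: k" "x \<in>: A" "y \<in>: A" "z \<in>: A"
  show "tsum G L (\<phi> (c \<odot> x) y z) = c \<odot>\<^sub>G tsum G L (\<phi> x y z) &
    tsum G L (\<phi> x (c \<odot> y) z) = c \<odot>\<^sub>G tsum G L (\<phi> x y z) &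
    tsum G L (\<phi> x y (c \<odot> z)) = c \<odot>\<^sub>G tsum G L (\<phi> x y z)"
   unfolding sm[OF c, symmetric] by (intro conjI tsum_cong[OF L]) (use c p in auto)
 qed
qed

lemma canonical_iff:
 assumes L: "triples L"
 shows "canonical_R_matrix k A (tsum A3 L t3) \<longleftrightarrow>
  cyc L & hexagon1 L & hexagon2 L & (\<exists>L'. triples L' & prod_one L L' & prod_one L' L)"
proof -
 let ?R = "tsum A3 L t3"
 have sw3: "sweedler3 k A A3 \<phi> ?R = tsum A3 L \<phi>" if "trilin k A A3 \<phi>" for \<phi>
  by (rule sweedler3_tsum[OF mod3 that L])
 have sw4: "sweedler3 k A A4 \<phi> ?R = tsum A4 L \<phi>" if "trilin k A A4 \<phi>" for \<phi>
  by (rule sweedler3_tsum[OF mod4 that L])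
 have t: "trilin k A A3 (%x y z. t3 x y (a * z))" "trilin k A A3 (%x y z. t3 (x * a) y z)"
  "trilin k A A3 (%x y z. t3 (a * x) y z)" "trilin k A A3 (%x y z. t3 x (y * a) z)"
  "trilin k A A3 (%x y z. t3 x (a * y) z)" "trilin k A A3 (%x y z. t3 x y (z * a))"
  if "a \<in>: A" for a
  using that by (auto intro!: trilinI simp: multilinear_simps)
 have t4: "trilin k A A4 (%x y z. t4 x y \<one> z)" "trilin k A A4 (%x y z. t4 x \<one> y z)"
  by (auto intro!: trilinI simp: multilinear_simps)
 have ti: "trilin k A A4 (%u v w. t4 (u * x) v (w * y) z)" "trilin k A A4 (%u v w. t4 x (y * u) v (z * w))"
  if "x \<in>: A" "y \<in>: A" "z \<in>: A" for x y z
  using that by (auto intro!: trilinI simp: multilinear_simps)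
 have to: "trilin k A A4 (%x y z. t4 (u * x) v (w * y) z)" "trilin k A A4 (%x y z. t4 x (y * u) v (z * w))"
  if "u \<in>: A" "v \<in>: A" "w \<in>: A" for u v w
  using that by (auto intro!: trilinI simp: multilinear_simps)
 have tt: "trilin k A A4 (%x y z. tsum A4 L (%u v w. t4 (u * x) v (w * y) z))"
  "trilin k A A4 (%x y z. tsum A4 L (%u v w. t4 x (y * u) v (z * w)))"
  by (rule trilin_tsum[OF mod4 L to(1)], assumption+) (rule trilin_tsum[OF mod4 L to(2)])
 have c: "trilin k A A4 \<psi> \<longleftrightarrow> trilin k A A4 \<phi>" "tsum A4 L \<psi> = tsum A4 L \<phi>"
  if "!!x y z. x \<in>: A ==> y \<in>: A ==> z \<in>: A ==> \<psi> x y z = \<phi> x y z" for \<phi> \<psi>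
  using that trilin_cong[of A4 \<phi> \<psi>] trilin_cong[of A4 \<psi> \<phi>] tsum_cong[OF L, of \<psi> \<phi> A4] by auto
 have h1: "sweedler3 k A A4 (%x y z. sweedler3 k A A4 (%u v w. t4 (u * x) v (w * y) z) ?R) ?R =
   tsum A4 L (%x y z. tsum A4 L (%u v w. t4 (u * x) v (w * y) z))"
 proof -
  have e: "sweedler3 k A A4 (%u v w. t4 (u * x) v (w * y) z) ?R = tsum A4 L (%u v w. t4 (u * x) v (w * y) z)"
   if "x \<in>: A" "y \<in>: A" "z \<in>: A" for x y z by (rule sw4[OF ti(1)[OF that]])
  show ?thesis using sw4[of "%x y z. sweedler3 k A A4 (%u v w. t4 (u * x) v (w * y) z) ?R"]
    c[OF e] tt(1) by simp
 qed
 have h2: "sweedler3 k A A4 (%x y z. sweedler3 k A A4 (%u v w. t4 x (y * u) v (z * w)) ?R) ?R =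
   tsum A4 L (%x y z. tsum A4 L (%u v w. t4 x (y * u) v (z * w)))"
 proof -
  have e: "sweedler3 k A A4 (%u v w. t4 x (y * u) v (z * w)) ?R = tsum A4 L (%u v w. t4 x (y * u) v (z * w))"
   if "x \<in>: A" "y \<in>: A" "z \<in>: A" for x y z by (rule sw4[OF ti(2)[OF that]])
  show ?thesis using sw4[of "%x y z. sweedler3 k A A4 (%u v w. t4 x (y * u) v (z * w)) ?R"]
    c[OF e] tt(2) by simp
 qed
 show ?thesis
  unfolding canonical_R_matrix_def cyc_def hexagon1_def hexagon2_def Units_iff[OF L] h1 h2 sw4[OF t4(1)] sw4[OF t4(2)]
  using L by (auto simp: sw3[OF t(1)] sw3[OF t(2)] sw3[OF t(3)] sw3[OF t(4)] sw3[OF t(5)] sw3[OF t(6)])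
qed

lemma canonical_unfold:
 "canonical_R_matrix k A R \<longleftrightarrow> (\<exists>L. triples L & R = tsum A3 L t3 &
  cyc L & hexagon1 L & hexagon2 L & (\<exists>L'. triples L' & prod_one L L' & prod_one L' L))"
proof
 assume R: "canonical_R_matrix k A R"
 then have "R \<in>: A3" unfolding canonical_R_matrix_def Units_def by blast
 from t3_rep[OF this] obtain L where "triples L" "R = tsum A3 L t3" .
 with R canonical_iff show "\<exists>L. triples L & R = tsum A3 L t3 &
  cyc L & hexagon1 L & hexagon2 L & (\<exists>L'. triples L' & prod_one L L' & prod_one L' L)" by blast
qed (use canonical_iff in blast)

lemma normalized_canonical:
 assumes P: "normalized_family P"
 shows "canonical_R_matrix k A (tsum A3 (flat P) t3)"
proof -
 note L = normalized_familyD(3)[OF P]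
 note p = normalized_prod_one[OF P]
 have "prod_one (flat P) (swap23 (flat P))"
  using prod_one_swap23[OF swap23_triples[OF L] L p] by simp
 then show ?thesis
  unfolding canonical_iff[OF L]
  using normalized_cyc[OF P] normalized_hexagon1[OF P] normalized_hexagon2[OF P] p swap23_triples[OF L] by blast
qed

lemma AA_A2: "carrier (AA_bimodule k A) = carrier A2" "add (AA_bimodule k A) = add A2"
 "zero (AA_bimodule k A) = zero A2" "smult (AA_bimodule k A) = smult A2"
 by (simp_all add: AA_bimodule_def alg2_def tensor_alg_def Let_def module.defs bimodule.defs)

lemma psum_AA: "psum (AA_bimodule k A) ws \<phi> = psum A2 ws \<phi>"
 unfolding psum_def by (rule lsum_same) (simp_all add: AA_A2)

lemma AA_act_psum:
 assumes "pairs ws" "a \<in>: A"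
 shows "a |>\<^bsub>AA_bimodule k A\<^esub> psum A2 ws t2 = psum A2 ws (%y z. t2 (a * y) z)"
  and "psum A2 ws t2 <|\<^bsub>AA_bimodule k A\<^esub> a = psum A2 ws (%y z. t2 y (z * a))"
proof -
 let ?B = "AA_bimodule k A"
 have ag: "abelian_group ?B" by (rule bimoduleD(2)[OF bimodule_AA])
 have c: "t2 y z \<in>: ?B" if "y \<in>: A" "z \<in>: A" for y z
  using that by (simp add: AA_A2 t2_simps)
 have "a |>\<^sub>?B psum ?B ws t2 = psum ?B ws (%y z. a |>\<^sub>?B t2 y z)"
  by (rule psum_additive[OF ag ag klinD(4)[OF AA_act(1)[OF assms(2)]] assms(1) c])
 also have "... = psum ?B ws (%y z. t2 (a * y) z)"
  by (rule psum_cong[OF assms(1)]) (simp add: AA_act(2)[OF assms(2)])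
 finally show "a |>\<^sub>?B psum A2 ws t2 = psum A2 ws (%y z. t2 (a * y) z)" unfolding psum_AA .
 have "psum ?B ws t2 <|\<^sub>?B a = psum ?B ws (%y z. t2 y z <|\<^sub>?B a)"
  by (rule psum_additive[OF ag ag klinD(4)[OF AA_act(3)[OF assms(2)]] assms(1) c])
 also have "... = psum ?B ws (%y z. t2 y (z * a))"
  by (rule psum_cong[OF assms(1)]) (simp add: AA_act(4)[OF assms(2)])
 finally show "psum A2 ws t2 <|\<^sub>?B a = psum A2 ws (%y z. t2 y (z * a))" unfolding psum_AA .
qed

lemma t2_rep:
 assumes "w \<in>: A2"
 obtains ws where "pairs ws" "w = psum A2 ws t2"
 using is_ktens_rep[OF ktens2 assms] unfolding pairs_def psum_def by metis

lemma psum_t2_closed: "pairs ws ==> psum A2 ws t2 \<in>: A2"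
 by (rule psum_closed[OF A2.ab_gr]) (simp_all add: t2_simps)

lemma invariant_psum:
 assumes "pairs ws"
 shows "psum A2 ws t2 \<in>: (invariants A (AA_bimodule k A)) \<longleftrightarrow>
  (\<forall>a\<in>\<A>. psum A2 ws (%y z. t2 (a * y) z) = psum A2 ws (%y z. t2 y (z * a)))"
 using psum_t2_closed[OF assms] by (simp add: AA_A2 AA_act_psum[OF assms])

text \<open>Lists of pairs present the elements of \<open>A \<otimes> M\<close>; those of \<open>A \<otimes> (A \<otimes> A)\<^sup>A\<close> come from families.\<close>
lemma family_rep:
 assumes T: "is_ktens k A (invariants A (AA_bimodule k A)) T t" and Y: "Y \<in>: T"
 obtains P where "inv_family P" "Y = lsum T (%(x, ws). t x (psum A2 ws t2)) P"
proof -
 obtain xs where xs: "set xs \<subseteq> \<A> \<times> carrier (invariants A (AA_bimodule k A))" "Y = lsum T (%(x, w). t x w) xs"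
  using is_ktens_rep[OF T Y] by blast
 have "\<forall>w\<in>carrier A2. \<exists>ws. pairs ws & w = psum A2 ws t2" using t2_rep by blast
 from bchoice[OF this] obtain r where r0: "\<forall>w\<in>carrier A2. pairs (r w) & w = psum A2 (r w) t2" ..
 have r: "pairs (r w)" "psum A2 (r w) t2 = w" if "w \<in>: A2" for w using r0 that by simp_all
 define P where "P = map (%(x, w). (x, r w)) xs"
 have c: "w \<in>: A2" if "w \<in>: (invariants A (AA_bimodule k A))" for w using that by (simp add: AA_A2)
 have "inv_family P"
  unfolding inv_family_def P_def
 proof (clarsimp split: prod.split, intro conjI ballI)
  fix x w assume "(x, w) \<in> set xs"
  then have i: "x \<in>: A" "w \<in>: (invariants A (AA_bimodule k A))" using xs(1) by auto
  show "x \<in>: A" by fact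
  show "pairs (r w)" by (rule r(1)[OF c[OF i(2)]])
  show "psum A2 (r w) (%y z. t2 (a * y) z) = psum A2 (r w) (%y z. t2 y (z * a))" if "a \<in>: A" for a
   using invariant_psum[OF r(1)[OF c[OF i(2)]]] i(2) that r(2)[OF c[OF i(2)]] by metis
 qed
 moreover have "Y = lsum T (%(x, ws). t x (psum A2 ws t2)) P"
  unfolding xs(2) P_def lsum_map
  by (rule lsum_cong) (use xs(1) r(2) c in auto)
 ultimately show thesis using that by blast
qed

lemma A_inv_AA_iff: "R \<in> A_inv_AA k A \<longleftrightarrow> (\<exists>P. inv_family P & R = tsum A3 (flat P) t3)"
proof -
 let ?B = "AA_bimodule k A" and ?W = "invariants A (AA_bimodule k A)"
 let ?K = "ktensor k A ?W" and ?K2 = "ktensor k A A2" and ?t = "ktens k A ?W"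
 have W: "module k ?W" by (rule module_invariants[OF bimodule_AA])
 have K: "is_ktens k A ?W ?K ?t" by (rule is_ktens_ktensor[OF modA W])
 have K2: "is_ktens k A A2 ?K2 (ktens k A A2)" by (rule is_ktens_ktensor[OF modA mod2])
 interpret K: module k ?K by (rule is_ktensD[OF K])
 interpret K2: module k ?K2 by (rule is_ktensD[OF K2])
 have same: "carrier ?K2 = carrier A3" "add ?K2 = add A3" "zero ?K2 = zero A3"
  by (simp_all add: alg3_def tensor_alg_def Let_def)
 define f where "f = ktensor_map k A ?W A A2 (%x. x) (%w. w)"
 have "bilin k A ?W ?K2 (%x w. ktens k A A2 x w)"
  by (rule bilinI) (simp_all add: is_ktens_simps[OF K2] AA_A2)
 note ta = is_ktens_the_additive[OF K K2.module_axioms this]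
 have f: "klin k ?K ?K2 f" "!!x w. x \<in>: A ==> w \<in>: ?W ==> f (?t x w) = ktens k A A2 x w"
  using ta unfolding f_def ktensor_map_def linear_maps_iff by blast+
 have fP: "f (lsum ?K (%(x, ws). ?t x (psum A2 ws t2)) P) = tsum A3 (flat P) t3" if P: "inv_family P" for P
 proof -
  have i: "x \<in>: A" "pairs ws" "psum A2 ws t2 \<in>: ?W" if "(x, ws) \<in> set P" for x ws
   using P that invariant_psum unfolding inv_family_def by blast+
  have "f (lsum ?K (%(x, ws). ?t x (psum A2 ws t2)) P) = lsum ?K2 (%p. f (case p of (x, ws) => ?t x (psum A2 ws t2))) P"
   by (rule klin_lsum[OF K.module_axioms K2.module_axioms f(1)])
     (use i is_ktens_simps(1)[OF K] in auto)
  also have "... = lsum A3 (%p. f (case p of (x, ws) => ?t x (psum A2 ws t2))) P"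
   by (rule lsum_same) (simp_all add: same)
  also have "... = lsum A3 (%(x, ws). psum A3 ws (t3 x)) P"
  proof (rule lsum_cong, clarify)
   fix x ws assume p: "(x, ws) \<in> set P"
   have "additive_on A2 A3 (ktens k A A2 x)"
    using is_ktens_bilin[OF ktens3] i(1)[OF p] unfolding bilin_def klin_def by blast
   from psum_additive[OF A2.ab_gr A3.ab_gr this i(2)[OF p], of t2]
   show "f (?t x (psum A2 ws t2)) = psum A3 ws (t3 x)"
    using f(2)[OF i(1)[OF p] i(3)[OF p]] psum_cong[OF i(2)[OF p], of "t3 x" "%y z. ktens k A A2 x (t2 y z)" A3]
    by (simp add: t2_simps tens3_def)
  qed
  also have "... = tsum A3 (flat P) t3"
   by (rule tsum_flat[OF A3.ab_gr P, symmetric]) (simp add: t3_simps)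
  finally show ?thesis .
 qed
 show ?thesis
 proof
  assume "R \<in> A_inv_AA k A"
  then obtain Y where Y: "Y \<in>: ?K" "R = f Y" unfolding A_inv_AA_def Let_def f_def by blast
  from family_rep[OF K Y(1)] obtain P where P: "inv_family P" "Y = lsum ?K (%(x, ws). ?t x (psum A2 ws t2)) P" .
  then show "\<exists>P. inv_family P & R = tsum A3 (flat P) t3" using fP Y(2) by blast
 next
  assume "\<exists>P. inv_family P & R = tsum A3 (flat P) t3"
  then obtain P where P: "inv_family P" "R = tsum A3 (flat P) t3" by blast
  have i: "x \<in>: A & psum A2 ws t2 \<in>: ?W" if "(x, ws) \<in> set P" for x ws
   using P(1) that invariant_psum unfolding inv_family_def by blast
  have "lsum ?K (%(x, ws). ?t x (psum A2 ws t2)) P \<in>: ?K"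
   by (rule K.lsum_closed) (use i is_ktens_simps(1)[OF K] in "auto simp del: invariants_simps")
  then show "R \<in> A_inv_AA k A"
   unfolding A_inv_AA_def Let_def P(2) fP[OF P(1), symmetric] f_def by blast
 qed
qed

lemma normalized_iff:
 "R \<in> A_inv_AA k A & sweedler3 k A A2 (%x y z. t2 (x * y) z) R = t2 \<one> \<one> \<longleftrightarrow>
  (\<exists>P. normalized_family P & R = tsum A3 (flat P) t3)"
proof -
 have "trilin k A A2 (%x y z. t2 (x * y) z)" by (auto intro!: trilinI simp: multilinear_simps)
 from sweedler3_tsum[OF mod2 this] show ?thesis
  unfolding A_inv_AA_iff normalized_family_def normalized_list_def using inv_family_triples by auto
qed

lemma normalized_ex_unique:
 "(\<exists>!R. R \<in> A_inv_AA k A & sweedler3 k A A2 (%x y z. t2 (x * y) z) R = t2 \<one> \<one>) \<longleftrightarrow>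
  (\<exists>P. normalized_family P)"
 unfolding normalized_iff using normalized_unique by blast

end

section \<open>Functionals, free modules and the trace ideal\<close>

definition functional :: "('k, 'x) ring_scheme => ('k, 'm, 'y) module_scheme => ('m => 'k) => bool" where
 "functional k M t \<longleftrightarrow> additive_on M k t & (\<forall>c\<in>carrier k. \<forall>x\<in>carrier M. t (c \<odot>\<^sub>M x) = c *\<^sub>k t x)"

lemma functionalD:
 assumes "functional k M t"
 shows "x \<in>: M ==> t x \<in>: k"
  and "x \<in>: M ==> y \<in>: M ==> t (x \<oplus>\<^sub>M y) = t x \<oplus>\<^sub>k t y"
  and "c \<in>: k ==> x \<in>: M ==> t (c \<odot>\<^sub>M x) = c *\<^sub>k t x"
  and "additive_on M k t"
 using assms unfolding functional_def additive_on_def by auto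

context module
begin

lemma finsum_lsum:
 assumes "distinct bs" "!!b. b \<in> set bs ==> f b \<in>: M"
 shows "finsum M f (set bs) = lsum M f bs"
 using assms by (induction bs) (auto simp: M.finsum_insert Pi_iff)

text \<open>The \<open>\<beta> b\<close> are the coordinates in a basis; finitely many elements involve finitely many of them.\<close>
lemma free_coordinates:
 assumes "free_module R M"
 obtains \<beta> where "!!b. functional R M (\<beta> b)"
  and "!!X. finite X ==> X \<subseteq> carrier M ==>
   \<exists>bs. set bs \<subseteq> carrier M & (\<forall>x\<in>X. x = lsum M (%b. \<beta> b x \<odot>\<^sub>M b) bs)"
proof -
 obtain B where B: "module_basis R M B" using assms unfolding free_module_def by blast
 have BM: "B \<subseteq> carrier M" using B unfolding module_basis_def by blast
 define supp where "supp c = {b \<in> B. c b \<noteq> \<zero>}" for c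
 define P where "P x c \<longleftrightarrow> c \<in> B \<rightarrow>\<^sub>E carrier R & finite (supp c) &
  x = (\<Oplus>\<^bsub>M\<^esub>b\<in>supp c. c b \<odot>\<^sub>M b)" for x c
 have ex1: "\<exists>!c. P x c" if "x \<in>: M" for x
  using B that unfolding module_basis_def P_def supp_def by blast
 define co where "co x = (THE c. P x c)" for x
 have co: "P x (co x)" if "x \<in>: M" for x unfolding co_def by (rule theI'[OF ex1[OF that]])
 have sum_ext: "(\<Oplus>\<^bsub>M\<^esub>b\<in>supp c. c b \<odot>\<^sub>M b) = (\<Oplus>\<^bsub>M\<^esub>b\<in>F. c b \<odot>\<^sub>M b)"
  if "finite F" "supp c \<subseteq> F" "F \<subseteq> B" "!!b. b \<in> B ==> c b \<in>: R" for c F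
  by (rule M.add.finprod_mono_neutral_cong_left[OF that(1,2)])
    (use that BM in "auto simp: supp_def subset_iff")
 have unique: "co x = c" if "x \<in>: M" "c \<in> B \<rightarrow>\<^sub>E carrier R" "finite F" "F \<subseteq> B" "supp c \<subseteq> F"
  "x = (\<Oplus>\<^bsub>M\<^esub>b\<in>F. c b \<odot>\<^sub>M b)" for x c F
 proof -
  have "(\<Oplus>\<^bsub>M\<^esub>b\<in>supp c. c b \<odot>\<^sub>M b) = (\<Oplus>\<^bsub>M\<^esub>b\<in>F. c b \<odot>\<^sub>M b)"
   by (rule sum_ext[OF that(3,5,4)]) (use that(2) in auto)
  then have "P x c" unfolding P_def using that finite_subset[OF that(5,3)] by simp
  then show ?thesis using ex1[OF that(1)] co[OF that(1)] by blast
 qed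
 have coB: "co x b \<in>: R" if "x \<in>: M" "b \<in> B" for x b
  using co[OF that(1)] that(2) unfolding P_def by auto
 have fin: "finite (supp (co x))" "supp (co x) \<subseteq> B" if "x \<in>: M" for x
  using co[OF that] unfolding P_def supp_def by auto
 have rep: "x = (\<Oplus>\<^bsub>M\<^esub>b\<in>F. co x b \<odot>\<^sub>M b)" if "x \<in>: M" "finite F" "supp (co x) \<subseteq> F" "F \<subseteq> B" for x F
  using co[OF that(1)] sum_ext[OF that(2,3,4)] coB[OF that(1)] unfolding P_def by metis
 define \<beta> where "\<beta> b x = (if b \<in> B then co x b else \<zero>)" for b x
 have add: "co (x \<oplus>\<^sub>M y) = (\<lambda>b\<in>B. co x b \<oplus> co y b)" if x: "x \<in>: M" and y: "y \<in>: M" for x y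
 proof -
  let ?F = "supp (co x) \<union> supp (co y)"
  have F: "finite ?F" "?F \<subseteq> B" using fin x y by auto
  show ?thesis
  proof (rule unique[OF _ _ F])
   have "x \<oplus>\<^sub>M y = (\<Oplus>\<^bsub>M\<^esub>b\<in>?F. co x b \<odot>\<^sub>M b) \<oplus>\<^sub>M (\<Oplus>\<^bsub>M\<^esub>b\<in>?F. co y b \<odot>\<^sub>M b)"
    using rep[OF x F(1) _ F(2)] rep[OF y F(1) _ F(2)] by auto
   also have "... = (\<Oplus>\<^bsub>M\<^esub>b\<in>?F. co x b \<odot>\<^sub>M b \<oplus>\<^sub>M co y b \<odot>\<^sub>M b)"
    by (rule M.finsum_addf[symmetric]) (use F(2) BM coB x y in "auto simp: subset_iff")
   also have "... = (\<Oplus>\<^bsub>M\<^esub>b\<in>?F. (\<lambda>b\<in>B. co x b \<oplus> co y b) b \<odot>\<^sub>M b)"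
    by (rule M.finsum_cong') (use F(2) BM coB x y in "auto simp: subset_iff smult_l_distr")
   finally show "x \<oplus>\<^sub>M y = (\<Oplus>\<^bsub>M\<^esub>b\<in>?F. (\<lambda>b\<in>B. co x b \<oplus> co y b) b \<odot>\<^sub>M b)" .
  qed (use x y coB in "auto simp: supp_def")
 qed
 have scale: "co (c \<odot>\<^sub>M x) = (\<lambda>b\<in>B. c * co x b)" if c: "c \<in>: R" and x: "x \<in>: M" for c x
 proof -
  let ?F = "supp (co x)"
  have F: "finite ?F" "?F \<subseteq> B" using fin x by auto
  show ?thesis
  proof (rule unique[OF _ _ F])
   have "c \<odot>\<^sub>M x = c \<odot>\<^sub>M (\<Oplus>\<^bsub>M\<^esub>b\<in>?F. co x b \<odot>\<^sub>M b)"
    using rep[OF x F(1) _ F(2)] by auto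
   also have "... = (\<Oplus>\<^bsub>M\<^esub>b\<in>?F. c \<odot>\<^sub>M (co x b \<odot>\<^sub>M b))"
    by (rule finsum_smult_ldistr[OF F(1) c]) (use F(2) BM coB x in "auto simp: subset_iff")
   also have "... = (\<Oplus>\<^bsub>M\<^esub>b\<in>?F. (\<lambda>b\<in>B. c * co x b) b \<odot>\<^sub>M b)"
    by (rule M.finsum_cong') (use F(2) BM coB x c in "auto simp: subset_iff smult_assoc1")
   finally show "c \<odot>\<^sub>M x = (\<Oplus>\<^bsub>M\<^esub>b\<in>?F. (\<lambda>b\<in>B. c * co x b) b \<odot>\<^sub>M b)" .
  qed (use c x coB in "auto simp: supp_def")
 qed
 have "functional R M (\<beta> b)" for b
  unfolding functional_def additive_on_def using coB by (auto simp: \<beta>_def add scale)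
 moreover have "\<exists>bs. set bs \<subseteq> carrier M & (\<forall>x\<in>X. x = lsum M (%b. \<beta> b x \<odot>\<^sub>M b) bs)"
  if X: "finite X" "X \<subseteq> carrier M" for X
 proof -
  let ?F = "\<Union>x\<in>X. supp (co x)"
  have F: "finite ?F" "?F \<subseteq> B" using X fin by auto
  obtain bs where bs: "set bs = ?F" "distinct bs" using finite_distinct_list[OF F(1)] by blast
  have "x = lsum M (%b. \<beta> b x \<odot>\<^sub>M b) bs" if "x \<in> X" for x
  proof -
   have x: "x \<in>: M" using that X by auto
   have "x = (\<Oplus>\<^bsub>M\<^esub>b\<in>set bs. co x b \<odot>\<^sub>M b)"
    unfolding bs(1) by (rule rep[OF x F(1) _ F(2)]) (use that in auto)
   also have "... = lsum M (%b. co x b \<odot>\<^sub>M b) bs"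
    by (rule finsum_lsum[OF bs(2)]) (use bs(1) F(2) BM coB x in "auto simp: subset_iff")
   also have "... = lsum M (%b. \<beta> b x \<odot>\<^sub>M b) bs"
    by (rule lsum_cong) (use bs(1) F(2) in "auto simp: \<beta>_def")
   finally show ?thesis .
  qed
  then show ?thesis using bs(1) F(2) BM by (intro exI[of _ bs]) auto
 qed
 ultimately show thesis using that by blast
qed

end

text \<open>
  A list of pairs \<open>(x, t)\<close> with \<open>m = \<Sum> t(m) x\<close> is a dual basis of a finitely generated projective
  module.
\<close>
definition dual_basis :: "('k, 'x) ring_scheme => ('k, 'm, 'y) module_scheme => ('m \<times> ('m => 'k)) list => bool" where
 "dual_basis k M D \<longleftrightarrow> (\<forall>(x, t)\<in>set D. x \<in>: M & functional k M t) &
   (\<forall>m\<in>carrier M. m = lsum M (%(x, t). t m \<odot>\<^sub>M x) D)"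

primrec list_span :: "('k, 'x) ring_scheme => ('k, 'm, 'y) module_scheme => 'm list => 'm set" where
 "list_span k M [] = {\<zero>\<^sub>M}"
| "list_span k M (x # xs) = {(c \<odot>\<^sub>M x) \<oplus>\<^sub>M s | c s. c \<in>: k & s \<in> list_span k M xs}"

definition trace_ideal :: "('k, 'x) ring_scheme => ('k, 'm, 'y) module_scheme => ('m => 'k) set => 'k set" where
 "trace_ideal k M F = {lsum k (%(t, m). t m) ps | ps. set ps \<subseteq> F \<times> carrier M}"

context module
begin

lemma list_span_closed:
 assumes "set xs \<subseteq> carrier M"
 shows "list_span R M xs \<subseteq> carrier M"
  and "s \<in> list_span R M xs ==> s' \<in> list_span R M xs ==> s \<oplus>\<^sub>M s' \<in> list_span R M xs"
  and "c \<in>: R ==> s \<in> list_span R M xs ==> c \<odot>\<^sub>M s \<in> list_span R M xs"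
  and "\<zero>\<^sub>M \<in> list_span R M xs"
proof -
 show sub: "list_span R M xs \<subseteq> carrier M"
  using assms by (induction xs) auto
 show "s \<oplus>\<^sub>M s' \<in> list_span R M xs" if "s \<in> list_span R M xs" "s' \<in> list_span R M xs"
  using assms that
 proof (induction xs arbitrary: s s')
  case (Cons x xs)
  then obtain c u c' u' where e: "c \<in>: R" "u \<in> list_span R M xs" "s = (c \<odot>\<^sub>M x) \<oplus>\<^sub>M u"
   "c' \<in>: R" "u' \<in> list_span R M xs" "s' = (c' \<odot>\<^sub>M x) \<oplus>\<^sub>M u'" by auto
  have xs: "set xs \<subseteq> carrier M" "x \<in>: M" using Cons.prems by auto
  have "list_span R M xs \<subseteq> carrier M" using xs(1) by (induction xs) auto
  then have u: "u \<in>: M" "u' \<in>: M" using e by auto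
  have "s \<oplus>\<^sub>M s' = ((c \<oplus> c') \<odot>\<^sub>M x) \<oplus>\<^sub>M (u \<oplus>\<^sub>M u')"
   using e u xs by (simp add: smult_l_distr M.a_ac)
  moreover have "u \<oplus>\<^sub>M u' \<in> list_span R M xs" by (rule Cons.IH[OF xs(1) e(2,5)])
  ultimately show ?case using e(1,4) by auto
 qed simp
 show "c \<odot>\<^sub>M s \<in> list_span R M xs" if "c \<in>: R" "s \<in> list_span R M xs"
  using assms that
 proof (induction xs arbitrary: s)
  case (Cons x xs)
  then obtain d u where e: "d \<in>: R" "u \<in> list_span R M xs" "s = (d \<odot>\<^sub>M x) \<oplus>\<^sub>M u" by auto
  have xs: "set xs \<subseteq> carrier M" "x \<in>: M" using Cons.prems by auto
  have "list_span R M xs \<subseteq> carrier M" using xs(1) by (induction xs) auto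
  then have u: "u \<in>: M" using e by auto
  have "c \<odot>\<^sub>M s = ((c * d) \<odot>\<^sub>M x) \<oplus>\<^sub>M (c \<odot>\<^sub>M u)"
   using e u xs that by (simp add: smult_r_distr smult_assoc1)
  moreover have "c \<odot>\<^sub>M u \<in> list_span R M xs" by (rule Cons.IH[OF xs(1) that(1) e(2)])
  ultimately show ?case using e(1) that by auto
 qed simp
 show "\<zero>\<^sub>M \<in> list_span R M xs"
  using assms by (induction xs) (auto, metis M.l_zero M.zero_closed R.zero_closed smult_l_null)
qed

lemma trace_ideal_closed:
 assumes F0: "\<forall>t\<in>F. functional R M t"
 shows "trace_ideal R M F \<subseteq> carrier R"
  and "a \<in> trace_ideal R M F ==> b \<in> trace_ideal R M F ==> a \<oplus> b \<in> trace_ideal R M F"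
  and "c \<in>: R ==> a \<in> trace_ideal R M F ==> c * a \<in> trace_ideal R M F"
  and "\<zero> \<in> trace_ideal R M F"
  and "t \<in> F ==> m \<in>: M ==> t m \<in> trace_ideal R M F"
proof -
 note F = bspec[OF F0]
 have c: "(case p of (t, m) => t m) \<in>: R" if "p \<in> F \<times> carrier M" for p
  using that functionalD(1)[OF F] by auto
 show "trace_ideal R M F \<subseteq> carrier R"
 proof
  fix a assume "a \<in> trace_ideal R M F"
  then obtain ps where ps: "set ps \<subseteq> F \<times> carrier M" "a = lsum R (%(t, m). t m) ps"
   unfolding trace_ideal_def by blast
  show "a \<in>: R" unfolding ps(2) by (rule R.lsum_closed, rule c) (use ps(1) in auto)
 qed
 show "a \<oplus> b \<in> trace_ideal R M F" if "a \<in> trace_ideal R M F" "b \<in> trace_ideal R M F"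
 proof -
  from that obtain ps qs where ps: "set ps \<subseteq> F \<times> carrier M" "a = lsum R (%(t, m). t m) ps"
   "set qs \<subseteq> F \<times> carrier M" "b = lsum R (%(t, m). t m) qs" unfolding trace_ideal_def by blast
  have "a \<oplus> b = lsum R (%(t, m). t m) (ps @ qs)" unfolding ps(2,4)
   by (rule R.lsum_append[symmetric]) (use ps(1,3) c in auto)
  then show ?thesis unfolding trace_ideal_def using ps(1,3) by (intro CollectI exI[of _ "ps @ qs"]) auto
 qed
 show "c * a \<in> trace_ideal R M F" if "c \<in>: R" "a \<in> trace_ideal R M F"
 proof -
  from that obtain ps where ps: "set ps \<subseteq> F \<times> carrier M" "a = lsum R (%(t, m). t m) ps"
   unfolding trace_ideal_def by blast
  have l: "additive_on R R (%x. c * x)" using that(1) by (auto simp: additive_on_def R.r_distr)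
  have "c * a = lsum R (%p. c * (case p of (t, m) => t m)) ps"
   unfolding ps(2) by (rule additive_on_lsum[OF R.ab_gr R.ab_gr l]) (use ps(1) c in auto)
  also have "... = lsum R (%(t, m). t m) (map (%(t, m). (t, c \<odot>\<^sub>M m)) ps)"
   unfolding lsum_map by (rule lsum_cong) (use ps(1) that(1) functionalD(3)[OF F] in auto)
  finally show ?thesis unfolding trace_ideal_def using ps(1) that(1)
   by (intro CollectI exI[of _ "map (%(t, m). (t, c \<odot>\<^sub>M m)) ps"]) auto
 qed
 show "\<zero> \<in> trace_ideal R M F" unfolding trace_ideal_def by (intro CollectI exI[of _ "[]"]) auto
 show "t m \<in> trace_ideal R M F" if "t \<in> F" "m \<in>: M"
  unfolding trace_ideal_def
  by (intro CollectI exI[of _ "[(t, m)]"]) (use that functionalD(1)[OF F] in auto)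
qed

text \<open>
  A faithful finitely generated projective module is a generator: its trace ideal \<open>I\<close> satisfies
  \<open>M = I M\<close>. Removing the generators one at a time, as in the proof of Nakayama's lemma, produces
  an \<open>e \<in> I\<close> such that \<open>1 - e\<close> annihilates \<open>M\<close>, whence \<open>e = 1\<close>.
\<close>
lemma trace_ideal_one:
 assumes D: "dual_basis R M D"
  and faithful: "!!c. c \<in>: R ==> (\<forall>m\<in>carrier M. c \<odot>\<^sub>M m = \<zero>\<^sub>M) ==> c = \<zero>"
 obtains ps where "set ps \<subseteq> snd ` set D \<times> carrier M" "lsum R (%(t, m). t m) ps = \<one>"
proof -
 let ?I = "trace_ideal R M (snd ` set D)"
 have "\<forall>t\<in>snd ` set D. functional R M t" using D unfolding dual_basis_def by auto
 note I = trace_ideal_closed[OF this]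
 have Dx: "x \<in>: M" "functional R M t" "t \<in> snd ` set D" if "(x, t) \<in> set D" for x t
  using D that unfolding dual_basis_def by force+
 have rep: "m = lsum M (%(x, t). t m \<odot>\<^sub>M x) D" if "m \<in>: M" for m
  using D that unfolding dual_basis_def by blast
 have step: "\<exists>e f. e \<in> ?I & f \<in>: R & f \<oplus> e = \<one> & (\<forall>m\<in>carrier M. f \<odot>\<^sub>M m = \<zero>\<^sub>M)"
  if "set xs \<subseteq> carrier M" "e \<in> ?I" "f \<in>: R" "f \<oplus> e = \<one>" "\<forall>m\<in>carrier M. f \<odot>\<^sub>M m \<in> list_span R M xs" for xs e f
  using that
 proof (induction xs arbitrary: e f)
  case Nil
  then show ?case by auto
 next
  case (Cons y xs)
  have y: "y \<in>: M" and xs: "set xs \<subseteq> carrier M" using Cons.prems by auto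
  note sp = list_span_closed[OF xs]
  have e: "e \<in>: R" using Cons.prems(2) I(1) by auto
  have f: "f \<in>: R" by fact
  have "\<forall>m\<in>carrier M. \<exists>c s. c \<in>: R & s \<in> list_span R M xs & f \<odot>\<^sub>M m = (c \<odot>\<^sub>M y) \<oplus>\<^sub>M s"
   using Cons.prems(5) unfolding list_span.simps by blast
  then obtain c s where cs: "!!m. m \<in>: M ==> c m \<in>: R"
   "!!m. m \<in>: M ==> s m \<in> list_span R M xs"
   "!!m. m \<in>: M ==> f \<odot>\<^sub>M m = (c m \<odot>\<^sub>M y) \<oplus>\<^sub>M s m" by metis
  have sM: "s m \<in>: M" if "m \<in>: M" for m using cs(2)[OF that] sp(1) by auto
  have key: "\<exists>b u. b \<in> ?I & u \<in> list_span R M xs & lsum M (%(x, t). t y \<odot>\<^sub>M (f \<odot>\<^sub>M x)) D' = (b \<odot>\<^sub>M y) \<oplus>\<^sub>M u"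
   if "set D' \<subseteq> set D" for D'
   using that
  proof (induction D')
   case Nil
   show ?case using I(4) sp(4) y by (intro exI[of _ \<zero>] exI[of _ "\<zero>\<^sub>M"]) simp
  next
   case (Cons p D')
   obtain x t where p: "p = (x, t)" by fastforce
   have xt: "x \<in>: M" "functional R M t" "t \<in> snd ` set D" using Dx Cons.prems p by auto
   obtain b u where bu: "b \<in> ?I" "u \<in> list_span R M xs"
    "lsum M (%(x, t). t y \<odot>\<^sub>M (f \<odot>\<^sub>M x)) D' = (b \<odot>\<^sub>M y) \<oplus>\<^sub>M u" using Cons by auto
   have ty: "t y \<in> ?I" "t y \<in>: R" using I(5)[OF xt(3) y] I(1) by auto
   have b: "b \<in>: R" "u \<in>: M" using bu I(1) sp(1) by auto
   have "t y \<odot>\<^sub>M (f \<odot>\<^sub>M x) = ((t y * c x) \<odot>\<^sub>M y) \<oplus>\<^sub>M (t y \<odot>\<^sub>M s x)"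
    using cs xt ty y sM by (simp add: smult_r_distr smult_assoc1)
   then have "lsum M (%(x, t). t y \<odot>\<^sub>M (f \<odot>\<^sub>M x)) (p # D') =
    ((t y * c x \<oplus> b) \<odot>\<^sub>M y) \<oplus>\<^sub>M ((t y \<odot>\<^sub>M s x) \<oplus>\<^sub>M u)"
    using bu(3) b cs(1)[OF xt(1)] ty sM[OF xt(1)] y by (simp add: p smult_l_distr M.a_ac)
   moreover have "t y * c x \<in> ?I" using I(3)[OF cs(1)[OF xt(1)] ty(1)] R.m_comm[OF ty(2) cs(1)[OF xt(1)]] by simp
   then have "t y * c x \<oplus> b \<in> ?I" using I(2) bu(1) by blast
   moreover have "(t y \<odot>\<^sub>M s x) \<oplus>\<^sub>M u \<in> list_span R M xs"
    using sp(2,3) ty(2) cs(2)[OF xt(1)] bu(2) by blast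
   ultimately show ?case by blast
  qed
  have "additive_on M M (%m. f \<odot>\<^sub>M m)" using f by (auto simp: additive_on_def smult_r_distr)
  then have "f \<odot>\<^sub>M lsum M (%(x, t). t y \<odot>\<^sub>M x) D = lsum M (%p. f \<odot>\<^sub>M (case p of (x, t) => t y \<odot>\<^sub>M x)) D"
   by (rule additive_on_lsum[OF M.ab_gr M.ab_gr])
     (use Dx functionalD(1)[OF Dx(2) y] in "auto intro!: smult_closed")
  also have "... = lsum M (%(x, t). t y \<odot>\<^sub>M (f \<odot>\<^sub>M x)) D"
   by (rule lsum_cong)
     (use Dx functionalD(1)[OF Dx(2) y] f in "auto simp: smult_assoc1[symmetric] R.m_comm")
  finally have "f \<odot>\<^sub>M y = lsum M (%(x, t). t y \<odot>\<^sub>M (f \<odot>\<^sub>M x)) D" using rep[OF y] by simp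
  with key[of D] obtain b u where bu: "b \<in> ?I" "u \<in> list_span R M xs" "f \<odot>\<^sub>M y = (b \<odot>\<^sub>M y) \<oplus>\<^sub>M u" by auto
  have b: "b \<in>: R" "u \<in>: M" using bu I(1) sp(1) by auto
  define f1 where "f1 = f \<oplus> (\<ominus> b)"
  have f1: "f1 \<in>: R" using f b by (simp add: f1_def)
  have f1y: "f1 \<odot>\<^sub>M y = u"
   using f b y bu(3) by (simp add: f1_def smult_l_distr smult_l_minus M.a_ac M.r_neg)
  have f1e: "f1 \<oplus> (e \<oplus> b) = \<one>"
  proof -
   have "f1 \<oplus> (e \<oplus> b) = (f \<oplus> e) \<oplus> (b \<oplus> (\<ominus> b))"
    using f b e by (simp add: f1_def R.a_ac)
   then show ?thesis using Cons.prems(4) b by (simp add: R.r_neg)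
  qed
  have f1I: "f1 * e \<oplus> (e \<oplus> b) \<in> ?I" using I(2,3) Cons.prems(2) bu(1) f1 by blast
  have "f1 * f \<oplus> (f1 * e \<oplus> (e \<oplus> b)) = f1 * (f \<oplus> e) \<oplus> (e \<oplus> b)"
   using f1 f e b by (simp add: R.r_distr R.a_assoc)
  then have sum1: "f1 * f \<oplus> (f1 * e \<oplus> (e \<oplus> b)) = \<one>"
   using Cons.prems(4) f1 f1e by simp
  have "(f1 * f) \<odot>\<^sub>M m \<in> list_span R M xs" if m: "m \<in>: M" for m
  proof -
   have "(f1 * f) \<odot>\<^sub>M m = (c m \<odot>\<^sub>M (f1 \<odot>\<^sub>M y)) \<oplus>\<^sub>M (f1 \<odot>\<^sub>M s m)"
    using f1 f m y cs(1)[OF m] cs(3)[OF m] sM[OF m]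
    by (simp add: smult_assoc1 smult_r_distr) (simp add: smult_assoc1[symmetric] R.m_comm)
   then show ?thesis using f1y bu(2) cs(1,2)[OF m] f1 sp(2,3) by simp
  qed
  then show ?case using Cons.IH[OF xs f1I _ sum1] f1 f by simp
 qed
 have "set (map fst D) \<subseteq> carrier M" using Dx by auto
 moreover have "\<forall>m\<in>carrier M. \<one> \<odot>\<^sub>M m \<in> list_span R M (map fst D)"
 proof
  fix m assume m: "m \<in>: M"
  have "lsum M (%(x, t). t m \<odot>\<^sub>M x) D' \<in> list_span R M (map fst D')" if "set D' \<subseteq> set D" for D'
   using that
  proof (induction D')
   case (Cons p D')
   obtain x t where p: "p = (x, t)" by fastforce
   then have "t m \<in>: R" using functionalD(1)[OF Dx(2) m] Cons.prems by auto
   with Cons show ?case by (auto simp: p)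
  qed simp
  from this[of D] show "\<one> \<odot>\<^sub>M m \<in> list_span R M (map fst D)" using rep[OF m] m by simp
 qed
 ultimately obtain e f where ef: "e \<in> ?I" "f \<in>: R" "f \<oplus> e = \<one>" "\<forall>m\<in>carrier M. f \<odot>\<^sub>M m = \<zero>\<^sub>M"
  using step[of "map fst D" \<zero> \<one>] I(4) by auto
 then have "f = \<zero>" using faithful by blast
 then have "e = \<one>" using ef(1,3) I(1) by auto
 with ef(1) show thesis using that unfolding trace_ideal_def by blast
qed

end

section \<open>The category of bimodules\<close>

definition bimap ::
 "('k, 'x) ring_scheme => ('k, 'a) module => ('k, 'a, 'm) bimodule => ('k, 'a, 'n) bimodule => ('m => 'n) => bool" where
 "bimap k A M N f \<longleftrightarrow> klin k M N f & (\<forall>a\<in>carrier A. \<forall>m\<in>carrier M.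
   f (a |>\<^sub>M m) = a |>\<^sub>N f m & f (m <|\<^sub>M a) = f m <|\<^sub>N a)"

lemma bimodule_maps_iff: "f \<in> bimodule_maps k A M N \<longleftrightarrow> bimap k A M N f & f \<in> extensional (carrier M)"
 unfolding bimodule_maps_def bimap_def linear_maps_iff by blast

lemma bimapD:
 assumes "bimap k A M N f"
 shows "klin k M N f" "additive_on M N f" "x \<in>: M ==> f x \<in>: N"
  and "x \<in>: M ==> y \<in>: M ==> f (x \<oplus>\<^sub>M y) = f x \<oplus>\<^sub>N f y"
  and "c \<in>: k ==> x \<in>: M ==> f (c \<odot>\<^sub>M x) = c \<odot>\<^sub>N f x"
  and "a \<in> carrier A ==> x \<in>: M ==> f (a |>\<^sub>M x) = a |>\<^sub>N f x"
  and "a \<in> carrier A ==> x \<in>: M ==> f (x <|\<^sub>M a) = f x <|\<^sub>N a"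
 using assms unfolding bimap_def klin_def additive_on_def by auto

lemma bimap_compose: "bimap k A M N f ==> bimap k A N P g ==> bimap k A M P (%x. g (f x))"
 unfolding bimap_def klin_def additive_on_def by (auto simp: Pi_iff)

definition mk_arrow ::
 "('u, 'z) partial_object_scheme => ('u, 'z) partial_object_scheme => ('u => 'u) =>
  (('u, 'z) partial_object_scheme, 'u) arrow" where
 "mk_arrow M N f = \<lparr>src = M, fn = restrict f (carrier M), tgt = N\<rparr>"

lemma mk_arrow_simps [simp]: "src (mk_arrow M N f) = M" "tgt (mk_arrow M N f) = N"
 "fn (mk_arrow M N f) = restrict f (carrier M)"
 by (simp_all add: mk_arrow_def)

lemma arrow_eqI:
 "src f = src g ==> tgt f = tgt g ==> fn f \<in> extensional S ==> fn g \<in> extensional S ==>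
  (!!x. x \<in> S ==> fn f x = fn g x) ==> f = (g :: ('o, 'u) arrow)"
 by (rule arrow.equality) (auto intro: extensionalityI)

lemma Bimod_cat_simps [simp]:
 "Ob (Bimod_cat U k A) = {M. bimodule k A M}"
 "idn (Bimod_cat U k A) = id_arrow" "cmp (Bimod_cat U k A) = cmpa"
 "tob (Bimod_cat U k A) = utensor A" "tar (Bimod_cat U k A) = utensor_arrow A"
 "assoc (Bimod_cat U k A) = uassoc A"
 by (simp_all add: Bimod_cat_def)

lemma Mod_cat_simps [simp]:
 "Ob (Mod_cat U k) = {M. module k M}"
 "idn (Mod_cat U k) = id_arrow" "cmp (Mod_cat U k) = cmpa"
 by (simp_all add: Mod_cat_def)

lemma Hom_Bimod: "h \<in> Hom (Bimod_cat U k A) M N \<longleftrightarrow>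
  src h = M & tgt h = N & bimap k A M N (fn h) & fn h \<in> extensional (carrier M)"
 by (cases h) (auto simp: Bimod_cat_def bimodule_maps_iff)

lemma Hom_Mod: "h \<in> Hom (Mod_cat U k) M N \<longleftrightarrow>
  src h = M & tgt h = N & klin k M N (fn h) & fn h \<in> extensional (carrier M)"
 by (cases h) (auto simp: Mod_cat_def linear_maps_iff)

lemma comp_arrow_simps [simp]: "src (cmpa g f) = src f" "tgt (cmpa g f) = tgt g"
 "fn (cmpa g f) = compose (carrier (src f)) (fn g) (fn f)"
 by (simp_all add: comp_arrow_def)

lemma id_arrow_simps [simp]: "src (id_arrow M) = M" "tgt (id_arrow M) = M"
 "fn (id_arrow M) = (\<lambda>x\<in>carrier M. x)"
 by (simp_all add: id_arrow_def)

lemma comp_fn: "x \<in>: (src f) ==> fn (cmpa g f) x = fn g (fn f x)"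
 by (simp add: compose_def)

lemma bimap_restrict:
 assumes "bimodule k A M" "bimap k A M N f"
 shows "bimap k A M N (restrict f (carrier M))"
proof -
 interpret M: bimodule k A M by fact
 show ?thesis using assms(2) unfolding bimap_def klin_def additive_on_def
  by (auto simp: M.lact_closed M.ract_closed)
qed

lemma mk_arrow_Hom:
 "bimodule k A M ==> bimap k A M N f ==> mk_arrow M N f \<in> Hom (Bimod_cat U k A) M N"
 unfolding Hom_Bimod by (simp add: bimap_restrict)

lemma klin_restrict:
 assumes "module k M" "klin k M N f"
 shows "klin k M N (restrict f (carrier M))"
proof -
 interpret M: module k M by fact
 show ?thesis using assms(2) unfolding klin_def additive_on_def by auto
qed

lemma mk_arrow_Hom_Mod: "module k M ==> klin k M N f ==> mk_arrow M N f \<in> Hom (Mod_cat U k) M N"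
 unfolding Hom_Mod by (simp add: klin_restrict)

lemma id_Hom: "bimodule k A M ==> id_arrow M \<in> Hom (Bimod_cat U k A) M M"
 unfolding Hom_Bimod id_arrow_simps
 using bimap_restrict[of k A M M "%x. x"] by (auto simp: bimap_def klin_def additive_on_def)

lemma comp_Hom:
 assumes M: "bimodule k A M" and f: "f \<in> Hom (Bimod_cat U k A) M N" and g: "g \<in> Hom (Bimod_cat U k A) N P"
 shows "cmpa g f \<in> Hom (Bimod_cat U k A) M P"
 using bimap_restrict[OF M bimap_compose, of N "fn f" P "fn g"] f g
 unfolding Hom_Bimod by (simp add: compose_def)

lemma Hom_eqI:
 assumes "f \<in> Hom (Bimod_cat U k A) M N" "g \<in> Hom (Bimod_cat U k A) M N" "!!x. x \<in>: M ==> fn f x = fn g x"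
 shows "f = g"
 using assms unfolding Hom_Bimod by (intro arrow_eqI[of f g "carrier M"]) auto

lemma Hom_Mod_eqI:
 assumes "f \<in> Hom (Mod_cat U k) M N" "g \<in> Hom (Mod_cat U k) M N" "!!x. x \<in>: M ==> fn f x = fn g x"
 shows "f = g"
 using assms unfolding Hom_Mod by (intro arrow_eqI[of f g "carrier M"]) auto

lemma comp_Hom_Mod:
 assumes M: "module k M" and f: "f \<in> Hom (Mod_cat U k) M N" and g: "g \<in> Hom (Mod_cat U k) N P"
 shows "cmpa g f \<in> Hom (Mod_cat U k) M P"
proof -
 have "klin k M P (%x. fn g (fn f x))"
  using f g unfolding Hom_Mod klin_def additive_on_def by (auto simp: Pi_iff)
 from klin_restrict[OF M this] f g show ?thesis
  unfolding Hom_Mod by (simp add: compose_def)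
qed

lemma bimap_inv:
 assumes M: "bimodule k A M" and N: "bimodule k A N" and f: "bimap k A M N f" "bij_betw f (carrier M) (carrier N)"
 shows "bimap k A N M (inv_into (carrier M) f)"
proof -
 interpret M: bimodule k A M by fact
 let ?g = "inv_into (carrier M) f"
 note b = bimapD[OF f(1)]
 have g: "?g y \<in>: M" "f (?g y) = y" if "y \<in>: N" for y
  using f(2) that by (auto simp: bij_betw_inv_into_right intro: bij_betw_apply[OF bij_betw_inv_into])
 have gf: "?g (f x) = x" if "x \<in>: M" for x using f(2) that by (simp add: bij_betw_inv_into_left)
 have "?g (y \<oplus>\<^sub>N y') = ?g y \<oplus>\<^sub>M ?g y'" if "y \<in>: N" "y' \<in>: N" for y y'
  using gf[of "?g y \<oplus>\<^sub>M ?g y'"] b(4)[of "?g y" "?g y'"] g that by simp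
 moreover have "?g (c \<odot>\<^sub>N y) = c \<odot>\<^sub>M ?g y" if "c \<in>: k" "y \<in>: N" for c y
  using gf[of "c \<odot>\<^sub>M ?g y"] b(5)[of c "?g y"] g that by simp
 moreover have "?g (a |>\<^sub>N y) = a |>\<^sub>M ?g y" if "a \<in> carrier A" "y \<in>: N" for a y
  using gf[of "a |>\<^sub>M ?g y"] b(6)[of a "?g y"] g that M.lact_closed by simp
 moreover have "?g (y <|\<^sub>N a) = ?g y <|\<^sub>M a" if "a \<in> carrier A" "y \<in>: N" for a y
  using gf[of "?g y <|\<^sub>M a"] b(7)[of a "?g y"] g that M.ract_closed by simp
 ultimately show ?thesis unfolding bimap_def klin_def additive_on_def using g(1) by auto
qed

lemma inverse_arrows_Bimod:
 assumes M: "bimodule k A M" and N: "bimodule k A N"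
  and f: "f \<in> Hom (Bimod_cat U k A) M N" and g: "g \<in> Hom (Bimod_cat U k A) N M"
  and "!!x. x \<in>: M ==> fn g (fn f x) = x" "!!y. y \<in>: N ==> fn f (fn g y) = y"
 shows "inverse_arrows (Bimod_cat U k A) M N f g"
proof -
 have "cmpa g f = id_arrow M"
  by (rule Hom_eqI[OF comp_Hom[OF M f g] id_Hom[OF M]]) (use assms(5) f in "auto simp: Hom_Bimod compose_def")
 moreover have "cmpa f g = id_arrow N"
  by (rule Hom_eqI[OF comp_Hom[OF N g f] id_Hom[OF N]]) (use assms(6) g in "auto simp: Hom_Bimod compose_def")
 ultimately show ?thesis unfolding inverse_arrows_def using f g by simp
qed

lemma iso_arrow_Bimod_iff:
 assumes M: "bimodule k A M" and N: "bimodule k A N" and f: "f \<in> Hom (Bimod_cat U k A) M N"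
 shows "iso_arrow (Bimod_cat U k A) M N f \<longleftrightarrow> bij_betw (fn f) (carrier M) (carrier N)"
proof
 assume "iso_arrow (Bimod_cat U k A) M N f"
 then obtain g where g: "g \<in> Hom (Bimod_cat U k A) N M" "cmpa g f = id_arrow M" "cmpa f g = id_arrow N"
  unfolding iso_arrow_def inverse_arrows_def by auto
 have "fn g (fn f x) = x" if "x \<in>: M" for x
  using arg_cong[OF g(2), of "%h. fn h x"] that f by (simp add: Hom_Bimod compose_def)
 moreover have "fn f (fn g y) = y" if "y \<in>: N" for y
  using arg_cong[OF g(3), of "%h. fn h y"] that g(1) by (simp add: Hom_Bimod compose_def)
 ultimately show "bij_betw (fn f) (carrier M) (carrier N)"
  using f g(1) bimapD(3)[of k A M N "fn f"] bimapD(3)[of k A N M "fn g"]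
  unfolding Hom_Bimod by (intro bij_betw_byWitness[of _ "fn g"]) auto
next
 assume b: "bij_betw (fn f) (carrier M) (carrier N)"
 let ?g = "mk_arrow N M (inv_into (carrier M) (fn f))"
 have "?g \<in> Hom (Bimod_cat U k A) N M"
  by (rule mk_arrow_Hom[OF N bimap_inv[OF M N _ b]]) (use f in "simp add: Hom_Bimod")
 moreover have "fn f x \<in>: N" if "x \<in>: M" for x using b that by (rule bij_betw_apply)
 ultimately have "inverse_arrows (Bimod_cat U k A) M N f ?g"
  using b by (intro inverse_arrows_Bimod[OF M N f]) (auto simp: bij_betw_inv_into_left bij_betw_inv_into_right)
 then show "iso_arrow (Bimod_cat U k A) M N f" unfolding iso_arrow_def by blast
qed

lemma iso_arrow_ModI:
 assumes M: "module k M" and N: "module k N" and f: "f \<in> Hom (Mod_cat U k) M N"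
  and b: "bij_betw (fn f) (carrier M) (carrier N)"
 shows "iso_arrow (Mod_cat U k) M N f"
proof -
 interpret M: module k M by fact
 let ?i = "inv_into (carrier M) (fn f)"
 let ?g = "mk_arrow N M ?i"
 have fl: "klin k M N (fn f)" using f by (simp add: Hom_Mod)
 note l = klinD[OF fl]
 have g: "?i y \<in>: M" "fn f (?i y) = y" if "y \<in>: N" for y
  using b that by (auto simp: bij_betw_inv_into_right intro: bij_betw_apply[OF bij_betw_inv_into])
 have gf: "?i (fn f x) = x" if "x \<in>: M" for x using b that by (simp add: bij_betw_inv_into_left)
 have "klin k N M ?i"
 proof (rule klinI)
  show "?i (y \<oplus>\<^sub>N y') = ?i y \<oplus>\<^sub>M ?i y'" if "y \<in>: N" "y' \<in>: N" for y y'
   using gf[of "?i y \<oplus>\<^sub>M ?i y'"] l(2)[of "?i y" "?i y'"] g that by simp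
  show "?i (c \<odot>\<^sub>N y) = c \<odot>\<^sub>M ?i y" if "c \<in>: k" "y \<in>: N" for c y
   using gf[of "c \<odot>\<^sub>M ?i y"] l(3)[of c "?i y"] g that by simp
 qed (rule g(1))
 then have gH: "?g \<in> Hom (Mod_cat U k) N M" by (rule mk_arrow_Hom_Mod[OF N])
 have idH: "id_arrow M' \<in> Hom (Mod_cat U k) M' M'" if M': "module k M'" for M'
  unfolding Hom_Mod id_arrow_simps
  using klin_restrict[OF M', of M' "%x. x"] by (auto simp: klin_def additive_on_def)
 have "cmpa ?g f = id_arrow M"
  by (rule Hom_Mod_eqI[OF comp_Hom_Mod[OF M f gH] idH[OF M]])
    (use f gf l(1) in "auto simp: Hom_Mod compose_def")
 moreover have "cmpa f ?g = id_arrow N"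
  by (rule Hom_Mod_eqI[OF comp_Hom_Mod[OF N gH f] idH[OF N]])
    (use f g in "auto simp: Hom_Mod compose_def")
 ultimately show ?thesis unfolding iso_arrow_def inverse_arrows_def using f gH by auto
qed

lemma iso_arrow_Mod_bij:
 assumes "iso_arrow (Mod_cat U k) M N f"
 shows "bij_betw (fn f) (carrier M) (carrier N)"
proof -
 obtain g where g: "f \<in> Hom (Mod_cat U k) M N" "g \<in> Hom (Mod_cat U k) N M"
  "cmpa g f = id_arrow M" "cmpa f g = id_arrow N"
  using assms unfolding iso_arrow_def inverse_arrows_def by auto
 have "fn g (fn f x) = x" if "x \<in>: M" for x
  using arg_cong[OF g(3), of "%h. fn h x"] that g(1) by (simp add: Hom_Mod compose_def)
 moreover have "fn f (fn g y) = y" if "y \<in>: N" for y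
  using arg_cong[OF g(4), of "%h. fn h y"] that g(2) by (simp add: Hom_Mod compose_def)
 ultimately show ?thesis
  using g(1,2) klinD(1)[of k M N "fn f"] klinD(1)[of k N M "fn g"]
  unfolding Hom_Mod by (intro bij_betw_byWitness[of _ "fn g"]) auto
qed

section \<open>Tensor products in the universe\<close>

locale kalg_univ = kalg k A for k :: "'k ring" and A :: "('k, 'a) module" (structure) +
 fixes univ :: "'u itself"
 assumes infinite_univ: "infinite (UNIV :: 'u set)"
  and k_lepoll: "carrier k \<lesssim> (UNIV :: 'u set)"
  and A_lepoll: "carrier A \<lesssim> (UNIV :: 'u set)"
begin

abbreviation "Inv == invariants A"

abbreviation "\<B> == Bimod_cat TYPE('u) k A"
abbreviation "\<M> == Mod_cat TYPE('u) k"
abbreviation "G == G_functor A :: (('k, 'a, 'u) bimodule, ('k, 'a, 'u) bimod_arrow, ('k, 'u) module, ('k, 'u) mod_arrow) cfunctor"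

lemma kA: "kalg k A" by (rule kalg_axioms)

lemma univ_lepoll: "(X :: 'u set) \<lesssim> (UNIV :: 'u set)"
 by (simp add: subset_imp_lepoll)

lemma copy_additive:
 fixes M :: "('k, 'a, 'x) bimodule"
 assumes "carrier M \<lesssim> (UNIV :: 'u set)"
 shows "additive_on M (bimodule_copy M :: ('k, 'a, 'u) bimodule) (emb (carrier M))"
 using bimodule_copy_iso[OF assms] by (auto simp: additive_on_def bij_betw_def)

lemma ktens_copy:
 fixes T :: "('k, 'a, 't) bimodule" and N :: "('k, 'n, 'w) module_scheme"
 assumes T: "is_ktens k A N T t" "bimodule k A T" and N: "carrier N \<lesssim> (UNIV :: 'u set)"
 defines "C == (bimodule_copy T :: ('k, 'a, 'u) bimodule)" and "e == (emb (carrier T) :: 't => 'u)"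
 shows "is_ktens k A N C (%x y. e (t x y))" "bimodule k A C" "carrier T \<lesssim> (UNIV :: 'u set)"
proof -
 show le: "carrier T \<lesssim> (UNIV :: 'u set)"
  by (rule tensor_lepoll[OF infinite_univ is_ktensD(4)[OF T(1)] A_lepoll N])
 note c = bimodule_copy_iso[OF le]
 show C: "bimodule k A C" unfolding C_def by (rule bimodule_copy_bimodule[OF kA T(2) le])
 have "is_tensor A N (carrier k) (%x c. c \<odot> x) (%c y. c \<odot>\<^sub>N y) C (%x y. e (t x y))"
  by (rule is_tensor_transport[OF is_ktensD(4)[OF T(1)] bimoduleD(2)[OF C], of e])
    (use c(1) copy_additive[OF le] in "auto simp: C_def e_def")
 then show "is_ktens k A N C (%x y. e (t x y))"
  using T(1) bimoduleD(1)[OF C] is_ktens_simps(1,4)[OF T(1)] c(4)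
  unfolding is_ktens_def C_def e_def by auto
qed

definition AAu :: "('k, 'a, 'u) bimodule" where "AAu = bimodule_copy (AA_bimodule k A)"
definition aat :: "'a => 'a => 'u" where "aat x y = emb (carrier (AA_bimodule k A)) (t2 x y)"

lemma AA_lepoll: "carrier (AA_bimodule k A) \<lesssim> (UNIV :: 'u set)"
 by (rule ktens_copy(3)[OF ktens_AA bimodule_AA A_lepoll])

lemmas AA_copy = bimodule_copy_iso[OF AA_lepoll, folded AAu_def]

lemma AAu_bimod: "bimodule k A AAu" unfolding AAu_def by (rule ktens_copy(2)[OF ktens_AA bimodule_AA A_lepoll])
lemma AAu_ktens: "is_ktens k A A AAu aat"
 unfolding AAu_def aat_def[abs_def] by (rule ktens_copy(1)[OF ktens_AA bimodule_AA A_lepoll])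

lemma AAu_act:
 assumes "a \<in>: A" "x \<in>: A" "y \<in>: A"
 shows "a |>\<^sub>AAu aat x y = aat (a * x) y" "aat x y <|\<^sub>AAu a = aat x (y * a)"
 using assms is_ktens_simps(1)[OF ktens_AA] by (simp_all add: aat_def AA_copy AA_act)

text \<open>The bimodule \<open>A \<otimes> A\<close> is free on \<open>1 \<otimes> 1\<close>.\<close>
lemma AAu_free:
 fixes M :: "('k, 'a, 'm) bimodule"
 assumes M: "bimodule k A M" and m: "m \<in>: M"
 obtains f where "bimap k A AAu M f"
  "!!x y. x \<in>: A ==> y \<in>: A ==> f (aat x y) = x |>\<^sub>M (m <|\<^sub>M y)"
proof -
 note s = bim_simps[OF M] and as = bimodule_assoc[OF M]
 have b: "bilin k A A M (%x y. x |>\<^sub>M (m <|\<^sub>M y))"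
  using m by (intro bilinI) (simp_all add: s)
 obtain f where f: "f \<in> linear_maps k AAu M"
  "!!x y. x \<in>: A ==> y \<in>: A ==> f (aat x y) = x |>\<^sub>M (m <|\<^sub>M y)"
  using is_ktens_lift[OF AAu_ktens bimoduleD(1)[OF M] b] by blast
 have fl: "klin k AAu M f" using f(1) by (simp add: linear_maps_iff)
 note l = klinD[OF fl]
 note sA = bim_simps[OF AAu_bimod]
 have "f (a |>\<^sub>AAu X) = a |>\<^sub>M f X & f (X <|\<^sub>AAu a) = f X <|\<^sub>M a"
  if a: "a \<in>: A" and X: "X \<in>: AAu" for a X
  using AAu_ktens X
 proof (induction rule: is_ktens_induct)
  case (pure x y)
  then show ?case using a m by (simp add: AAu_act f(2) s as)
 next
  case (add X Y)
  then show ?case using a by (simp add: l sA(1,2,4,5) s(4,5))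
 qed
 then have "bimap k A AAu M f" unfolding bimap_def using fl by blast
 with f(2) show thesis using that by blast
qed

lemma utensor_facts:
 fixes M N :: "('k, 'a, 'u) bimodule"
 assumes M: "bimodule k A M" and N: "bimodule k A N"
 shows "bimodule k A (utensor A M N)"
  and "is_tensor M N \<A> (%m a. m <|\<^sub>M a) (%a n. a |>\<^sub>N n) (utensor A M N) (utens A M N)" (is "PROP ?p1")
  and "!!c m n. c \<in>: k ==> m \<in>: M ==> n \<in>: N ==>
   utens A M N (c \<odot>\<^sub>M m) n = c \<odot>\<^bsub>utensor A M N\<^esub> utens A M N m n" (is "PROP ?p2")
  and "!!a m n. a \<in>: A ==> m \<in>: M ==> n \<in>: N ==>
   utens A M N (a |>\<^sub>M m) n = a |>\<^bsub>utensor A M N\<^esub> utens A M N m n" (is "PROP ?p3")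
  and "!!a m n. a \<in>: A ==> m \<in>: M ==> n \<in>: N ==>
   utens A M N m (n <|\<^sub>N a) = utens A M N m n <|\<^bsub>utensor A M N\<^esub> a" (is "PROP ?p4")
proof -
 let ?T = "atensor A M N"
 have le: "carrier ?T \<lesssim> (UNIV :: 'u set)"
  by (rule tensor_lepoll[OF infinite_univ is_tensor_atensor[OF assms] univ_lepoll univ_lepoll])
 note c = bimodule_copy_iso[OF le, folded utensor_def]
 show C: "bimodule k A (utensor A M N)" unfolding utensor_def
  by (rule bimodule_copy_bimodule[OF kA bimodule_atensor[OF assms] le])
 show "PROP ?p1"
  by (rule is_tensor_transport[OF is_tensor_atensor[OF assms] bimoduleD(2)[OF C] c(1)])
    (use copy_additive[OF le] in "auto simp: utensor_def utens_def")
 note t = is_tensor_simps(1)[OF is_tensor_atensor[OF assms]] and a = atensor_act[OF assms]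
 show "PROP ?p2"
  and "PROP ?p3"
  and "PROP ?p4"
  by (simp_all add: utens_def c(4-6) t a)
qed

lemma F_ob_facts:
 fixes N :: "('k, 'u) module"
 assumes N: "module k N"
 shows "bimodule k A (F_ob k A N)" "is_ktens k A N (F_ob k A N) (F_tens k A N)"
  and "!!a x n. a \<in>: A ==> x \<in>: A ==> n \<in>: N ==>
   a |>\<^bsub>F_ob k A N\<^esub> F_tens k A N x n = F_tens k A N (a * x) n" (is "PROP ?p1")
  and "!!a x n. a \<in>: A ==> x \<in>: A ==> n \<in>: N ==>
   F_tens k A N x n <|\<^bsub>F_ob k A N\<^esub> a = F_tens k A N (x * a) n" (is "PROP ?p2")
proof -
 note T = ktens_induced[OF N] and B = bimodule_induced[OF N]
 note K = ktens_copy[OF T B univ_lepoll]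
 show "bimodule k A (F_ob k A N)" unfolding F_ob_def by (rule K(2))
 show "is_ktens k A N (F_ob k A N) (F_tens k A N)"
  using K(1) unfolding F_ob_def F_tens_def[abs_def] .
 note c = bimodule_copy_iso[OF K(3), folded F_ob_def]
 show "PROP ?p1"
  and "PROP ?p2"
  using is_ktens_simps(1)[OF T] induced_act[OF N] by (simp_all add: F_tens_def c)
qed

text \<open>Linear maps \<open>N \<rightarrow> M\<^sup>A\<close> correspond to bimodule maps \<open>A \<otimes> N \<rightarrow> M\<close>.\<close>
lemma F_lift:
 fixes N :: "('k, 'u) module" and M :: "('k, 'a, 'm) bimodule"
 assumes N: "module k N" and M: "bimodule k A M" and g: "klin k N (Inv M) g"
 defines "f == the_additive (F_ob k A N) M (%h. \<forall>a\<in>\<A>. \<forall>n\<in>carrier N. h (F_tens k A N a n) = a |>\<^sub>M g n)"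
 shows "f \<in> bimodule_maps k A (F_ob k A N) M"
  and "!!a n. a \<in>: A ==> n \<in>: N ==> f (F_tens k A N a n) = a |>\<^sub>M g n" (is "PROP ?p1")
proof -
 note F = F_ob_facts[OF N]
 note s = bim_simps[OF M] and as = bimodule_assoc[OF M] and sF = bim_simps[OF F(1)]
 have gn: "g n \<in>: M" "!!a. a \<in>: A ==> a |>\<^sub>M g n = g n <|\<^sub>M a" if "n \<in>: N" for n
  using klinD(1)[OF g that] by auto
 have b: "bilin k A N M (%a n. a |>\<^sub>M g n)"
  by (rule bilinI) (use klinD(2,3)[OF g] gn in "simp_all add: s")
 note t = is_ktens_the_additive[OF F(2) bimoduleD(1)[OF M] b, folded f_def]
 show v: "PROP ?p1" by (rule t(2))
 have fl: "klin k (F_ob k A N) M f" "f \<in> extensional (carrier (F_ob k A N))" using t(1) by (simp_all add: linear_maps_iff)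
 note l = klinD[OF fl(1)]
 have "f (a |>\<^bsub>F_ob k A N\<^esub> X) = a |>\<^sub>M f X & f (X <|\<^bsub>F_ob k A N\<^esub> a) = f X <|\<^sub>M a"
  if a: "a \<in>: A" and X: "X \<in>: (F_ob k A N)" for a X
  using F(2) X
 proof (induction rule: is_ktens_induct)
  case (pure x n)
  have "(x |>\<^sub>M g n) <|\<^sub>M a = x |>\<^sub>M (a |>\<^sub>M g n)"
   using a pure(1) gn(1)[OF pure(2)] gn(2)[OF pure(2) a] by (simp only: as(3))
  then show ?case using a pure gn(1) by (simp add: F(3,4) v as(1))
 next
  case (add X Y)
  then show ?case using a by (simp add: l sF(1,2,4,5) s(4,5))
 qed
 then show "f \<in> bimodule_maps k A (F_ob k A N) M"
  unfolding bimodule_maps_iff bimap_def using fl by blast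
qed

section \<open>The functors and the natural section of the counit\<close>

lemma G_simps [simp]: "fob G = invariants A"
 "far G h = mk_arrow (Inv (src h)) (Inv (tgt h)) (fn h)"
 by (simp_all add: G_functor_def mk_arrow_def)

lemma klin_invariants:
 assumes "bimap k A M N f"
 shows "klin k (Inv M) (Inv N) f"
 using bimapD[OF assms] by (intro klinI) (auto, metis)

lemma G_Hom:
 assumes M: "bimodule k A M" and h: "h \<in> Hom \<B> M N"
 shows "far G h \<in> Hom \<M> (Inv M) (Inv N)"
 using mk_arrow_Hom_Mod[OF module_invariants[OF M] klin_invariants] h by (auto simp: Hom_Bimod)

lemma G_comp:
 assumes M: "bimodule k A M" and f: "f \<in> Hom \<B> M N" and g: "g \<in> Hom \<B> N P"
 shows "far G (cmpa g f) = cmpa (far G g) (far G f)"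
proof -
 have "klin k (Inv M) (Inv N) (fn f)"
  by (rule klin_invariants) (use f in "simp add: Hom_Bimod")
 from klinD(1)[OF this]
 have "fn f x \<in>: (Inv N)" if "x \<in>: (Inv M)" for x
  using that .
 then show ?thesis
  using f g by (intro arrow_eqI[of _ _ "carrier (Inv M)"])
   (auto simp: Hom_Bimod compose_def simp del: invariants_simps, auto)
qed

text \<open>\<open>R\<^sup>2mR\<^sup>3\<close>, for one of the invariants in a family.\<close>
definition qq :: "('k, 'a, 'u) bimodule => ('a \<times> 'a) list => 'u => 'u" where
 "qq X ws m = psum X ws (%y z. y |>\<^sub>X (m <|\<^sub>X z))"

context
 fixes X :: "('k, 'a, 'u) bimodule"
 assumes X: "bimodule k A X"
begin

lemmas X_simps = bim_simps[OF X]
lemmas X_assoc = bimodule_assoc[OF X]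
abbreviation "XA == Inv X"
abbreviation "Xk == module.truncate X :: ('k, 'u) module"

lemma X_ag: "abelian_group X" by (rule bimoduleD(2)[OF X])

lemma W_mod: "module k XA" by (rule module_invariants[OF X])
lemma V_mod: "module k Xk" by (rule module_truncate[OF X])
lemmas FW = F_ob_facts[OF W_mod]
lemmas FV = F_ob_facts[OF V_mod]

lemma X_bilin: "m \<in>: X ==> bilin k A A X (%y z. y |>\<^sub>X (m <|\<^sub>X z))"
 by (rule bilinI) (simp_all add: X_simps)

lemma qq_inv:
 assumes P: "inv_family P" "(x, ws) \<in> set P" and m: "m \<in>: X"
 shows "qq X ws m \<in>: XA"
proof -
 have ws: "pairs ws" using P unfolding inv_family_def by auto
 have c: "qq X ws m \<in>: X" unfolding qq_def
  by (rule psum_closed[OF X_ag ws]) (use m in "simp add: X_simps")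
 have "a |>\<^sub>X qq X ws m = qq X ws m <|\<^sub>X a" if a: "a \<in>: A" for a
 proof -
  have "a |>\<^sub>X qq X ws m = psum X ws (%y z. a |>\<^sub>X (y |>\<^sub>X (m <|\<^sub>X z)))"
   unfolding qq_def by (rule psum_additive[OF X_ag X_ag klinD(4)[OF bimoduleD(3)[OF X a]] ws]) (use m in "simp add: X_simps")
  also have "... = psum X ws (%y z. (a * y) |>\<^sub>X (m <|\<^sub>X z))"
   by (rule psum_cong[OF ws]) (use a m in "simp add: X_simps X_assoc")
  also have "... = psum X ws (%y z. y |>\<^sub>X (m <|\<^sub>X (z * a)))"
   by (rule inv_app[OF P a bimoduleD(1)[OF X] X_bilin[OF m]])
  also have "... = psum X ws (%y z. (y |>\<^sub>X (m <|\<^sub>X z)) <|\<^sub>X a)"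
   by (rule psum_cong[OF ws]) (use a m in "simp add: X_simps X_assoc")
  also have "... = qq X ws m <|\<^sub>X a"
   unfolding qq_def by (rule psum_additive[OF X_ag X_ag klinD(4)[OF bimoduleD(4)[OF X a]] ws, symmetric]) (use m in "simp add: X_simps")
  finally show ?thesis .
 qed
 with c show ?thesis by simp
qed

lemma qq_klin:
 assumes P: "inv_family P" "(x, ws) \<in> set P"
 shows "klin k X XA (qq X ws)"
proof (rule klinI)
 interpret X: module k X by (rule bimoduleD[OF X])
 have ws: "pairs ws" using P unfolding inv_family_def by auto
 show "qq X ws m \<in>: XA" if "m \<in>: X" for m by (rule qq_inv[OF P that])
 show "qq X ws (m \<oplus>\<^sub>X n) = qq X ws m \<oplus>\<^sub>XA qq X ws n" if "m \<in>: X" "n \<in>: X" for m n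
  unfolding qq_def psum_def invariants_simps
  by (subst X.lsum_add[symmetric])
    (use ws that in "auto intro!: lsum_cong simp: pairs_def X_simps subset_iff")
 show "qq X ws (c \<odot>\<^sub>X m) = c \<odot>\<^sub>XA qq X ws m" if "c \<in>: k" "m \<in>: X" for c m
 proof -
  have l: "additive_on X X (%u. c \<odot>\<^sub>X u)" using that by (auto simp: additive_on_def X.smult_r_distr)
  show ?thesis unfolding qq_def invariants_simps
   by (subst psum_additive[OF X_ag X_ag l ws]) (use that in "auto intro!: psum_cong[OF ws] simp: X_simps")
 qed
qed

text \<open>This is \<open>m = R\<^sup>1R\<^sup>2mR\<^sup>3\<close>.\<close>
lemma fam_expand:
 assumes P: "normalized_family P" and m: "m \<in>: X"
 shows "m = lsum X (%(x, ws). x |>\<^sub>X qq X ws m) P"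
proof -
 note P' = normalized_familyD[OF P]
 have "m = tsum X (flat P) (%x y z. (x * y) |>\<^sub>X (m <|\<^sub>X z))"
  using normalized_app[OF P'(3,2) bimoduleD(1)[OF X] X_bilin[OF m]] m by (simp add: X_simps)
 also have "... = tsum X (flat P) (%x y z. x |>\<^sub>X (y |>\<^sub>X (m <|\<^sub>X z)))"
  by (rule tsum_cong[OF P'(3)]) (use m in "simp add: X_simps X_assoc")
 also have "... = lsum X (%(x, ws). psum X ws (%y z. x |>\<^sub>X (y |>\<^sub>X (m <|\<^sub>X z)))) P"
  by (rule tsum_flat[OF X_ag P'(1)]) (use m in "simp add: X_simps")
 also have "... = lsum X (%(x, ws). x |>\<^sub>X qq X ws m) P"
 proof (rule lsum_cong, clarify)
  fix x ws assume i: "(x, ws) \<in> set P"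
  have x: "x \<in>: A" "pairs ws" using P'(1) i unfolding inv_family_def by auto
  show "psum X ws (%y z. x |>\<^sub>X (y |>\<^sub>X (m <|\<^sub>X z))) = x |>\<^sub>X qq X ws m"
   unfolding qq_def
   by (rule psum_additive[OF X_ag X_ag klinD(4)[OF bimoduleD(3)[OF X x(1)]] x(2), symmetric]) (use m in "simp add: X_simps")
 qed
 finally show ?thesis .
qed

text \<open>The inclusion \<open>X\<^sup>A \<subseteq> X\<close> remains injective after tensoring with the flat module \<open>A\<close>.\<close>
lemma F_incl:
 assumes flat: "flat_module TYPE('u) k A"
 obtains j where "bimap k A (F_ob k A XA) (F_ob k A Xk) j"
  "!!a w. a \<in>: A ==> w \<in>: XA ==> j (F_tens k A XA a w) = F_tens k A Xk a w"
  "inj_on j (carrier (F_ob k A XA))"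
proof -
 let ?KW = "ktensor k A XA" and ?KV = "ktensor k A Xk"
 have KW: "is_ktens k A XA ?KW (ktens k A XA)" by (rule is_ktens_ktensor[OF modA W_mod])
 have KV: "is_ktens k A Xk ?KV (ktens k A Xk)" by (rule is_ktens_ktensor[OF modA V_mod])
 note sW = is_ktens_simps[OF FW(2)] and sV = is_ktens_simps[OF FV(2)]
 have wV: "w \<in>: Xk" if "w \<in>: XA" for w using that by simp
 have gi: "klin k XA (Inv (F_ob k A Xk)) (%w. F_tens k A Xk \<one> w)"
  by (rule klinI) (auto simp: sV(1) FV(3,4), (simp add: sV(3)[of "\<one>", simplified] sV(5)[of _ "\<one>", simplified])+)
 note L = F_lift[OF W_mod FV(1) gi]
 obtain j where j: "bimap k A (F_ob k A XA) (F_ob k A Xk) j"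
  "!!a w. a \<in>: A ==> w \<in>: XA ==> j (F_tens k A XA a w) = F_tens k A Xk a w"
 proof
  show "bimap k A (F_ob k A XA) (F_ob k A Xk)
   (the_additive (F_ob k A XA) (F_ob k A Xk) (%h. \<forall>a\<in>\<A>. \<forall>n\<in>carrier XA. h (F_tens k A XA a n) = a |>\<^bsub>F_ob k A Xk\<^esub> F_tens k A Xk \<one> n))"
   using L(1) unfolding bimodule_maps_iff by blast
  show "the_additive (F_ob k A XA) (F_ob k A Xk) (%h. \<forall>a\<in>\<A>. \<forall>n\<in>carrier XA. h (F_tens k A XA a n) = a |>\<^bsub>F_ob k A Xk\<^esub> F_tens k A Xk \<one> n) (F_tens k A XA a w) = F_tens k A Xk a w"
   if "a \<in>: A" "w \<in>: XA" for a w
   using L(2)[OF that] FV(3)[OF that(1) A.one_closed wV[OF that(2)]] that by simp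
 qed
 define i where "i = (\<lambda>w\<in>carrier XA. w)"
 have "klin k XA Xk (%x. x)" by (rule klinI) simp_all
 then have il: "i \<in> linear_maps k XA Xk" unfolding i_def linear_maps_iff
  by (simp add: klin_restrict[OF W_mod] del: invariants_simps truncate_simps)
 have iw: "i w = w" if "w \<in>: XA" for w using that by (simp add: i_def)
 have "inj_on i (carrier XA)" by (auto simp: i_def inj_on_def)
 then have inj: "inj_on (ktensor_map k A XA A Xk (%x. x) i) (carrier ?KW)"
  using flat W_mod V_mod \<open>i \<in> linear_maps k XA Xk\<close> unfolding flat_module_def by blast
 let ?f = "ktensor_map k A XA A Xk (%x. x) i"
 have b: "bilin k A XA ?KV (%a w. ktens k A Xk a (i w))"
  using \<open>i \<in> linear_maps k XA Xk\<close> unfolding linear_maps_iff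
  by (intro bilinI) (simp_all add: klinD(1-3)[of k XA Xk i] is_ktens_simps[OF KV] del: invariants_simps truncate_simps)
 note f = is_ktens_the_additive[OF KW is_ktensD(3)[OF KV] b, folded ktensor_map_def]
 have fl: "additive_on ?KW ?KV ?f" using f(1) unfolding linear_maps_iff klin_def by blast
  \<comment> \<open>identify the copies with the tensor products themselves\<close>
 have eW: "bij_betw (emb (carrier (induced_bimodule k A XA))) (carrier ?KW) (carrier (F_ob k A XA))"
  and eWa: "additive_on ?KW (F_ob k A XA) (emb (carrier (induced_bimodule k A XA)))"
  and eV: "bij_betw (emb (carrier (induced_bimodule k A Xk))) (carrier ?KV) (carrier (F_ob k A Xk))"
  and eVa: "additive_on ?KV (F_ob k A Xk) (emb (carrier (induced_bimodule k A Xk)))"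
 proof -
  have same: "carrier (induced_bimodule k A N) = carrier (ktensor k A N)" "add (induced_bimodule k A N) = add (ktensor k A N)"
   for N :: "('k, 'u) module"
   by (simp_all add: induced_bimodule_def Let_def module.defs bimodule.defs)
  have le: "carrier (induced_bimodule k A N) \<lesssim> (UNIV :: 'u set)" if "module k N" for N :: "('k, 'u) module"
   by (rule ktens_copy(3)[OF ktens_induced[OF that] bimodule_induced[OF that] univ_lepoll])
  show "bij_betw (emb (carrier (induced_bimodule k A XA))) (carrier ?KW) (carrier (F_ob k A XA))"
   "bij_betw (emb (carrier (induced_bimodule k A Xk))) (carrier ?KV) (carrier (F_ob k A Xk))"
   using bimodule_copy_iso(1)[OF le[OF W_mod]] bimodule_copy_iso(1)[OF le[OF V_mod]]
   by (simp_all add: F_ob_def same)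
  show "additive_on ?KW (F_ob k A XA) (emb (carrier (induced_bimodule k A XA)))"
   "additive_on ?KV (F_ob k A Xk) (emb (carrier (induced_bimodule k A Xk)))"
   using copy_additive[OF le[OF W_mod]] copy_additive[OF le[OF V_mod]]
   by (simp_all add: F_ob_def same additive_on_def)
 qed
 have comm: "j (emb (carrier (induced_bimodule k A XA)) Y) = emb (carrier (induced_bimodule k A Xk)) (?f Y)"
  if "Y \<in>: ?KW" for Y
 proof (rule is_tensor_ext[OF is_ktensD(4)[OF KW] _ _ _ that])
  show "additive_on ?KW (F_ob k A Xk) (%Y. j (emb (carrier (induced_bimodule k A XA)) Y))"
   by (rule additive_on_compose[OF eWa bimapD(2)[OF j(1)]])
  show "additive_on ?KW (F_ob k A Xk) (%Y. emb (carrier (induced_bimodule k A Xk)) (?f Y))"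
   by (rule additive_on_compose[OF fl eVa])
  fix a w assume aw: "a \<in>: A" "w \<in>: XA"
  then show "j (emb (carrier (induced_bimodule k A XA)) (ktens k A XA a w)) =
   emb (carrier (induced_bimodule k A Xk)) (?f (ktens k A XA a w))"
   using j(2)[OF aw] f(2)[OF aw] iw[OF aw(2)] by (simp add: F_tens_def)
 qed
 have "inj_on j (carrier (F_ob k A XA))"
 proof (rule inj_onI)
  fix Y Y' assume Y: "Y \<in>: (F_ob k A XA)" "Y' \<in>: (F_ob k A XA)" "j Y = j Y'"
  then obtain Z Z' where Z: "Z \<in>: ?KW" "Y = emb (carrier (induced_bimodule k A XA)) Z"
   "Z' \<in>: ?KW" "Y' = emb (carrier (induced_bimodule k A XA)) Z'"
   using eW unfolding bij_betw_def by blast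
  then have "(emb (carrier (induced_bimodule k A Xk)) (?f Z) :: 'u) = emb (carrier (induced_bimodule k A Xk)) (?f Z')"
   using comm[OF Z(1)] comm[OF Z(3)] Y(3) unfolding Z(2) Z(4) by simp
  then have "?f Z = ?f Z'"
   using eV Z additive_onD(1)[OF fl] unfolding bij_betw_def inj_on_def by blast
  then show "Y = Y'" using inj Z unfolding inj_on_def by blast
 qed
 with j show thesis using that by blast
qed

text \<open>\<open>m \<mapsto> R\<^sup>1 \<otimes> R\<^sup>2mR\<^sup>3\<close>, the inverse of the counit.\<close>
definition zeta :: "('a \<times> ('a \<times> 'a) list) list => 'u => 'u" where
 "zeta P m = lsum (F_ob k A XA) (%(x, ws). F_tens k A XA x (qq X ws m)) P"

lemma zeta_closed:
 assumes P: "inv_family P" and m: "m \<in>: X"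
 shows "zeta P m \<in>: (F_ob k A XA)"
proof -
 have "F_tens k A XA x (qq X ws m) \<in>: (F_ob k A XA)" if "(x, ws) \<in> set P" for x ws
  using is_ktens_simps(1)[OF FW(2)] qq_inv[OF P that m] P that unfolding inv_family_def by blast
 then show ?thesis unfolding zeta_def
  using abelian_group.lsum_closed[OF bimoduleD(2)[OF FW(1)], of P "%(x, ws). F_tens k A XA x (qq X ws m)"] by auto
qed

lemma zeta_klin:
 assumes P: "inv_family P"
 shows "klin k X (F_ob k A XA) (zeta P)"
proof (rule klinI)
 interpret F: module k "F_ob k A XA" by (rule bimoduleD[OF FW(1)])
 note t = is_ktens_simps[OF FW(2)]
 have x: "x \<in>: A" if "(x, ws) \<in> set P" for x ws using P that unfolding inv_family_def by auto
 note q = klinD(1-3)[OF qq_klin[OF P]]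
 show "zeta P m \<in>: (F_ob k A XA)" if "m \<in>: X" for m by (rule zeta_closed[OF P that])
 show "zeta P (m \<oplus>\<^sub>X n) = zeta P m \<oplus>\<^bsub>F_ob k A XA\<^esub> zeta P n" if mn: "m \<in>: X" "n \<in>: X" for m n
  unfolding zeta_def
  by (subst F.lsum_add[symmetric]; (rule lsum_cong)?)
    (use mn x q t in "auto simp del: invariants_simps")
 show "zeta P (c \<odot>\<^sub>X m) = c \<odot>\<^bsub>F_ob k A XA\<^esub> zeta P m" if c: "c \<in>: k" "m \<in>: X" for c m
 proof -
  have l: "additive_on (F_ob k A XA) (F_ob k A XA) (%u. c \<odot>\<^bsub>F_ob k A XA\<^esub> u)" using c by (auto simp: additive_on_def F.smult_r_distr)
  have cl: "(case i of (x, ws) => F_tens k A XA x (qq X ws m)) \<in>: (F_ob k A XA)" if "i \<in> set P" for i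
   using that x q(1) t(1) c by (cases i rule: prod.exhaust) (auto simp del: invariants_simps)
  show ?thesis unfolding zeta_def
   by (subst additive_on_lsum[OF F.ab_gr F.ab_gr l cl], assumption, rule lsum_cong)
     (use c x q t in "auto simp del: invariants_simps")
 qed
qed

text \<open>Since \<open>A\<close> is flat, identities in \<open>A \<otimes> X\<^sup>A\<close> may be verified in \<open>A \<otimes> X\<close>, where the legs of
  \<open>R\<close> can be separated.\<close>
lemma zeta_bimap:
 assumes flat: "flat_module TYPE('u) k A" and P: "normalized_family P"
 shows "bimap k A X (F_ob k A XA) (zeta P)"
  and "!!m. m \<in>: XA ==> zeta P m = F_tens k A XA \<one> m"
proof -
 note P' = normalized_familyD[OF P] and cy = normalized_cyc[OF P]
 let ?FW = "F_ob k A XA" and ?FV = "F_ob k A Xk" and ?L = "flat P"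
 obtain j where j: "bimap k A ?FW ?FV j"
  "!!a w. a \<in>: A ==> w \<in>: XA ==> j (F_tens k A XA a w) = F_tens k A Xk a w"
  "inj_on j (carrier ?FW)" using F_incl[OF flat] by blast
 note sV = is_ktens_simps[OF FV(2)] and mV = bimoduleD(1)[OF FV(1)]
 have agV: "abelian_group ?FV" and agW: "abelian_group ?FW" using bimoduleD(2) FV(1) FW(1) by blast+
 have x: "x \<in>: A" "pairs ws" if "(x, ws) \<in> set P" for x ws using P'(1) that unfolding inv_family_def by auto
 have jz: "j (zeta P m) = tsum ?FV ?L (%x y z. F_tens k A Xk x (y |>\<^sub>X (m <|\<^sub>X z)))" if m: "m \<in>: X" for m
 proof -
  have cl: "(case i of (x, ws) => F_tens k A XA x (qq X ws m)) \<in>: ?FW" if "i \<in> set P" for i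
   using that x qq_inv[OF P'(1) _ m] is_ktens_simps(1)[OF FW(2)] by (cases i rule: prod.exhaust) (auto simp del: invariants_simps)
  have "j (zeta P m) = lsum ?FV (%i. j (case i of (x, ws) => F_tens k A XA x (qq X ws m))) P"
   unfolding zeta_def by (rule additive_on_lsum[OF agW agV bimapD(2)[OF j(1)] cl])
  also have "... = lsum ?FV (%(x, ws). psum ?FV ws (%y z. F_tens k A Xk x (y |>\<^sub>X (m <|\<^sub>X z)))) P"
  proof (rule lsum_cong, clarify)
   fix x ws assume i: "(x, ws) \<in> set P"
   have l: "additive_on X ?FV (%v. F_tens k A Xk x v)"
    using x(1)[OF i] sV(1,3) by (auto simp: additive_on_def)
   have "psum ?FV ws (%y z. F_tens k A Xk x (y |>\<^sub>X (m <|\<^sub>X z))) = F_tens k A Xk x (qq X ws m)"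
    unfolding qq_def by (rule psum_additive[OF X_ag agV l x(2)[OF i], symmetric]) (use m in "simp add: X_simps")
   then show "j (F_tens k A XA x (qq X ws m)) = psum ?FV ws (%y z. F_tens k A Xk x (y |>\<^sub>X (m <|\<^sub>X z)))"
    using j(2)[OF x(1)[OF i] qq_inv[OF P'(1) i m]] by simp
  qed
  also have "... = tsum ?FV ?L (%x y z. F_tens k A Xk x (y |>\<^sub>X (m <|\<^sub>X z)))"
   by (rule tsum_flat[OF agV P'(1), symmetric]) (use m sV(1) in "simp add: X_simps")
  finally show ?thesis .
 qed
 have tri: "trilin k A ?FV (%x y z. F_tens k A Xk x (y |>\<^sub>X (m <|\<^sub>X z)))" if m: "m \<in>: X" for m
  using m sV by (intro trilinI) (simp_all add: X_simps)
 have act: "a |>\<^sub>?FV tsum ?FV ?L (%x y z. F_tens k A Xk x (y |>\<^sub>X (m <|\<^sub>X z))) = j (zeta P (a |>\<^sub>X m))"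
  "tsum ?FV ?L (%x y z. F_tens k A Xk x (y |>\<^sub>X (m <|\<^sub>X z))) <|\<^sub>?FV a = j (zeta P (m <|\<^sub>X a))"
  if a: "a \<in>: A" and m: "m \<in>: X" for a m
 proof -
  have "a |>\<^sub>?FV tsum ?FV ?L (%x y z. F_tens k A Xk x (y |>\<^sub>X (m <|\<^sub>X z))) =
    tsum ?FV ?L (%x y z. a |>\<^sub>?FV F_tens k A Xk x (y |>\<^sub>X (m <|\<^sub>X z)))"
   by (rule tsum_additive[OF agV agV klinD(4)[OF bimoduleD(3)[OF FV(1) a]] P'(3)])
     (use m sV(1) in "simp add: X_simps")
  also have "... = tsum ?FV ?L (%x y z. F_tens k A Xk (a * x) (y |>\<^sub>X (m <|\<^sub>X z)))"
   by (rule tsum_cong[OF P'(3)]) (use a m FV(3) in "simp add: X_simps")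
  also have "... = tsum ?FV ?L (%x y z. F_tens k A Xk x ((y * a) |>\<^sub>X (m <|\<^sub>X z)))"
   by (rule cyc_app(2)[OF cy a mV tri[OF m]])
  also have "... = tsum ?FV ?L (%x y z. F_tens k A Xk x (y |>\<^sub>X ((a |>\<^sub>X m) <|\<^sub>X z)))"
   by (rule tsum_cong[OF P'(3)]) (use a m in "simp add: X_simps X_assoc")
  also have "... = j (zeta P (a |>\<^sub>X m))" by (rule jz[symmetric]) (use a m in "simp add: X_simps")
  finally show "a |>\<^sub>?FV tsum ?FV ?L (%x y z. F_tens k A Xk x (y |>\<^sub>X (m <|\<^sub>X z))) = j (zeta P (a |>\<^sub>X m))" .
  have "tsum ?FV ?L (%x y z. F_tens k A Xk x (y |>\<^sub>X (m <|\<^sub>X z))) <|\<^sub>?FV a =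
    tsum ?FV ?L (%x y z. F_tens k A Xk x (y |>\<^sub>X (m <|\<^sub>X z)) <|\<^sub>?FV a)"
   by (rule tsum_additive[OF agV agV klinD(4)[OF bimoduleD(4)[OF FV(1) a]] P'(3)])
     (use m sV(1) in "simp add: X_simps")
  also have "... = tsum ?FV ?L (%x y z. F_tens k A Xk (x * a) (y |>\<^sub>X (m <|\<^sub>X z)))"
   by (rule tsum_cong[OF P'(3)]) (use a m FV(4) in "simp add: X_simps")
  also have "... = tsum ?FV ?L (%x y z. F_tens k A Xk x (y |>\<^sub>X (m <|\<^sub>X (a * z))))"
   by (rule cyc_app(1)[OF cy a mV tri[OF m], symmetric])
  also have "... = tsum ?FV ?L (%x y z. F_tens k A Xk x (y |>\<^sub>X ((m <|\<^sub>X a) <|\<^sub>X z)))"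
   by (rule tsum_cong[OF P'(3)]) (use a m in "simp add: X_simps X_assoc")
  also have "... = j (zeta P (m <|\<^sub>X a))" by (rule jz[symmetric]) (use a m in "simp add: X_simps")
  finally show "tsum ?FV ?L (%x y z. F_tens k A Xk x (y |>\<^sub>X (m <|\<^sub>X z))) <|\<^sub>?FV a = j (zeta P (m <|\<^sub>X a))" .
 qed
 note sFW = bim_simps(1,2)[OF FW(1)] and zc = zeta_closed[OF P'(1)]
 show "bimap k A X ?FW (zeta P)"
  unfolding bimap_def
 proof (intro conjI ballI zeta_klin[OF P'(1)])
  fix a m assume am: "a \<in>: A" "m \<in>: X"
  have "j (zeta P (a |>\<^sub>X m)) = j (a |>\<^sub>?FW zeta P m)"
   using act(1)[OF am] jz[OF am(2)] bimapD(6)[OF j(1) am(1) zc[OF am(2)]] by simp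
  then show "zeta P (a |>\<^sub>X m) = a |>\<^sub>?FW zeta P m"
   using j(3) zc X_simps(1)[OF am] sFW(1)[OF am(1) zc[OF am(2)]] unfolding inj_on_def by blast
  have "j (zeta P (m <|\<^sub>X a)) = j (zeta P m <|\<^sub>?FW a)"
   using act(2)[OF am] jz[OF am(2)] bimapD(7)[OF j(1) am(1) zc[OF am(2)]] by simp
  then show "zeta P (m <|\<^sub>X a) = zeta P m <|\<^sub>?FW a"
   using j(3) zc X_simps(2)[OF am] sFW(2)[OF am(1) zc[OF am(2)]] unfolding inj_on_def by blast
 qed
 fix m assume m: "m \<in>: XA"
 then have mX: "m \<in>: X" and mi: "!!a. a \<in>: A ==> a |>\<^sub>X m = m <|\<^sub>X a" by auto
 have "j (zeta P m) = tsum ?FV ?L (%x y z. F_tens k A Xk x ((y * \<one> * z) |>\<^sub>X m))"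
  unfolding jz[OF mX] by (rule tsum_cong[OF P'(3)]) (use mX in "simp add: mi[symmetric] X_assoc")
 also have "... = F_tens k A Xk \<one> (\<one> |>\<^sub>X m)"
  by (rule sandwich_app[OF P A.one_closed mV]) (use mX sV in "auto intro!: bilinI simp: X_simps")
 also have "... = j (F_tens k A XA \<one> m)" using j(2)[OF A.one_closed m] mX by (simp add: X_simps)
 finally show "zeta P m = F_tens k A XA \<one> m"
  using j(3) zc[OF mX] is_ktens_simps(1)[OF FW(2) A.one_closed m] unfolding inj_on_def by blast
qed

end

section \<open>Full faithfulness, separability and the element \<open>R\<close>\<close>

abbreviation "counit == FG_counit k A :: ('k, 'a, 'u) bimodule => ('k, 'a, 'u) bimod_arrow"

lemma counit:
 fixes X :: "('k, 'a, 'u) bimodule"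
 assumes X: "bimodule k A X"
 shows "counit X \<in> Hom \<B> (F_ob k A (Inv X)) X"
  and "!!a m. a \<in>: A ==> m \<in>: (Inv X) ==> fn (counit X) (F_tens k A (Inv X) a m) = a |>\<^sub>X m" (is "PROP ?p1")
proof -
 have "klin k (Inv X) (Inv X) (%x. x)" by (simp add: klin_def additive_on_def)
 note L = F_lift[OF module_invariants[OF X] X this]
 show "counit X \<in> Hom \<B> (F_ob k A (Inv X)) X"
  using L(1) unfolding Hom_Bimod by (simp add: FG_counit_def Let_def bimodule_maps_iff)
 show "PROP ?p1"
  using L(2) by (simp add: FG_counit_def Let_def del: invariants_simps)
qed

lemma counit_zeta:
 assumes X: "bimodule k A X" and P: "normalized_family P" and m: "m \<in>: X"
 shows "fn (counit X) (zeta X P m) = m"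
proof -
 note P' = normalized_familyD[OF P] and FW = F_ob_facts[OF module_invariants[OF X]]
 have b: "bimap k A (F_ob k A (Inv X)) X (fn (counit X))" using counit(1)[OF X] by (simp add: Hom_Bimod)
 have i: "x \<in>: A" "qq X ws m \<in>: (Inv X)" if "(x, ws) \<in> set P" for x ws
  using P'(1) that qq_inv[OF X P'(1) that m] unfolding inv_family_def by blast+
 have "fn (counit X) (zeta X P m) = lsum X (%p. fn (counit X) (case p of (x, ws) => F_tens k A (Inv X) x (qq X ws m))) P"
  unfolding zeta_def[OF X]
  by (rule additive_on_lsum[OF bimoduleD(2)[OF FW(1)] bimoduleD(2)[OF X] bimapD(2)[OF b]])
    (use i is_ktens_simps(1)[OF FW(2)] in "auto simp del: invariants_simps")
 also have "... = lsum X (%(x, ws). x |>\<^sub>X qq X ws m) P"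
  by (rule lsum_cong) (use i counit(2)[OF X] in "auto simp del: invariants_simps")
 also have "... = m" by (rule fam_expand[OF X P m, symmetric])
 finally show ?thesis .
qed

lemma zeta_counit:
 assumes flat: "flat_module TYPE('u) k A"
  and X: "bimodule k A X" and P: "normalized_family P" and Y: "Y \<in>: (F_ob k A (Inv X))"
 shows "zeta X P (fn (counit X) Y) = Y"
proof -
 note FW = F_ob_facts[OF module_invariants[OF X]]
 note z = zeta_bimap[OF X flat P]
 have b: "bimap k A (F_ob k A (Inv X)) X (fn (counit X))" using counit(1)[OF X] by (simp add: Hom_Bimod)
 show ?thesis using FW(2) Y
 proof (induction rule: is_ktens_induct)
  case (pure a m)
  have "zeta X P (a |>\<^sub>X m) = a |>\<^bsub>F_ob k A (Inv X)\<^esub> F_tens k A (Inv X) \<one> m"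
   using bimapD(6)[OF z(1), of a m] z(2)[OF pure(2)] pure by simp
  then show ?case using pure counit(2)[OF X pure] FW(3)[OF pure(1) A.one_closed pure(2)] by simp
 next
  case (add Y Y')
  then show ?case by (simp add: bimapD(3,4)[OF b] bimapD(4)[OF z(1)])
 qed
qed

text \<open>A bimodule map satisfies \<open>f(m) = R\<^sup>1f(R\<^sup>2mR\<^sup>3)\<close>. Conversely, for a linear map \<open>g\<close> of the invariants,
  \<open>m \<mapsto> R\<^sup>1g(R\<^sup>2mR\<^sup>3)\<close> is a bimodule map that extends it.\<close>
lemma normalized_fully_faithful:
 assumes flat: "flat_module TYPE('u) k A" and P: "normalized_family P"
 shows "fully_faithful \<B> \<M> G"
 unfolding fully_faithful_def
proof (intro ballI)
 fix X Y :: "('k, 'a, 'u) bimodule"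
 assume "X \<in> Ob \<B>" "Y \<in> Ob \<B>"
 then have X: "bimodule k A X" and Y: "bimodule k A Y" by simp_all
 note P' = normalized_familyD[OF P]
 have expand: "fn h m = lsum Y (%(x, ws). x |>\<^sub>Y fn h (qq X ws m)) P"
  if h: "h \<in> Hom \<B> X Y" and m: "m \<in>: X" for h m
 proof -
  have hb: "bimap k A X Y (fn h)" using h by (simp add: Hom_Bimod)
  have i: "x \<in>: A" "qq X ws m \<in>: X" if "(x, ws) \<in> set P" for x ws
   using P'(1) that qq_inv[OF X P'(1) that m] unfolding inv_family_def by auto
  have "fn h m = fn h (lsum X (%(x, ws). x |>\<^sub>X qq X ws m) P)"
   using fam_expand[OF X P m] by simp
  also have "... = lsum Y (%p. fn h (case p of (x, ws) => x |>\<^sub>X qq X ws m)) P"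
   by (rule additive_on_lsum[OF bimoduleD(2)[OF X] bimoduleD(2)[OF Y] bimapD(2)[OF hb]])
     (use i bim_simps(1)[OF X] in auto)
  also have "... = lsum Y (%(x, ws). x |>\<^sub>Y fn h (qq X ws m)) P"
   by (rule lsum_cong) (use i bimapD(6)[OF hb] in auto)
  finally show ?thesis .
 qed
 have inj: "inj_on (far G) (Hom \<B> X Y)"
 proof (rule inj_onI)
  fix h h' assume h: "h \<in> Hom \<B> X Y" "h' \<in> Hom \<B> X Y" "far G h = far G h'"
  have e: "fn h w = fn h' w" if "w \<in>: (Inv X)" for w
   using arg_cong[OF h(3), of "%f. fn f w"] that h(1,2) by (simp add: Hom_Bimod)
  show "h = h'"
  proof (rule Hom_eqI[OF h(1,2)])
   fix m assume m: "m \<in>: X"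
   show "fn h m = fn h' m" unfolding expand[OF h(1) m] expand[OF h(2) m]
    by (rule lsum_cong) (use e qq_inv[OF X P'(1) _ m] in "auto simp del: invariants_simps")
  qed
 qed
 have surj: "\<exists>h\<in>Hom \<B> X Y. far G h = g" if g: "g \<in> Hom \<M> (Inv X) (Inv Y)" for g
 proof -
  have gl: "klin k (Inv X) (Inv Y) (fn g)" using g by (simp add: Hom_Mod)
  note L = F_lift[OF module_invariants[OF X] Y gl]
  define f where "f = the_additive (F_ob k A (Inv X)) Y
   (%h. \<forall>a\<in>\<A>. \<forall>n\<in>carrier (Inv X). h (F_tens k A (Inv X) a n) = a |>\<^sub>Y fn g n)"
  have f: "bimap k A (F_ob k A (Inv X)) Y f"
   "!!a n. a \<in>: A ==> n \<in>: (Inv X) ==> f (F_tens k A (Inv X) a n) = a |>\<^sub>Y fn g n"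
   using L unfolding f_def bimodule_maps_iff by blast+
  note z = zeta_bimap[OF X flat P]
  let ?h = "mk_arrow X Y (%m. f (zeta X P m))"
  have h: "?h \<in> Hom \<B> X Y" by (rule mk_arrow_Hom[OF X bimap_compose[OF z(1) f(1)]])
  have "far G ?h = g"
  proof (rule Hom_Mod_eqI[OF G_Hom[OF X h] g])
   fix m assume m: "m \<in>: (Inv X)"
   have "fn g m \<in>: Y" using klinD(1)[OF gl m] by simp
   then show "fn (far G ?h) m = fn g m"
    using m z(2)[OF m] f(2)[OF A.one_closed m] bim_simps(11)[OF Y] by simp
  qed
  with h show ?thesis by blast
 qed
 show "bij_betw (far G) (Hom \<B> X Y) (Hom \<M> (fob G X) (fob G Y))"
  unfolding bij_betw_def
 proof (intro conjI inj equalityI subsetI)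
  fix g assume "g \<in> far G ` Hom \<B> X Y"
  then show "g \<in> Hom \<M> (fob G X) (fob G Y)" using G_Hom[OF X] by auto
 next
  fix g assume "g \<in> Hom \<M> (fob G X) (fob G Y)"
  then show "g \<in> far G ` Hom \<B> X Y" using surj[of g] by (auto simp: image_iff)
 qed
qed

lemma fully_faithful_separable:
 assumes ff: "fully_faithful \<B> \<M> G"
 shows "separable_functor \<B> \<M> G"
proof -
 have bij: "bij_betw (far G) (Hom \<B> X Y) (Hom \<M> (fob G X) (fob G Y))" if "X \<in> Ob \<B>" "Y \<in> Ob \<B>" for X Y
  using ff that unfolding fully_faithful_def by blast
 define P where "P X Y = inv_into (Hom \<B> X Y) (far G)" for X Y
 have PH: "P X Y h \<in> Hom \<B> X Y" "far G (P X Y h) = h"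
  if "X \<in> Ob \<B>" "Y \<in> Ob \<B>" "h \<in> Hom \<M> (fob G X) (fob G Y)" for X Y h
  using bij[OF that(1,2)] that(3) unfolding P_def
  by (auto intro: bij_betw_apply[OF bij_betw_inv_into] simp only: bij_betw_inv_into_right)
 have PG: "P X Y (far G f) = f" if "X \<in> Ob \<B>" "Y \<in> Ob \<B>" "f \<in> Hom \<B> X Y" for X Y f
  unfolding P_def by (rule bij_betw_inv_into_left[OF bij[OF that(1,2)] that(3)])
 show ?thesis
  unfolding separable_functor_def
 proof (intro exI[of _ P] conjI ballI)
  fix X Y assume "X \<in> Ob \<B>" "Y \<in> Ob \<B>"
  then show "P X Y \<in> Hom \<M> (fob G X) (fob G Y) \<rightarrow> Hom \<B> X Y" using PH(1) by blast
 next
  fix X Y f assume "X \<in> Ob \<B>" "Y \<in> Ob \<B>" "f \<in> Hom \<B> X Y"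
  then show "P X Y (far G f) = f" by (rule PG)
 next
  fix X' X Y Y' f g h
  assume o: "X' \<in> Ob \<B>" "X \<in> Ob \<B>" "Y \<in> Ob \<B>" "Y' \<in> Ob \<B>"
   and f: "f \<in> Hom \<B> X' X" and g: "g \<in> Hom \<B> Y Y'" and h: "h \<in> Hom \<M> (fob G X) (fob G Y)"
  have b: "bimodule k A X'" "bimodule k A X" "bimodule k A Y" using o by simp_all
  let ?p = "P X Y h"
  have p: "?p \<in> Hom \<B> X Y" "far G ?p = h" using PH[OF o(2,3) h] by blast+
  have pf: "cmpa ?p f \<in> Hom \<B> X' Y" by (rule comp_Hom[OF b(1) f p(1)])
  have gpf: "cmpa g (cmpa ?p f) \<in> Hom \<B> X' Y'" by (rule comp_Hom[OF b(1) pf g])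
  have "far G (cmpa g (cmpa ?p f)) = cmpa (far G g) (cmpa h (far G f))"
   using G_comp[OF b(1) pf g] G_comp[OF b(1) f p(1)] p(2) by simp
  then have "P X' Y' (cmpa (far G g) (cmpa h (far G f))) = cmpa g (cmpa ?p f)"
   using PG[OF o(1,4) gpf] by simp
  then show "P X' Y' (cmp \<M> (far G g) (cmp \<M> h (far G f))) = cmp \<B> g (cmp \<B> (P X Y h) f)" by simp
 qed
qed

text \<open>The counit at \<open>A \<otimes> A\<close> is multiplication of the first two legs, so a preimage of \<open>1 \<otimes> 1\<close> is a
  normalized element.\<close>
lemma counit_hits_one:
 assumes Y: "Y \<in>: (F_ob k A (Inv AAu))" "fn (counit AAu) Y = aat \<one> \<one>"
 shows "\<exists>P. normalized_family P"
proof -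
 let ?B = "AA_bimodule k A" and ?e = "emb (carrier (AA_bimodule k A)) :: _ => 'u"
 let ?W = "Inv AAu" and ?F = "F_ob k A (Inv AAu)"
 note FW = F_ob_facts[OF module_invariants[OF AAu_bimod]]
 note c = counit[OF AAu_bimod]
 have b: "bimap k A ?F AAu (fn (counit AAu))" using c(1) by (simp add: Hom_Bimod)
 obtain xs where xs: "set xs \<subseteq> \<A> \<times> carrier ?W" "Y = lsum ?F (%(x, w). F_tens k A ?W x w) xs"
  using is_ktens_rep[OF FW(2) Y(1)] by blast
 have sB: "x |>\<^sub>?B w \<in>: ?B" "w <|\<^sub>?B x \<in>: ?B" if "x \<in>: A" "w \<in>: ?B" for x w
  using bim_simps(1,2)[OF bimodule_AA] that by blast+
 have e_inj: "?e u = ?e v ==> u = v" if "u \<in>: ?B" "v \<in>: ?B" for u v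
  using AA_copy(1) that unfolding bij_betw_def inj_on_def by blast
 have rep: "\<exists>ws. pairs ws & w = ?e (psum A2 ws t2) &
   (\<forall>a\<in>\<A>. psum A2 ws (%y z. t2 (a * y) z) = psum A2 ws (%y z. t2 y (z * a)))"
  if w: "w \<in>: ?W" for w
 proof -
  obtain v where v: "v \<in>: ?B" "w = ?e v" using w AA_copy(1) unfolding bij_betw_def by auto
  obtain ws where ws: "pairs ws" "v = psum A2 ws t2" using t2_rep v(1) unfolding AA_A2 by blast
  have "a |>\<^sub>?B v = v <|\<^sub>?B a" if a: "a \<in>: A" for a
  proof -
   have "a |>\<^sub>AAu w = w <|\<^sub>AAu a" using w a by simp
   then have "?e (a |>\<^sub>?B v) = ?e (v <|\<^sub>?B a)" using v by (simp add: AA_copy(5,6))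
   then show ?thesis by (rule e_inj[OF sB[OF a v(1)]])
  qed
  then show ?thesis using ws v(2) AA_act_psum[OF ws(1)] by (intro exI[of _ ws]) simp
 qed
 then have "\<forall>w\<in>carrier ?W. \<exists>ws. pairs ws & w = ?e (psum A2 ws t2) &
   (\<forall>a\<in>\<A>. psum A2 ws (%y z. t2 (a * y) z) = psum A2 ws (%y z. t2 y (z * a)))" by (rule ballI)
 from bchoice[OF this] obtain r where r: "\<forall>w\<in>carrier ?W. pairs (r w) & w = ?e (psum A2 (r w) t2) &
   (\<forall>a\<in>\<A>. psum A2 (r w) (%y z. t2 (a * y) z) = psum A2 (r w) (%y z. t2 y (z * a)))" ..
 define P where "P = map (%(x, w). (x, r w)) xs"
 have P: "inv_family P"
  unfolding inv_family_def P_def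
 proof (clarsimp split: prod.split simp del: invariants_simps, intro conjI ballI)
  fix x w assume "(x, w) \<in> set xs"
  then have xw: "x \<in>: A" "w \<in>: ?W" using xs(1) by auto
  show "x \<in>: A" by (rule xw)
  show "pairs (r w)" using r xw(2) by blast
  show "psum A2 (r w) (%y z. t2 (a * y) z) = psum A2 (r w) (%y z. t2 y (z * a))" if "a \<in>: A" for a
   using r xw(2) that by blast
 qed
 note agA = bimoduleD(2)[OF AAu_bimod] and agB = bimoduleD(2)[OF bimodule_AA]
 have i: "x \<in>: A" "pairs ws" "psum A2 ws t2 \<in>: ?B" if "(x, ws) \<in> set P" for x ws
  using P that psum_t2_closed unfolding inv_family_def AA_A2 by blast+
 have "aat \<one> \<one> = lsum AAu (%p. fn (counit AAu) (case p of (x, w) => F_tens k A ?W x w)) xs"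
  unfolding Y(2)[symmetric] xs(2)
  by (rule additive_on_lsum[OF bimoduleD(2)[OF FW(1)] agA bimapD(2)[OF b]])
    (use xs(1) is_ktens_simps(1)[OF FW(2)] in "auto simp del: invariants_simps")
 also have "... = lsum AAu (%(x, ws). x |>\<^sub>AAu ?e (psum A2 ws t2)) P"
  unfolding P_def lsum_map
 proof (rule lsum_cong)
  fix p assume p: "p \<in> set xs"
  obtain x w where p': "p = (x, w)" by fastforce
  have xw: "x \<in>: A" "w \<in>: ?W" using p p' xs(1) by auto
  then have "w = ?e (psum A2 (r w) t2)" using r by blast
  with c(2)[OF xw] show "fn (counit AAu) (case p of (x, w) => F_tens k A ?W x w) =
    (case case p of (x, w) => (x, r w) of (x, ws) => x |>\<^sub>AAu ?e (psum A2 ws t2))"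
   unfolding p' by simp
 qed
 also have "... = lsum AAu (%p. ?e (case p of (x, ws) => psum ?B ws (%y z. t2 (x * y) z))) P"
  by (rule lsum_cong) (use i AA_act_psum(1) in "auto simp: AA_copy(5) psum_AA")
 also have "... = ?e (lsum ?B (%(x, ws). psum ?B ws (%y z. t2 (x * y) z)) P)"
  by (rule additive_on_lsum[OF agB agA copy_additive[OF AA_lepoll, folded AAu_def], symmetric])
    (use i is_ktens_simps(1)[OF ktens_AA] in "auto intro!: psum_closed[OF agB]")
 also have "lsum ?B (%(x, ws). psum ?B ws (%y z. t2 (x * y) z)) P = tsum ?B (flat P) (%x y z. t2 (x * y) z)"
  by (rule tsum_flat[OF agB P, symmetric]) (simp add: is_ktens_simps(1)[OF ktens_AA])
 finally have "t2 \<one> \<one> = tsum ?B (flat P) (%x y z. t2 (x * y) z)"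
  unfolding aat_def
  by (rule e_inj[rotated 2])
    (auto intro!: tsum_closed[OF agB inv_family_triples[OF P]] simp: is_ktens_simps(1)[OF ktens_AA])
 also have "... = tsum A2 (flat P) (%x y z. t2 (x * y) z)"
  unfolding tsum_def by (rule lsum_same) (simp_all add: AA_A2)
 finally show ?thesis using P unfolding normalized_family_def normalized_list_def by metis
qed

lemma aat_one: "aat \<one> \<one> \<in>: AAu"
 using is_ktens_simps(1)[OF AAu_ktens] by simp

lemma unit_klin:
 fixes N :: "('k, 'u) module"
 assumes N: "module k N"
 shows "klin k N (Inv (F_ob k A N)) (%n. F_tens k A N \<one> n)"
 using is_ktens_simps[OF F_ob_facts(2)[OF N]] F_ob_facts(3,4)[OF N]
 by (intro klinI) auto

text \<open>Apply the natural retraction to the unit \<open>(A \<otimes> A)\<^sup>A \<rightarrow> (A \<otimes> (A \<otimes> A)\<^sup>A)\<^sup>A\<close>. Naturality and the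
  triangle identity make the result a section of the counit at \<open>A \<otimes> A\<close>.\<close>
lemma separable_normalized:
 assumes sep: "separable_functor \<B> \<M> G"
 shows "\<exists>P. normalized_family P"
proof -
 let ?W = "Inv AAu"
 let ?Y = "F_ob k A ?W"
 have W: "module k ?W" by (rule module_invariants[OF AAu_bimod])
 have Yb: "bimodule k A ?Y" by (rule F_ob_facts(1)[OF W])
 from sep[unfolded separable_functor_def] obtain P where
  P1: "\<forall>X\<in>Ob \<B>. \<forall>Y\<in>Ob \<B>. P X Y \<in> Hom \<M> (fob G X) (fob G Y) \<rightarrow> Hom \<B> X Y"
  and P2: "\<forall>X\<in>Ob \<B>. \<forall>Y\<in>Ob \<B>. \<forall>f\<in>Hom \<B> X Y. P X Y (far G f) = f"
  and P3: "\<forall>X'\<in>Ob \<B>. \<forall>X\<in>Ob \<B>. \<forall>Y\<in>Ob \<B>. \<forall>Y'\<in>Ob \<B>.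
    \<forall>f\<in>Hom \<B> X' X. \<forall>g\<in>Hom \<B> Y Y'. \<forall>h\<in>Hom \<M> (fob G X) (fob G Y).
     P X' Y' (far G g \<cdot>\<^bsub>\<M>\<^esub> h \<cdot>\<^bsub>\<M>\<^esub> far G f) = g \<cdot>\<^bsub>\<B>\<^esub> P X Y h \<cdot>\<^bsub>\<B>\<^esub> f"
  by (elim exE conjE)
 have o: "AAu \<in> Ob \<B>" "?Y \<in> Ob \<B>" using AAu_bimod Yb by simp_all
 let ?h = "mk_arrow ?W (Inv ?Y) (%w. F_tens k A ?W \<one> w)"
 have h: "?h \<in> Hom \<M> ?W (Inv ?Y)" by (rule mk_arrow_Hom_Mod[OF W unit_klin[OF W]])
 note c = counit[OF AAu_bimod]
 have idH: "id_arrow AAu \<in> Hom \<B> AAu AAu" by (rule id_Hom[OF AAu_bimod])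
 have p: "P AAu ?Y ?h \<in> Hom \<B> AAu ?Y" using bspec[OF bspec[OF P1 o(1)] o(2)] h by auto
 have Gid: "far G (id_arrow AAu) \<in> Hom \<M> ?W ?W" by (rule G_Hom[OF AAu_bimod idH])
 have Gc: "far G (counit AAu) \<in> Hom \<M> (Inv ?Y) ?W" by (rule G_Hom[OF Yb c(1)])
 have hG: "cmpa ?h (far G (id_arrow AAu)) \<in> Hom \<M> ?W (Inv ?Y)" by (rule comp_Hom_Mod[OF W Gid h])
 have "cmpa (far G (counit AAu)) (cmpa ?h (far G (id_arrow AAu))) = far G (id_arrow AAu)"
 proof (rule Hom_Mod_eqI[OF comp_Hom_Mod[OF W hG Gc] Gid])
  fix w assume w: "w \<in>: ?W"
  have "F_tens k A ?W \<one> w \<in>: (Inv ?Y)" using klinD(1)[OF unit_klin[OF W] w] .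
  moreover have wA: "w \<in>: AAu" using w by simp
  moreover have "src (counit AAu) = ?Y" using c(1) by (simp add: Hom_Bimod)
  ultimately show "fn (cmpa (far G (counit AAu)) (cmpa ?h (far G (id_arrow AAu)))) w = fn (far G (id_arrow AAu)) w"
   using w c(2)[OF A.one_closed w] bim_simps(11)[OF AAu_bimod wA]
   by (simp add: compose_def del: invariants_simps)
 qed
 then have "id_arrow AAu = cmpa (counit AAu) (cmpa (P AAu ?Y ?h) (id_arrow AAu))"
  using bspec[OF bspec[OF bspec[OF bspec[OF bspec[OF bspec[OF bspec[OF P3 o(1)] o(1)] o(2)] o(1)] idH] c(1)], of ?h]
   bspec[OF bspec[OF bspec[OF P2 o(1)] o(1)] idH] h by simp
 from arg_cong[OF this, of "%f. fn f (aat \<one> \<one>)"]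
 have "fn (counit AAu) (fn (P AAu ?Y ?h) (aat \<one> \<one>)) = aat \<one> \<one>"
  using aat_one p by (simp add: compose_def Hom_Bimod)
 moreover have "fn (P AAu ?Y ?h) (aat \<one> \<one>) \<in>: ?Y"
  using p bimapD(3)[of k A AAu ?Y "fn (P AAu ?Y ?h)"] aat_one by (simp add: Hom_Bimod)
 ultimately show ?thesis using counit_hits_one by blast
qed

section \<open>Equivalences\<close>

abbreviation "FF == F_functor k A :: (('k, 'u) module, ('k, 'u) mod_arrow, ('k, 'a, 'u) bimodule, ('k, 'a, 'u) bimod_arrow) cfunctor"

lemma F_fob: "fob FF = F_ob k A" by (simp add: F_functor_def)

lemma F_far:
 assumes N: "module k N" and N': "module k N'" and f: "f \<in> Hom \<M> N N'"
 shows "far FF f \<in> Hom \<B> (F_ob k A N) (F_ob k A N')" (is "PROP ?p1")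
  and "!!a n. a \<in>: A ==> n \<in>: N ==> fn (far FF f) (F_tens k A N a n) = F_tens k A N' a (fn f n)" (is "PROP ?p2")
proof -
 have fl: "klin k N N' (fn f)" and sf: "src f = N" "tgt f = N'" using f by (simp_all add: Hom_Mod)
 note u = unit_klin[OF N'] and F' = F_ob_facts[OF N']
 have g: "klin k N (Inv (F_ob k A N')) (%n. F_tens k A N' \<one> (fn f n))"
  by (rule klinI) (use klinD(1-3)[OF fl] klinD(1-3)[OF u] in "simp_all del: invariants_simps")
 note L = F_lift[OF N F'(1) g]
 have e: "a |>\<^bsub>F_ob k A N'\<^esub> F_tens k A N' \<one> (fn f n) = F_tens k A N' a (fn f n)" if "a \<in>: A" "n \<in>: N" for a n
  using F'(3)[OF that(1) A.one_closed klinD(1)[OF fl that(2)]] that by simp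
 have fnF: "fn (far FF f) = the_additive (F_ob k A N) (F_ob k A N') (%h. \<forall>a\<in>\<A>. \<forall>n\<in>carrier N. h (F_tens k A N a n) = a |>\<^bsub>F_ob k A N'\<^esub> F_tens k A N' \<one> (fn f n))"
  by (simp add: F_functor_def sf e cong: ball_cong)
 show "PROP ?p1"
  using L(1) unfolding Hom_Bimod fnF bimodule_maps_iff by (simp add: F_functor_def sf)
 show "PROP ?p2"
  unfolding fnF using L(2) e by simp
qed

abbreviation "unit == FG_unit k A :: ('k, 'u) module => ('k, 'u) mod_arrow"

lemma unit_mk: "unit N = mk_arrow N (Inv (F_ob k A N)) (%n. F_tens k A N \<one> n)"
 by (simp add: FG_unit_def mk_arrow_def)

lemma unit_natural:
 assumes N: "module k N" and N': "module k N'" and f: "f \<in> Hom \<M> N N'"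
 shows "cmpa (far G (far FF f)) (unit N) = cmpa (unit N') f"
proof -
 note F = F_far[OF N N' f]
 have u: "unit N \<in> Hom \<M> N (Inv (F_ob k A N))" "unit N' \<in> Hom \<M> N' (Inv (F_ob k A N'))"
  unfolding unit_mk by (intro mk_arrow_Hom_Mod N N' unit_klin)+
 have G: "far G (far FF f) \<in> Hom \<M> (Inv (F_ob k A N)) (Inv (F_ob k A N'))"
  by (rule G_Hom[OF F_ob_facts(1)[OF N] F(1)])
 show ?thesis
 proof (rule Hom_Mod_eqI[OF comp_Hom_Mod[OF N u(1) G] comp_Hom_Mod[OF N f u(2)]])
  fix n assume n: "n \<in>: N"
  have "F_tens k A N \<one> n \<in>: (Inv (F_ob k A N))" by (rule klinD(1)[OF unit_klin[OF N] n])
  moreover have "src (far FF f) = F_ob k A N" "src f = N" "fn f n \<in>: N'"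
   using F(1) f n by (simp_all add: Hom_Bimod Hom_Mod klinD(1)[of k N N' "fn f"])
  ultimately show "fn (cmpa (far G (far FF f)) (unit N)) n = fn (cmpa (unit N') f) n"
   using n F(2)[OF A.one_closed n] by (simp add: compose_def unit_mk del: invariants_simps)
 qed
qed

lemma counit_natural:
 assumes X: "bimodule k A X" and Y: "bimodule k A Y" and h: "h \<in> Hom \<B> X Y"
 shows "cmpa h (counit X) = cmpa (counit Y) (far FF (far G h))"
proof -
 note W = module_invariants[OF X] and W' = module_invariants[OF Y]
 note g = G_Hom[OF X h]
 note F = F_far[OF W W' g] and FW = F_ob_facts[OF W]
 have hb: "bimap k A X Y (fn h)" using h by (simp add: Hom_Bimod)
 note l = comp_Hom[OF FW(1) counit(1)[OF X] h] and r = comp_Hom[OF FW(1) F(1) counit(1)[OF Y]]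
 show ?thesis
 proof (rule Hom_eqI[OF l r])
  fix Z assume Z: "Z \<in>: (F_ob k A (Inv X))"
  have la: "additive_on (F_ob k A (Inv X)) Y (fn (cmpa h (counit X)))"
   and ra: "additive_on (F_ob k A (Inv X)) Y (fn (cmpa (counit Y) (far FF (far G h))))"
   using l r bimapD(2) unfolding Hom_Bimod by blast+
  show "fn (cmpa h (counit X)) Z = fn (cmpa (counit Y) (far FF (far G h))) Z"
  proof (rule is_tensor_ext[OF is_ktensD(4)[OF FW(2)] la ra _ Z])
   fix a m assume am: "a \<in>: A" "m \<in>: (Inv X)"
   have mX: "m \<in>: X" using am by simp
   have t: "F_tens k A (Inv X) a m \<in>: (F_ob k A (Inv X))"
    by (rule is_ktens_simps(1)[OF FW(2) am])
   have hm: "fn (far G h) m = fn h m" using am h by (simp add: Hom_Bimod)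
   have "fn (cmpa h (counit X)) (F_tens k A (Inv X) a m) = a |>\<^sub>Y fn h m"
    using counit(1)[OF X] t counit(2)[OF X am] bimapD(6)[OF hb am(1) mX] by (simp add: compose_def Hom_Bimod)
   moreover have "fn (cmpa (counit Y) (far FF (far G h))) (F_tens k A (Inv X) a m) = a |>\<^sub>Y fn h m"
    using F(1) t F(2)[OF am] counit(2)[OF Y am(1), of "fn h m"] hm
     klinD(1)[OF klin_invariants[OF hb] am(2)] unfolding Hom_Bimod
    by (simp add: compose_def del: invariants_simps G_simps)
   ultimately show "fn (cmpa h (counit X)) (F_tens k A (Inv X) a m) =
    fn (cmpa (counit Y) (far FF (far G h))) (F_tens k A (Inv X) a m)" by simp
  qed
 qed
qed

lemma equivalence_iff:
 "inverse_equivalences \<M> \<B> FF G unit counit \<longleftrightarrow>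
  (\<forall>N :: ('k, 'u) module. module k N --> bij_betw (F_tens k A N \<one>) (carrier N) (carrier (Inv (F_ob k A N)))) &
  (\<forall>X. bimodule k A X --> bij_betw (fn (counit X)) (carrier (F_ob k A (Inv X))) (carrier X))"
proof -
 have u: "iso_arrow \<M> N (Inv (F_ob k A N)) (unit N) \<longleftrightarrow>
   bij_betw (F_tens k A N \<one>) (carrier N) (carrier (Inv (F_ob k A N)))" if N: "module k N" for N
 proof -
  have b: "bij_betw (fn (unit N)) (carrier N) S \<longleftrightarrow> bij_betw (F_tens k A N \<one>) (carrier N) S" for S
   by (rule bij_betw_cong) (simp add: unit_mk)
  have "unit N \<in> Hom \<M> N (Inv (F_ob k A N))"
   unfolding unit_mk by (rule mk_arrow_Hom_Mod[OF N unit_klin[OF N]])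
  then show ?thesis
   using iso_arrow_ModI[OF N module_invariants[OF F_ob_facts(1)[OF N]]] iso_arrow_Mod_bij b by blast
 qed
 have c: "iso_arrow \<B> (F_ob k A (Inv X)) X (counit X) \<longleftrightarrow>
   bij_betw (fn (counit X)) (carrier (F_ob k A (Inv X))) (carrier X)" if X: "bimodule k A X" for X
  by (rule iso_arrow_Bimod_iff[OF F_ob_facts(1)[OF module_invariants[OF X]] X counit(1)[OF X]])
 have "natural_iso \<M> \<M> id_functor (comp_functor G FF) unit \<longleftrightarrow>
   (\<forall>N. module k N --> iso_arrow \<M> N (Inv (F_ob k A N)) (unit N))"
  unfolding natural_iso_def id_functor_def comp_functor_def
  using unit_natural by (auto simp: F_fob simp del: G_simps(2))
 moreover have "natural_iso \<B> \<B> (comp_functor FF G) id_functor counit \<longleftrightarrow>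
   (\<forall>X. bimodule k A X --> iso_arrow \<B> (F_ob k A (Inv X)) X (counit X))"
  unfolding natural_iso_def id_functor_def comp_functor_def
  using counit_natural by (auto simp: F_fob simp del: G_simps(2))
 ultimately show ?thesis unfolding inverse_equivalences_def by (simp add: u c)
qed

lemma equivalence_normalized:
 assumes "inverse_equivalences \<M> \<B> FF G unit counit"
 shows "\<exists>P. normalized_family P"
proof -
 from conjunct2[OF assms[unfolded equivalence_iff]]
 have "bimodule k A AAu --> bij_betw (fn (counit AAu)) (carrier (F_ob k A (Inv AAu))) (carrier AAu)"
  by (rule spec)
 then have "fn (counit AAu) ` carrier (F_ob k A (Inv AAu)) = carrier AAu"
  using AAu_bimod by (simp add: bij_betw_def)
 then have "aat \<one> \<one> \<in> fn (counit AAu) ` carrier (F_ob k A (Inv AAu))"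
  using aat_one by (rule ssubst)
 then obtain Y where Y: "Y \<in>: (F_ob k A (Inv AAu))" "aat \<one> \<one> = fn (counit AAu) Y"
  by (rule imageE)
 from counit_hits_one[OF Y(1) Y(2)[symmetric]] show ?thesis .
qed

lemma normalized_counit_bij:
 assumes flat: "flat_module TYPE('u) k A" and P: "normalized_family P" and X: "bimodule k A X"
 shows "bij_betw (fn (counit X)) (carrier (F_ob k A (Inv X))) (carrier X)"
proof (rule bij_betw_byWitness[of _ "zeta X P"])
 have "bimap k A (F_ob k A (Inv X)) X (fn (counit X))" using counit(1)[OF X] by (simp add: Hom_Bimod)
 then show "fn (counit X) ` carrier (F_ob k A (Inv X)) \<subseteq> carrier X"
  by (intro image_subsetI) (rule bimapD(3))
 show "zeta X P ` carrier X \<subseteq> carrier (F_ob k A (Inv X))"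
  using zeta_closed[OF X normalized_familyD(1)[OF P]] by blast
qed (use zeta_counit[OF flat X P] counit_zeta[OF X P] in blast)+

end

section \<open>Free algebras\<close>

context kalg
begin

text \<open>For free \<open>A\<close>, writing \<open>R\<close> in a basis of the first factor shows that \<open>a\<^sub>2 R = R a\<^sub>3\<close> puts \<open>R\<close>
  into \<open>A \<otimes> (A \<otimes> A)\<^sup>A\<close>.\<close>
lemma free_family:
 assumes free: "free_module k A" and c: "cyc L" and n: "normalized_list L"
 obtains P where "normalized_family P" "tsum A3 (flat P) t3 = tsum A3 L t3"
proof -
 from c have L: "triples L" by (simp add: cyc_def)
 obtain \<beta> where \<beta>: "!!b. functional k A (\<beta> b)"
  and rep: "!!X. finite X ==> X \<subseteq> \<A> ==>
   \<exists>bs. set bs \<subseteq> \<A> & (\<forall>x\<in>X. x = lsum A (%b. \<beta> b x \<odot> b) bs)"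
  using free_coordinates[OF free] by blast
 note bD = functionalD(1-3)[OF \<beta>]
 have "\<exists>bs. set bs \<subseteq> \<A> & (\<forall>x\<in>fst ` set L. x = lsum A (%b. \<beta> b x \<odot> b) bs)"
  by (rule rep) (use L in "auto simp: triples_def")
 then obtain bs where bs: "set bs \<subseteq> \<A>" "\<forall>x\<in>fst ` set L. x = lsum A (%b. \<beta> b x \<odot> b) bs" by blast
 define ws where "ws b = map (%(x, y, z). (\<beta> b x \<odot> y, z)) L" for b
 define P where "P = map (%b. (b, ws b)) bs"
 have pw: "pairs (ws b)" for b
  using L bD(1) unfolding pairs_def ws_def triples_def by auto
 have pws: "psum G (ws b) \<phi> = tsum G L (%x y z. \<phi> (\<beta> b x \<odot> y) z)" for G :: "('g, 'z) ring_scheme" and b \<phi>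
  unfolding psum_def ws_def tsum_def lsum_map by (rule lsum_cong) auto
 have P: "inv_family P"
  unfolding inv_family_def P_def
 proof (clarsimp, intro conjI ballI)
  fix b assume "b \<in> set bs"
  then show "b \<in>: A" using bs(1) by auto
  show "pairs (ws b)" by (rule pw)
  fix a assume a: "a \<in>: A"
  have t: "trilin k A A2 (%x y z. \<beta> b x \<odot>\<^sub>A2 t2 y z)"
   by (rule trilinI)
     (simp_all add: bD t2_simps A2.smult_l_distr A2.smult_r_distr A2.smult_assoc1[symmetric] R.m_comm)
  have "psum A2 (ws b) (%y z. t2 (a * y) z) = tsum A2 L (%x y z. \<beta> b x \<odot>\<^sub>A2 t2 (a * y) z)"
   unfolding pws by (rule tsum_cong[OF L]) (use a bD in "simp add: multilinear_simps")
  also have "... = tsum A2 L (%x y z. \<beta> b x \<odot>\<^sub>A2 t2 y (z * a))"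
   by (rule cyc_app(3)[OF c a mod2 t])
  also have "... = psum A2 (ws b) (%y z. t2 y (z * a))"
   unfolding pws by (rule tsum_cong[OF L]) (use a bD in "simp add: multilinear_simps")
  finally show "psum A2 (ws b) (%y z. t2 (a * y) z) = psum A2 (ws b) (%y z. t2 y (z * a))" .
 qed
 have sum_eq: "tsum G (flat P) \<phi> = tsum G L \<phi>" if G: "module k G" and \<phi>: "trilin k A G \<phi>"
  for G :: "('k, 'g) module" and \<phi>
 proof -
  interpret G: module k G by fact
  note p = trilinD[OF \<phi>]
  have "tsum G (flat P) \<phi> = lsum G (%(x, ws). psum G ws (\<phi> x)) P"
   by (rule tsum_flat[OF G.ab_gr P]) (rule p(1))
  also have "... = lsum G (%b. lsum G (%(x, y, z). \<phi> b (\<beta> b x \<odot> y) z) L) bs"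
   unfolding P_def lsum_map by (simp add: pws tsum_def)
  also have "... = lsum G (%t. lsum G (%b. case t of (x, y, z) => \<phi> b (\<beta> b x \<odot> y) z) bs) L"
   by (rule G.lsum_swap) (use L bs(1) bD(1) p(1) in "auto simp: triples_def subset_iff")
  also have "... = lsum G (%(x, y, z). \<phi> x y z) L"
  proof (rule lsum_cong)
   fix t assume t: "t \<in> set L"
   obtain x y z where t': "t = (x, y, z)" by (cases t)
   have xyz: "x \<in>: A" "y \<in>: A" "z \<in>: A" using L t t' unfolding triples_def by auto
   have l: "additive_on A G (%x. \<phi> x y z)" using xyz p by (auto simp: additive_on_def)
   have "\<phi> x y z = \<phi> (lsum A (%b. \<beta> b x \<odot> b) bs) y z" using bs(2) t t' by force
   also have "... = lsum G (%b. \<phi> (\<beta> b x \<odot> b) y z) bs"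
    by (rule additive_on_lsum[OF ab_gr G.ab_gr l]) (use bs(1) bD(1) xyz in auto)
   also have "... = lsum G (%b. \<phi> b (\<beta> b x \<odot> y) z) bs"
    by (rule lsum_cong) (use bs(1) bD(1) xyz p in auto)
   finally show "lsum G (%b. case t of (x, y, z) => \<phi> b (\<beta> b x \<odot> y) z) bs = (case t of (x, y, z) => \<phi> x y z)"
    by (simp add: t')
  qed
  finally show ?thesis unfolding tsum_def .
 qed
 have "trilin k A A2 (%x y z. t2 (x * y) z)"
  by (auto intro!: trilinI simp: multilinear_simps)
 from sum_eq[OF mod2 this] have "normalized_list (flat P)"
  using n unfolding normalized_list_def by simp
 then show thesis using that P sum_eq[OF mod3 t3_trilin] unfolding normalized_family_def by blast
qed

section \<open>Central algebras\<close>

lemma scalar_central: "c \<in>: k ==> c \<odot> \<one> \<in> center A"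
 by (simp add: center_iff smult_mult_left smult_mult_right)

text \<open>Some coordinate of \<open>1\<close> is invertible in \<open>k\<close>; apply it to the first factor of \<open>z \<otimes> 1 = 1 \<otimes> z\<close>.\<close>
lemma field_central:
 assumes fld: "field k" and free: "free_module k A" and ne: "\<one> \<noteq> \<zero>" and P: "normalized_family P"
 shows "central_algebra k A"
proof -
 interpret K: field k by fact
 obtain \<beta> where \<beta>: "!!b. functional k A (\<beta> b)"
  and rep: "!!X. finite X ==> X \<subseteq> \<A> ==>
   \<exists>bs. set bs \<subseteq> \<A> & (\<forall>x\<in>X. x = lsum A (%b. \<beta> b x \<odot> b) bs)"
  using free_coordinates[OF free] by blast
 note bD = functionalD(1-3)[OF \<beta>]
 obtain bs where bs: "set bs \<subseteq> \<A>" "\<one> = lsum A (%b. \<beta> b \<one> \<odot> b) bs"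
  using rep[of "{\<one>}"] by auto
 have "\<exists>b. \<beta> b \<one> \<noteq> \<zero>\<^sub>k"
 proof (rule ccontr)
  assume "\<not> ?thesis"
  then have "lsum A (%b. \<beta> b \<one> \<odot> b) bs = lsum A (%b. \<zero>) bs"
   using bs(1) by (intro lsum_cong) auto
  then show False using bs(2) ne lsum_zero[of bs] by simp
 qed
 then obtain b where b: "\<beta> b \<one> \<noteq> \<zero>\<^sub>k" by blast
 define u where "u = \<beta> b \<one>"
 have u: "u \<in>: k" "u \<in> Units k" using b bD(1) by (simp_all add: u_def K.field_Units)
 have inj: "inj_on (%c. c \<odot> \<one>) (carrier k)"
 proof (rule inj_onI)
  fix c d assume cd: "c \<in>: k" "d \<in>: k" "c \<odot> \<one> = d \<odot> \<one>"
  then have "c *\<^sub>k u = d *\<^sub>k u" using bD(3)[of _ "\<one>" b] by (metis A.one_closed u_def)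
  then show "c = d" using cd u b K.m_rcancel[of u c d] unfolding u_def by simp
 qed
 have "z \<in> (%c. c \<odot> \<one>) ` carrier k" if z: "z \<in> center A" for z
 proof -
  have zc: "z \<in>: A" using z by (simp add: center_iff)
  have bl: "bilin k A A A (%p q. \<beta> b p \<odot> q)"
   by (rule bilinI) (simp_all add: bD smult_l_distr smult_r_distr smult_assoc1[symmetric] R.m_comm)
  have "lsum A (%i. \<beta> b z \<odot> \<one>) [()] = lsum A (%i. \<beta> b \<one> \<odot> z) [()]"
   by (rule t2_transfer[OF modA bl]) (use zc central_tensor_one[OF P z] in auto)
  then have e: "\<beta> b z \<odot> \<one> = u \<odot> z" using zc bD(1) by (simp add: u_def)
  have "(inv\<^bsub>k\<^esub> u *\<^sub>k \<beta> b z) \<odot> \<one> = (inv\<^bsub>k\<^esub> u *\<^sub>k u) \<odot> z"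
   using u zc bD(1) e smult_assoc1[of "inv\<^bsub>k\<^esub> u" "\<beta> b z" "\<one>"] smult_assoc1[of "inv\<^bsub>k\<^esub> u" u z]
   by (metis A.one_closed R.Units_inv_closed)
  moreover have "inv\<^bsub>k\<^esub> u *\<^sub>k u = \<one>\<^sub>k" using u(2) by simp
  ultimately have "(inv\<^bsub>k\<^esub> u *\<^sub>k \<beta> b z) \<odot> \<one> = z" using zc by (simp only: smult_one)
  then show ?thesis using u zc bD(1) by (intro image_eqI[of _ _ "inv\<^bsub>k\<^esub> u *\<^sub>k \<beta> b z"]) auto
 qed
 then show ?thesis unfolding central_algebra_def bij_betw_def using inj scalar_central by blast
qed

text \<open>The central element \<open>w\<^sup>1cw\<^sup>2\<close> as a scalar.\<close>
definition coef :: "('a \<times> 'a) list => 'a => 'k" where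
 "coef ws c = inv_into (carrier k) (%c. c \<odot> \<one>) (psum A ws (%y z. y * c * z))"

context
 fixes P
 assumes central: "central_algebra k A" and P: "normalized_family P"
begin

lemma coef:
 assumes i: "(x, ws) \<in> set P" and a: "a \<in>: A"
 shows "coef ws a \<in>: k" "coef ws a \<odot> \<one> = psum A ws (%y z. y * a * z)"
proof -
 have "psum A ws (%y z. y * a * z) \<in> center A"
  by (rule inv_family_central[OF normalized_familyD(1)[OF P] i a])
 then have "psum A ws (%y z. y * a * z) \<in> (%c. c \<odot> \<one>) ` carrier k"
  using central unfolding central_algebra_def bij_betw_def by simp
 from inv_into_into[OF this] f_inv_into_f[OF this]
 show "coef ws a \<in>: k" "coef ws a \<odot> \<one> = psum A ws (%y z. y * a * z)"
  unfolding coef_def .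
qed

lemma scalar_inj: "c \<in>: k ==> d \<in>: k ==> c \<odot> \<one> = d \<odot> \<one> ==> c = d"
 using central unfolding central_algebra_def bij_betw_def inj_on_def by blast

lemma coef_functional:
 assumes i: "(x, ws) \<in> set P"
 shows "functional k A (coef ws)"
proof -
 note c = coef[OF i]
 have ws: "pairs ws" using normalized_familyD(1)[OF P] i unfolding inv_family_def by auto
 have "coef ws (a \<oplus> b) = coef ws a \<oplus>\<^sub>k coef ws b" if ab: "a \<in>: A" "b \<in>: A" for a b
 proof (rule scalar_inj)
  have "psum A ws (%y z. y * (a \<oplus> b) * z) = psum A ws (%y z. y * a * z) \<oplus> psum A ws (%y z. y * b * z)"
   unfolding psum_def
   by (subst lsum_add[symmetric]) (use ws ab in "auto intro!: lsum_cong simp: pairs_def mult_simps subset_iff")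
  then show "coef ws (a \<oplus> b) \<odot> \<one> = (coef ws a \<oplus>\<^sub>k coef ws b) \<odot> \<one>"
   using ab by (simp add: c smult_l_distr)
 qed (use ab c in auto)
 moreover have "coef ws (d \<odot> a) = d *\<^sub>k coef ws a" if ab: "d \<in>: k" "a \<in>: A" for d a
 proof (rule scalar_inj)
  have l: "additive_on A A (%u. d \<odot> u)" using ab by (auto simp: additive_on_def smult_r_distr)
  have "psum A ws (%y z. y * (d \<odot> a) * z) = psum A ws (%y z. d \<odot> (y * a * z))"
   by (rule psum_cong[OF ws]) (use ab in "simp add: mult_simps")
  also have "... = d \<odot> psum A ws (%y z. y * a * z)"
   by (rule psum_additive[OF ab_gr ab_gr l ws, symmetric]) (use ab in simp)
  finally show "coef ws (d \<odot> a) \<odot> \<one> = (d *\<^sub>k coef ws a) \<odot> \<one>"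
   using ab by (simp add: c smult_assoc1)
 qed (use ab c in auto)
 ultimately show ?thesis unfolding functional_def additive_on_def using c(1) by auto
qed

text \<open>This is again \<open>c = R\<^sup>1(R\<^sup>2cR\<^sup>3)\<close>.\<close>
lemma coef_dual_basis: "dual_basis k A (map (%(x, ws). (x, coef ws)) P)"
 unfolding dual_basis_def
proof (intro conjI ballI)
 note P' = normalized_familyD[OF P]
 have i: "x \<in>: A" "pairs ws" if "(x, ws) \<in> set P" for x ws using P'(1) that unfolding inv_family_def by auto
 show "case p of (x, t) => x \<in>: A & functional k A t" if "p \<in> set (map (%(x, ws). (x, coef ws)) P)" for p
  using that i coef_functional by auto
 fix a assume a: "a \<in>: A"
 have "a = tsum A (flat P) (%x y z. (x * y) * a * z)"
  by (subst normalized_app[OF P'(3,2) modA, of "%p q. p * a * q"])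
    (use a in "auto intro!: bilinI simp: mult_simps")
 also have "... = tsum A (flat P) (%x y z. x * (y * a * z))"
  by (rule tsum_cong[OF P'(3)]) (use a in "simp add: A.m_assoc")
 also have "... = lsum A (%(x, ws). psum A ws (%y z. x * (y * a * z))) P"
  by (rule tsum_flat[OF ab_gr P'(1)]) (use a in simp)
 also have "... = lsum A (%(x, ws). coef ws a \<odot> x) P"
 proof (rule lsum_cong, clarify)
  fix x ws assume p: "(x, ws) \<in> set P"
  have l: "additive_on A A (%u. x * u)" using i(1)[OF p] by (auto simp: additive_on_def mult_simps)
  have "psum A ws (%y z. x * (y * a * z)) = x * psum A ws (%y z. y * a * z)"
   by (rule psum_additive[OF ab_gr ab_gr l i(2)[OF p], symmetric]) (use a in simp)
  also have "... = coef ws a \<odot> x"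
   unfolding coef(2)[OF p a, symmetric] using coef(1)[OF p a] i(1)[OF p] by (simp add: smult_mult_right)
  finally show "psum A ws (%y z. x * (y * a * z)) = coef ws a \<odot> x" .
 qed
 also have "... = lsum A (%(x, t). t a \<odot> x) (map (%(x, ws). (x, coef ws)) P)"
  unfolding lsum_map by (rule lsum_cong) auto
 finally show "a = lsum A (%(x, t). t a \<odot> x) (map (%(x, ws). (x, coef ws)) P)" .
qed

lemma central_faithful:
 assumes "c \<in>: k" "\<forall>m\<in>\<A>. c \<odot> m = \<zero>"
 shows "c = \<zero>\<^sub>k"
 by (rule scalar_inj) (use assms in auto)

text \<open>If \<open>1\<close> is the sum of the values \<open>t(m)\<close>, then the sum of the functionals \<open>c \<mapsto> t(mc)\<close> takes \<open>1\<close> to \<open>1\<close>.\<close>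
lemma central_retraction: "\<exists>\<mu>. functional k A \<mu> & \<mu> \<one> = \<one>\<^sub>k"
proof -
 let ?D = "map (%(x, ws). (x, coef ws)) P"
 obtain ps where ps: "set ps \<subseteq> snd ` set ?D \<times> \<A>" "lsum k (%(t, m). t m) ps = \<one>\<^sub>k"
  using trace_ideal_one[OF coef_dual_basis central_faithful] by blast
 have t: "functional k A t" "m \<in>: A" if "(t, m) \<in> set ps" for t m
  using ps(1) that coef_functional by auto
 note tD = functionalD(1-3)[OF t(1)]
 define \<mu> where "\<mu> c = lsum k (%(t, m). t (m * c)) ps" for c
 have "functional k A \<mu>"
  unfolding functional_def additive_on_def
 proof (intro conjI ballI funcsetI)
  show cl: "\<mu> c \<in>: k" if "c \<in>: A" for c
   unfolding \<mu>_def by (rule R.lsum_closed) (use that t tD(1) in auto)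
  show "\<mu> (c \<oplus> d) = \<mu> c \<oplus>\<^sub>k \<mu> d" if "c \<in>: A" "d \<in>: A" for c d
   unfolding \<mu>_def
   by (subst R.lsum_add[symmetric]; (rule lsum_cong)?) (use that t tD in "auto simp: mult_simps")
  show "\<mu> (d \<odot> c) = d *\<^sub>k \<mu> c" if "d \<in>: k" "c \<in>: A" for c d
  proof -
   have l: "additive_on k k (%u. d *\<^sub>k u)" using that by (auto simp: additive_on_def R.r_distr)
   have cl: "(case p of (t, m) => t (m * c)) \<in>: k" if "p \<in> set ps" for p
    using that t tD(1) \<open>c \<in>: A\<close> by (cases p rule: prod.exhaust) auto
   show ?thesis unfolding \<mu>_def
    by (subst additive_on_lsum[OF R.ab_gr R.ab_gr l cl], assumption, rule lsum_cong)
      (use that t tD in "auto simp: mult_simps")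
  qed
 qed
 moreover have "\<mu> \<one> = lsum k (%(t, m). t m) ps"
  unfolding \<mu>_def by (rule lsum_cong) (use t in auto)
 ultimately show ?thesis using ps(2) by metis
qed

end

end

context kalg_univ
begin

text \<open>A retraction \<open>\<mu> : A \<rightarrow> k\<close> gives a left inverse of the unit. For surjectivity, applying \<open>\<mu>\<close> to the first
  leg of \<open>R\<^sup>1 \<otimes> R\<^sup>2R\<^sup>3 = 1 \<otimes> 1\<close> gives \<open>X = \<mu>(R\<^sup>1) R\<^sup>2XR\<^sup>3\<close> for invariant \<open>X\<close>.\<close>
lemma central_unit_bij:
 fixes N :: "('k, 'u) module"
 assumes central: "central_algebra k A" and P: "normalized_family P" and N: "module k N"
 shows "bij_betw (F_tens k A N \<one>) (carrier N) (carrier (Inv (F_ob k A N)))"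
proof -
 note P' = normalized_familyD[OF P] and F = F_ob_facts[OF N]
 let ?F = "F_ob k A N" and ?t = "F_tens k A N"
 interpret N: module k N by fact
 interpret F: module k ?F by (rule bimoduleD[OF F(1)])
 note t = is_ktens_simps[OF F(2)] and s = bim_simps[OF F(1)] and as = bimodule_assoc[OF F(1)]
 obtain \<mu> where \<mu>: "functional k A \<mu>" "\<mu> \<one> = \<one>\<^sub>k" using central_retraction[OF central P] by blast
 note mD = functionalD(1-3)[OF \<mu>(1)]
 have b: "bilin k A N N (%a n. \<mu> a \<odot>\<^sub>N n)"
  by (rule bilinI) (simp_all add: mD N.smult_l_distr N.smult_r_distr N.smult_assoc1[symmetric] R.m_comm)
 obtain \<theta> where \<theta>: "\<theta> \<in> linear_maps k ?F N" "!!a n. a \<in>: A ==> n \<in>: N ==> \<theta> (?t a n) = \<mu> a \<odot>\<^sub>N n"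
  using is_ktens_lift[OF F(2) N b] by blast
 have inj: "inj_on (?t \<one>) (carrier N)"
  by (rule inj_on_inverseI[of _ \<theta>]) (simp add: \<theta>(2) \<mu>(2))
 define I where "I = ?t \<one> ` carrier N"
 have Ia: "X \<oplus>\<^sub>?F Y \<in> I" if "X \<in> I" "Y \<in> I" for X Y
  using that unfolding I_def by (auto simp: t(3)[OF A.one_closed, symmetric])
 have Is: "c \<odot>\<^sub>?F X \<in> I" if "X \<in> I" "c \<in>: k" for X c
  using that unfolding I_def by (auto simp: t(5)[OF _ A.one_closed, symmetric])
 have Iz: "\<zero>\<^sub>?F \<in> I"
 proof -
  have "?t \<one> \<zero>\<^sub>N = \<zero>\<^sub>?F"
   using additive_on_zero[OF N.ab_gr F.ab_gr, of "?t \<one>"]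
    is_ktens_bilin[OF F(2)] unfolding bilin_def klin_def by simp
  then show ?thesis unfolding I_def by force
 qed
 have sum: "lsum ?F f xs \<in> I" if "!!i. i \<in> set xs ==> f i \<in> I" for f :: "'i => 'u" and xs
  using that by (induction xs) (auto intro: Iz Ia)
  \<comment> \<open>\<open>w\<^sup>1 (a \<otimes> n) w\<^sup>2 = w\<^sup>1 a w\<^sup>2 \<otimes> n\<close> with \<open>w\<^sup>1 a w\<^sup>2\<close> central, hence a scalar\<close>
 have q: "psum ?F ws (%y z. y |>\<^sub>?F (X <|\<^sub>?F z)) \<in> I" if i: "(x, ws) \<in> set P" and X: "X \<in>: ?F" for x ws X
  using F(2) X
 proof (induction rule: is_ktens_induct)
  case (pure a n)
  have ws: "pairs ws" using P'(1) i unfolding inv_family_def by auto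
  have l: "additive_on A ?F (%c. ?t c n)" using pure by (auto simp: additive_on_def t)
  have "psum ?F ws (%y z. y |>\<^sub>?F (?t a n <|\<^sub>?F z)) = psum ?F ws (%y z. ?t (y * a * z) n)"
   by (rule psum_cong[OF ws]) (use pure in "simp add: F(3,4) A.m_assoc")
  also have "... = ?t (psum A ws (%y z. y * a * z)) n"
   by (rule psum_additive[OF ab_gr F.ab_gr l ws, symmetric]) (use pure in simp)
  also have "... = ?t \<one> (coef ws a \<odot>\<^sub>N n)"
   using coef[OF central P i pure(1)] pure by (simp add: t(4,5) flip: coef(2)[OF central P i pure(1)])
  also have "... \<in> I" unfolding I_def using coef(1)[OF central P i pure(1)] pure by (intro imageI) simp
  finally show ?case .
 next
  case (add X Y)
  have ws: "pairs ws" using P'(1) i unfolding inv_family_def by auto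
  have "psum ?F ws (%y z. y |>\<^sub>?F ((X \<oplus>\<^sub>?F Y) <|\<^sub>?F z)) =
   psum ?F ws (%y z. y |>\<^sub>?F (X <|\<^sub>?F z)) \<oplus>\<^sub>?F psum ?F ws (%y z. y |>\<^sub>?F (Y <|\<^sub>?F z))"
   unfolding psum_def
   by (subst F.lsum_add[symmetric]; (rule lsum_cong)?)
     (use ws add(1,2) in "auto simp: pairs_def s subset_iff")
  with add Ia show ?case by simp
 qed
 have "X \<in> I" if "X \<in>: (Inv ?F)" for X
 proof -
  from that have X: "X \<in>: ?F" and Xi: "!!a. a \<in>: A ==> a |>\<^sub>?F X = X <|\<^sub>?F a" by auto
  have b: "bilin k A A ?F (%p q. \<mu> p \<odot>\<^sub>?F (q |>\<^sub>?F X))"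
   using X by (intro bilinI)
    (simp_all add: mD s F.smult_l_distr F.smult_r_distr F.smult_assoc1[symmetric] R.m_comm)
  have "X = tsum ?F (flat P) (%x y z. \<mu> x \<odot>\<^sub>?F ((y * \<one> * z) |>\<^sub>?F X))"
   using sandwich_app[OF P A.one_closed F.module_axioms b] X \<mu>(2) by (simp add: s)
  also have "... = tsum ?F (flat P) (%x y z. \<mu> x \<odot>\<^sub>?F (y |>\<^sub>?F (X <|\<^sub>?F z)))"
   by (rule tsum_cong[OF P'(3)]) (use X in "simp add: Xi[symmetric] as")
  also have "... = lsum ?F (%(x, ws). psum ?F ws (%y z. \<mu> x \<odot>\<^sub>?F (y |>\<^sub>?F (X <|\<^sub>?F z)))) P"
   by (rule tsum_flat[OF F.ab_gr P'(1)]) (use X mD(1) in "simp add: s")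
  also have "... \<in> I"
  proof (rule sum)
   fix p assume p: "p \<in> set P"
   obtain x ws where p': "p = (x, ws)" by fastforce
   have x: "x \<in>: A" "pairs ws" using P'(1) p p' unfolding inv_family_def by auto
   have l: "additive_on ?F ?F (%u. \<mu> x \<odot>\<^sub>?F u)" using mD(1) x by (auto simp: additive_on_def F.smult_r_distr)
   have "psum ?F ws (%y z. \<mu> x \<odot>\<^sub>?F (y |>\<^sub>?F (X <|\<^sub>?F z))) = \<mu> x \<odot>\<^sub>?F psum ?F ws (%y z. y |>\<^sub>?F (X <|\<^sub>?F z))"
    by (rule psum_additive[OF F.ab_gr F.ab_gr l x(2), symmetric]) (use X in "simp add: s")
   then show "(case p of (x, ws) => psum ?F ws (%y z. \<mu> x \<odot>\<^sub>?F (y |>\<^sub>?F (X <|\<^sub>?F z)))) \<in> I"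
    using Is[OF q[OF _ X] mD(1)[OF x(1)]] p p' by auto
  qed
  finally show ?thesis .
 qed
 moreover have "I \<subseteq> carrier (Inv ?F)"
  unfolding I_def using klinD(1)[OF unit_klin[OF N]] by blast
 ultimately show ?thesis using inj unfolding bij_betw_def I_def by blast
qed

lemma central_equivalence:
 assumes flat: "flat_module TYPE('u) k A" and central: "central_algebra k A" and P: "normalized_family P"
 shows "inverse_equivalences \<M> \<B> FF G unit counit"
 unfolding equivalence_iff using central_unit_bij[OF central P] normalized_counit_bij[OF flat P] by simp

text \<open>Every module that is small enough has an isomorphic copy in the universe.\<close>
lemma module_copy:
 fixes M :: "('k, 'm, 'w) module_scheme"
 assumes M: "module k M" and le: "carrier M \<lesssim> (UNIV :: 'u set)"
 obtains C :: "('k, 'u) module" and e where "module k C" "bij_betw e (carrier M) (carrier C)" "klin k M C e"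
proof -
 interpret M: module k M by fact
 let ?e = "emb (carrier M) :: 'm => 'u"
 have inj: "inj_on ?e (carrier M)" by (rule inj_on_emb[OF le])
 let ?d = "inv_into (carrier M) ?e"
 define C :: "('k, 'u) module" where "C = \<lparr>carrier = ?e ` carrier M, monoid.mult = undefined, one = undefined,
   zero = ?e \<zero>\<^sub>M, add = (%x y. ?e (?d x \<oplus>\<^sub>M ?d y)), smult = (%c x. ?e (c \<odot>\<^sub>M ?d x))\<rparr>"
 have C: "carrier C = ?e ` carrier M" "\<zero>\<^sub>C = ?e \<zero>\<^sub>M"
  "!!x y. x \<in>: M ==> y \<in>: M ==> ?e x \<oplus>\<^sub>C ?e y = ?e (x \<oplus>\<^sub>M y)"
  "!!c x. x \<in>: M ==> c \<odot>\<^sub>C ?e x = ?e (c \<odot>\<^sub>M x)"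
  by (simp_all add: C_def inv_into_f_f[OF inj])
 have "abelian_group C"
 proof (rule abelian_groupI)
  fix x assume "x \<in>: C"
  then obtain m where m: "m \<in>: M" "x = ?e m" using C by auto
  then show "\<exists>y\<in>carrier C. y \<oplus>\<^sub>C x = \<zero>\<^sub>C"
   by (intro bexI[of _ "?e (\<ominus>\<^sub>M m)"]) (simp_all add: C M.l_neg)
 qed (use C in "auto simp: M.a_ac")
 then have "module k C"
  by (intro moduleI) (use C in "auto simp: is_cring M.smult_l_distr M.smult_r_distr M.smult_assoc1")
 moreover have "bij_betw ?e (carrier M) (carrier C)" using inj C(1) by (simp add: bij_betw_def)
 moreover have "klin k M C ?e" by (rule klinI) (auto simp: C)
 ultimately show thesis using that by blast
qed

text \<open>The unit at the module \<open>k\<close> is the map from \<open>k\<close> to \<open>(A \<otimes> k)\<^sup>A = A\<^sup>A\<close>, the centre.\<close>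
lemma equivalence_central:
 assumes eq: "inverse_equivalences \<M> \<B> FF G unit counit"
 shows "central_algebra k A"
proof -
 define k0 :: "('k, 'k) module" where "k0 = ring.extend k (module.fields (%c d. c *\<^sub>k d))"
 have k0: "carrier k0 = carrier k" "\<zero>\<^sub>k0 = \<zero>\<^sub>k" "add k0 = add k" "!!c d. c \<odot>\<^sub>k0 d = c *\<^sub>k d"
  by (simp_all add: k0_def ring.defs module.defs)
 have "abelian_group k0" by (rule abelian_group_cong[OF R.ab_gr]) (simp_all add: k0)
 then have mk0: "module k k0"
  by (intro moduleI) (simp_all add: k0 is_cring R.l_distr R.r_distr R.m_assoc)
 obtain N :: "('k, 'u) module" and e where N: "module k N" and e: "bij_betw e (carrier k) (carrier N)" "klin k k0 N e"
  using module_copy[OF mk0] k_lepoll unfolding k0 by metis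
 note F = F_ob_facts[OF N]
 let ?F = "F_ob k A N" and ?t = "F_tens k A N"
 note t = is_ktens_simps[OF F(2)]
 have b: "bij_betw (?t \<one>) (carrier N) (carrier (Inv ?F))"
  using eq N unfolding equivalence_iff by simp
 have eN: "e c \<in>: N" if "c \<in>: k" for c using e(1) that by (rule bij_betw_apply)
 have te: "?t a (e c) = ?t (c \<odot> a) (e \<one>\<^sub>k)" if "a \<in>: A" "c \<in>: k" for a c
 proof -
  have "e c = c \<odot>\<^sub>N e \<one>\<^sub>k" using klinD(3)[OF e(2), of c "\<one>\<^sub>k"] that by (simp add: k0)
  then show ?thesis using that eN by (simp add: t(4,5))
 qed
 have inj: "inj_on (%c. c \<odot> \<one>) (carrier k)"
 proof (rule inj_onI)
  fix c d assume cd: "c \<in>: k" "d \<in>: k" "c \<odot> \<one> = d \<odot> \<one>"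
  have "?t \<one> (e c) = ?t \<one> (e d)"
   unfolding te[OF A.one_closed cd(1)] te[OF A.one_closed cd(2)] cd(3) ..
  from inj_onD[OF bij_betw_imp_inj_on[OF b] this eN[OF cd(1)] eN[OF cd(2)]] have "e c = e d" .
  from inj_onD[OF bij_betw_imp_inj_on[OF e(1)] this cd(1,2)] show "c = d" .
 qed
  \<comment> \<open>the isomorphism \<open>A \<otimes> k \<cong> A\<close>\<close>
 define d where "d = inv_into (carrier k) e"
 have d: "d n \<in>: k" "e (d n) = n" if "n \<in>: N" for n
  using e(1) that unfolding d_def by (auto simp: bij_betw_inv_into_right intro: bij_betw_apply[OF bij_betw_inv_into])
 have de: "d (e c) = c" if "c \<in>: k" for c using e(1) that unfolding d_def by (simp add: bij_betw_inv_into_left)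
 have d1: "d (n \<oplus>\<^sub>N n') = d n \<oplus>\<^sub>k d n'" if "n \<in>: N" "n' \<in>: N" for n n'
  using klinD(2)[OF e(2), of "d n" "d n'"] de[of "d n \<oplus>\<^sub>k d n'"] d that by (simp add: k0)
 have d2: "d (c \<odot>\<^sub>N n) = c *\<^sub>k d n" if "c \<in>: k" "n \<in>: N" for c n
  using klinD(3)[OF e(2), of c "d n"] de[of "c *\<^sub>k d n"] d that by (simp add: k0)
 have bl: "bilin k A N A (%a n. d n \<odot> a)"
  by (rule bilinI) (simp_all add: d d1 d2 smult_l_distr smult_r_distr smult_assoc1[symmetric] R.m_comm)
 obtain \<theta> where \<theta>: "!!a n. a \<in>: A ==> n \<in>: N ==> \<theta> (?t a n) = d n \<odot> a"
  using is_ktens_lift[OF F(2) modA bl] by metis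
 have "z \<in> (%c. c \<odot> \<one>) ` carrier k" if z: "z \<in> center A" for z
 proof -
  have zc: "z \<in>: A" and zm: "!!a. a \<in>: A ==> z * a = a * z" using z by (auto simp: center_iff)
  have e1: "e \<one>\<^sub>k \<in>: N" by (rule eN) simp
  have "?t z (e \<one>\<^sub>k) \<in>: (Inv ?F)"
   using t(1)[OF zc e1] F(3,4)[OF _ zc e1] zm by simp
  then obtain n where n: "n \<in>: N" "?t z (e \<one>\<^sub>k) = ?t \<one> n"
   using b unfolding bij_betw_def by blast
  have "z = d n \<odot> \<one>"
   using arg_cong[OF n(2), of \<theta>] \<theta>[OF zc e1] \<theta>[OF A.one_closed n(1)] de zc by simp
  then show ?thesis using d(1)[OF n(1)] by blast
 qed
 then show ?thesis unfolding central_algebra_def bij_betw_def using inj scalar_central by blast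
qed

end

section \<open>Azumaya algebras\<close>

context module
begin

lemma list_span_finsum:
 assumes "set xs \<subseteq> carrier M" "s \<in> list_span R M xs"
 shows "\<exists>c\<in>set xs \<rightarrow> carrier R. s = (\<Oplus>\<^bsub>M\<^esub>x\<in>set xs. c x \<odot>\<^sub>M x)"
 using assms
proof (induction xs arbitrary: s)
 case (Cons y xs)
 then obtain d u where d: "d \<in>: R" "u \<in> list_span R M xs" "s = (d \<odot>\<^sub>M y) \<oplus>\<^sub>M u" by auto
 have xs: "set xs \<subseteq> carrier M" "y \<in>: M" using Cons.prems by auto
 obtain c where c: "c \<in> set xs \<rightarrow> carrier R" "u = (\<Oplus>\<^bsub>M\<^esub>x\<in>set xs. c x \<odot>\<^sub>M x)" using Cons.IH[OF xs(1) d(2)] by blast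
 have cx: "c x \<odot>\<^sub>M x \<in>: M" if "x \<in> set xs" for x using c(1) xs that by auto
 show ?case
 proof (cases "y \<in> set xs")
  case True
  then have i: "set (y # xs) = insert y (set xs - {y})" "set xs = insert y (set xs - {y})" by auto
  let ?c = "c(y := d \<oplus> c y)"
  have cy: "c y \<in>: R" using c(1) True by auto
  have rest: "(\<Oplus>\<^bsub>M\<^esub>x\<in>set xs - {y}. c x \<odot>\<^sub>M x) \<in>: M" using cx by (intro M.finsum_closed) auto
  have "u = (c y \<odot>\<^sub>M y) \<oplus>\<^sub>M (\<Oplus>\<^bsub>M\<^esub>x\<in>set xs - {y}. c x \<odot>\<^sub>M x)"
   unfolding c(2) by (subst i(2), subst M.finsum_insert) (use cx cy xs in auto)
  then have "s = ((d \<oplus> c y) \<odot>\<^sub>M y) \<oplus>\<^sub>M (\<Oplus>\<^bsub>M\<^esub>x\<in>set xs - {y}. c x \<odot>\<^sub>M x)"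
   using d(1,3) cy xs(2) rest by (simp add: smult_l_distr M.a_assoc)
  also have "(\<Oplus>\<^bsub>M\<^esub>x\<in>set xs - {y}. c x \<odot>\<^sub>M x) = (\<Oplus>\<^bsub>M\<^esub>x\<in>set xs - {y}. ?c x \<odot>\<^sub>M x)"
   by (rule M.finsum_cong') (use cx in auto)
  also have "((d \<oplus> c y) \<odot>\<^sub>M y) \<oplus>\<^sub>M ... = (\<Oplus>\<^bsub>M\<^esub>x\<in>set (y # xs). ?c x \<odot>\<^sub>M x)"
   unfolding i(1) by (subst M.finsum_insert) (use cx cy d(1) xs in auto)
  finally show ?thesis using c(1) cy d(1) by (intro bexI[of _ ?c]) auto
 next
  case False
  let ?c = "c(y := d)"
  have "s = (d \<odot>\<^sub>M y) \<oplus>\<^sub>M (\<Oplus>\<^bsub>M\<^esub>x\<in>set xs. ?c x \<odot>\<^sub>M x)"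
   unfolding d(3) c(2) using False cx
   by (intro arg_cong2[where f = "add M"] refl M.finsum_cong') auto
  also have "... = (\<Oplus>\<^bsub>M\<^esub>x\<in>set (y # xs). ?c x \<odot>\<^sub>M x)"
   unfolding list.set by (subst M.finsum_insert) (use cx False d(1) xs in auto)
  finally show ?thesis using c(1) d(1) by (intro bexI[of _ ?c]) auto
 qed
qed simp

lemma dual_basis_finitely_generated:
 assumes "dual_basis R M D"
 shows "finitely_generated R M"
 unfolding finitely_generated_def
proof (intro exI[of _ "set (map fst D)"] conjI ballI)
 have D: "x \<in>: M" "functional R M t" if "(x, t) \<in> set D" for x t using assms that unfolding dual_basis_def by auto
 then show sub: "set (map fst D) \<subseteq> carrier M" by auto
 fix m assume m: "m \<in>: M"
 have "lsum M (%(x, t). t m \<odot>\<^sub>M x) E \<in> list_span R M (map fst E)" if "set E \<subseteq> set D" for E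
  using that
 proof (induction E)
  case (Cons p E)
  obtain x t where p: "p = (x, t)" by fastforce
  then have "t m \<in>: R" using functionalD(1)[OF D(2) m] Cons.prems by auto
  with Cons show ?case by (auto simp: p)
 qed simp
 from this[of D] have "m \<in> list_span R M (map fst D)" using assms m unfolding dual_basis_def by auto
 from list_span_finsum[OF sub this]
 show "\<exists>c\<in>set (map fst D) \<rightarrow> carrier R. m = (\<Oplus>\<^bsub>M\<^esub>s\<in>set (map fst D). c s \<odot>\<^sub>M s)" .
qed simp

text \<open>Lift the values on the \<open>x\<close> of the dual basis and extend by the functionals.\<close>
lemma dual_basis_projective:
 assumes D: "dual_basis R M D"
 shows "projective_module U R M"
 unfolding projective_module_def
proof (intro allI impI ballI)
 fix P Q :: "('a, 'u) module" and g f
 assume P: "module R P" and Q: "module R Q" and g: "g \<in> linear_maps R P Q" and f: "f \<in> linear_maps R M Q"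
  and surj: "g ` carrier P = carrier Q"
 interpret P: module R P by fact
 interpret Q: module R Q by fact
 have gl: "klin R P Q g" and fl: "klin R M Q f" using g f by (simp_all add: linear_maps_iff)
 have Dx: "x \<in>: M" "functional R M t" if "(x, t) \<in> set D" for x t using D that unfolding dual_basis_def by auto
 note tD = functionalD(1-3)[OF Dx(2)]
 have "\<forall>y\<in>carrier Q. \<exists>p. p \<in>: P & g p = y" unfolding surj[symmetric] by blast
 from bchoice[OF this] obtain r where "\<forall>y\<in>carrier Q. r y \<in>: P & g (r y) = y" ..
 then have r: "!!y. y \<in>: Q ==> r y \<in>: P" "!!y. y \<in>: Q ==> g (r y) = y" by auto
 define h where "h m = lsum P (%(x, t). t m \<odot>\<^sub>P r (f x)) D" for m
 have rP: "r (f x) \<in>: P" if "(x, t) \<in> set D" for x t using r(1) klinD(1)[OF fl Dx(1)[OF that]] .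
 have cl: "(case p of (x, t) => t m \<odot>\<^sub>P r (f x)) \<in>: P" if "p \<in> set D" "m \<in>: M" for p m
  using that rP tD(1) by (cases p rule: prod.exhaust) auto
 have hl: "klin R M P h"
 proof (rule klinI)
  show "h m \<in>: P" if "m \<in>: M" for m unfolding h_def by (rule P.lsum_closed) (rule cl[OF _ that])
  show "h (m \<oplus>\<^sub>M n) = h m \<oplus>\<^sub>P h n" if "m \<in>: M" "n \<in>: M" for m n
   unfolding h_def
  proof (subst P.lsum_add[symmetric])
   show "(case p of (x, t) => t m \<odot>\<^sub>P r (f x)) \<in>: P" "(case p of (x, t) => t n \<odot>\<^sub>P r (f x)) \<in>: P" if "p \<in> set D" for p
    by (rule cl[OF that], fact)+
   show "lsum P (%(x, t). t (m \<oplus>\<^sub>M n) \<odot>\<^sub>P r (f x)) D =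
    lsum P (%p. (case p of (x, t) => t m \<odot>\<^sub>P r (f x)) \<oplus>\<^sub>P (case p of (x, t) => t n \<odot>\<^sub>P r (f x))) D"
   proof (rule lsum_cong)
    fix p assume p: "p \<in> set D"
    obtain x t where p': "p = (x, t)" by fastforce
    note i = p[unfolded p']
    show "(case p of (x, t) => t (m \<oplus>\<^sub>M n) \<odot>\<^sub>P r (f x)) =
     (case p of (x, t) => t m \<odot>\<^sub>P r (f x)) \<oplus>\<^sub>P (case p of (x, t) => t n \<odot>\<^sub>P r (f x))"
     using tD(1)[OF i that(1)] tD(1)[OF i that(2)] rP[OF i] by (simp add: p' tD(2)[OF i that] P.smult_l_distr)
   qed
  qed
  show "h (c \<odot>\<^sub>M m) = c \<odot>\<^sub>P h m" if "c \<in>: R" "m \<in>: M" for c m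
  proof -
   have l: "additive_on P P (%u. c \<odot>\<^sub>P u)" using that by (auto simp: additive_on_def P.smult_r_distr)
   have sm: "(case p of (x, t) => t (c \<odot>\<^sub>M m) \<odot>\<^sub>P r (f x)) = c \<odot>\<^sub>P (case p of (x, t) => t m \<odot>\<^sub>P r (f x))" if p: "p \<in> set D" for p
   proof -
    obtain x t where p': "p = (x, t)" by fastforce
    note i = p[unfolded p']
    show ?thesis using tD(1)[OF i \<open>m \<in>: M\<close>] rP[OF i] \<open>c \<in>: R\<close>
     by (simp add: p' tD(3)[OF i \<open>c \<in>: R\<close> \<open>m \<in>: M\<close>] P.smult_assoc1)
   qed
   show ?thesis unfolding h_def
    by (subst additive_on_lsum[OF P.ab_gr P.ab_gr l cl[OF _ that(2)]], assumption, rule lsum_cong) (rule sm)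
  qed
 qed
 show "\<exists>h\<in>linear_maps R M P. \<forall>x\<in>carrier M. g (h x) = f x"
 proof (intro bexI[of _ "restrict h (carrier M)"] ballI)
  show "restrict h (carrier M) \<in> linear_maps R M P"
   unfolding linear_maps_iff using klin_restrict[OF module_axioms hl] by simp
  fix m assume m: "m \<in>: M"
  have "g (h m) = lsum Q (%p. g (case p of (x, t) => t m \<odot>\<^sub>P r (f x))) D"
   unfolding h_def by (rule klin_lsum[OF P Q gl cl[OF _ m]])
  also have "... = lsum Q (%p. f (case p of (x, t) => t m \<odot>\<^sub>M x)) D"
   by (rule lsum_cong)
     (use Dx tD(1)[OF _ m] rP r(2)[OF klinD(1)[OF fl Dx(1)]] m in "auto simp: klinD(3)[OF gl] klinD(3)[OF fl]")
  also have "... = f (lsum M (%(x, t). t m \<odot>\<^sub>M x) D)"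
   by (rule klin_lsum[OF module_axioms Q fl, symmetric]) (use Dx tD(1)[OF _ m] in auto)
  also have "lsum M (%(x, t). t m \<odot>\<^sub>M x) D = m" using D m unfolding dual_basis_def by simp
  finally show "g (restrict h (carrier M) m) = f m" using m by simp
 qed
qed

end

context kalg
begin

abbreviation "E == End_algebra k A"
abbreviation "T == tensor_alg k A (op_algebra A)"

lemma E_simps: "carrier E = linear_maps k A A" "\<zero>\<^sub>E = (\<lambda>x\<in>\<A>. \<zero>)"
 "f \<oplus>\<^sub>E g = (\<lambda>x\<in>\<A>. f x \<oplus> g x)" "c \<odot>\<^sub>E f = (\<lambda>x\<in>\<A>. c \<odot> f x)"
 "f *\<^sub>E g = compose \<A> f g" "\<one>\<^sub>E = (\<lambda>x\<in>\<A>. x)"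
 by (simp_all add: End_algebra_def)

lemma E_carrier: "f \<in>: E \<longleftrightarrow> klin k A A f & f \<in> extensional \<A>"
 by (simp add: E_simps linear_maps_iff)

lemma restrict_E: "klin k A A f ==> restrict f \<A> \<in>: E"
 unfolding E_carrier using klin_restrict[OF modA] by auto

lemma E_module: "module k E"
proof (rule moduleI)
 have l: "klin k A A f" if "f \<in>: E" for f using that by (simp add: E_carrier)
 note D = klinD(1-3)[OF l]
 have ext: "f = g" if "f \<in> extensional \<A>" "g \<in> extensional \<A>" "!!x. x \<in>: A ==> f x = g x" for f g :: "'a => 'a"
  using that by (rule extensionalityI)
 show "cring k" by (rule is_cring)
 show "abelian_group E"
 proof (rule abelian_groupI)
  fix f assume f: "f \<in>: E"
  show "\<exists>g\<in>carrier E. g \<oplus>\<^sub>E f = \<zero>\<^sub>E"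
  proof (intro bexI[of _ "\<lambda>x\<in>\<A>. \<ominus> f x"])
   show "(\<lambda>x\<in>\<A>. \<ominus> f x) \<in>: E"
    by (rule restrict_E, rule klinI) (use D[OF f] in "simp_all add: minus_add smult_r_minus")
   show "(\<lambda>x\<in>\<A>. \<ominus> f x) \<oplus>\<^sub>E f = \<zero>\<^sub>E"
    unfolding E_simps by (rule ext) (use D(1)[OF f] in "auto simp: l_neg")
  qed
 next
  fix f g assume f: "f \<in>: E" and g: "g \<in>: E"
  show "f \<oplus>\<^sub>E g \<in>: E" unfolding E_simps(3)
   by (rule restrict_E, rule klinI) (use D[OF f] D[OF g] in "simp_all add: a_ac smult_r_distr")
  show "f \<oplus>\<^sub>E g = g \<oplus>\<^sub>E f" unfolding E_simps
   by (rule ext) (use D[OF f] D[OF g] in "auto simp: a_comm")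
  fix h assume h: "h \<in>: E"
  show "f \<oplus>\<^sub>E g \<oplus>\<^sub>E h = f \<oplus>\<^sub>E (g \<oplus>\<^sub>E h)" unfolding E_simps
   by (rule ext) (use D[OF f] D[OF g] D[OF h] in "auto simp: a_assoc")
 next
  show "\<zero>\<^sub>E \<in>: E" unfolding E_simps(2) by (rule restrict_E, rule klinI) simp_all
  fix f assume f: "f \<in>: E"
  show "\<zero>\<^sub>E \<oplus>\<^sub>E f = f" unfolding E_simps
   by (rule ext) (use D[OF f] f in "auto simp: E_carrier")
 qed
 fix f assume f: "f \<in>: E"
 show "\<one>\<^sub>k \<odot>\<^sub>E f = f"
  unfolding E_simps by (rule ext) (use D[OF f] f in "auto simp: E_carrier")
 fix c d g assume c: "c \<in>: k"
 show "c \<odot>\<^sub>E f \<in>: E" unfolding E_simps(4)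
  by (rule restrict_E, rule klinI)
    (use c D[OF f] in "simp_all add: smult_r_distr smult_assoc1[symmetric] R.m_comm")
 show "(c \<oplus>\<^sub>k d) \<odot>\<^sub>E f = c \<odot>\<^sub>E f \<oplus>\<^sub>E d \<odot>\<^sub>E f" if "d \<in>: k"
  unfolding E_simps by (rule ext) (use c that D[OF f] in "auto simp: smult_l_distr")
 show "(c *\<^sub>k d) \<odot>\<^sub>E f = c \<odot>\<^sub>E (d \<odot>\<^sub>E f)" if "d \<in>: k"
  unfolding E_simps by (rule ext) (use c that D[OF f] in "auto simp: smult_assoc1")
 show "c \<odot>\<^sub>E (f \<oplus>\<^sub>E g) = c \<odot>\<^sub>E f \<oplus>\<^sub>E c \<odot>\<^sub>E g" if "g \<in>: E"
  unfolding E_simps by (rule ext) (use c D[OF that] D[OF f] in "auto simp: smult_r_distr")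
qed

lemma op_simps: "carrier (op_algebra A) = \<A>" "add (op_algebra A) = add A"
 "zero (op_algebra A) = zero A" "smult (op_algebra A) = smult A"
 "x *\<^bsub>op_algebra A\<^esub> y = y * x" "\<one>\<^bsub>op_algebra A\<^esub> = \<one>"
 by (simp_all add: op_algebra_def)

lemma op_module: "module k (op_algebra A)"
 by (rule module_cong[OF modA]) (simp_all add: op_simps)

lemma ktens_op: "ktens k A (op_algebra A) = t2"
 by (simp add: tens2_eq ktens_def pure_tensor_def[abs_def] tensor_kernel_def tensor_relations_def op_simps)

lemma T_ktens: "is_ktens k A (op_algebra A) T t2"
 using is_ktens_tensor_alg[OF modA op_module] by (simp add: ktens_op)

lemma T_A2: "carrier T = carrier A2" "add T = add A2" "zero T = zero A2"
 by (simp_all add: alg2_def tensor_alg_def ktensor_def tensor_group_def tensor_kernel_def tensor_relations_def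
   Let_def op_simps ring.defs module.defs)

lemma T_mult:
 assumes "a \<in>: A" "b \<in>: A" "a' \<in>: A" "b' \<in>: A"
 shows "t2 a b *\<^sub>T t2 a' b' = t2 (a * a') (b' * b)"
proof -
 have "bilin k (op_algebra A) (op_algebra A) (op_algebra A) (monoid.mult (op_algebra A))"
  by (rule bilinI) (simp_all add: op_simps mult_simps)
 from tensor_alg_mult(2)[OF modA mult_bilin op_module this] assms show ?thesis
  by (simp add: op_simps ktens_op)
qed

lemma T_bilin: "bilin k T T T (monoid.mult T)"
proof -
 have "bilin k (op_algebra A) (op_algebra A) (op_algebra A) (monoid.mult (op_algebra A))"
  by (rule bilinI) (simp_all add: op_simps mult_simps)
 from tensor_alg_mult(1)[OF modA mult_bilin op_module this] show ?thesis .
qed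

definition Phi :: "'a tensor2 => 'a => 'a" where
 "Phi = the_additive T E (%f. \<forall>a\<in>\<A>. \<forall>b\<in>\<A>. f (ktens k A (op_algebra A) a b) =
     (\<lambda>x\<in>\<A>. a * x * b))"

lemma sandwich_E: "a \<in>: A ==> b \<in>: A ==> (\<lambda>x\<in>\<A>. a * x * b) \<in>: E"
 by (rule restrict_E, rule klinI) (simp_all add: mult_simps)

lemma Phi: "klin k T E Phi" "Phi \<in> extensional (carrier T)"
 "!!a b. a \<in>: A ==> b \<in>: A ==> Phi (t2 a b) = (\<lambda>x\<in>\<A>. a * x * b)"
proof -
 have b: "bilin k A (op_algebra A) E (%a b. \<lambda>x\<in>\<A>. a * x * b)"
  by (rule bilinI) (auto simp: op_simps sandwich_E, auto simp: E_simps mult_simps intro!: restrict_ext)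
 note t = is_ktens_the_additive[OF T_ktens E_module b, unfolded op_simps]
 show "klin k T E Phi" "Phi \<in> extensional (carrier T)"
  using t(1) unfolding Phi_def ktens_op linear_maps_iff by blast+
 show "!!a b. a \<in>: A ==> b \<in>: A ==> Phi (t2 a b) = (\<lambda>x\<in>\<A>. a * x * b)"
  using t(2) unfolding Phi_def ktens_op by blast
qed

lemma Phi_klin: "X \<in>: A2 ==> klin k A A (Phi X)"
 using klinD(1)[OF Phi(1), of X] by (simp add: T_A2 E_carrier)

lemma Phi_add: "X \<in>: A2 ==> Y \<in>: A2 ==> c \<in>: A ==> Phi (X \<oplus>\<^sub>A2 Y) c = Phi X c \<oplus> Phi Y c"
 using klinD(2)[OF Phi(1), of X Y] by (simp add: T_A2 E_simps)

lemma Phi_eval: "c \<in>: A ==> additive_on A2 A (%X. Phi X c)"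
 unfolding additive_on_def using Phi_add klinD(1)[OF Phi_klin] by auto

lemma Phi_psum:
 assumes ws: "pairs ws" and c: "c \<in>: A"
 shows "Phi (psum A2 ws t2) c = psum A ws (%y z. y * c * z)"
proof -
 have "Phi (psum A2 ws t2) c = psum A ws (%y z. Phi (t2 y z) c)"
  by (rule psum_additive[OF A2.ab_gr ab_gr Phi_eval[OF c] ws]) (simp add: t2_simps)
 also have "... = psum A ws (%y z. y * c * z)"
  by (rule psum_cong[OF ws]) (simp add: Phi(3) c)
 finally show ?thesis .
qed

lemma Phi_tsum:
 assumes L: "triples L" and c: "c \<in>: A"
  and pq: "!!x y z. x \<in>: A ==> y \<in>: A ==> z \<in>: A ==> p x y z \<in>: A & q x y z \<in>: A"
 shows "Phi (tsum A2 L (%x y z. t2 (p x y z) (q x y z))) c = tsum A L (%x y z. p x y z * c * q x y z)"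
proof -
 have "Phi (tsum A2 L (%x y z. t2 (p x y z) (q x y z))) c = tsum A L (%x y z. Phi (t2 (p x y z) (q x y z)) c)"
  by (rule tsum_additive[OF A2.ab_gr ab_gr Phi_eval[OF c] L]) (use pq in "simp add: t2_simps")
 also have "... = tsum A L (%x y z. p x y z * c * q x y z)"
  by (rule tsum_cong[OF L]) (use pq c in "simp add: Phi(3)")
 finally show ?thesis .
qed

lemma Phi_ring_hom: "Phi \<in> ring_hom T E"
proof (rule ring_hom_memI)
 show "Phi X \<in>: E" if "X \<in>: T" for X by (rule klinD(1)[OF Phi(1) that])
 show "Phi (X \<oplus>\<^sub>T Y) = Phi X \<oplus>\<^sub>E Phi Y" if "X \<in>: T" "Y \<in>: T" for X Y
  by (rule klinD(2)[OF Phi(1) that])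
 show "Phi \<one>\<^sub>T = \<one>\<^sub>E"
  by (auto simp: tensor_alg_one ktens_op op_simps Phi(3) E_simps intro!: restrict_ext)
 have m: "Phi (X *\<^sub>T Y) c = Phi X (Phi Y c)" if X: "X \<in>: T" and Y: "Y \<in>: T" and c: "c \<in>: A" for X Y c
 proof -
  have A2c: "X *\<^sub>T Y \<in>: A2" if "X \<in>: A2" "Y \<in>: A2" for X Y
   using bilinD(1)[OF T_bilin] that by (simp add: T_A2)
  have add1: "(X \<oplus>\<^sub>A2 X') *\<^sub>T Y = X *\<^sub>T Y \<oplus>\<^sub>A2 X' *\<^sub>T Y" "Y *\<^sub>T (X \<oplus>\<^sub>A2 X') = Y *\<^sub>T X \<oplus>\<^sub>A2 Y *\<^sub>T X'"
   if "X \<in>: A2" "Y \<in>: A2" "X' \<in>: A2" for X Y X'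
   using bilinD(2,3)[OF T_bilin] that by (simp_all add: T_A2)
  from X have X2: "X \<in>: A2" by (simp add: T_A2)
  from Y have Y2: "Y \<in>: A2" by (simp add: T_A2)
  show ?thesis using ktens2 X2
  proof (induction rule: is_ktens_induct)
   case (pure a b)
   show ?case using ktens2 Y2
   proof (induction rule: is_ktens_induct)
    case (pure a' b')
    then show ?case using \<open>a \<in>: A\<close> \<open>b \<in>: A\<close> c by (simp add: T_mult Phi(3) A.m_assoc)
   next
    case (add Y Y')
    have "t2 a b \<in>: A2" using pure by (simp add: t2_simps)
    with add c show ?case
     by (simp add: add1 A2c Phi_add klinD(1,2)[OF Phi_klin])
   qed
  next
   case (add X X')
   then show ?case using Y2 c by (simp add: add1 A2c Phi_add klinD(1)[OF Phi_klin])
  qed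
 qed
 show "Phi (X *\<^sub>T Y) = Phi X *\<^sub>E Phi Y" if X: "X \<in>: T" and Y: "Y \<in>: T" for X Y
 proof (rule extensionalityI[of _ "\<A>"])
  have "X *\<^sub>T Y \<in>: T" by (rule bilinD(1)[OF T_bilin X Y])
  then show "Phi (X *\<^sub>T Y) \<in> extensional \<A>" using klinD(1)[OF Phi(1)] by (simp add: E_carrier)
  show "Phi X *\<^sub>E Phi Y \<in> extensional \<A>" by (simp add: E_simps)
  fix c assume "c \<in>: A"
  then show "Phi (X *\<^sub>T Y) c = (Phi X *\<^sub>E Phi Y) c" using m[OF X Y] by (simp add: E_simps compose_def)
 qed
qed

text \<open>The inverse of \<open>A \<otimes> A\<^sup>o\<^sup>p \<rightarrow> End(A)\<close> is \<open>f \<mapsto> f(R\<^sup>1) R\<^sup>2 \<otimes> R\<^sup>3\<close>.\<close>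
lemma normalized_central_azumaya:
 assumes central: "central_algebra k A" and P: "normalized_family P"
 shows "azumaya U k A"
proof -
 note P' = normalized_familyD[OF P] and cy = normalized_cyc[OF P]
 note L = P'(3)
 have i: "x \<in>: A" "pairs ws" if "(x, ws) \<in> set P" for x ws using P'(1) that unfolding inv_family_def by auto
 have inv: "tsum A2 (flat P) (%x y z. t2 (Phi X x * y) z) = X" if "X \<in>: A2" for X
  using ktens2 that
 proof (induction rule: is_ktens_induct)
  case (pure a b)
  have tr: "trilin k A A2 (%x y z. t2 (a * (x * y)) z)" using pure by (intro trilinI) (simp_all add: multilinear_simps)
  have bl: "bilin k A A A2 (%p q. t2 (a * p) (b * q))" using pure by (intro bilinI) (simp_all add: multilinear_simps)
  have "tsum A2 (flat P) (%x y z. t2 (Phi (t2 a b) x * y) z) = tsum A2 (flat P) (%x y z. t2 (a * ((x * b) * y)) z)"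
   by (rule tsum_cong[OF L]) (use pure in "simp add: Phi(3) A.m_assoc")
  also have "... = tsum A2 (flat P) (%x y z. t2 (a * (x * y)) (b * z))"
   by (rule cyc_app(1)[OF cy pure(2) mod2 tr, symmetric])
  also have "... = t2 a b" using normalized_app[OF L P'(2) mod2 bl] pure by simp
  finally show ?case .
 next
  case (add X Y)
  have c: "t2 (Phi X x * y) z \<in>: A2" if "X \<in>: A2" "x \<in>: A" "y \<in>: A" "z \<in>: A" for X x y z
   using that klinD(1)[OF Phi_klin] by (simp add: t2_simps)
  have "tsum A2 (flat P) (%x y z. t2 (Phi (X \<oplus>\<^sub>A2 Y) x * y) z) =
   tsum A2 (flat P) (%x y z. t2 (Phi X x * y) z \<oplus>\<^sub>A2 t2 (Phi Y x * y) z)"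
   by (rule tsum_cong[OF L]) (use add(1,2) klinD(1)[OF Phi_klin] in "simp add: Phi_add mult_simps t2_simps")
  then show ?case using add c by (simp add: tsum_add[OF A2.ab_gr L])
 qed
 have surj: "\<exists>X\<in>carrier A2. Phi X = f" if f: "f \<in>: E" for f
 proof -
  have fl: "klin k A A f" and fe: "f \<in> extensional \<A>" using f by (simp_all add: E_carrier)
  let ?X = "tsum A2 (flat P) (%x y z. t2 (f x * y) z)"
  have X: "?X \<in>: A2"
   by (rule tsum_closed[OF A2.ab_gr L]) (use klinD(1)[OF fl] in "simp add: t2_simps")
  have "Phi ?X c = f c" if c: "c \<in>: A" for c
  proof -
   have "Phi ?X c = tsum A (flat P) (%x y z. f x * y * c * z)"
    by (rule Phi_tsum[OF L c]) (use klinD(1)[OF fl] in simp)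
   also have "... = tsum A (flat P) (%x y z. f x * (y * c * z))"
    by (rule tsum_cong[OF L]) (use c klinD(1)[OF fl] in "simp add: A.m_assoc")
   also have "... = lsum A (%(x, ws). psum A ws (%y z. f x * (y * c * z))) P"
    by (rule tsum_flat[OF ab_gr P'(1)]) (use c klinD(1)[OF fl] in simp)
   also have "... = lsum A (%p. f (case p of (x, ws) => coef ws c \<odot> x)) P"
   proof (rule lsum_cong)
    fix p assume p: "p \<in> set P"
    obtain x ws where p': "p = (x, ws)" by fastforce
    note p'' = p[unfolded p']
    have fx: "f x \<in>: A" using klinD(1)[OF fl i(1)[OF p'']] .
    have l: "additive_on A A (%u. f x * u)" using fx by (auto simp: additive_on_def mult_simps)
    have "psum A ws (%y z. f x * (y * c * z)) = f x * psum A ws (%y z. y * c * z)"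
     by (rule psum_additive[OF ab_gr ab_gr l i(2)[OF p''], symmetric]) (use c in simp)
    also have "... = f (coef ws c \<odot> x)"
     unfolding coef(2)[OF central P p'' c, symmetric]
     using coef(1)[OF central P p'' c] fx i(1)[OF p''] by (simp add: smult_mult_right klinD(3)[OF fl])
    finally show "(case p of (x, ws) => psum A ws (%y z. f x * (y * c * z))) = f (case p of (x, ws) => coef ws c \<odot> x)"
     by (simp add: p')
   qed
   also have "... = f (lsum A (%(x, ws). coef ws c \<odot> x) P)"
    by (rule klin_lsum[OF modA modA fl, symmetric]) (use i coef(1)[OF central P _ c] in auto)
   also have "lsum A (%(x, ws). coef ws c \<odot> x) P = lsum A (%(x, t). t c \<odot> x) (map (%(x, ws). (x, coef ws)) P)"
    unfolding lsum_map by (rule lsum_cong) auto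
   also have "... = c" using coef_dual_basis[OF central P] c unfolding dual_basis_def by simp
   finally show ?thesis .
  qed
  moreover have "Phi ?X \<in> extensional \<A>" using klinD(1)[OF Phi(1), of ?X] X by (simp add: T_A2 E_carrier)
  ultimately have "Phi ?X = f" using fe by (intro extensionalityI[of _ "\<A>"]) auto
  with X show ?thesis by blast
 qed
 have "inj_on Phi (carrier T)"
  unfolding T_A2 by (rule inj_on_inverseI[of _ "%f. tsum A2 (flat P) (%x y z. t2 (f x * y) z)"]) (rule inv)
 moreover have "Phi ` carrier T = carrier E"
  using surj klinD(1)[OF Phi(1)] by (auto simp: T_A2)
 ultimately have "Phi \<in> ring_iso T E" using Phi_ring_hom unfolding ring_iso_def bij_betw_def by blast
 then show ?thesis
  using dual_basis_finitely_generated[OF coef_dual_basis[OF central P]]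
   dual_basis_projective[OF coef_dual_basis[OF central P], of U] central_faithful[OF central P]
  unfolding azumaya_def Phi_def faithful_module_def by blast
qed

text \<open>For a functional \<open>t\<close>, the endomorphism \<open>c \<mapsto> t(c) 1\<close> comes from an element of \<open>A \<otimes> A\<close>, which is
  invariant because \<open>t(c) 1\<close> is central and the correspondence injective. Attaching these elements to a dual basis gives \<open>R\<close>. For central \<open>z\<close>
  they also show \<open>t(m) z = t(zm) 1\<close>, and \<open>1\<close> is a sum of values \<open>t(m)\<close>.\<close>
lemma azumaya_family:
 assumes az: "Phi \<in> ring_iso T E" and faithful: "faithful_module k A" and D: "dual_basis k A D"
 shows "central_algebra k A" "\<exists>P. normalized_family P"
proof -
 have bij: "bij_betw Phi (carrier A2) (carrier E)" using az unfolding ring_iso_def T_A2 by blast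
 have Dx: "x \<in>: A" "functional k A t" if "(x, t) \<in> set D" for x t using D that unfolding dual_basis_def by auto
 have eqI: "X = Y" if "X \<in>: A2" "Y \<in>: A2" "!!c. c \<in>: A ==> Phi X c = Phi Y c" for X Y
 proof -
  have "Phi X \<in>: E" "Phi Y \<in>: E" by (rule bij_betw_apply[OF bij that(1)], rule bij_betw_apply[OF bij that(2)])
  then have "Phi X = Phi Y" using that(3) by (intro extensionalityI[of _ "\<A>"]) (auto simp: E_carrier)
  then show ?thesis using bij that(1,2) unfolding bij_betw_def inj_on_def by blast
 qed
 have "\<exists>ws. pairs ws & (\<forall>c\<in>\<A>. psum A ws (%y z. y * c * z) = t c \<odot> \<one>)" if t: "functional k A t" for t
 proof -
  note tD = functionalD(1-3)[OF t]
  have "(\<lambda>c\<in>\<A>. t c \<odot> \<one>) \<in>: E"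
   by (rule restrict_E, rule klinI) (simp_all add: tD smult_l_distr smult_assoc1)
  then have "(\<lambda>c\<in>\<A>. t c \<odot> \<one>) \<in> Phi ` carrier A2" using bij unfolding bij_betw_def by simp
  then obtain X where X: "X \<in>: A2" "Phi X = (\<lambda>c\<in>\<A>. t c \<odot> \<one>)" by auto
  from t2_rep[OF X(1)] obtain ws where ws: "pairs ws" "X = psum A2 ws t2" .
  have "psum A ws (%y z. y * c * z) = t c \<odot> \<one>" if "c \<in>: A" for c
   using Phi_psum[OF ws(1) that] X(2) that unfolding ws(2) by simp
  with ws(1) show ?thesis by blast
 qed
 then have "\<forall>t\<in>{t. functional k A t}. \<exists>ws. pairs ws & (\<forall>c\<in>\<A>. psum A ws (%y z. y * c * z) = t c \<odot> \<one>)"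
  by (intro ballI) simp
 from bchoice[OF this] obtain r where r0: "\<forall>t\<in>{t. functional k A t}. pairs (r t) & (\<forall>c\<in>\<A>. psum A (r t) (%y z. y * c * z) = t c \<odot> \<one>)" ..
 have r: "pairs (r t)" "!!c. c \<in>: A ==> psum A (r t) (%y z. y * c * z) = t c \<odot> \<one>" if "functional k A t" for t
  using r0 that by auto
 obtain ps where ps: "set ps \<subseteq> snd ` set D \<times> \<A>" "lsum k (%(t, m). t m) ps = \<one>\<^sub>k"
  using trace_ideal_one[OF D] faithful unfolding faithful_module_def by blast
 have inj: "inj_on (%c. c \<odot> \<one>) (carrier k)"
 proof (rule inj_onI)
  fix c d assume cd: "c \<in>: k" "d \<in>: k" "c \<odot> \<one> = d \<odot> \<one>"
  have "c \<odot> m = d \<odot> m" if m: "m \<in>: A" for m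
   using arg_cong[OF cd(3), of "%u. u * m"] cd(1,2) m by (simp add: smult_mult_left)
  then have "\<forall>m\<in>\<A>. (c \<oplus>\<^sub>k (\<ominus>\<^sub>k d)) \<odot> m = \<zero>"
   using cd(1,2) by (simp add: smult_l_distr smult_l_minus r_neg)
  then have "c \<oplus>\<^sub>k (\<ominus>\<^sub>k d) = \<zero>\<^sub>k" using faithful cd(1,2) unfolding faithful_module_def by simp
  then show "c = d" using cd(1,2) using R.minus_equality[of c "\<ominus>\<^sub>k d"] by simp
 qed
 have "z \<in> (%c. c \<odot> \<one>) ` carrier k" if z: "z \<in> center A" for z
 proof -
  have zc: "z \<in>: A" and zm: "!!a. a \<in>: A ==> z * a = a * z" using z by (auto simp: center_iff)
  have move: "t m \<odot> z = t (z * m) \<odot> \<one>" if t: "functional k A t" and m: "m \<in>: A" for t m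
  proof -
   have l: "additive_on A A (%u. z * u)" using zc by (auto simp: additive_on_def mult_simps)
   have "t m \<odot> z = z * psum A (r t) (%y w. y * m * w)"
    using r(2)[OF t m] functionalD(1)[OF t m] zc by (simp add: smult_mult_right)
   also have "... = psum A (r t) (%y w. z * (y * m * w))"
    by (rule psum_additive[OF ab_gr ab_gr l r(1)[OF t]]) (use m in simp)
   also have "... = psum A (r t) (%y w. y * (z * m) * w)"
   proof (rule psum_cong[OF r(1)[OF t]])
    fix y w assume yw: "y \<in>: A" "w \<in>: A"
    have "z * (y * m * w) = (z * y) * m * w" using yw zc m by (simp add: A.m_assoc)
    then show "z * (y * m * w) = y * (z * m) * w" unfolding zm[OF yw(1)] using yw zc m by (simp add: A.m_assoc)
   qed
   also have "... = t (z * m) \<odot> \<one>" by (rule r(2)[OF t]) (use zc m in simp)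
   finally show ?thesis .
  qed
  have pt: "functional k A t" "m \<in>: A" if "(t, m) \<in> set ps" for t m using ps(1) Dx(2) that by auto
  define s where "s = lsum k (%(t, m). t (z * m)) ps"
  have s: "s \<in>: k" unfolding s_def by (rule R.lsum_closed) (use pt functionalD(1) zc in fastforce)
  have l1: "additive_on k A (%c. c \<odot> z)" and l2: "additive_on k A (%c. c \<odot> \<one>)"
   using zc by (auto simp: additive_on_def smult_l_distr)
  have "z = lsum k (%(t, m). t m) ps \<odot> z" using ps(2) zc by simp
  also have "... = lsum A (%p. (case p of (t, m) => t m) \<odot> z) ps"
   by (rule additive_on_lsum[OF R.ab_gr ab_gr l1]) (use pt functionalD(1) in fastforce)
  also have "... = lsum A (%p. (case p of (t, m) => t (z * m)) \<odot> \<one>) ps"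
   by (rule lsum_cong) (use pt move in auto)
  also have "... = s \<odot> \<one>"
   unfolding s_def by (rule additive_on_lsum[OF R.ab_gr ab_gr l2, symmetric])
    (use pt functionalD(1) zc in fastforce)
  finally show ?thesis using s by blast
 qed
 then show "central_algebra k A" unfolding central_algebra_def bij_betw_def using inj scalar_central by blast
 define P where "P = map (%(x, t). (x, r t)) D"
 have P: "inv_family P"
  unfolding inv_family_def P_def
 proof (clarsimp, intro conjI ballI)
  fix x t assume i: "(x, t) \<in> set D"
  show "x \<in>: A" by (rule Dx(1)[OF i])
  note t = Dx(2)[OF i]
  show "pairs (r t)" by (rule r(1)[OF t])
  fix a assume a: "a \<in>: A"
  note rp = r(1)[OF t]
  let ?l = "map (%(y, z). (a * y, z)) (r t)" and ?r = "map (%(y, z). (y, z * a)) (r t)"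
  have lr: "pairs ?l" "pairs ?r" using rp a unfolding pairs_def by auto
  have e: "psum G ?l \<phi> = psum G (r t) (%y z. \<phi> (a * y) z)" "psum G ?r \<phi> = psum G (r t) (%y z. \<phi> y (z * a))"
   for G :: "('g, 'z) ring_scheme" and \<phi>
   unfolding psum_def lsum_map by (auto intro!: lsum_cong)
  have "psum A2 ?l t2 = psum A2 ?r t2"
  proof (rule eqI[OF psum_t2_closed[OF lr(1)] psum_t2_closed[OF lr(2)]])
   fix c assume c: "c \<in>: A"
   have la: "additive_on A A (%u. a * u)" and ra: "additive_on A A (%u. u * a)"
    using a by (auto simp: additive_on_def mult_simps)
   have "Phi (psum A2 ?l t2) c = psum A (r t) (%y z. a * (y * c * z))"
    unfolding Phi_psum[OF lr(1) c] unfolding e by (rule psum_cong[OF rp]) (use a c in "simp add: A.m_assoc")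
   also have "... = a * (t c \<odot> \<one>)"
    unfolding r(2)[OF t c, symmetric]
    by (rule psum_additive[OF ab_gr ab_gr la rp, symmetric]) (use c in simp)
   also have "... = (t c \<odot> \<one>) * a"
    using functionalD(1)[OF t c] a by (simp add: mult_simps)
   also have "... = psum A (r t) (%y z. (y * c * z) * a)"
    unfolding r(2)[OF t c, symmetric]
    by (rule psum_additive[OF ab_gr ab_gr ra rp]) (use c in simp)
   also have "... = Phi (psum A2 ?r t2) c"
    unfolding Phi_psum[OF lr(2) c] unfolding e by (rule psum_cong[OF rp]) (use a c in "simp add: A.m_assoc")
   finally show "Phi (psum A2 ?l t2) c = Phi (psum A2 ?r t2) c" .
  qed
  then show "psum A2 (r t) (%y z. t2 (a * y) z) = psum A2 (r t) (%y z. t2 y (z * a))" unfolding e .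
 qed
 note L = inv_family_triples[OF P]
 have "tsum A2 (flat P) (%x y z. t2 (x * y) z) = t2 \<one> \<one>"
 proof (rule eqI)
  show "tsum A2 (flat P) (%x y z. t2 (x * y) z) \<in>: A2"
   by (rule tsum_closed[OF A2.ab_gr L]) (simp add: t2_simps)
  show "t2 \<one> \<one> \<in>: A2" by (simp add: t2_simps)
  fix c assume c: "c \<in>: A"
  have "Phi (tsum A2 (flat P) (%x y z. t2 (x * y) z)) c = tsum A (flat P) (%x y z. x * y * c * z)"
   by (rule Phi_tsum[OF L c]) simp
  also have "... = tsum A (flat P) (%x y z. x * (y * c * z))"
   by (rule tsum_cong[OF L]) (use c in "simp add: A.m_assoc")
  also have "... = lsum A (%(x, ws). psum A ws (%y z. x * (y * c * z))) P"
   by (rule tsum_flat[OF ab_gr P]) (use c in simp)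
  also have "... = lsum A (%(x, t). t c \<odot> x) D"
   unfolding P_def lsum_map
  proof (rule lsum_cong)
   fix p assume p: "p \<in> set D"
   obtain x t where p': "p = (x, t)" by fastforce
   note i = p[unfolded p'] 
   note t = Dx(2)[OF i] and x = Dx(1)[OF i]
   have l: "additive_on A A (%u. x * u)" using x by (auto simp: additive_on_def mult_simps)
   have "psum A (r t) (%y z. x * (y * c * z)) = x * psum A (r t) (%y z. y * c * z)"
    by (rule psum_additive[OF ab_gr ab_gr l r(1)[OF t], symmetric]) (use c in simp)
   also have "... = t c \<odot> x" unfolding r(2)[OF t c] using functionalD(1)[OF t c] x by (simp add: smult_mult_right)
   finally show "(case case p of (x, t) => (x, r t) of (x, ws) => psum A ws (%y z. x * (y * c * z))) =
    (case p of (x, t) => t c \<odot> x)" by (simp add: p')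
  qed
  also have "... = c" using D c unfolding dual_basis_def by simp
  finally show "Phi (tsum A2 (flat P) (%x y z. t2 (x * y) z)) c = Phi (t2 \<one> \<one>) c" using c by (simp add: Phi(3))
 qed
 then show "\<exists>P. normalized_family P" using P unfolding normalized_family_def normalized_list_def by blast
qed

end

context kalg_univ
begin

text \<open>Split the surjection onto \<open>A\<close> from the free module on a finite generating set. Projectivity refers to
  modules in the universe, so the surjection is transported to copies there.\<close>
lemma projective_dual_basis:
 assumes fg: "finitely_generated k A" and proj: "projective_module TYPE('u) k A"
 shows "\<exists>D. dual_basis k A D"
proof -
 obtain S where S: "finite S" "S \<subseteq> \<A>"
  "!!x. x \<in>: A ==> \<exists>c\<in>S \<rightarrow> carrier k. x = (\<Oplus>\<^bsub>A\<^esub>s\<in>S. c s \<odot> s)"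
  using fg unfolding finitely_generated_def by blast
 obtain ss where ss: "set ss = S" "distinct ss" using finite_distinct_list[OF S(1)] by blast
  \<comment> \<open>the free module on \<open>S\<close>\<close>
 define K :: "('k, 'a => 'k) module" where "K = \<lparr>carrier = S \<rightarrow>\<^sub>E carrier k, monoid.mult = undefined, one = undefined,
  zero = (\<lambda>s\<in>S. \<zero>\<^sub>k), add = (%f g. \<lambda>s\<in>S. f s \<oplus>\<^sub>k g s), smult = (%c f. \<lambda>s\<in>S. c *\<^sub>k f s)\<rparr>"
 have Ks: "carrier K = S \<rightarrow>\<^sub>E carrier k" "\<zero>\<^sub>K = (\<lambda>s\<in>S. \<zero>\<^sub>k)"
  "!!f g. f \<oplus>\<^sub>K g = (\<lambda>s\<in>S. f s \<oplus>\<^sub>k g s)" "!!c f. c \<odot>\<^sub>K f = (\<lambda>s\<in>S. c *\<^sub>k f s)"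
  by (simp_all add: K_def)
 have ext: "f = g" if "f \<in> extensional S" "g \<in> extensional S" "!!x. x \<in> S ==> f x = g x" for f g :: "'a => 'k"
  using that by (rule extensionalityI)
 have in_k: "f s \<in>: k" if "f \<in> S \<rightarrow>\<^sub>E carrier k" "s \<in> S" for f s using that by auto
 have "abelian_group K"
 proof (rule abelian_groupI)
  fix f assume f: "f \<in>: K"
  show "\<exists>g\<in>carrier K. g \<oplus>\<^sub>K f = \<zero>\<^sub>K"
   by (rule bexI[of _ "\<lambda>s\<in>S. \<ominus>\<^sub>k f s"]) (use f in "auto simp: Ks in_k R.l_neg intro!: restrict_ext")
  show "\<zero>\<^sub>K \<oplus>\<^sub>K f = f" unfolding Ks
   by (rule ext) (use f in "auto simp: Ks in_k PiE_def")
 qed (auto simp: Ks in_k R.a_ac intro!: restrict_ext)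
 then have K: "module k K"
 proof (intro moduleI)
  show "\<one>\<^sub>k \<odot>\<^sub>K f = f" if "f \<in>: K" for f unfolding Ks
   by (rule ext) (use that in "auto simp: Ks in_k PiE_def")
 qed (auto simp: Ks in_k is_cring R.l_distr R.r_distr R.m_assoc intro!: restrict_ext)
 obtain i where i: "inj_on i (carrier k)" "i ` carrier k \<subseteq> (UNIV :: 'u set)" using k_lepoll unfolding lepoll_def by blast
 have "inj_on (%f. map (%s. i (f s)) ss) (carrier K)"
 proof (rule inj_onI)
  fix f g assume fg: "f \<in>: K" "g \<in>: K" "map (%s. i (f s)) ss = map (%s. i (g s)) ss"
  have "f s = g s" if s: "s \<in> S" for s
  proof -
   have "i (f s) = i (g s)" using fg(3) s ss(1) by simp
   then show ?thesis using inj_onD[OF i(1)] in_k fg(1,2) s unfolding Ks by blast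
  qed
  then show "f = g" using fg(1,2) unfolding Ks by (intro ext) (auto simp: PiE_def)
 qed
 then have "carrier K \<lesssim> (UNIV :: 'u list set)" unfolding lepoll_def by (intro exI conjI) auto
 then have Kle: "carrier K \<lesssim> (UNIV :: 'u set)" by (rule lepoll_trans[OF _ infinite_lists_lepoll[OF infinite_univ]])
 obtain C1 :: "('k, 'u) module" and e1 where C1: "module k C1" "bij_betw e1 (carrier K) (carrier C1)" "klin k K C1 e1"
  using module_copy[OF K Kle] by blast
 obtain C2 :: "('k, 'u) module" and e2 where C2: "module k C2" "bij_betw e2 \<A> (carrier C2)" "klin k A C2 e2"
  using module_copy[OF modA A_lepoll] by blast
 define g0 where "g0 c = lsum A (%s. c s \<odot> s) ss" for c
 have sA: "s \<in>: A" "s \<in> S" if "s \<in> set ss" for s using that ss S(2) by auto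
 have g0: "klin k K A g0"
 proof (rule klinI)
  show "g0 c \<in>: A" if "c \<in>: K" for c unfolding g0_def by (rule lsum_closed) (use that sA in_k in "auto simp: Ks")
  show "g0 (c \<oplus>\<^sub>K d) = g0 c \<oplus> g0 d" if "c \<in>: K" "d \<in>: K" for c d
   unfolding g0_def
   by (subst lsum_add[symmetric]; (rule lsum_cong)?) (use that sA in_k in "auto simp: Ks smult_l_distr")
  show "g0 (a \<odot>\<^sub>K c) = a \<odot> g0 c" if "a \<in>: k" "c \<in>: K" for a c
  proof -
   have l: "additive_on A A (%u. a \<odot> u)" using that by (auto simp: additive_on_def smult_r_distr)
   have cl: "c s \<odot> s \<in>: A" if "s \<in> set ss" for s using that sA in_k \<open>c \<in>: K\<close> by (auto simp: Ks)
   show ?thesis unfolding g0_def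
    by (subst additive_on_lsum[OF ab_gr ab_gr l cl], assumption, rule lsum_cong)
      (use that sA in_k in "auto simp: Ks smult_assoc1")
  qed
 qed
 define d1 where "d1 = inv_into (carrier K) e1"
 have d1: "d1 y \<in>: K" "e1 (d1 y) = y" if "y \<in>: C1" for y
  using C1(2) that unfolding d1_def by (auto simp: bij_betw_inv_into_right intro: bij_betw_apply[OF bij_betw_inv_into])
 have de1: "d1 (e1 c) = c" if "c \<in>: K" for c using C1(2) that unfolding d1_def by (simp add: bij_betw_inv_into_left)
 interpret K: module k K by (rule K)
 have d1l: "klin k C1 K d1"
 proof (rule klinI)
  show "d1 (x \<oplus>\<^sub>C1 y) = d1 x \<oplus>\<^sub>K d1 y" if "x \<in>: C1" "y \<in>: C1" for x y
   using klinD(2)[OF C1(3), of "d1 x" "d1 y"] de1[of "d1 x \<oplus>\<^sub>K d1 y"] d1 that by simp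
  show "d1 (c \<odot>\<^sub>C1 x) = c \<odot>\<^sub>K d1 x" if "c \<in>: k" "x \<in>: C1" for c x
   using klinD(3)[OF C1(3), of c "d1 x"] de1[of "c \<odot>\<^sub>K d1 x"] d1 that by simp
 qed (rule d1(1))
 let ?g = "restrict (%y. e2 (g0 (d1 y))) (carrier C1)" and ?f = "restrict e2 \<A>"
 have "klin k C1 C2 (%y. e2 (g0 (d1 y)))"
  by (rule klinI) (simp_all add: klinD(1-3)[OF d1l] klinD(1-3)[OF g0] klinD(1-3)[OF C2(3)])
 then have gl: "?g \<in> linear_maps k C1 C2" unfolding linear_maps_iff using klin_restrict[OF C1(1)] by auto
 have fl: "?f \<in> linear_maps k A C2" unfolding linear_maps_iff using klin_restrict[OF modA C2(3)] by auto
 have surj: "?g ` carrier C1 = carrier C2"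
 proof
  show "?g ` carrier C1 \<subseteq> carrier C2" using gl unfolding linear_maps_iff by (auto dest: klinD(1))
  show "carrier C2 \<subseteq> ?g ` carrier C1"
  proof
   fix y assume "y \<in>: C2"
   then obtain x where x: "x \<in>: A" "y = e2 x" using C2(2) unfolding bij_betw_def by blast
   from S(3)[OF x(1)] obtain c where c: "c \<in> S \<rightarrow> carrier k" "x = (\<Oplus>\<^bsub>A\<^esub>s\<in>S. c s \<odot> s)" by blast
   have "x = lsum A (%s. c s \<odot> s) ss"
    unfolding c(2) ss(1)[symmetric] by (rule finsum_lsum[OF ss(2)]) (use c(1) sA in auto)
   also have "... = g0 (restrict c S)" unfolding g0_def by (rule lsum_cong) (use sA in auto)
   finally have xg: "x = g0 (restrict c S)" .
   have cK: "restrict c S \<in>: K" using c(1) by (auto simp: Ks)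
   have "e1 (restrict c S) \<in>: C1" using C1(2) cK by (rule bij_betw_apply)
   moreover have "?g (e1 (restrict c S)) = y" using de1[OF cK] xg x(2) calculation by simp
   ultimately show "y \<in> ?g ` carrier C1" by (metis imageI)
  qed
 qed
 from proj[unfolded projective_module_def, rule_format, OF C1(1) C2(1) gl fl surj]
 obtain h where h: "h \<in> linear_maps k A C1" "\<forall>x\<in>\<A>. ?g (h x) = ?f x" ..
 have hl: "klin k A C1 h" using h(1) by (simp add: linear_maps_iff)
 define D where "D = map (%s. (s, %x. d1 (h x) s)) ss"
 have dh: "klin k A K (%x. d1 (h x))"
  by (rule klinI) (simp_all add: klinD(1-3)[OF d1l] klinD(1-3)[OF hl])
 have fun_s: "functional k A (%x. d1 (h x) s)" if "s \<in> S" for s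
  unfolding functional_def additive_on_def
  using klinD(1-3)[OF dh] that in_k by (auto simp: Ks)
 have "x = lsum A (%(y, t). t x \<odot> y) D" if x: "x \<in>: A" for x
 proof -
  have hx: "h x \<in>: C1" by (rule klinD(1)[OF hl x])
  have gx: "g0 (d1 (h x)) \<in>: A" using klinD(1)[OF g0 d1(1)[OF hx]] .
  have "e2 (g0 (d1 (h x))) = e2 x" using h(2)[rule_format, OF x] hx x by simp
  from inj_onD[OF bij_betw_imp_inj_on[OF C2(2)] this gx x]
  have "x = g0 (d1 (h x))" ..
  also have "... = lsum A (%(y, t). t x \<odot> y) D" unfolding D_def lsum_map g0_def by simp
  finally show ?thesis .
 qed
 then have "dual_basis k A D" unfolding dual_basis_def D_def using sA fun_s by auto
 then show ?thesis ..
qed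

lemma azumaya_iff: "azumaya TYPE('u) k A \<longleftrightarrow> central_algebra k A & (\<exists>P. normalized_family P)"
proof
 assume az: "azumaya TYPE('u) k A"
 then have a: "finitely_generated k A" "projective_module TYPE('u) k A" "faithful_module k A" "Phi \<in> ring_iso T E"
  unfolding azumaya_def Phi_def by blast+
 obtain D where D: "dual_basis k A D" using projective_dual_basis[OF a(1,2)] by blast
 show "central_algebra k A & (\<exists>P. normalized_family P)" using azumaya_family[OF a(4,3) D] by blast
next
 assume "central_algebra k A & (\<exists>P. normalized_family P)"
 then show "azumaya TYPE('u) k A" using normalized_central_azumaya by blast
qed

end

section \<open>The monoidal structure on pure tensors\<close>

context kalg_univ
begin

abbreviation "tens_ar \<equiv> utensor_arrow A"
abbreviation tensor_ob :: "('k, 'a, 'u) bimodule => ('k, 'a, 'u) bimodule => ('k, 'a, 'u) bimodule" (infixl "\<otimes>" 70)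
 where "M \<otimes> N == utensor A M N"
abbreviation pt :: "('k, 'a, 'u) bimodule => ('k, 'a, 'u) bimodule => 'u => 'u => 'u" where "pt == utens A"
abbreviation "BM == bimodule k A"

lemma pt_simps:
 fixes M N :: "('k, 'a, 'u) bimodule"
 assumes M: "BM M" and N: "BM N"
 shows "!!m n. m \<in>: M ==> n \<in>: N ==> pt M N m n \<in>: (M \<otimes> N)" (is "PROP ?p1")
  and "!!m m' n. m \<in>: M ==> m' \<in>: M ==> n \<in>: N ==>
   pt M N (m \<oplus>\<^sub>M m') n = pt M N m n \<oplus>\<^bsub>M \<otimes> N\<^esub> pt M N m' n" (is "PROP ?p2")
  and "!!m n n'. m \<in>: M ==> n \<in>: N ==> n' \<in>: N ==>
   pt M N m (n \<oplus>\<^sub>N n') = pt M N m n \<oplus>\<^bsub>M \<otimes> N\<^esub> pt M N m n'" (is "PROP ?p3")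
  and "!!a m n. a \<in>: A ==> m \<in>: M ==> n \<in>: N ==> pt M N (m <|\<^sub>M a) n = pt M N m (a |>\<^sub>N n)" (is "PROP ?p4")
  and "!!a m n. a \<in>: A ==> m \<in>: M ==> n \<in>: N ==> a |>\<^bsub>M \<otimes> N\<^esub> pt M N m n = pt M N (a |>\<^sub>M m) n" (is "PROP ?p5")
  and "!!a m n. a \<in>: A ==> m \<in>: M ==> n \<in>: N ==> pt M N m n <|\<^bsub>M \<otimes> N\<^esub> a = pt M N m (n <|\<^sub>N a)" (is "PROP ?p6")
  and "!!c m n. c \<in>: k ==> m \<in>: M ==> n \<in>: N ==> pt M N (c \<odot>\<^sub>M m) n = c \<odot>\<^bsub>M \<otimes> N\<^esub> pt M N m n" (is "PROP ?p7")
  and "!!c m n. c \<in>: k ==> m \<in>: M ==> n \<in>: N ==> pt M N m (c \<odot>\<^sub>N n) = c \<odot>\<^bsub>M \<otimes> N\<^esub> pt M N m n"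
proof -
 note u = utensor_facts[OF M N] and t = is_tensor_simps[OF utensor_facts(2)[OF M N]]
 show "PROP ?p1" by (rule t(1))
 show "PROP ?p2" by (rule t(2))
 show "PROP ?p3" by (rule t(3))
 show bal: "PROP ?p4"
  by (rule t(4))
 show "PROP ?p5"
  by (rule u(4)[symmetric])
 show "PROP ?p6"
  by (rule u(5)[symmetric])
 show sm: "PROP ?p7"
  by (rule u(3))
 show "pt M N m (c \<odot>\<^sub>N n) = c \<odot>\<^bsub>M \<otimes> N\<^esub> pt M N m n" if "c \<in>: k" "m \<in>: M" "n \<in>: N" for c m n
  using bal[of "c \<odot> \<one>" m n] sm[OF that] that bim_simps(7,11)[OF N] bim_simps(8,12)[OF M] by simp
qed

lemma pt_bim: "BM M ==> BM N ==> BM (M \<otimes> N)" by (rule utensor_facts(1))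

lemma pt_ext:
 "BM M ==> BM N ==> additive_on (M \<otimes> N) Q f ==> additive_on (M \<otimes> N) Q g ==>
  (!!m n. m \<in>: M ==> n \<in>: N ==> f (pt M N m n) = g (pt M N m n)) ==>
  X \<in>: (M \<otimes> N) ==> f X = g X"
 by (rule is_tensor_ext[OF utensor_facts(2)])

lemma bimodule_additive:
 assumes "BM M"
 shows "a \<in>: A ==> additive_on M M (%m. a |>\<^sub>M m)" "a \<in>: A ==> additive_on M M (%m. m <|\<^sub>M a)"
 using bim_simps(1,2,4,5)[OF assms] by (auto simp: additive_on_def)

lemma additive_add:
 fixes T :: "('t, 'z) ring_scheme" and Q :: "('q, 'y) ring_scheme"
 assumes "abelian_group Q" "additive_on T Q f" "additive_on T Q g"
 shows "additive_on T Q (%X. f X \<oplus>\<^sub>Q g X)"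
proof -
 interpret Q: abelian_group Q by fact
 have "(f x \<oplus>\<^sub>Q f y) \<oplus>\<^sub>Q (g x \<oplus>\<^sub>Q g y) = (f x \<oplus>\<^sub>Q g x) \<oplus>\<^sub>Q (f y \<oplus>\<^sub>Q g y)" if "x \<in>: T" "y \<in>: T" for x y
  using additive_onD(1)[OF assms(2)] additive_onD(1)[OF assms(3)] that by (simp add: Q.a_ac)
 then show ?thesis unfolding additive_on_def
  using additive_onD[OF assms(2)] additive_onD[OF assms(3)] by auto
qed

text \<open>A map that commutes with the actions of \<open>A\<close> is linear, as \<open>k\<close> acts through \<open>A\<close>.\<close>
lemma bimapI:
 fixes M :: "('k, 'a, 'm) bimodule" and N :: "('k, 'a, 'n) bimodule"
 assumes M: "BM M" and N: "BM N" and f: "additive_on M N f"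
  and l: "!!a m. a \<in>: A ==> m \<in>: M ==> f (a |>\<^sub>M m) = a |>\<^sub>N f m"
  and r: "!!a m. a \<in>: A ==> m \<in>: M ==> f (m <|\<^sub>M a) = f m <|\<^sub>N a"
 shows "bimap k A M N f"
proof -
 have "f (c \<odot>\<^sub>M m) = c \<odot>\<^sub>N f m" if "c \<in>: k" "m \<in>: M" for c m
  using l[of "c \<odot> \<one>" m] that additive_onD(1)[OF f] bim_simps(7,11)[OF M] bim_simps(7,11)[OF N] by simp
 then show ?thesis unfolding bimap_def klin_def using f l r by blast
qed

lemma tensor_bimap:
 fixes M N :: "('k, 'a, 'u) bimodule" and P :: "('k, 'a, 'p) bimodule"
 assumes M: "BM M" and N: "BM N" and P: "BM P"
  and cl: "!!m n. m \<in>: M ==> n \<in>: N ==> \<phi> m n \<in>: P"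
  and add: "!!m m' n. m \<in>: M ==> m' \<in>: M ==> n \<in>: N ==> \<phi> (m \<oplus>\<^sub>M m') n = \<phi> m n \<oplus>\<^sub>P \<phi> m' n"
   "!!m n n'. m \<in>: M ==> n \<in>: N ==> n' \<in>: N ==> \<phi> m (n \<oplus>\<^sub>N n') = \<phi> m n \<oplus>\<^sub>P \<phi> m n'"
  and bal: "!!a m n. a \<in>: A ==> m \<in>: M ==> n \<in>: N ==> \<phi> (m <|\<^sub>M a) n = \<phi> m (a |>\<^sub>N n)"
   "!!a m n. a \<in>: A ==> m \<in>: M ==> n \<in>: N ==> \<phi> (a |>\<^sub>M m) n = a |>\<^sub>P \<phi> m n"
   "!!a m n. a \<in>: A ==> m \<in>: M ==> n \<in>: N ==> \<phi> m (n <|\<^sub>N a) = \<phi> m n <|\<^sub>P a"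
 defines "f == the_additive (M \<otimes> N) P (%h. \<forall>m\<in>carrier M. \<forall>n\<in>carrier N. h (pt M N m n) = \<phi> m n)"
 shows "bimap k A (M \<otimes> N) P f" "f \<in> extensional (carrier (M \<otimes> N))" (is "PROP ?p1")
  and "!!m n. m \<in>: M ==> n \<in>: N ==> f (pt M N m n) = \<phi> m n" (is "PROP ?p2")
proof -
 note T = pt_bim[OF M N]
 have "balanced_map M N \<A> (%m a. m <|\<^sub>M a) (%a n. a |>\<^sub>N n) P \<phi>"
  unfolding balanced_map_def additive_on_def using cl add bal(1) by auto
 note t = is_tensor_the_additive[OF utensor_facts(2)[OF M N] bimoduleD(2)[OF P] this, folded f_def]
 have fa: "additive_on (M \<otimes> N) P f" using t(1) by (simp add: additive_maps_iff)
 show "PROP ?p1" using t(1) by (simp add: additive_maps_iff)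
 show v: "PROP ?p2" by (rule t(2))
 note s = bim_simps(1,2)[OF M] bim_simps(1,2)[OF N]
 show "bimap k A (M \<otimes> N) P f"
 proof (rule bimapI[OF T P fa])
  fix a X assume a: "a \<in>: A" and X: "X \<in>: (M \<otimes> N)"
  show "f (a |>\<^bsub>M \<otimes> N\<^esub> X) = a |>\<^sub>P f X"
   by (rule pt_ext[OF M N additive_on_compose[OF bimodule_additive(1)[OF T a] fa]
      additive_on_compose[OF fa bimodule_additive(1)[OF P a]] _ X])
     (use a in "simp add: pt_simps[OF M N] s v bal")
  show "f (X <|\<^bsub>M \<otimes> N\<^esub> a) = f X <|\<^sub>P a"
   by (rule pt_ext[OF M N additive_on_compose[OF bimodule_additive(2)[OF T a] fa]
      additive_on_compose[OF fa bimodule_additive(2)[OF P a]] _ X])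
     (use a in "simp add: pt_simps[OF M N] s v bal")
 qed
qed

lemma utensor_arrow_facts:
 assumes M: "BM M" "BM M'" and N: "BM N" "BM N'" and f: "f \<in> Hom \<B> M M'" and g: "g \<in> Hom \<B> N N'"
 shows "tens_ar f g \<in> Hom \<B> (M \<otimes> N) (M' \<otimes> N')" (is "PROP ?p1")
  and "!!m n. m \<in>: M ==> n \<in>: N ==> fn (tens_ar f g) (pt M N m n) = pt M' N' (fn f m) (fn g n)" (is "PROP ?p2")
proof -
 have s: "src f = M" "tgt f = M'" "src g = N" "tgt g = N'" and b: "bimap k A M M' (fn f)" "bimap k A N N' (fn g)"
  using f g by (simp_all add: Hom_Bimod)
 note bf = bimapD[OF b(1)] and bg = bimapD[OF b(2)]
 have e: "fn (tens_ar f g) = the_additive (M \<otimes> N) (M' \<otimes> N')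
  (%h. \<forall>m\<in>carrier M. \<forall>n\<in>carrier N. h (pt M N m n) = pt M' N' (fn f m) (fn g n))"
  by (simp add: utensor_arrow_def Let_def s)
 note t = tensor_bimap[OF M(1) N(1) pt_bim[OF M(2) N(2)], of "%m n. pt M' N' (fn f m) (fn g n)", folded e]
 note c = bf(3,4,6,7) bg(3,4,6,7) pt_simps[OF M(2) N(2)]
 show "PROP ?p1"
  unfolding Hom_Bimod
 proof (intro conjI)
  show "bimap k A (M \<otimes> N) (M' \<otimes> N') (fn (tens_ar f g))" by (rule t(1)) (simp_all add: c)
  show "fn (tens_ar f g) \<in> extensional (carrier (M \<otimes> N))" by (rule t(2)) (simp_all add: c)
 qed (simp_all add: utensor_arrow_def Let_def s)
 show "PROP ?p2"
  by (rule t(3)) (simp_all add: c)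
qed

lemma pt3_ext:
 assumes "BM M" "BM N" "BM P" and f: "additive_on (M \<otimes> N \<otimes> P) Q f" and g: "additive_on (M \<otimes> N \<otimes> P) Q g"
  and e: "!!m n p. m \<in>: M ==> n \<in>: N ==> p \<in>: P ==>
   f (pt (M \<otimes> N) P (pt M N m n) p) = g (pt (M \<otimes> N) P (pt M N m n) p)"
  and X: "X \<in>: (M \<otimes> N \<otimes> P)"
 shows "f X = g X"
proof (rule pt_ext[OF pt_bim[OF assms(1,2)] assms(3) f g _ X])
 fix Y p assume Y: "Y \<in>: (M \<otimes> N)" and p: "p \<in>: P"
 have l: "additive_on (M \<otimes> N) (M \<otimes> N \<otimes> P) (%Y. pt (M \<otimes> N) P Y p)"
  using pt_simps(1,2)[OF pt_bim[OF assms(1,2)] assms(3)] p by (auto simp: additive_on_def)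
 show "f (pt (M \<otimes> N) P Y p) = g (pt (M \<otimes> N) P Y p)"
  by (rule pt_ext[OF assms(1,2) additive_on_compose[OF l f] additive_on_compose[OF l g] e[OF _ _ p] Y])
qed

lemma pt3_ext':
 assumes "BM M" "BM N" "BM P" and f: "additive_on (M \<otimes> (N \<otimes> P)) Q f" and g: "additive_on (M \<otimes> (N \<otimes> P)) Q g"
  and e: "!!m n p. m \<in>: M ==> n \<in>: N ==> p \<in>: P ==>
   f (pt M (N \<otimes> P) m (pt N P n p)) = g (pt M (N \<otimes> P) m (pt N P n p))"
  and X: "X \<in>: (M \<otimes> (N \<otimes> P))"
 shows "f X = g X"
proof (rule pt_ext[OF assms(1) pt_bim[OF assms(2,3)] f g _ X])
 fix m Y assume m: "m \<in>: M" and Y: "Y \<in>: (N \<otimes> P)"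
 have l: "additive_on (N \<otimes> P) (M \<otimes> (N \<otimes> P)) (%Y. pt M (N \<otimes> P) m Y)"
  using pt_simps(1,3)[OF assms(1) pt_bim[OF assms(2,3)]] m by (auto simp: additive_on_def)
 show "f (pt M (N \<otimes> P) m Y) = g (pt M (N \<otimes> P) m Y)"
  by (rule pt_ext[OF assms(2,3) additive_on_compose[OF l f] additive_on_compose[OF l g] e[OF m] Y])
qed

text \<open>For fixed \<open>p\<close>, the assignment \<open>m \<otimes> n \<mapsto> m \<otimes> (n \<otimes> p)\<close> is a map on \<open>M \<otimes> N\<close>, and it is balanced
  in \<open>p\<close>; the inverse of the associator arises in the same way.\<close>
lemma assoc_map:
 assumes M: "BM M" and N: "BM N" and P: "BM P"
 obtains f where "bimap k A (M \<otimes> N \<otimes> P) (M \<otimes> (N \<otimes> P)) f"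
  "!!m n p. m \<in>: M ==> n \<in>: N ==> p \<in>: P ==>
   f (pt (M \<otimes> N) P (pt M N m n) p) = pt M (N \<otimes> P) m (pt N P n p)"
proof -
 let ?T = "M \<otimes> (N \<otimes> P)"
 note MN = pt_bim[OF M N] and NP = pt_bim[OF N P]
 note T = pt_bim[OF M NP]
 note c = pt_simps[OF M NP] pt_simps[OF N P] bim_simps[OF M] bim_simps[OF N] bim_simps[OF P]
 define g where "g p = the_additive (M \<otimes> N) ?T (%h. \<forall>m\<in>carrier M. \<forall>n\<in>carrier N. h (pt M N m n) = pt M (N \<otimes> P) m (pt N P n p))" for p
 have b: "balanced_map M N \<A> (%m a. m <|\<^sub>M a) (%a n. a |>\<^sub>N n) ?T (%m n. pt M (N \<otimes> P) m (pt N P n p))"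
  if "p \<in>: P" for p
  unfolding balanced_map_def additive_on_def using that by (simp add: c)
 note t = is_tensor_the_additive[OF utensor_facts(2)[OF M N] bimoduleD(2)[OF T] b, folded g_def]
 have ga: "additive_on (M \<otimes> N) ?T (g p)" if "p \<in>: P" for p using t(1)[OF that] by (simp add: additive_maps_iff)
 have ext: "u X = v X" if "additive_on (M \<otimes> N) ?T u" "additive_on (M \<otimes> N) ?T v"
  "!!m n. m \<in>: M ==> n \<in>: N ==> u (pt M N m n) = v (pt M N m n)" "X \<in>: (M \<otimes> N)" for u v X
  using that by (rule pt_ext[OF M N])
 note act = bimodule_additive[OF MN] bimodule_additive[OF T]
 have 1: "g (p \<oplus>\<^sub>P q) X = g p X \<oplus>\<^sub>?T g q X" if "p \<in>: P" "q \<in>: P" "X \<in>: (M \<otimes> N)" for p q X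
 proof -
  interpret P: module k P by (rule bimoduleD(1)[OF P])
  show ?thesis
   by (rule ext[OF ga additive_add[OF bimoduleD(2)[OF T] ga[OF that(1)] ga[OF that(2)]] _ that(3)])
     (use that in "simp_all add: t(2) c")
 qed
 have 2: "g p (X <|\<^bsub>M \<otimes> N\<^esub> a) = g (a |>\<^sub>P p) X" if "a \<in>: A" "p \<in>: P" "X \<in>: (M \<otimes> N)" for a p X
  by (rule ext[OF additive_on_compose[OF act(2)[OF that(1)] ga[OF that(2)]] ga _ that(3)])
    (use that in "simp_all add: t(2) c pt_simps[OF M N]")
 have 3: "g p (a |>\<^bsub>M \<otimes> N\<^esub> X) = a |>\<^sub>?T g p X" if "a \<in>: A" "p \<in>: P" "X \<in>: (M \<otimes> N)" for a p X
  by (rule ext[OF additive_on_compose[OF act(1)[OF that(1)] ga[OF that(2)]] additive_on_compose[OF ga[OF that(2)] act(3)[OF that(1)]] _ that(3)])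
    (use that in "simp_all add: t(2) c pt_simps[OF M N]")
 have 4: "g (p <|\<^sub>P a) X = g p X <|\<^sub>?T a" if "a \<in>: A" "p \<in>: P" "X \<in>: (M \<otimes> N)" for a p X
  by (rule ext[OF ga additive_on_compose[OF ga[OF that(2)] act(4)[OF that(1)]] _ that(3)])
    (use that in "simp_all add: t(2) c")
 note f = tensor_bimap[OF MN P T, of "%X p. g p X", OF additive_onD(1)[OF ga] additive_onD(2)[OF ga] 1 2 3 4]
 show thesis by (rule that[OF f(1)]) (simp_all add: f(3) pt_simps[OF M N] t(2))
qed

lemma assoc_map_inverse:
 assumes M: "BM M" and N: "BM N" and P: "BM P"
 obtains f where "bimap k A (M \<otimes> (N \<otimes> P)) (M \<otimes> N \<otimes> P) f"
  "!!m n p. m \<in>: M ==> n \<in>: N ==> p \<in>: P ==>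
   f (pt M (N \<otimes> P) m (pt N P n p)) = pt (M \<otimes> N) P (pt M N m n) p"
proof -
 let ?T = "M \<otimes> N \<otimes> P"
 note MN = pt_bim[OF M N] and NP = pt_bim[OF N P]
 note T = pt_bim[OF MN P]
 note c = pt_simps[OF MN P] pt_simps[OF M N] bim_simps[OF M] bim_simps[OF N] bim_simps[OF P]
 define g where "g m = the_additive (N \<otimes> P) ?T (%h. \<forall>n\<in>carrier N. \<forall>p\<in>carrier P. h (pt N P n p) = pt (M \<otimes> N) P (pt M N m n) p)" for m
 have b: "balanced_map N P \<A> (%m a. m <|\<^sub>N a) (%a n. a |>\<^sub>P n) ?T (%n p. pt (M \<otimes> N) P (pt M N m n) p)"
  if "m \<in>: M" for m
  unfolding balanced_map_def additive_on_def using that by (simp add: c pt_simps(4)[OF MN P, symmetric])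
 note t = is_tensor_the_additive[OF utensor_facts(2)[OF N P] bimoduleD(2)[OF T] b, folded g_def]
 have ga: "additive_on (N \<otimes> P) ?T (g m)" if "m \<in>: M" for m using t(1)[OF that] by (simp add: additive_maps_iff)
 have ext: "u X = v X" if "additive_on (N \<otimes> P) ?T u" "additive_on (N \<otimes> P) ?T v"
  "!!m n. m \<in>: N ==> n \<in>: P ==> u (pt N P m n) = v (pt N P m n)" "X \<in>: (N \<otimes> P)" for u v X
  using that by (rule pt_ext[OF N P])
 note act = bimodule_additive[OF NP] bimodule_additive[OF T]
 have 1: "g (p \<oplus>\<^sub>M q) X = g p X \<oplus>\<^sub>?T g q X" if "p \<in>: M" "q \<in>: M" "X \<in>: (N \<otimes> P)" for p q X
 proof -
  interpret M: module k M by (rule bimoduleD(1)[OF M])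
  show ?thesis
   by (rule ext[OF ga additive_add[OF bimoduleD(2)[OF T] ga[OF that(1)] ga[OF that(2)]] _ that(3)])
     (use that in "simp_all add: t(2) c")
 qed
 have 2: "g (m <|\<^sub>M a) X = g m (a |>\<^bsub>N \<otimes> P\<^esub> X)" if "a \<in>: A" "m \<in>: M" "X \<in>: (N \<otimes> P)" for a m X
  by (rule ext[OF ga additive_on_compose[OF act(1)[OF that(1)] ga[OF that(2)]] _ that(3)])
    (use that in "simp_all add: t(2) c pt_simps[OF N P]")
 have 3: "g (a |>\<^sub>M m) X = a |>\<^sub>?T g m X" if "a \<in>: A" "m \<in>: M" "X \<in>: (N \<otimes> P)" for a m X
  by (rule ext[OF ga additive_on_compose[OF ga[OF that(2)] act(3)[OF that(1)]] _ that(3)])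
    (use that in "simp_all add: t(2) c")
 have 4: "g m (X <|\<^bsub>N \<otimes> P\<^esub> a) = g m X <|\<^sub>?T a" if "a \<in>: A" "m \<in>: M" "X \<in>: (N \<otimes> P)" for a m X
  by (rule ext[OF additive_on_compose[OF act(2)[OF that(1)] ga[OF that(2)]] additive_on_compose[OF ga[OF that(2)] act(4)[OF that(1)]] _ that(3)])
    (use that in "simp_all add: t(2) c pt_simps[OF N P]")
 note f = tensor_bimap[OF M NP T, of g, OF additive_onD(1)[OF ga] 1 additive_onD(2)[OF ga] 2 3 4]
 show thesis by (rule that[OF f(1)]) (simp_all add: f(3) pt_simps[OF N P] t(2))
qed

lemma uassoc_facts:
 assumes M: "BM M" and N: "BM N" and P: "BM P"
 shows "uassoc A M N P \<in> Hom \<B> (M \<otimes> N \<otimes> P) (M \<otimes> (N \<otimes> P))"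
  and "!!m n p. m \<in>: M ==> n \<in>: N ==> p \<in>: P ==>
   fn (uassoc A M N P) (pt (M \<otimes> N) P (pt M N m n) p) = pt M (N \<otimes> P) m (pt N P n p)" (is "PROP ?p1")
  and "inv_arrow \<B> (M \<otimes> N \<otimes> P) (M \<otimes> (N \<otimes> P)) (uassoc A M N P) \<in> Hom \<B> (M \<otimes> (N \<otimes> P)) (M \<otimes> N \<otimes> P)"
  and "!!m n p. m \<in>: M ==> n \<in>: N ==> p \<in>: P ==>
   fn (inv_arrow \<B> (M \<otimes> N \<otimes> P) (M \<otimes> (N \<otimes> P)) (uassoc A M N P)) (pt M (N \<otimes> P) m (pt N P n p)) =
   pt (M \<otimes> N) P (pt M N m n) p"
proof -
 let ?S = "M \<otimes> N \<otimes> P" and ?T = "M \<otimes> (N \<otimes> P)"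
 note S = pt_bim[OF pt_bim[OF M N] P] and T = pt_bim[OF M pt_bim[OF N P]]
 note c = pt_simps(1)[OF pt_bim[OF M N] P] pt_simps(1)[OF M N] pt_simps(1)[OF M pt_bim[OF N P]] pt_simps(1)[OF N P]
 obtain f where f: "bimap k A ?S ?T f" "!!m n p. m \<in>: M ==> n \<in>: N ==> p \<in>: P ==>
   f (pt (M \<otimes> N) P (pt M N m n) p) = pt M (N \<otimes> P) m (pt N P n p)" using assoc_map[OF assms] by blast
 obtain g where g: "bimap k A ?T ?S g" "!!m n p. m \<in>: M ==> n \<in>: N ==> p \<in>: P ==>
   g (pt M (N \<otimes> P) m (pt N P n p)) = pt (M \<otimes> N) P (pt M N m n) p" using assoc_map_inverse[OF assms] by blast
 have fH: "mk_arrow ?S ?T f \<in> Hom \<B> ?S ?T" by (rule mk_arrow_Hom[OF S f(1)])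
 have gH: "mk_arrow ?T ?S g \<in> Hom \<B> ?T ?S" by (rule mk_arrow_Hom[OF T g(1)])
 have fr: "additive_on ?S ?T (restrict f (carrier ?S))" using fH by (auto simp: Hom_Bimod dest: bimapD(2))
 have "the_additive ?S ?T (%h. \<forall>m\<in>carrier M. \<forall>n\<in>carrier N. \<forall>p\<in>carrier P.
   h (pt (M \<otimes> N) P (pt M N m n) p) = pt M (N \<otimes> P) m (pt N P n p)) = restrict f (carrier ?S)"
 proof (rule the_additive_eq)
  show "restrict f (carrier ?S) \<in> additive_maps ?S ?T" using fr by (simp add: additive_maps_iff)
  show "\<forall>m\<in>carrier M. \<forall>n\<in>carrier N. \<forall>p\<in>carrier P.
   restrict f (carrier ?S) (pt (M \<otimes> N) P (pt M N m n) p) = pt M (N \<otimes> P) m (pt N P n p)" by (simp add: f(2) c)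
  fix h assume h: "h \<in> additive_maps ?S ?T" "\<forall>m\<in>carrier M. \<forall>n\<in>carrier N. \<forall>p\<in>carrier P.
   h (pt (M \<otimes> N) P (pt M N m n) p) = pt M (N \<otimes> P) m (pt N P n p)"
  then have "h X = restrict f (carrier ?S) X" if "X \<in>: ?S" for X
   by (intro pt3_ext[OF M N P _ fr _ that]) (auto simp: additive_maps_iff f(2) c)
  then show "h = restrict f (carrier ?S)" using h(1) by (intro extensionalityI[of _ "carrier ?S"]) (auto simp: additive_maps_iff)
 qed
 then have e: "uassoc A M N P = mk_arrow ?S ?T f" by (simp add: uassoc_def Let_def mk_arrow_def)
 show "uassoc A M N P \<in> Hom \<B> ?S ?T" unfolding e by (rule fH)
 show "PROP ?p1" by (simp add: e f(2) c)
 have id_add: "additive_on Q Q (%X. X)" for Q :: "('k, 'a, 'u) bimodule" by (simp add: additive_on_def)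
 have gf: "g (f X) = X" if "X \<in>: ?S" for X
  by (rule pt3_ext[OF M N P additive_on_compose[OF bimapD(2)[OF f(1)] bimapD(2)[OF g(1)]] id_add _ that]) (simp add: f(2) g(2))
 have fg: "f (g X) = X" if "X \<in>: ?T" for X
  by (rule pt3_ext'[OF M N P additive_on_compose[OF bimapD(2)[OF g(1)] bimapD(2)[OF f(1)]] id_add _ that]) (simp add: f(2) g(2))
 have inv: "inverse_arrows \<B> ?S ?T (mk_arrow ?S ?T f) (mk_arrow ?T ?S g)"
  by (rule inverse_arrows_Bimod[OF S T fH gH]) (simp_all add: gf fg bimapD(3)[OF f(1)] bimapD(3)[OF g(1)])
 have uniq: "h = mk_arrow ?T ?S g" if h: "inverse_arrows \<B> ?S ?T (mk_arrow ?S ?T f) h" for h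
 proof (rule Hom_eqI[OF _ gH])
  show hH: "h \<in> Hom \<B> ?T ?S" using h by (simp add: inverse_arrows_def)
  fix X assume X: "X \<in>: ?T"
  have gX: "g X \<in>: ?S" by (rule bimapD(3)[OF g(1) X])
  have "fn (cmpa h (mk_arrow ?S ?T f)) (g X) = g X" using h gX by (simp add: inverse_arrows_def)
  then show "fn h X = fn (mk_arrow ?T ?S g) X" using gX X by (simp add: compose_def fg)
 qed
 have i: "inv_arrow \<B> ?S ?T (uassoc A M N P) = mk_arrow ?T ?S g"
  unfolding inv_arrow_def e by (rule the_equality) (rule inv, rule uniq)
 show "inv_arrow \<B> ?S ?T (uassoc A M N P) \<in> Hom \<B> ?T ?S" unfolding i by (rule gH)
 show "!!m n p. m \<in>: M ==> n \<in>: N ==> p \<in>: P ==>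
   fn (inv_arrow \<B> ?S ?T (uassoc A M N P)) (pt M (N \<otimes> P) m (pt N P n p)) = pt (M \<otimes> N) P (pt M N m n) p"
  by (simp add: i g(2) c)
qed

end

section \<open>Braidings\<close>

context kalg
begin

text \<open>
  If \<open>R a = b R\<close> then \<open>a R\<^sup>-\<^sup>1 = R\<^sup>-\<^sup>1 b\<close>. Multiplication by \<open>a\<close> on the right and on the left is
  given factorwise by \<open>a\<^sub>i\<close> and \<open>a\<^sub>i'\<close>, and similarly for \<open>b\<close>.
\<close>
lemma inverse_move:
 assumes L: "triples L" "triples L'" "prod_one L L'" "prod_one L' L" and G: "module k G" and \<psi>: "trilin k A G \<psi>"
  and a: "\<forall>(f, f')\<in>{(a1, a1'), (a2, a2'), (a3, a3'), (b1, b1'), (b2, b2'), (b3, b3')}.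
   klin k A A f & klin k A A f' & (\<forall>x\<in>\<A>. \<forall>y\<in>\<A>. x * f' y = f x * y)"
  and m: "!!\<phi>. trilin k A G \<phi> ==> tsum G L (%x y z. \<phi> (a1 x) (a2 y) (a3 z)) = tsum G L (%x y z. \<phi> (b1' x) (b2' y) (b3' z))"
 shows "tsum G L' (%p q r. \<psi> (a1' p) (a2' q) (a3' r)) = tsum G L' (%p q r. \<psi> (b1 p) (b2 q) (b3 r))"
proof -
 let ?S = "tsum G L" and ?S' = "tsum G L'"
 have ag: "abelian_group G" using G unfolding module_def by blast
 have k: "klin k A A f" if "f \<in> {a1, a2, a3, a1', a2', a3', b1, b2, b3, b1', b2', b3'}" for f using a that by auto
 have e: "x * a1' y = a1 x * y" "x * a2' y = a2 x * y" "x * a3' y = a3 x * y"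
  "x * b1' y = b1 x * y" "x * b2' y = b2 x * y" "x * b3' y = b3 x * y"
  if "x \<in>: A" "y \<in>: A" for x y using a that by auto
 note [simp] = klinD(1-3)[OF k] trilinD[OF \<psi>] mult_simps
 note c = tsum_cong[OF L(1)] and c' = tsum_cong[OF L(2)]
 have "?S' (%p q r. \<psi> (a1' p) (a2' q) (a3' r)) =
  ?S' (%p q r. ?S' (%s t o'. ?S (%x y z. \<psi> (s * x * a1' p) (t * y * a2' q) (o' * z * a3' r))))"
 proof (rule c')
  fix p q r assume [simp]: "p \<in>: A" "q \<in>: A" "r \<in>: A"
  have "trilin k A G (%u v w. \<psi> (u * a1' p) (v * a2' q) (w * a3' r))" by (rule trilinI) simp_all
  from prod_one_app[OF L(2,1,4) G this] show "\<psi> (a1' p) (a2' q) (a3' r) =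
   ?S' (%s t o'. ?S (%x y z. \<psi> (s * x * a1' p) (t * y * a2' q) (o' * z * a3' r)))" by simp
 qed
 also have "... = ?S' (%p q r. ?S' (%s t o'. ?S (%x y z. \<psi> (s * (a1 x * p)) (t * (a2 y * q)) (o' * (a3 z * r)))))"
  by (intro c c') (simp add: A.m_assoc e(1-3)[symmetric])
 also have "... = ?S' (%p q r. ?S' (%s t o'. ?S (%x y z. \<psi> (s * (b1' x * p)) (t * (b2' y * q)) (o' * (b3' z * r)))))"
  by (intro c', rule m) (rule trilinI, simp_all)
 also have "... = ?S' (%p q r. ?S' (%s t o'. ?S (%x y z. \<psi> (b1 s * (x * p)) (b2 t * (y * q)) (b3 o' * (z * r)))))"
  by (intro c c') (simp add: A.m_assoc[symmetric] e(4-6))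
 also have "... = ?S' (%s t o'. ?S' (%p q r. ?S (%x y z. \<psi> (b1 s * (x * p)) (b2 t * (y * q)) (b3 o' * (z * r)))))"
  by (rule tsum_swap[OF ag L(2,2)]) (intro tsum_closed[OF ag L(1)], simp)
 also have "... = ?S' (%s t o'. ?S (%x y z. ?S' (%p q r. \<psi> (b1 s * (x * p)) (b2 t * (y * q)) (b3 o' * (z * r)))))"
  by (rule c', rule tsum_swap[OF ag L(2,1)]) simp
 also have "... = ?S' (%s t o'. \<psi> (b1 s * \<one>) (b2 t * \<one>) (b3 o' * \<one>))"
  by (rule c', rule prod_one_app[OF L(1,2,3) G]) (rule trilinI, simp_all)
 also have "... = ?S' (%p q r. \<psi> (b1 p) (b2 q) (b3 r))" by (rule c') simp
 finally show ?thesis .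
qed

text \<open>Moving the relations \<open>R a = b R\<close> across gives relations for the inverse, which are those of \<open>R\<close> after the
  exchange of the last two factors.\<close>
lemma cyc_inverse:
 assumes L: "cyc L" "triples L'" "prod_one L L'" "prod_one L' L"
 shows "cyc (swap23 L')"
 unfolding cyc_def tsum_swap23
proof (intro conjI ballI)
 have tL: "triples L" using L(1) by (simp add: cyc_def)
 show "triples (swap23 L')" by (rule swap23_triples[OF L(2)])
 fix a assume a: "a \<in>: A"
 let ?S = "tsum A3 L'" and ?i = "%x. x" and ?r = "%x. x * a" and ?l = "%x. a * x"
 have "trilin k A A3 (%x y z. t3 x z y)" by (rule trilinI) (simp_all add: t3_simps)
 note mv = inverse_move[OF tL L(2-4) mod3 this]
 have k: "klin k A A ?i" "klin k A A ?r" "klin k A A ?l" using a by (auto intro!: klinI simp: mult_simps)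
 show "?S (%x y z. t3 x z (a * y)) = ?S (%x y z. t3 (x * a) z y)"
  by (rule mv[of ?i ?i ?r ?l ?i ?i ?r ?l ?i ?i ?i ?i])
    (use cyc_app(2)[OF L(1) a mod3] k a in "simp_all add: A.m_assoc")
 show "?S (%x y z. t3 (a * x) z y) = ?S (%x y z. t3 x (z * a) y)"
  by (rule mv[of ?r ?l ?i ?i ?i ?i ?i ?i ?i ?i ?r ?l])
    (use cyc_app(1)[OF L(1) a mod3] k a in "simp_all add: A.m_assoc")
 show "?S (%x y z. t3 x (a * z) y) = ?S (%x y z. t3 x z (y * a))"
  by (rule mv[of ?i ?i ?i ?i ?r ?l ?i ?i ?r ?l ?i ?i])
    (use cyc_app(3)[OF L(1) a mod3] k a in "simp_all add: A.m_assoc")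
qed

lemma hexagon1_alt:
 assumes c: "cyc L"
 shows "hexagon1 L \<longleftrightarrow> tsum A4 L (%x y z. t4 x y \<one> z) =
   tsum A4 L (%x y z. tsum A4 L (%p q r. t4 (p * x) (y * q) r z))"
proof -
 from c have L: "triples L" by (simp add: cyc_def)
 have "tsum A4 L (%x y z. tsum A4 L (%u v w. t4 (u * x) v (w * y) z)) =
  tsum A4 L (%x y z. tsum A4 L (%p q r. t4 (p * x) (y * q) r z))"
 proof (rule tsum_cong[OF L])
  fix x y z assume [simp]: "x \<in>: A" "y \<in>: A" "z \<in>: A"
  have "trilin k A A4 (%u v w. t4 (u * x) v w z)" by (intro trilinI) (simp_all add: multilinear_simps)
  from cyc_app(3)[OF c _ mod4 this, of y]
  show "tsum A4 L (%u v w. t4 (u * x) v (w * y) z) = tsum A4 L (%p q r. t4 (p * x) (y * q) r z)" by simp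
 qed
 then show ?thesis unfolding hexagon1_def by simp
qed

end

context kalg_univ
begin

text \<open>The family of maps \<open>m \<otimes> n \<mapsto> R\<^sup>1 n R\<^sup>2 \<otimes> m R\<^sup>3\<close>.\<close>
definition braid_by :: "('a \<times> 'a \<times> 'a) list =>
  (('k, 'a, 'u) bimodule => ('k, 'a, 'u) bimodule => ('k, 'a, 'u) bimod_arrow) => bool" where
 "braid_by L c \<longleftrightarrow> triples L & (\<forall>M N. BM M --> BM N --> c M N \<in> Hom \<B> (M \<otimes> N) (N \<otimes> M) &
   (\<forall>m\<in>carrier M. \<forall>n\<in>carrier N. fn (c M N) (pt M N m n) =
    tsum (N \<otimes> M) L (%x y z. pt N M (x |>\<^sub>N (n <|\<^sub>N y)) (m <|\<^sub>M z))))"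

lemma braid_byD:
 assumes "braid_by L c"
 shows "triples L" "BM M ==> BM N ==> c M N \<in> Hom \<B> (M \<otimes> N) (N \<otimes> M)"
  and "BM M ==> BM N ==> m \<in>: M ==> n \<in>: N ==> fn (c M N) (pt M N m n) =
    tsum (N \<otimes> M) L (%x y z. pt N M (x |>\<^sub>N (n <|\<^sub>N y)) (m <|\<^sub>M z))"
 using assms unfolding braid_by_def by blast+

lemma Hom_bimap: "f \<in> Hom \<B> M N ==> bimap k A M N (fn f)" "f \<in> Hom \<B> M N ==> src f = M"
 by (simp_all add: Hom_Bimod)

lemma trilin_pt:
 fixes M N :: "('k, 'a, 'u) bimodule"
 assumes M: "BM M" and N: "BM N" and m: "m \<in>: M" and n: "n \<in>: N"
 shows "trilin k A (N \<otimes> M) (%x y z. pt N M (x |>\<^sub>N (n <|\<^sub>N y)) (m <|\<^sub>M z))"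
 using m n
 by (intro trilinI) (simp_all add: pt_simps[OF N M] bim_simps(1-10)[OF N] bim_simps(1-10)[OF M])

text \<open>Conjugation by \<open>R\<close> permuting the three factors cyclically makes the map balanced, left linear
  and right linear, in this order.\<close>
lemma list_braiding:
 assumes L: "cyc L"
 obtains c where "braid_by L c"
proof -
 have tL: "triples L" using L by (simp add: cyc_def)
 have "\<exists>f. bimap k A (M \<otimes> N) (N \<otimes> M) f & (\<forall>m\<in>carrier M. \<forall>n\<in>carrier N. f (pt M N m n) =
    tsum (N \<otimes> M) L (%x y z. pt N M (x |>\<^sub>N (n <|\<^sub>N y)) (m <|\<^sub>M z)))"
  if M: "BM M" and N: "BM N" for M N :: "('k, 'a, 'u) bimodule"
 proof -
  let ?S = "tsum (N \<otimes> M) L"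
  let ?\<phi> = "%m n. ?S (%x y z. pt N M (x |>\<^sub>N (n <|\<^sub>N y)) (m <|\<^sub>M z))"
  note T = pt_bim[OF N M]
  note ag = bimoduleD(2)[OF T] and md = bimoduleD(1)[OF T]
  note p = pt_simps[OF N M] and s = bim_simps(1-6)[OF N] bim_simps(1-6)[OF M]
  note a = bimodule_assoc[OF N] bimodule_assoc[OF M]
  note tr = trilin_pt[OF M N]
  interpret M: module k M by (rule bimoduleD(1)[OF M])
  interpret N: module k N by (rule bimoduleD(1)[OF N])
  show ?thesis
  proof (intro exI conjI ballI)
   have 1: "?\<phi> m n \<in>: (N \<otimes> M)" if "m \<in>: M" "n \<in>: N" for m n
    by (rule tsum_closed[OF ag tL]) (use that in "simp add: p s")
   have 2: "?\<phi> (m \<oplus>\<^sub>M m') n = ?\<phi> m n \<oplus>\<^bsub>N \<otimes> M\<^esub> ?\<phi> m' n" if "m \<in>: M" "m' \<in>: M" "n \<in>: N" for m m' n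
    by (subst tsum_add[OF ag tL, symmetric]) (use that in "auto simp: p s intro!: tsum_cong[OF tL]")
   have 3: "?\<phi> m (n \<oplus>\<^sub>N n') = ?\<phi> m n \<oplus>\<^bsub>N \<otimes> M\<^esub> ?\<phi> m n'" if "m \<in>: M" "n \<in>: N" "n' \<in>: N" for m n n'
    by (subst tsum_add[OF ag tL, symmetric]) (use that in "auto simp: p s intro!: tsum_cong[OF tL]")
   have 4: "?\<phi> (m <|\<^sub>M b) n = ?\<phi> m (b |>\<^sub>N n)" if b: "b \<in>: A" and m: "m \<in>: M" and n: "n \<in>: N" for b m n
   proof -
    have "?\<phi> (m <|\<^sub>M b) n = ?S (%x y z. pt N M (x |>\<^sub>N (n <|\<^sub>N y)) (m <|\<^sub>M (b * z)))"
     by (rule tsum_cong[OF tL]) (use b m n in "simp add: s a")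
    also have "... = ?S (%x y z. pt N M ((x * b) |>\<^sub>N (n <|\<^sub>N y)) (m <|\<^sub>M z))"
     by (rule cyc_app(1)[OF L b md tr[OF m n]])
    also have "... = ?\<phi> m (b |>\<^sub>N n)"
     by (rule tsum_cong[OF tL]) (use b m n in "simp add: s a")
    finally show ?thesis .
   qed
   have 5: "?\<phi> (b |>\<^sub>M m) n = b |>\<^bsub>N \<otimes> M\<^esub> ?\<phi> m n" if b: "b \<in>: A" and m: "m \<in>: M" and n: "n \<in>: N" for b m n
   proof -
    have "?\<phi> (b |>\<^sub>M m) n = ?S (%x y z. pt N M (x |>\<^sub>N (n <|\<^sub>N (y * b))) (m <|\<^sub>M z))"
     by (rule tsum_cong[OF tL]) (use b m n in "simp add: s a p(4)[symmetric]")
    also have "... = ?S (%x y z. pt N M ((b * x) |>\<^sub>N (n <|\<^sub>N y)) (m <|\<^sub>M z))"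
     by (rule cyc_app(2)[OF L b md tr[OF m n], symmetric])
    also have "... = ?S (%x y z. b |>\<^bsub>N \<otimes> M\<^esub> pt N M (x |>\<^sub>N (n <|\<^sub>N y)) (m <|\<^sub>M z))"
     by (rule tsum_cong[OF tL]) (use b m n in "simp add: s a p")
    also have "... = b |>\<^bsub>N \<otimes> M\<^esub> ?\<phi> m n"
     by (rule tsum_additive[OF ag ag bimodule_additive(1)[OF T b] tL, symmetric]) (use m n in "simp add: s p")
    finally show ?thesis .
   qed
   have 6: "?\<phi> m (n <|\<^sub>N b) = ?\<phi> m n <|\<^bsub>N \<otimes> M\<^esub> b" if b: "b \<in>: A" and m: "m \<in>: M" and n: "n \<in>: N" for b m n
   proof -
    have "?\<phi> m (n <|\<^sub>N b) = ?S (%x y z. pt N M (x |>\<^sub>N (n <|\<^sub>N (b * y))) (m <|\<^sub>M z))"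
     by (rule tsum_cong[OF tL]) (use b m n in "simp add: s a")
    also have "... = ?S (%x y z. pt N M (x |>\<^sub>N (n <|\<^sub>N y)) (m <|\<^sub>M (z * b)))"
     by (rule cyc_app(3)[OF L b md tr[OF m n]])
    also have "... = ?S (%x y z. pt N M (x |>\<^sub>N (n <|\<^sub>N y)) (m <|\<^sub>M z) <|\<^bsub>N \<otimes> M\<^esub> b)"
     by (rule tsum_cong[OF tL]) (use b m n in "simp add: s a p")
    also have "... = ?\<phi> m n <|\<^bsub>N \<otimes> M\<^esub> b"
     by (rule tsum_additive[OF ag ag bimodule_additive(2)[OF T b] tL, symmetric]) (use m n in "simp add: s p")
    finally show ?thesis .
   qed
   note t = tensor_bimap[OF M N T, of ?\<phi>, OF 1 2 3 4 5 6]
   show "bimap k A (M \<otimes> N) (N \<otimes> M) (the_additive (M \<otimes> N) (N \<otimes> M) (%h. \<forall>m\<in>carrier M. \<forall>n\<in>carrier N. h (pt M N m n) = ?\<phi> m n))"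
    by (rule t(1))
   show "the_additive (M \<otimes> N) (N \<otimes> M) (%h. \<forall>m\<in>carrier M. \<forall>n\<in>carrier N. h (pt M N m n) = ?\<phi> m n) (pt M N m n) = ?\<phi> m n"
    if "m \<in>: M" "n \<in>: N" for m n by (rule t(3)) (assumption | rule that)+
  qed
 qed
 then have ex: "\<exists>c. c \<in> Hom \<B> (M \<otimes> N) (N \<otimes> M) & (\<forall>m\<in>carrier M. \<forall>n\<in>carrier N. fn c (pt M N m n) =
    tsum (N \<otimes> M) L (%x y z. pt N M (x |>\<^sub>N (n <|\<^sub>N y)) (m <|\<^sub>M z)))" (is "\<exists>c. ?Q c M N")
  if M: "BM M" and N: "BM N" for M N :: "('k, 'a, 'u) bimodule"
 proof -
  assume *: "!!M N :: ('k, 'a, 'u) bimodule. BM M ==> BM N ==> \<exists>f. bimap k A (M \<otimes> N) (N \<otimes> M) f & (\<forall>m\<in>carrier M. \<forall>n\<in>carrier N. f (pt M N m n) =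
    tsum (N \<otimes> M) L (%x y z. pt N M (x |>\<^sub>N (n <|\<^sub>N y)) (m <|\<^sub>M z)))"
  obtain f where f: "bimap k A (M \<otimes> N) (N \<otimes> M) f" "\<forall>m\<in>carrier M. \<forall>n\<in>carrier N. f (pt M N m n) =
    tsum (N \<otimes> M) L (%x y z. pt N M (x |>\<^sub>N (n <|\<^sub>N y)) (m <|\<^sub>M z))" using *[OF M N] by (elim exE conjE)
  show ?thesis
   by (rule exI[of _ "mk_arrow (M \<otimes> N) (N \<otimes> M) f"])
     (use f(2) mk_arrow_Hom[OF pt_bim[OF M N] f(1)] pt_simps(1)[OF M N] in simp)
 qed
 define c where "c M N = (SOME c. ?Q c M N)" for M N :: "('k, 'a, 'u) bimodule"
 have "?Q (c M N) M N" if "BM M" "BM N" for M N unfolding c_def by (rule someI_ex[OF ex[OF that]])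
 then have "braid_by L c" unfolding braid_by_def using tL by simp
 then show thesis by (rule that)
qed

lemma braid_by_natural:
 assumes c: "braid_by L c" and U: "BM U" "BM U'" and V: "BM V" "BM V'" and f: "f \<in> Hom \<B> U U'" and g: "g \<in> Hom \<B> V V'"
 shows "cmpa (c U' V') (tens_ar f g) = cmpa (tens_ar g f) (c U V)"
proof (rule Hom_eqI)
 note cD = braid_byD[OF c]
 note T = pt_bim[OF U(1) V(1)] and T' = pt_bim[OF V(2) U(2)]
 note fg = utensor_arrow_facts[OF U V f g] and gf = utensor_arrow_facts[OF V U g f]
 note cH = cD(2)[OF U(1) V(1)] and cH' = cD(2)[OF U(2) V(2)]
 show l: "cmpa (c U' V') (tens_ar f g) \<in> Hom \<B> (U \<otimes> V) (V' \<otimes> U')" by (rule comp_Hom[OF T fg(1) cH'])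
 show r: "cmpa (tens_ar g f) (c U V) \<in> Hom \<B> (U \<otimes> V) (V' \<otimes> U')" by (rule comp_Hom[OF T cH gf(1)])
 note bf = bimapD[OF Hom_bimap(1)[OF f]] and bg = bimapD[OF Hom_bimap(1)[OF g]]
 fix X assume X: "X \<in>: (U \<otimes> V)"
 show "fn (cmpa (c U' V') (tens_ar f g)) X = fn (cmpa (tens_ar g f) (c U V)) X"
 proof (rule pt_ext[OF U(1) V(1) bimapD(2)[OF Hom_bimap(1)[OF l]] bimapD(2)[OF Hom_bimap(1)[OF r]] _ X])
  fix u v assume u: "u \<in>: U" and v: "v \<in>: V"
  note p = pt_simps(1)[OF U(1) V(1) u v]
  have "fn (cmpa (c U' V') (tens_ar f g)) (pt U V u v) =
   tsum (V' \<otimes> U') L (%x y z. pt V' U' (x |>\<^bsub>V'\<^esub> (fn g v <|\<^bsub>V'\<^esub> y)) (fn f u <|\<^bsub>U'\<^esub> z))"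
   using p by (subst comp_fn) (simp_all add: Hom_bimap(2)[OF fg(1)] fg(2) u v cD(3)[OF U(2) V(2)] bf(3) bg(3))
  also have "... = tsum (V' \<otimes> U') L (%x y z. fn (tens_ar g f) (pt V U (x |>\<^sub>V (v <|\<^sub>V y)) (u <|\<^sub>U z)))"
   by (rule tsum_cong[OF cD(1)]) (simp add: gf(2) bim_simps(1,2)[OF U(1)] bim_simps(1,2)[OF V(1)] u v bf(3,6,7) bg(3,6,7))
  also have "... = fn (tens_ar g f) (tsum (V \<otimes> U) L (%x y z. pt V U (x |>\<^sub>V (v <|\<^sub>V y)) (u <|\<^sub>U z)))"
   by (rule tsum_additive[OF bimoduleD(2)[OF pt_bim[OF V(1) U(1)]] bimoduleD(2)[OF T'] bimapD(2)[OF Hom_bimap(1)[OF gf(1)]] cD(1), symmetric])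
     (simp add: pt_simps(1)[OF V(1) U(1)] bim_simps(1,2)[OF U(1)] bim_simps(1,2)[OF V(1)] u v)
  also have "... = fn (cmpa (tens_ar g f) (c U V)) (pt U V u v)"
   using p by (subst comp_fn) (simp_all add: Hom_bimap(2)[OF cH] cD(3)[OF U(1) V(1)] u v)
  finally show "fn (cmpa (c U' V') (tens_ar f g)) (pt U V u v) = fn (cmpa (tens_ar g f) (c U V)) (pt U V u v)" .
 qed
qed

lemma braid_by_compose:
 assumes c: "braid_by L c" and d: "braid_by S d" and U: "BM U" and V: "BM V" and u: "u \<in>: U" and v: "v \<in>: V"
 shows "fn (d V U) (fn (c U V) (pt U V u v)) = tsum (U \<otimes> V) L (%x y z. tsum (U \<otimes> V) S (%p q r.
  pt U V (p |>\<^sub>U (u <|\<^sub>U (z * q))) (x |>\<^sub>V (v <|\<^sub>V (y * r)))))"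
proof -
 note cD = braid_byD[OF c] and dD = braid_byD[OF d]
 note s = bim_simps(1,2)[OF U] bim_simps(1,2)[OF V] u v
 have "fn (d V U) (fn (c U V) (pt U V u v)) = tsum (U \<otimes> V) L (%x y z. fn (d V U) (pt V U (x |>\<^sub>V (v <|\<^sub>V y)) (u <|\<^sub>U z)))"
  unfolding cD(3)[OF U V u v]
  by (rule tsum_additive[OF bimoduleD(2)[OF pt_bim[OF V U]] bimoduleD(2)[OF pt_bim[OF U V]] bimapD(2)[OF Hom_bimap(1)[OF dD(2)[OF V U]]] cD(1)])
    (simp add: pt_simps(1)[OF V U] s)
 also have "... = tsum (U \<otimes> V) L (%x y z. tsum (U \<otimes> V) S (%p q r.
   pt U V (p |>\<^sub>U ((u <|\<^sub>U z) <|\<^sub>U q)) ((x |>\<^sub>V (v <|\<^sub>V y)) <|\<^sub>V r)))"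
  by (rule tsum_cong[OF cD(1)], rule dD(3)[OF V U]) (simp_all add: s)
 also have "... = tsum (U \<otimes> V) L (%x y z. tsum (U \<otimes> V) S (%p q r.
  pt U V (p |>\<^sub>U (u <|\<^sub>U (z * q))) (x |>\<^sub>V (v <|\<^sub>V (y * r)))))"
  by (intro tsum_cong[OF cD(1)] tsum_cong[OF dD(1)]) (simp add: s bimodule_assoc[OF U] bimodule_assoc[OF V])
 finally show ?thesis .
qed

lemma braid_by_inverse:
 assumes c: "braid_by L c" and d: "braid_by S d" and S: "cyc S" and p: "prod_one (swap23 L) S"
  and U: "BM U" and V: "BM V" and X: "X \<in>: (U \<otimes> V)"
 shows "fn (d V U) (fn (c U V) X) = X"
proof -
 note cD = braid_byD[OF c] and dD = braid_byD[OF d]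
 note T = pt_bim[OF U V]
 note md = bimoduleD(1)[OF T]
 note s = bim_simps(1-10)[OF U] bim_simps(1-10)[OF V] and ps = pt_simps[OF U V]
 have l: "additive_on (U \<otimes> V) (U \<otimes> V) (%X. fn (d V U) (fn (c U V) X))"
  by (rule additive_on_compose[OF bimapD(2)[OF Hom_bimap(1)[OF cD(2)[OF U V]]] bimapD(2)[OF Hom_bimap(1)[OF dD(2)[OF V U]]]])
 have r: "additive_on (U \<otimes> V) (U \<otimes> V) (%X. X)" by (simp add: additive_on_def)
 show ?thesis
 proof (rule pt_ext[OF U V l r _ X])
  fix u v assume u: "u \<in>: U" and v: "v \<in>: V"
  let ?\<psi> = "%a b e. pt U V (a |>\<^sub>U (u <|\<^sub>U b)) (v <|\<^sub>V e)"
  have tr: "trilin k A (U \<otimes> V) ?\<psi>" by (rule trilin_pt[OF V U v u])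
  note trD = trilinD[OF tr]
  have "fn (d V U) (fn (c U V) (pt U V u v)) = tsum (U \<otimes> V) L (%x y z. tsum (U \<otimes> V) S (%p q r.
   pt U V (p |>\<^sub>U (u <|\<^sub>U (z * q))) (x |>\<^sub>V (v <|\<^sub>V (y * r)))))" by (rule braid_by_compose[OF c d U V u v])
  also have "... = tsum (U \<otimes> V) L (%x y z. tsum (U \<otimes> V) S (%p q r. ?\<psi> p (z * (q * x)) (y * r)))"
   by (intro tsum_cong[OF cD(1)] tsum_cong[OF dD(1)])
     (simp add: s u v ps(4)[symmetric] bimodule_assoc[OF U] bimodule_assoc[OF V] A.m_assoc)
  also have "... = tsum (U \<otimes> V) L (%x y z. tsum (U \<otimes> V) S (%p q r. ?\<psi> (x * p) (z * q) (y * r)))"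
  proof (rule tsum_cong[OF cD(1)])
   fix x y z assume c: "x \<in>: A" "y \<in>: A" "z \<in>: A"
   have "trilin k A (U \<otimes> V) (%p q r. ?\<psi> p (z * q) (y * r))" using c by (intro trilinI) (simp_all add: trD mult_simps)
   from cyc_app(2)[OF S c(1) md this, symmetric]
   show "tsum (U \<otimes> V) S (%p q r. ?\<psi> p (z * (q * x)) (y * r)) =
    tsum (U \<otimes> V) S (%p q r. ?\<psi> (x * p) (z * q) (y * r))" .
  qed
  also have "... = tsum (U \<otimes> V) (swap23 L) (%x y z. tsum (U \<otimes> V) S (%p q r. ?\<psi> (x * p) (y * q) (z * r)))"
   unfolding tsum_swap23 ..
  also have "... = ?\<psi> \<one> \<one> \<one>"
   by (rule prod_one_app[OF swap23_triples[OF cD(1)] dD(1) p md tr])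
  also have "... = pt U V u v" using u v bim_simps(11,12)[OF U] bim_simps(12)[OF V] by simp
  finally show "fn (d V U) (fn (c U V) (pt U V u v)) = pt U V u v" .
 qed
qed

subsection \<open>The hexagons on pure tensors\<close>

lemma hexagon_arrows1:
 assumes U: "BM U" and V: "BM V" and W: "BM W"
  and c: "braid_by L c"
 shows "cmpa (uassoc A V W U) (cmpa (c U (V \<otimes> W)) (uassoc A U V W)) \<in> Hom \<B> (U \<otimes> V \<otimes> W) (V \<otimes> (W \<otimes> U))" (is "PROP ?p1")
  and "X \<in>: (U \<otimes> V \<otimes> W) ==> fn (cmpa (uassoc A V W U) (cmpa (c U (V \<otimes> W)) (uassoc A U V W))) X =
   fn (uassoc A V W U) (fn (c U (V \<otimes> W)) (fn (uassoc A U V W) X))" (is "PROP ?p2")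
  and "cmpa (tens_ar (id_arrow V) (c U W)) (cmpa (uassoc A V U W) (tens_ar (c U V) (id_arrow W)))
   \<in> Hom \<B> (U \<otimes> V \<otimes> W) (V \<otimes> (W \<otimes> U))" (is "PROP ?p3")
  and "X \<in>: (U \<otimes> V \<otimes> W) ==> fn (cmpa (tens_ar (id_arrow V) (c U W)) (cmpa (uassoc A V U W) (tens_ar (c U V) (id_arrow W)))) X =
   fn (tens_ar (id_arrow V) (c U W)) (fn (uassoc A V U W) (fn (tens_ar (c U V) (id_arrow W)) X))" (is "PROP ?p4")
proof -
 note c = braid_byD(2)[OF c]
 note S = pt_bim[OF pt_bim[OF U V] W]
 note a1 = uassoc_facts(1)[OF U V W] and a2 = c[OF U pt_bim[OF V W]] and a3 = uassoc_facts(1)[OF V W U]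
 note b1 = utensor_arrow_facts(1)[OF pt_bim[OF U V] pt_bim[OF V U] W W c[OF U V] id_Hom[OF W]]
  and b2 = uassoc_facts(1)[OF V U W]
  and b3 = utensor_arrow_facts(1)[OF V V pt_bim[OF U W] pt_bim[OF W U] id_Hom[OF V] c[OF U W]]
 note a12 = comp_Hom[OF S a1 a2] and b12 = comp_Hom[OF S b1 b2]
 show "PROP ?p1"
  by (rule comp_Hom[OF S a12 a3])
 show "PROP ?p3"
  by (rule comp_Hom[OF S b12 b3])
 show "PROP ?p2"
  by (simp add: compose_def Hom_bimap(2)[OF a1])
 show "PROP ?p4"
  by (simp add: compose_def Hom_bimap(2)[OF b1])
qed

text \<open>The hexagon for \<open>c(U, V \<otimes> W)\<close> is governed by the identity \<open>hexagon2\<close>, and the one for \<open>c(U \<otimes> V, W)\<close>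
  below by \<open>hexagon1\<close>.\<close>
lemma hexagon1_values:
 assumes c: "braid_by L c" and U: "BM U" and V: "BM V" and W: "BM W" and u: "u \<in>: U" and v: "v \<in>: V" and w: "w \<in>: W"
 defines "\<phi> == %x y z t. pt V (W \<otimes> U) (x |>\<^sub>V v) (pt W U (y |>\<^sub>W (w <|\<^sub>W z)) (u <|\<^sub>U t))"
  and "X == pt (U \<otimes> V) W (pt U V u v) w"
 shows "fn (uassoc A V W U) (fn (c U (V \<otimes> W)) (fn (uassoc A U V W) X)) =
   tsum (V \<otimes> (W \<otimes> U)) L (%x y z. \<phi> x \<one> y z)" (is "PROP ?p1")
  and "fn (tens_ar (id_arrow V) (c U W)) (fn (uassoc A V U W) (fn (tens_ar (c U V) (id_arrow W)) X)) =
   tsum (V \<otimes> (W \<otimes> U)) L (%x y z. tsum (V \<otimes> (W \<otimes> U)) L (%p q r. \<phi> x (y * p) q (z * r)))" (is "PROP ?p2")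
proof -
 let ?S = "tsum (V \<otimes> (W \<otimes> U)) L"
 note cD = braid_byD[OF c]
 note VW = pt_bim[OF V W] and WU = pt_bim[OF W U] and VU = pt_bim[OF V U] and UV = pt_bim[OF U V] and UW = pt_bim[OF U W]
 note T = pt_bim[OF V WU]
 note s = u v w bim_simps(1,2)[OF U] bim_simps(1,2)[OF V] bim_simps(1,2)[OF W]
 note pc = pt_simps(1,5,6)[OF V W] pt_simps(1,5,6)[OF W U] pt_simps(1,5,6)[OF V U] pt_simps(1)[OF U V] pt_simps(1)[OF U W]
 note ag = bimoduleD(2) and add = bimapD(2)[OF Hom_bimap(1)]
 note a1 = uassoc_facts[OF U V W] and a3 = uassoc_facts[OF V W U] and a2 = uassoc_facts[OF V U W]
 note b1 = utensor_arrow_facts[OF UV VU W W cD(2)[OF U V] id_Hom[OF W]]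
  and b3 = utensor_arrow_facts[OF V V UW WU id_Hom[OF V] cD(2)[OF U W]]
 have "fn (uassoc A V W U) (fn (c U (V \<otimes> W)) (fn (uassoc A U V W) X)) =
   fn (uassoc A V W U) (tsum (V \<otimes> W \<otimes> U) L (%x y z. pt (V \<otimes> W) U (x |>\<^bsub>V \<otimes> W\<^esub> (pt V W v w <|\<^bsub>V \<otimes> W\<^esub> y)) (u <|\<^sub>U z)))"
  unfolding X_def by (simp add: a1(2) s cD(3)[OF U VW] pc)
 also have "... = ?S (%x y z. fn (uassoc A V W U) (pt (V \<otimes> W) U (x |>\<^bsub>V \<otimes> W\<^esub> (pt V W v w <|\<^bsub>V \<otimes> W\<^esub> y)) (u <|\<^sub>U z)))"
  by (rule tsum_additive[OF ag[OF pt_bim[OF VW U]] ag[OF T] add[OF a3(1)] cD(1)]) (simp add: s pc pt_simps(1)[OF VW U])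
 also have "... = ?S (%x y z. \<phi> x \<one> y z)"
  by (rule tsum_cong[OF cD(1)]) (simp add: \<phi>_def s pc a3(2) bim_simps(11)[OF W])
 finally show "PROP ?p1" .
 have l: "additive_on (V \<otimes> U) (V \<otimes> U \<otimes> W) (%Y. pt (V \<otimes> U) W Y w)"
  using pt_simps(1,2)[OF VU W] w by (auto simp: additive_on_def)
 have "fn (tens_ar (c U V) (id_arrow W)) X =
   pt (V \<otimes> U) W (tsum (V \<otimes> U) L (%x y z. pt V U (x |>\<^sub>V (v <|\<^sub>V y)) (u <|\<^sub>U z))) w"
  unfolding X_def by (simp add: b1(2) s pc cD(3)[OF U V])
 also have "... = tsum (V \<otimes> U \<otimes> W) L (%x y z. pt (V \<otimes> U) W (pt V U (x |>\<^sub>V (v <|\<^sub>V y)) (u <|\<^sub>U z)) w)"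
  by (rule tsum_additive[OF ag[OF VU] ag[OF pt_bim[OF VU W]] l cD(1)]) (simp add: s pc)
 finally have 1: "fn (tens_ar (c U V) (id_arrow W)) X = ..." .
 have 2: "fn (uassoc A V U W) ... = tsum (V \<otimes> (U \<otimes> W)) L (%x y z. fn (uassoc A V U W) (pt (V \<otimes> U) W (pt V U (x |>\<^sub>V (v <|\<^sub>V y)) (u <|\<^sub>U z)) w))"
  by (rule tsum_additive[OF ag[OF pt_bim[OF VU W]] ag[OF pt_bim[OF V UW]] add[OF a2(1)] cD(1)]) (simp add: s pc pt_simps(1)[OF VU W])
 also have "... = tsum (V \<otimes> (U \<otimes> W)) L (%x y z. pt V (U \<otimes> W) (x |>\<^sub>V (v <|\<^sub>V y)) (pt U W (u <|\<^sub>U z) w))"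
  by (rule tsum_cong[OF cD(1)]) (simp add: s pc a2(2))
 finally have 3: "fn (uassoc A V U W) (fn (tens_ar (c U V) (id_arrow W)) X) = ..." unfolding 1 .
 have "fn (tens_ar (id_arrow V) (c U W)) ... = ?S (%x y z.
   fn (tens_ar (id_arrow V) (c U W)) (pt V (U \<otimes> W) (x |>\<^sub>V (v <|\<^sub>V y)) (pt U W (u <|\<^sub>U z) w)))"
  by (rule tsum_additive[OF ag[OF pt_bim[OF V UW]] ag[OF T] add[OF b3(1)] cD(1)]) (simp add: s pc pt_simps(1)[OF V UW])
 also have "... = ?S (%x y z. ?S (%p q r. \<phi> x (y * p) q (z * r)))"
 proof (rule tsum_cong[OF cD(1)])
  fix x y z assume xyz: "x \<in>: A" "y \<in>: A" "z \<in>: A"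
  let ?v = "x |>\<^sub>V (v <|\<^sub>V y)"
  have l: "additive_on (W \<otimes> U) (V \<otimes> (W \<otimes> U)) (%Y. pt V (W \<otimes> U) ?v Y)"
   using pt_simps(1,3)[OF V WU] s xyz by (auto simp: additive_on_def)
  have "fn (tens_ar (id_arrow V) (c U W)) (pt V (U \<otimes> W) ?v (pt U W (u <|\<^sub>U z) w)) =
   pt V (W \<otimes> U) ?v (tsum (W \<otimes> U) L (%p q r. pt W U (p |>\<^sub>W (w <|\<^sub>W q)) ((u <|\<^sub>U z) <|\<^sub>U r)))"
   using xyz by (simp add: b3(2) s pc cD(3)[OF U W])
  also have "... = ?S (%p q r. pt V (W \<otimes> U) ?v (pt W U (p |>\<^sub>W (w <|\<^sub>W q)) ((u <|\<^sub>U z) <|\<^sub>U r)))"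
   by (rule tsum_additive[OF ag[OF WU] ag[OF T] l cD(1)]) (use xyz in "simp add: s pc")
  also have "... = ?S (%p q r. \<phi> x (y * p) q (z * r))"
  proof (rule tsum_cong[OF cD(1)])
   fix p q r assume pqr: "p \<in>: A" "q \<in>: A" "r \<in>: A"
   have "?v = (x |>\<^sub>V v) <|\<^sub>V y" using xyz s bimodule_assoc(3)[OF V] by simp
   then show "pt V (W \<otimes> U) ?v (pt W U (p |>\<^sub>W (w <|\<^sub>W q)) ((u <|\<^sub>U z) <|\<^sub>U r)) = \<phi> x (y * p) q (z * r)"
    using xyz pqr by (simp add: \<phi>_def s pc pt_simps(4)[OF V WU] bimodule_assoc[OF W] bimodule_assoc(2)[OF U])
  qed
  finally show "fn (tens_ar (id_arrow V) (c U W)) (pt V (U \<otimes> W) ?v (pt U W (u <|\<^sub>U z) w)) =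
   ?S (%p q r. \<phi> x (y * p) q (z * r))" .
 qed
 finally show "PROP ?p2" unfolding 3 .
qed

abbreviation unassoc :: "('k, 'a, 'u) bimodule => ('k, 'a, 'u) bimodule => ('k, 'a, 'u) bimodule => ('k, 'a, 'u) bimod_arrow" where
 "unassoc M N P == inv_arrow \<B> (M \<otimes> N \<otimes> P) (M \<otimes> (N \<otimes> P)) (uassoc A M N P)"

lemma hexagon_arrows2:
 assumes U: "BM U" and V: "BM V" and W: "BM W"
  and c: "braid_by L c"
 defines "h == cmpa (uassoc A W U V) (cmpa (tens_ar (c U W) (id_arrow V))
   (cmpa (unassoc U W V) (cmpa (tens_ar (id_arrow U) (c V W)) (uassoc A U V W))))"
 shows "h \<in> Hom \<B> (U \<otimes> V \<otimes> W) (W \<otimes> (U \<otimes> V))" (is "PROP ?p1")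
  and "X \<in>: (U \<otimes> V \<otimes> W) ==> fn h X = fn (uassoc A W U V) (fn (tens_ar (c U W) (id_arrow V))
   (fn (unassoc U W V) (fn (tens_ar (id_arrow U) (c V W)) (fn (uassoc A U V W) X))))" (is "PROP ?p2")
proof -
 note c = braid_byD(2)[OF c]
 note S = pt_bim[OF pt_bim[OF U V] W]
 note a1 = uassoc_facts(1)[OF U V W]
  and a2 = utensor_arrow_facts(1)[OF U U pt_bim[OF V W] pt_bim[OF W V] id_Hom[OF U] c[OF V W]]
  and a3 = uassoc_facts(3)[OF U W V]
  and a4 = utensor_arrow_facts(1)[OF pt_bim[OF U W] pt_bim[OF W U] V V c[OF U W] id_Hom[OF V]]
  and a5 = uassoc_facts(1)[OF W U V]
 note a12 = comp_Hom[OF S a1 a2] note a13 = comp_Hom[OF S a12 a3] note a14 = comp_Hom[OF S a13 a4]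
 show "PROP ?p1"
  unfolding h_def by (rule comp_Hom[OF S a14 a5])
 show "PROP ?p2"
  unfolding h_def by (simp add: compose_def Hom_bimap(2)[OF a1])
qed

lemma hexagon2_values:
 assumes c: "braid_by L c" and U: "BM U" and V: "BM V" and W: "BM W" and u: "u \<in>: U" and v: "v \<in>: V" and w: "w \<in>: W"
 defines "\<phi> == %x y z t. pt W (U \<otimes> V) (x |>\<^sub>W (w <|\<^sub>W y)) (pt U V (u <|\<^sub>U z) (v <|\<^sub>V t))"
  and "X == pt (U \<otimes> V) W (pt U V u v) w"
 shows "fn (c (U \<otimes> V) W) X = tsum (W \<otimes> (U \<otimes> V)) L (%x y z. \<phi> x y \<one> z)" (is "PROP ?p1")
  and "fn (uassoc A W U V) (fn (tens_ar (c U W) (id_arrow V))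
   (fn (unassoc U W V) (fn (tens_ar (id_arrow U) (c V W)) (fn (uassoc A U V W) X)))) =
   tsum (W \<otimes> (U \<otimes> V)) L (%x y z. tsum (W \<otimes> (U \<otimes> V)) L (%p q r. \<phi> (p * x) (y * q) r z))" (is "PROP ?p2")
proof -
 let ?S = "tsum (W \<otimes> (U \<otimes> V)) L"
 note cD = braid_byD[OF c]
 note VW = pt_bim[OF V W] and WV = pt_bim[OF W V] and WU = pt_bim[OF W U] and UV = pt_bim[OF U V] and UW = pt_bim[OF U W]
 note T = pt_bim[OF W UV]
 note s = u v w bim_simps(1,2)[OF U] bim_simps(1,2)[OF V] bim_simps(1,2)[OF W]
 note pc = pt_simps(1)[OF V W] pt_simps(1)[OF W V] pt_simps(1)[OF W U] pt_simps(1,6)[OF U V] pt_simps(1)[OF U W]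
 note ag = bimoduleD(2) and add = bimapD(2)[OF Hom_bimap(1)]
 note a1 = uassoc_facts[OF U V W] and a3 = uassoc_facts[OF U W V] and a5 = uassoc_facts[OF W U V]
 note b2 = utensor_arrow_facts[OF U U VW WV id_Hom[OF U] cD(2)[OF V W]]
  and b4 = utensor_arrow_facts[OF UW WU V V cD(2)[OF U W] id_Hom[OF V]]
 show "PROP ?p1"
  unfolding X_def cD(3)[OF UV W pt_simps(1)[OF U V u v] w]
  by (rule tsum_cong[OF cD(1)]) (simp add: \<phi>_def s pc bim_simps(12)[OF U])
 have l: "additive_on (W \<otimes> V) (U \<otimes> (W \<otimes> V)) (%Y. pt U (W \<otimes> V) u Y)"
  using pt_simps(1,3)[OF U WV] u by (auto simp: additive_on_def)
 have "fn (tens_ar (id_arrow U) (c V W)) (fn (uassoc A U V W) X) =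
   pt U (W \<otimes> V) u (tsum (W \<otimes> V) L (%x y z. pt W V (x |>\<^sub>W (w <|\<^sub>W y)) (v <|\<^sub>V z)))"
  unfolding X_def by (simp add: a1(2) b2(2) s pc cD(3)[OF V W])
 also have "... = tsum (U \<otimes> (W \<otimes> V)) L (%x y z. pt U (W \<otimes> V) u (pt W V (x |>\<^sub>W (w <|\<^sub>W y)) (v <|\<^sub>V z)))"
  by (rule tsum_additive[OF ag[OF WV] ag[OF pt_bim[OF U WV]] l cD(1)]) (simp add: s pc)
 finally have 1: "fn (tens_ar (id_arrow U) (c V W)) (fn (uassoc A U V W) X) = ..." .
 have "fn (unassoc U W V) ... = tsum (U \<otimes> W \<otimes> V) L (%x y z. fn (unassoc U W V) (pt U (W \<otimes> V) u (pt W V (x |>\<^sub>W (w <|\<^sub>W y)) (v <|\<^sub>V z))))"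
  by (rule tsum_additive[OF ag[OF pt_bim[OF U WV]] ag[OF pt_bim[OF UW V]] add[OF a3(3)] cD(1)]) (simp add: s pc pt_simps(1)[OF U WV])
 also have "... = tsum (U \<otimes> W \<otimes> V) L (%x y z. pt (U \<otimes> W) V (pt U W u (x |>\<^sub>W (w <|\<^sub>W y))) (v <|\<^sub>V z))"
  by (rule tsum_cong[OF cD(1)]) (simp add: s pc a3(4))
 finally have 2: "fn (unassoc U W V) (fn (tens_ar (id_arrow U) (c V W)) (fn (uassoc A U V W) X)) = ..." unfolding 1 .
 have "fn (tens_ar (c U W) (id_arrow V)) ... = tsum (W \<otimes> U \<otimes> V) L (%x y z.
   fn (tens_ar (c U W) (id_arrow V)) (pt (U \<otimes> W) V (pt U W u (x |>\<^sub>W (w <|\<^sub>W y))) (v <|\<^sub>V z)))"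
  by (rule tsum_additive[OF ag[OF pt_bim[OF UW V]] ag[OF pt_bim[OF WU V]] add[OF b4(1)] cD(1)]) (simp add: s pc pt_simps(1)[OF UW V])
 then have 3: "fn (uassoc A W U V) (fn (tens_ar (c U W) (id_arrow V)) (fn (unassoc U W V) (fn (tens_ar (id_arrow U) (c V W)) (fn (uassoc A U V W) X)))) =
  fn (uassoc A W U V) (tsum (W \<otimes> U \<otimes> V) L (%x y z.
   fn (tens_ar (c U W) (id_arrow V)) (pt (U \<otimes> W) V (pt U W u (x |>\<^sub>W (w <|\<^sub>W y))) (v <|\<^sub>V z))))" unfolding 2 by simp
 also have "... = ?S (%x y z. fn (uassoc A W U V)
   (fn (tens_ar (c U W) (id_arrow V)) (pt (U \<otimes> W) V (pt U W u (x |>\<^sub>W (w <|\<^sub>W y))) (v <|\<^sub>V z))))"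
  by (rule tsum_additive[OF ag[OF pt_bim[OF WU V]] ag[OF T] add[OF a5(1)] cD(1)], rule bimapD(3)[OF Hom_bimap(1)[OF b4(1)]])
    (simp add: s pc pt_simps(1)[OF UW V])
 also have "... = ?S (%x y z. ?S (%p q r. \<phi> (p * x) (y * q) r z))"
 proof (rule tsum_cong[OF cD(1)])
  fix x y z assume xyz: "x \<in>: A" "y \<in>: A" "z \<in>: A"
  let ?w = "x |>\<^sub>W (w <|\<^sub>W y)" and ?v = "v <|\<^sub>V z"
  have l: "additive_on (W \<otimes> U) (W \<otimes> U \<otimes> V) (%Y. pt (W \<otimes> U) V Y ?v)"
   using pt_simps(1,2)[OF WU V] s xyz by (auto simp: additive_on_def)
  have "fn (tens_ar (c U W) (id_arrow V)) (pt (U \<otimes> W) V (pt U W u ?w) ?v) =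
   pt (W \<otimes> U) V (tsum (W \<otimes> U) L (%p q r. pt W U (p |>\<^sub>W (?w <|\<^sub>W q)) (u <|\<^sub>U r))) ?v"
   using xyz by (simp add: b4(2) s pc cD(3)[OF U W])
  also have "... = tsum (W \<otimes> U \<otimes> V) L (%p q r. pt (W \<otimes> U) V (pt W U (p |>\<^sub>W (?w <|\<^sub>W q)) (u <|\<^sub>U r)) ?v)"
   by (rule tsum_additive[OF ag[OF WU] ag[OF pt_bim[OF WU V]] l cD(1)]) (use xyz in "simp add: s pc")
  finally have "fn (uassoc A W U V) (fn (tens_ar (c U W) (id_arrow V)) (pt (U \<otimes> W) V (pt U W u ?w) ?v)) =
   fn (uassoc A W U V) ..." by simp
  also have "... = ?S (%p q r. fn (uassoc A W U V) (pt (W \<otimes> U) V (pt W U (p |>\<^sub>W (?w <|\<^sub>W q)) (u <|\<^sub>U r)) ?v))"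
   by (rule tsum_additive[OF ag[OF pt_bim[OF WU V]] ag[OF T] add[OF a5(1)] cD(1)]) (use xyz in "simp add: s pc pt_simps(1)[OF WU V]")
  also have "... = ?S (%p q r. \<phi> (p * x) (y * q) r z)"
   by (rule tsum_cong[OF cD(1)]) (use xyz in "simp add: \<phi>_def s pc a5(2) bimodule_assoc[OF W]")
  finally show "fn (uassoc A W U V) (fn (tens_ar (c U W) (id_arrow V)) (pt (U \<otimes> W) V (pt U W u ?w) ?v)) =
   ?S (%p q r. \<phi> (p * x) (y * q) r z)" .
 qed
 finally show "PROP ?p2" .
qed

lemma quadlin_pt:
 assumes U: "BM U" and V: "BM V" and W: "BM W" and u: "u \<in>: U" and v: "v \<in>: V" and w: "w \<in>: W"
 shows "quadlin k A (V \<otimes> (W \<otimes> U)) (%x y z t. pt V (W \<otimes> U) (x |>\<^sub>V v) (pt W U (y |>\<^sub>W (w <|\<^sub>W z)) (u <|\<^sub>U t)))" (is "PROP ?p1")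
  and "quadlin k A (W \<otimes> (U \<otimes> V)) (%x y z t. pt W (U \<otimes> V) (x |>\<^sub>W (w <|\<^sub>W y)) (pt U V (u <|\<^sub>U z) (v <|\<^sub>V t)))" (is "PROP ?p2")
proof -
 note s = u v w bim_simps(1-10)[OF U] bim_simps(1-10)[OF V] bim_simps(1-10)[OF W]
 note p = pt_simps[OF V pt_bim[OF W U]] pt_simps[OF W pt_bim[OF U V]] pt_simps[OF W U] pt_simps[OF U V]
 show "PROP ?p1"
  unfolding quadlin_def by (intro conjI ballI trilinI klinI) (simp_all add: s p)
 show "PROP ?p2"
  unfolding quadlin_def by (intro conjI ballI trilinI klinI) (simp_all add: s p)
qed

text \<open>The inverse of \<open>R\<close>, with its last two factors exchanged, satisfies the cyclic relations as well; the
  family that it defines is the inverse of \<open>c\<close>.\<close>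
lemma canonical_braiding:
 assumes L: "cyc L" "hexagon1 L" "hexagon2 L" and L': "triples L'" "prod_one L L'" "prod_one L' L" and c: "braid_by L c"
 shows "braiding \<B> c"
proof -
 note cD = braid_byD[OF c]
 have tL: "triples L" by (rule cD(1))
 have S: "cyc (swap23 L')" by (rule cyc_inverse[OF L(1) L'])
 obtain d where d: "braid_by (swap23 L') d" using list_braiding[OF S] by blast
 note dD = braid_byD[OF d]
 have p1: "prod_one (swap23 L) (swap23 L')" by (rule prod_one_swap23[OF tL L'(1,2)])
 have p2: "prod_one (swap23 (swap23 L')) L" using L'(3) by simp
 have iso: "iso_arrow \<B> (U \<otimes> V) (V \<otimes> U) (c U V)" if U: "BM U" and V: "BM V" for U V
 proof -
  have "inverse_arrows \<B> (U \<otimes> V) (V \<otimes> U) (c U V) (d V U)"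
   by (rule inverse_arrows_Bimod[OF pt_bim[OF U V] pt_bim[OF V U] cD(2)[OF U V] dD(2)[OF V U]
      braid_by_inverse[OF c d S p1 U V] braid_by_inverse[OF d c L(1) p2 V U]])
  then show ?thesis unfolding iso_arrow_def by blast
 qed
 have h1: "cmpa (uassoc A V W U) (cmpa (c U (V \<otimes> W)) (uassoc A U V W)) =
   cmpa (tens_ar (id_arrow V) (c U W)) (cmpa (uassoc A V U W) (tens_ar (c U V) (id_arrow W)))" (is "?l = ?r")
  if U: "BM U" and V: "BM V" and W: "BM W" for U V W
 proof (rule Hom_eqI)
  let ?T = "V \<otimes> (W \<otimes> U)"
  note T = pt_bim[OF V pt_bim[OF W U]]
  note h = hexagon_arrows1[OF U V W c]
  show l: "?l \<in> Hom \<B> (U \<otimes> V \<otimes> W) ?T" and r: "?r \<in> Hom \<B> (U \<otimes> V \<otimes> W) ?T" using h(1,3) by blast+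
  fix X assume X: "X \<in>: (U \<otimes> V \<otimes> W)"
  show "fn ?l X = fn ?r X"
  proof (rule pt3_ext[OF U V W bimapD(2)[OF Hom_bimap(1)[OF l]] bimapD(2)[OF Hom_bimap(1)[OF r]] _ X])
   fix u v w assume u: "u \<in>: U" and v: "v \<in>: V" and w: "w \<in>: W"
   let ?X = "pt (U \<otimes> V) W (pt U V u v) w"
   have X: "?X \<in>: (U \<otimes> V \<otimes> W)" by (rule pt_simps(1)[OF pt_bim[OF U V] W pt_simps(1)[OF U V u v] w])
   show "fn ?l ?X = fn ?r ?X"
    unfolding h(2)[OF X] h(4)[OF X] hexagon1_values[OF c U V W u v w]
    by (rule hexagon_app[OF tL bimoduleD(1)[OF T] quadlin_pt(1)[OF U V W u v w]])
      (use L(3) in "simp_all add: hexagon2_def")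
  qed
 qed
 have h2: "c (U \<otimes> V) W = cmpa (uassoc A W U V) (cmpa (tens_ar (c U W) (id_arrow V))
   (cmpa (unassoc U W V) (cmpa (tens_ar (id_arrow U) (c V W)) (uassoc A U V W))))" (is "?l = ?r")
  if U: "BM U" and V: "BM V" and W: "BM W" for U V W
 proof (rule Hom_eqI)
  let ?T = "W \<otimes> (U \<otimes> V)"
  note T = pt_bim[OF W pt_bim[OF U V]]
  note h = hexagon_arrows2[OF U V W c]
  show l: "?l \<in> Hom \<B> (U \<otimes> V \<otimes> W) ?T" by (rule cD(2)[OF pt_bim[OF U V] W])
  show r: "?r \<in> Hom \<B> (U \<otimes> V \<otimes> W) ?T" by (rule h(1))
  fix X assume X: "X \<in>: (U \<otimes> V \<otimes> W)"
  show "fn ?l X = fn ?r X"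
  proof (rule pt3_ext[OF U V W bimapD(2)[OF Hom_bimap(1)[OF l]] bimapD(2)[OF Hom_bimap(1)[OF r]] _ X])
   fix u v w assume u: "u \<in>: U" and v: "v \<in>: V" and w: "w \<in>: W"
   let ?X = "pt (U \<otimes> V) W (pt U V u v) w"
   have X: "?X \<in>: (U \<otimes> V \<otimes> W)" by (rule pt_simps(1)[OF pt_bim[OF U V] W pt_simps(1)[OF U V u v] w])
   show "fn ?l ?X = fn ?r ?X"
    unfolding h(2)[OF X] hexagon2_values[OF c U V W u v w]
    by (rule hexagon_app[OF tL bimoduleD(1)[OF T] quadlin_pt(2)[OF U V W u v w]])
      (use L(2) in "simp_all add: hexagon1_alt[OF L(1)]")
  qed
 qed
 show ?thesis
  unfolding braiding_def Bimod_cat_simps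
  using iso braid_by_natural[OF c] h1 h2 by simp
qed

text \<open>\<open>(A \<otimes> A) \<otimes>\<^sub>A X\<close> is \<open>A \<otimes> X\<close>. Thus equations in tensor products of copies of \<open>A \<otimes> A\<close> over \<open>A\<close> become
  equations in tensor powers of \<open>A\<close>, from which \<open>R\<close> can be recovered.\<close>
lemma split_free:
 fixes X :: "('k, 'a, 'u) bimodule" and Q :: "('k, 'q) module" and T :: "('k, 't) module"
 assumes X: "BM X" and h: "klin k X Q h" and T: "is_ktens k A Q T t"
 obtains f where "klin k (AAu \<otimes> X) T f"
  "!!a b x. a \<in>: A ==> b \<in>: A ==> x \<in>: X ==> f (pt AAu X (aat a b) x) = t a (h (b |>\<^sub>X x))"
proof -
 note mT = is_ktensD(3)[OF T] and ts = is_ktens_simps[OF T] and hl = klinD(1-3)[OF h]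
 note s = bim_simps[OF X] and sA = bim_simps[OF AAu_bimod] and asX = bimodule_assoc[OF X]
 interpret T: module k T by (rule mT)
 interpret X: module k X by (rule bimoduleD(1)[OF X])
 have b: "bilin k A A T (%a b. t a (h (b |>\<^sub>X x)))" if "x \<in>: X" for x
  by (rule bilinI) (use that in "simp_all add: ts hl s")
 define g where "g x = the_additive AAu T (%f. \<forall>a\<in>\<A>. \<forall>b\<in>\<A>. f (aat a b) = t a (h (b |>\<^sub>X x)))" for x
 note t = is_ktens_the_additive[OF AAu_ktens mT b, folded g_def]
 have gl: "klin k AAu T (g x)" if "x \<in>: X" for x using t(1)[OF that] by (simp add: linear_maps_iff)
 note g = klinD(1-3)[OF gl]
 have 1: "g (x \<oplus>\<^sub>X y) w = g x w \<oplus>\<^sub>T g y w" if "w \<in>: AAu" "x \<in>: X" "y \<in>: X" for w x y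
  using AAu_ktens that(1)
  by (induction rule: is_ktens_induct) (use that in "simp_all add: t(2) ts hl s g T.a_ac")
 have 2: "g x (w <|\<^sub>AAu a) = g (a |>\<^sub>X x) w" if "w \<in>: AAu" "x \<in>: X" "a \<in>: A" for w x a
  using AAu_ktens that(1)
  by (induction rule: is_ktens_induct) (use that in "simp_all add: t(2) s g sA asX AAu_act")
 have bal: "balanced_map AAu X \<A> (%m a. m <|\<^sub>AAu a) (%a n. a |>\<^sub>X n) T (%w x. g x w)"
  unfolding balanced_map_def additive_on_def using g 1 2 by simp
 obtain f where f: "f \<in> additive_maps (AAu \<otimes> X) T" "!!w x. w \<in>: AAu ==> x \<in>: X ==> f (pt AAu X w x) = g x w"
  using is_tensor_lift[OF utensor_facts(2)[OF AAu_bimod X] T.ab_gr bal] by blast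
 have fa: "additive_on (AAu \<otimes> X) T f" using f(1) by (simp add: additive_maps_iff)
 note B = pt_bim[OF AAu_bimod X]
 interpret B: module k "AAu \<otimes> X" by (rule bimoduleD(1)[OF B])
 interpret AAu: module k AAu by (rule bimoduleD(1)[OF AAu_bimod])
 have "f (c \<odot>\<^bsub>AAu \<otimes> X\<^esub> Y) = c \<odot>\<^sub>T f Y" if c: "c \<in>: k" and Y: "Y \<in>: (AAu \<otimes> X)" for c Y
 proof (rule pt_ext[OF AAu_bimod X _ _ _ Y])
  show "additive_on (AAu \<otimes> X) T (%Y. f (c \<odot>\<^bsub>AAu \<otimes> X\<^esub> Y))"
   by (rule additive_on_compose[OF _ fa]) (use c in "auto simp: additive_on_def B.smult_r_distr")
  show "additive_on (AAu \<otimes> X) T (%Y. c \<odot>\<^sub>T f Y)"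
   by (rule additive_on_compose[OF fa]) (use c in "auto simp: additive_on_def T.smult_r_distr")
  show "f (c \<odot>\<^bsub>AAu \<otimes> X\<^esub> pt AAu X w x) = c \<odot>\<^sub>T f (pt AAu X w x)" if "w \<in>: AAu" "x \<in>: X" for w x
   using c that by (simp add: pt_simps(7)[OF AAu_bimod X, symmetric] f(2) g)
 qed
 then have "klin k (AAu \<otimes> X) T f" unfolding klin_def using fa by blast
 then show thesis by (rule that) (simp add: f(2) t(2) is_ktens_simps(1)[OF AAu_ktens])
qed

lemma aat_closed: "x \<in>: A ==> y \<in>: A ==> aat x y \<in>: AAu"
 by (rule is_ktens_simps(1)[OF AAu_ktens])

lemma AAu_square:
 obtains h where "klin k (AAu \<otimes> AAu) A3 h"
  "!!a b c d. a \<in>: A ==> b \<in>: A ==> c \<in>: A ==> d \<in>: A ==>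
   h (pt AAu AAu (aat a b) (aat c d)) = t3 a (b * c) d"
proof -
 obtain h0 where h0: "h0 \<in> linear_maps k AAu A2" "!!x y. x \<in>: A ==> y \<in>: A ==> h0 (aat x y) = t2 x y"
  by (rule is_ktens_lift[OF AAu_ktens mod2 is_ktens_bilin[OF ktens2]]) (rule that)
 have h0l: "klin k AAu A2 h0" using h0(1) by (simp add: linear_maps_iff)
 obtain h where h: "klin k (AAu \<otimes> AAu) A3 h"
  "!!a b x. a \<in>: A ==> b \<in>: A ==> x \<in>: AAu ==> h (pt AAu AAu (aat a b) x) = ktens k A A2 a (h0 (b |>\<^sub>AAu x))"
  by (rule split_free[OF AAu_bimod h0l ktens3]) (rule that)
 show thesis by (rule that[OF h(1)]) (simp add: h(2) AAu_act aat_closed h0(2) tens3_def)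
qed

lemma AAu_cube:
 obtains h where "klin k (AAu \<otimes> (AAu \<otimes> AAu)) A4 h"
  "!!a b c d e f. a \<in>: A ==> b \<in>: A ==> c \<in>: A ==> d \<in>: A ==> e \<in>: A ==> f \<in>: A ==>
   h (pt AAu (AAu \<otimes> AAu) (aat a b) (pt AAu AAu (aat c d) (aat e f))) = t4 a (b * c) (d * e) f"
proof -
 obtain h1 where h1: "klin k (AAu \<otimes> AAu) A3 h1"
  "!!a b c d. a \<in>: A ==> b \<in>: A ==> c \<in>: A ==> d \<in>: A ==>
   h1 (pt AAu AAu (aat a b) (aat c d)) = t3 a (b * c) d" by (rule AAu_square) (rule that)
 obtain h where h: "klin k (AAu \<otimes> (AAu \<otimes> AAu)) A4 h"
  "!!a b x. a \<in>: A ==> b \<in>: A ==> x \<in>: (AAu \<otimes> AAu) ==>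
   h (pt AAu (AAu \<otimes> AAu) (aat a b) x) = ktens k A A3 a (h1 (b |>\<^bsub>AAu \<otimes> AAu\<^esub> x))"
  by (rule split_free[OF pt_bim[OF AAu_bimod AAu_bimod] h1(1) ktens4]) (rule that)
 show thesis
  by (rule that[OF h(1)]) (simp add: h(2) AAu_act aat_closed pt_simps(1,5)[OF AAu_bimod AAu_bimod] h1(2) tens4_def)
qed

text \<open>The part of the notion of a braiding that ties the family to an element; it passes to the inverse.\<close>
definition natural_family :: "(('k, 'a, 'u) bimodule => ('k, 'a, 'u) bimodule => ('k, 'a, 'u) bimod_arrow) => bool" where
 "natural_family c \<longleftrightarrow> (\<forall>U V. BM U --> BM V --> c U V \<in> Hom \<B> (U \<otimes> V) (V \<otimes> U)) &
   (\<forall>U U' V V' f g. BM U --> BM U' --> BM V --> BM V' --> f \<in> Hom \<B> U U' --> g \<in> Hom \<B> V V' -->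
    cmpa (c U' V') (tens_ar f g) = cmpa (tens_ar g f) (c U V))"

text \<open>Every \<open>m\<close> is the image of \<open>1 \<otimes> 1\<close> under a bimodule map from \<open>A \<otimes> A\<close>, so by naturality a family is
  determined by its value at \<open>(1 \<otimes> 1) \<otimes> (1 \<otimes> 1)\<close> in \<open>(A \<otimes> A) \<otimes>\<^sub>A (A \<otimes> A) = A \<otimes> A \<otimes> A\<close>.\<close>
lemma natural_family_braid_by:
 assumes c: "natural_family c"
 obtains L where "braid_by L c"
proof -
 let ?B = "AAu \<otimes> AAu" and ?e = "aat \<one> \<one>"
 note AB = AAu_bimod and B = pt_bim[OF AAu_bimod AAu_bimod]
 note ps = pt_simps[OF AB AB]
 have cH: "c U V \<in> Hom \<B> (U \<otimes> V) (V \<otimes> U)" if "BM U" "BM V" for U V using c that unfolding natural_family_def by blast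
 have e: "?e \<in>: AAu" by (simp add: aat_closed)
 have rep: "\<exists>L. triples L & X = tsum ?B L (%x y z. pt AAu AAu (aat x y) (aat \<one> z))" if X: "X \<in>: ?B" for X
 proof -
  interpret B: module k ?B by (rule bimoduleD(1)[OF B])
  have app: "\<exists>L. triples L & X \<oplus>\<^sub>?B Y = tsum ?B L (%x y z. pt AAu AAu (aat x y) (aat \<one> z))"
   if "\<exists>L. triples L & X = tsum ?B L (%x y z. pt AAu AAu (aat x y) (aat \<one> z))"
    "\<exists>L. triples L & Y = tsum ?B L (%x y z. pt AAu AAu (aat x y) (aat \<one> z))" for X Y
  proof -
   from that obtain L L' where L: "triples L" "X = tsum ?B L (%x y z. pt AAu AAu (aat x y) (aat \<one> z))"
    "triples L'" "Y = tsum ?B L' (%x y z. pt AAu AAu (aat x y) (aat \<one> z))" by blast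
   have "X \<oplus>\<^sub>?B Y = tsum ?B (L @ L') (%x y z. pt AAu AAu (aat x y) (aat \<one> z))"
    unfolding L(2,4) tsum_def
    by (rule B.lsum_append[symmetric]) (use L(1,3) in "auto simp: triples_def ps(1) aat_closed")
   moreover have "triples (L @ L')" using L(1,3) by (simp add: triples_def)
   ultimately show ?thesis by blast
  qed
  show ?thesis using utensor_facts(2)[OF AB AB] X
  proof (induction rule: is_tensor_induct)
   case (pure p q)
   show ?case using AAu_ktens pure(1)
   proof (induction rule: is_ktens_induct)
    case (pure a b)
    note ab = pure
    show ?case using AAu_ktens \<open>q \<in>: AAu\<close>
    proof (induction rule: is_ktens_induct)
     case (pure x y)
     have "pt AAu AAu (aat a b) (aat x y) = pt AAu AAu (aat a b) (x |>\<^sub>AAu aat \<one> y)" using pure by (simp add: AAu_act)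
     also have "... = pt AAu AAu (aat a (b * x)) (aat \<one> y)"
      using ab pure by (subst ps(4)[symmetric]) (simp_all add: aat_closed AAu_act)
     finally show ?case using ab pure ps(1)[of "aat a (b * x)" "aat \<one> y"]
      by (intro exI[of _ "[(a, b * x, y)]"]) (simp add: triples_def tsum_def aat_closed)
    next
     case (add q q')
     then show ?case using app ab by (simp add: ps(3) aat_closed)
    qed
   next
    case (add p p')
    then show ?case using app \<open>q \<in>: AAu\<close> by (simp add: ps(2))
   qed
  qed (rule app)
 qed
 have "fn (c AAu AAu) (pt AAu AAu ?e ?e) \<in>: ?B" by (rule bimapD(3)[OF Hom_bimap(1)[OF cH[OF AB AB]] ps(1)[OF e e]])
 from rep[OF this] obtain L where L: "triples L"
  "fn (c AAu AAu) (pt AAu AAu ?e ?e) = tsum ?B L (%x y z. pt AAu AAu (aat x y) (aat \<one> z))" by blast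
 have "fn (c M N) (pt M N m n) = tsum (N \<otimes> M) L (%x y z. pt N M (x |>\<^sub>N (n <|\<^sub>N y)) (m <|\<^sub>M z))"
  if M: "BM M" and N: "BM N" and m: "m \<in>: M" and n: "n \<in>: N" for M N m n
 proof -
  obtain f where f: "bimap k A AAu M f" "!!x y. x \<in>: A ==> y \<in>: A ==> f (aat x y) = x |>\<^sub>M (m <|\<^sub>M y)"
   using AAu_free[OF M m] by blast
  obtain g where g: "bimap k A AAu N g" "!!x y. x \<in>: A ==> y \<in>: A ==> g (aat x y) = x |>\<^sub>N (n <|\<^sub>N y)"
   using AAu_free[OF N n] by blast
  let ?f = "mk_arrow AAu M f" and ?g = "mk_arrow AAu N g"
  have fH: "?f \<in> Hom \<B> AAu M" and gH: "?g \<in> Hom \<B> AAu N" by (rule mk_arrow_Hom[OF AB f(1)], rule mk_arrow_Hom[OF AB g(1)])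
  note fg = utensor_arrow_facts[OF AB M AB N fH gH] and gf = utensor_arrow_facts[OF AB N AB M gH fH]
  note s = bim_simps(2,11,12)[OF M] bim_simps(1,2,11,12)[OF N] m n
  have nat: "cmpa (c M N) (tens_ar ?f ?g) = cmpa (tens_ar ?g ?f) (c AAu AAu)"
   using c AB M N fH gH unfolding natural_family_def by blast
  have "fn (c M N) (pt M N m n) = fn (c M N) (fn (tens_ar ?f ?g) (pt AAu AAu ?e ?e))"
   by (simp add: fg(2) e f(2) g(2) s)
  also have "... = fn (cmpa (c M N) (tens_ar ?f ?g)) (pt AAu AAu ?e ?e)"
   by (rule comp_fn[symmetric]) (simp add: Hom_bimap(2)[OF fg(1)] ps(1) e)
  also have "... = fn (tens_ar ?g ?f) (fn (c AAu AAu) (pt AAu AAu ?e ?e))"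
   unfolding nat by (rule comp_fn) (simp add: Hom_bimap(2)[OF cH[OF AB AB]] ps(1) e)
  also have "... = tsum (N \<otimes> M) L (%x y z. fn (tens_ar ?g ?f) (pt AAu AAu (aat x y) (aat \<one> z)))"
   unfolding L(2) by (rule tsum_additive[OF bimoduleD(2)[OF B] bimoduleD(2)[OF pt_bim[OF N M]] bimapD(2)[OF Hom_bimap(1)[OF gf(1)]] L(1)])
    (simp add: ps(1) aat_closed)
  also have "... = tsum (N \<otimes> M) L (%x y z. pt N M (x |>\<^sub>N (n <|\<^sub>N y)) (m <|\<^sub>M z))"
   by (rule tsum_cong[OF L(1)]) (simp add: gf(2) aat_closed f(2) g(2) s)
  finally show ?thesis .
 qed
 then have "braid_by L c" unfolding braid_by_def using L(1) cH by blast
 then show thesis by (rule that)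
qed

text \<open>Evaluating on \<open>(1 \<otimes> 1) \<otimes> (1 \<otimes> 1)\<close>, multiplied by \<open>a\<close> in the middle, on the left and on the right.\<close>
lemma braid_by_cyc:
 assumes c: "braid_by L c"
 shows "cyc L"
 unfolding cyc_def
proof (intro conjI ballI)
 let ?B = "AAu \<otimes> AAu" and ?e = "aat \<one> \<one>"
 note cD = braid_byD[OF c] and AB = AAu_bimod
 note B = pt_bim[OF AB AB] and ps = pt_simps[OF AB AB] and s = bim_simps(1,2)[OF AB]
 obtain h1 where h1: "klin k ?B A3 h1" "!!a b c d. a \<in>: A ==> b \<in>: A ==> c \<in>: A ==> d \<in>: A ==>
   h1 (pt AAu AAu (aat a b) (aat c d)) = t3 a (b * c) d" by (rule AAu_square) (rule that)
 show L: "triples L" by (rule cD(1))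
 have e: "?e \<in>: AAu" by (simp add: aat_closed)
 have v: "h1 (fn (c AAu AAu) (pt AAu AAu m n)) = tsum A3 L (%x y z. h1 (pt AAu AAu (x |>\<^sub>AAu (n <|\<^sub>AAu y)) (m <|\<^sub>AAu z)))"
  if "m \<in>: AAu" "n \<in>: AAu" for m n
  unfolding cD(3)[OF AB AB that]
  by (rule tsum_additive[OF bimoduleD(2)[OF B] A3.ab_gr klinD(4)[OF h1(1)] L]) (simp add: ps s that)
 note cb = bimapD[OF Hom_bimap(1)[OF cD(2)[OF AB AB]]]
 fix a assume a: "a \<in>: A"
 let ?X = "tsum ?B L (%x y z. pt AAu AAu (x |>\<^sub>AAu (?e <|\<^sub>AAu y)) (?e <|\<^sub>AAu z))"
 have "tsum A3 L (%x y z. t3 x y (a * z)) = h1 (fn (c AAu AAu) (pt AAu AAu (?e <|\<^sub>AAu a) ?e))"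
  by (subst v) (use a in "auto simp: s e aat_closed AAu_act h1(2) intro!: tsum_cong[OF L]")
 also have "... = h1 (fn (c AAu AAu) (pt AAu AAu ?e (a |>\<^sub>AAu ?e)))" using a e by (simp add: ps(4))
 also have "... = tsum A3 L (%x y z. t3 (x * a) y z)"
  by (subst v) (use a in "auto simp: s e aat_closed AAu_act h1(2) intro!: tsum_cong[OF L]")
 finally show "tsum A3 L (%x y z. t3 x y (a * z)) = tsum A3 L (%x y z. t3 (x * a) y z)" .
 have "tsum A3 L (%x y z. t3 (a * x) y z) = tsum A3 L (%x y z. h1 (a |>\<^sub>?B pt AAu AAu (x |>\<^sub>AAu (?e <|\<^sub>AAu y)) (?e <|\<^sub>AAu z)))"
  by (rule tsum_cong[OF L]) (use a in "simp add: s e AAu_act h1(2) ps(5) aat_closed")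
 also have "... = h1 (a |>\<^sub>?B ?X)"
  by (rule tsum_additive[OF bimoduleD(2)[OF B] A3.ab_gr additive_on_compose[OF bimodule_additive(1)[OF B a] klinD(4)[OF h1(1)]] L, symmetric])
    (simp add: ps s e)
 also have "... = h1 (fn (c AAu AAu) (pt AAu AAu (a |>\<^sub>AAu ?e) ?e))"
  unfolding cD(3)[OF AB AB e e, symmetric] using cb(6)[OF a ps(1)[OF e e]] ps(5)[OF a e e] by simp
 also have "... = tsum A3 L (%x y z. t3 x (y * a) z)"
  by (subst v) (use a in "auto simp: s e aat_closed AAu_act h1(2) intro!: tsum_cong[OF L]")
 finally show "tsum A3 L (%x y z. t3 (a * x) y z) = tsum A3 L (%x y z. t3 x (y * a) z)" .
 have "tsum A3 L (%x y z. t3 x (a * y) z) = h1 (fn (c AAu AAu) (pt AAu AAu ?e (?e <|\<^sub>AAu a)))"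
  by (subst v) (use a in "auto simp: s e aat_closed AAu_act h1(2) intro!: tsum_cong[OF L]")
 also have "... = h1 (?X <|\<^sub>?B a)"
  unfolding cD(3)[OF AB AB e e, symmetric] using cb(7)[OF a ps(1)[OF e e]] ps(6)[OF a e e] by simp
 also have "... = tsum A3 L (%x y z. h1 (pt AAu AAu (x |>\<^sub>AAu (?e <|\<^sub>AAu y)) (?e <|\<^sub>AAu z) <|\<^sub>?B a))"
  by (rule tsum_additive[OF bimoduleD(2)[OF B] A3.ab_gr additive_on_compose[OF bimodule_additive(2)[OF B a] klinD(4)[OF h1(1)]] L])
    (simp add: ps s e)
 also have "... = tsum A3 L (%x y z. t3 x y (z * a))"
  by (rule tsum_cong[OF L]) (use a in "simp add: s e AAu_act h1(2) ps(6) aat_closed")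
 finally show "tsum A3 L (%x y z. t3 x (a * y) z) = tsum A3 L (%x y z. t3 x y (z * a))" .
qed

text \<open>If \<open>d\<close> is inverse to \<open>c\<close>, then so are the elements, up to the exchange of the last two factors.\<close>
lemma braid_by_prod_one:
 assumes c: "braid_by L c" and d: "braid_by S d"
  and dc: "fn (d AAu AAu) (fn (c AAu AAu) (pt AAu AAu (aat \<one> \<one>) (aat \<one> \<one>))) = pt AAu AAu (aat \<one> \<one>) (aat \<one> \<one>)"
 shows "prod_one (swap23 L) S"
proof -
 let ?B = "AAu \<otimes> AAu" and ?e = "aat \<one> \<one>"
 note L = braid_byD(1)[OF c] and S = braid_byD(1)[OF d] and AB = AAu_bimod
 note B = pt_bim[OF AB AB] and ps = pt_simps[OF AB AB] and s = bim_simps(1,2)[OF AB]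
 obtain h1 where h1: "klin k ?B A3 h1" "!!a b c d. a \<in>: A ==> b \<in>: A ==> c \<in>: A ==> d \<in>: A ==>
   h1 (pt AAu AAu (aat a b) (aat c d)) = t3 a (b * c) d" by (rule AAu_square) (rule that)
 note ag = bimoduleD(2)[OF B] A3.ab_gr klinD(4)[OF h1(1)]
 have e: "?e \<in>: AAu" by (simp add: aat_closed)
 have "t3 \<one> \<one> \<one> = h1 (fn (d AAu AAu) (fn (c AAu AAu) (pt AAu AAu ?e ?e)))" unfolding dc by (simp add: h1(2))
 also have "... = tsum A3 L (%x y z. h1 (tsum ?B S (%p q r.
   pt AAu AAu (p |>\<^sub>AAu (?e <|\<^sub>AAu (z * q))) (x |>\<^sub>AAu (?e <|\<^sub>AAu (y * r))))))"
  unfolding braid_by_compose[OF c d AB AB e e]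
  by (rule tsum_additive[OF ag L]) (intro tsum_closed[OF ag(1) S], simp add: ps s e)
 also have "... = tsum A3 L (%x y z. tsum A3 S (%p q r. h1 (
   pt AAu AAu (p |>\<^sub>AAu (?e <|\<^sub>AAu (z * q))) (x |>\<^sub>AAu (?e <|\<^sub>AAu (y * r))))))"
  by (rule tsum_cong[OF L], rule tsum_additive[OF ag S]) (simp add: ps s e)
 also have "... = tsum A3 L (%x y z. tsum A3 S (%p q r. t3 p (z * (q * x)) (y * r)))"
  by (intro tsum_cong[OF L] tsum_cong[OF S]) (simp add: AAu_act h1(2) A.m_assoc)
 also have "... = tsum A3 (swap23 L) (%x y z. tsum A3 S (%u v w. t3 (x * u) (y * v) (z * w)))"
  by (rule cyc_prod_swap23[OF braid_by_cyc[OF d] L, symmetric])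
 finally show ?thesis unfolding prod_one_def by simp
qed

lemma braidingD:
 assumes c: "braiding \<B> c"
 shows "U \<in> Ob \<B> ==> V \<in> Ob \<B> ==> iso_arrow \<B> (U \<otimes> V) (V \<otimes> U) (c U V)"
  and "natural_family c"
  and "BM U ==> BM V ==> BM W ==> cmpa (uassoc A V W U) (cmpa (c U (V \<otimes> W)) (uassoc A U V W)) =
   cmpa (tens_ar (id_arrow V) (c U W)) (cmpa (uassoc A V U W) (tens_ar (c U V) (id_arrow W)))" (is "PROP ?p1")
  and "BM U ==> BM V ==> BM W ==> c (U \<otimes> V) W = cmpa (uassoc A W U V) (cmpa (tens_ar (c U W) (id_arrow V))
   (cmpa (unassoc U W V) (cmpa (tens_ar (id_arrow U) (c V W)) (uassoc A U V W))))" (is "PROP ?p2")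
proof -
 show iso: "U \<in> Ob \<B> ==> V \<in> Ob \<B> ==> iso_arrow \<B> (U \<otimes> V) (V \<otimes> U) (c U V)" for U V
  using c unfolding braiding_def by simp
 have "c U V \<in> Hom \<B> (U \<otimes> V) (V \<otimes> U)" if "BM U" "BM V" for U V
  using iso[of U V] that unfolding iso_arrow_def inverse_arrows_def by auto
 moreover have "cmpa (c U' V') (tens_ar f g) = cmpa (tens_ar g f) (c U V)"
  if "BM U" "BM U'" "BM V" "BM V'" "f \<in> Hom \<B> U U'" "g \<in> Hom \<B> V V'" for U U' V V' f g
  using c that unfolding braiding_def by simp
 ultimately show "natural_family c" unfolding natural_family_def by simp
 show "PROP ?p1"
  using c unfolding braiding_def by simp
 show "PROP ?p2"
  using c unfolding braiding_def by simp
qed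

lemma natural_family_inverse:
 assumes c: "natural_family c" and iso: "!!U V. U \<in> Ob \<B> ==> V \<in> Ob \<B> ==> iso_arrow \<B> (U \<otimes> V) (V \<otimes> U) (c U V)"
 obtains d where "natural_family d"
  "!!U V X. BM U ==> BM V ==> X \<in>: (U \<otimes> V) ==> fn (d V U) (fn (c U V) X) = X"
  "!!U V X. BM U ==> BM V ==> X \<in>: (V \<otimes> U) ==> fn (c U V) (fn (d V U) X) = X"
proof -
 define d where "d V U = (SOME g. inverse_arrows \<B> (U \<otimes> V) (V \<otimes> U) (c U V) g)" for U V
 have inv: "inverse_arrows \<B> (U \<otimes> V) (V \<otimes> U) (c U V) (d V U)" if "BM U" "BM V" for U V
  using someI_ex[of "inverse_arrows \<B> (U \<otimes> V) (V \<otimes> U) (c U V)"] iso[of U V] that unfolding iso_arrow_def d_def by simp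
 have cH: "c U V \<in> Hom \<B> (U \<otimes> V) (V \<otimes> U)" and dH: "d V U \<in> Hom \<B> (V \<otimes> U) (U \<otimes> V)"
  and dc: "cmpa (d V U) (c U V) = id_arrow (U \<otimes> V)" and cd: "cmpa (c U V) (d V U) = id_arrow (V \<otimes> U)"
  if "BM U" "BM V" for U V using inv[OF that] unfolding inverse_arrows_def by simp_all
 have 1: "fn (d V U) (fn (c U V) X) = X" if "BM U" "BM V" "X \<in>: (U \<otimes> V)" for U V X
  using arg_cong[OF dc[OF that(1,2)], of "%h. fn h X"] that(3) Hom_bimap(2)[OF cH[OF that(1,2)]] by (simp add: compose_def)
 have 2: "fn (c U V) (fn (d V U) X) = X" if "BM U" "BM V" "X \<in>: (V \<otimes> U)" for U V X
  using arg_cong[OF cd[OF that(1,2)], of "%h. fn h X"] that(3) Hom_bimap(2)[OF dH[OF that(1,2)]] by (simp add: compose_def)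
 have nat: "cmpa (d U' V') (tens_ar f g) = cmpa (tens_ar g f) (d U V)"
  if U: "BM U" "BM U'" and V: "BM V" "BM V'" and f: "f \<in> Hom \<B> U U'" and g: "g \<in> Hom \<B> V V'" for U U' V V' f g
 proof (rule Hom_eqI)
  note fg = utensor_arrow_facts(1)[OF U V f g] and gf = utensor_arrow_facts(1)[OF V U g f]
  show "cmpa (d U' V') (tens_ar f g) \<in> Hom \<B> (U \<otimes> V) (V' \<otimes> U')"
   by (rule comp_Hom[OF pt_bim[OF U(1) V(1)] fg dH[OF V(2) U(2)]])
  show "cmpa (tens_ar g f) (d U V) \<in> Hom \<B> (U \<otimes> V) (V' \<otimes> U')"
   by (rule comp_Hom[OF pt_bim[OF U(1) V(1)] dH[OF V(1) U(1)] gf])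
  fix X assume X: "X \<in>: (U \<otimes> V)"
  let ?Y = "fn (d U V) X"
  have Y: "?Y \<in>: (V \<otimes> U)" by (rule bimapD(3)[OF Hom_bimap(1)[OF dH[OF V(1) U(1)]] X])
  have gY: "fn (tens_ar g f) ?Y \<in>: (V' \<otimes> U')" by (rule bimapD(3)[OF Hom_bimap(1)[OF gf] Y])
  have n: "cmpa (c V' U') (tens_ar g f) = cmpa (tens_ar f g) (c V U)"
   using c U V f g unfolding natural_family_def by simp
  have "fn (tens_ar f g) X = fn (tens_ar f g) (fn (c V U) ?Y)" using 2[OF V(1) U(1) X] by simp
  also have "... = fn (cmpa (c V' U') (tens_ar g f)) ?Y"
   unfolding n by (rule comp_fn[symmetric]) (simp add: Hom_bimap(2)[OF cH[OF V(1) U(1)]] Y)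
  also have "... = fn (c V' U') (fn (tens_ar g f) ?Y)"
   by (rule comp_fn) (simp add: Hom_bimap(2)[OF gf] Y)
  finally show "fn (cmpa (d U' V') (tens_ar f g)) X = fn (cmpa (tens_ar g f) (d U V)) X"
   using X 1[OF V(2) U(2) gY] by (simp add: compose_def Hom_bimap(2)[OF fg] Hom_bimap(2)[OF dH[OF V(1) U(1)]])
 qed
 have "natural_family d" unfolding natural_family_def using dH nat by simp
 then show thesis using 1 2 by (rule that)
qed

text \<open>The hexagons are evaluated with \<open>1 \<otimes> 1\<close> in all three places, where they become equations in
  \<open>A \<otimes> A \<otimes> A \<otimes> A\<close>.\<close>
lemma braiding_canonical:
 assumes c: "braiding \<B> c"
 obtains L where "braid_by L c" "canonical_R_matrix k A (tsum A3 L t3)"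
proof -
 note cb = braidingD[OF c]
 obtain L where cL: "braid_by L c" by (rule natural_family_braid_by[OF cb(2)])
 obtain d where d: "natural_family d"
  "!!U V X. BM U ==> BM V ==> X \<in>: (U \<otimes> V) ==> fn (d V U) (fn (c U V) X) = X"
  "!!U V X. BM U ==> BM V ==> X \<in>: (V \<otimes> U) ==> fn (c U V) (fn (d V U) X) = X"
  by (rule natural_family_inverse[OF cb(2,1)]) (assumption | rule that)+
 obtain S where dS: "braid_by S d" by (rule natural_family_braid_by[OF d(1)])
 note L = braid_byD(1)[OF cL] and S = braid_byD(1)[OF dS]
 note AB = AAu_bimod
 let ?e = "aat \<one> \<one>"
 note B2 = pt_bim[OF AB AB]
 note B3 = pt_bim[OF AB B2]
 have e: "?e \<in>: AAu" by (simp add: aat_closed)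
 note ee = pt_simps(1)[OF AB AB e e]
 have "prod_one (swap23 L) S" by (rule braid_by_prod_one[OF cL dS d(2)[OF AB AB ee]])
 from prod_one_swap23[OF swap23_triples[OF L] S this] have p1: "prod_one L (swap23 S)" by simp
 have p2: "prod_one (swap23 S) L" by (rule braid_by_prod_one[OF dS cL d(3)[OF AB AB ee]])
 have cy: "cyc L" by (rule braid_by_cyc[OF cL])
 obtain h where h: "klin k (AAu \<otimes> (AAu \<otimes> AAu)) A4 h"
  "!!a b c d e f. a \<in>: A ==> b \<in>: A ==> c \<in>: A ==> d \<in>: A ==> e \<in>: A ==> f \<in>: A ==>
   h (pt AAu (AAu \<otimes> AAu) (aat a b) (pt AAu AAu (aat c d) (aat e f))) = t4 a (b * c) (d * e) f"
  by (rule AAu_cube) (rule that)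
 note s = bim_simps(1,2)[OF AB] e
 let ?X = "pt (AAu \<otimes> AAu) AAu (pt AAu AAu ?e ?e) ?e" and ?T = "AAu \<otimes> (AAu \<otimes> AAu)"
 have X: "?X \<in>: (AAu \<otimes> AAu \<otimes> AAu)" by (rule pt_simps(1)[OF B2 AB ee e])
 note ag = bimoduleD(2)[OF B3] A4.ab_gr klinD(4)[OF h(1)]
 define \<phi> where "\<phi> x y z t = pt AAu (AAu \<otimes> AAu) (x |>\<^sub>AAu ?e) (pt AAu AAu (y |>\<^sub>AAu (?e <|\<^sub>AAu z)) (?e <|\<^sub>AAu t))" for x y z t
 define \<psi> where "\<psi> x y z t = pt AAu (AAu \<otimes> AAu) (x |>\<^sub>AAu (?e <|\<^sub>AAu y)) (pt AAu AAu (?e <|\<^sub>AAu z) (?e <|\<^sub>AAu t))" for x y z t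
 have cl: "\<phi> x y z t \<in>: ?T" "\<psi> x y z t \<in>: ?T" "h (\<phi> x y z t) = t4 x y z t" "h (\<psi> x y z t) = t4 x y z t"
  if "x \<in>: A" "y \<in>: A" "z \<in>: A" "t \<in>: A" for x y z t
  unfolding \<phi>_def \<psi>_def using that by (simp_all add: s aat_closed pt_simps(1)[OF AB B2] pt_simps(1)[OF AB AB] AAu_act h(2))
 have single: "h (tsum ?T L (%x y z. \<beta> (p x y z) (q x y z) (r x y z) (o' x y z))) = tsum A4 L (%x y z. t4 (p x y z) (q x y z) (r x y z) (o' x y z))" (is "h (tsum _ _ ?a) = ?r")
  if "\<beta> \<in> {\<phi>, \<psi>}" "!!x y z. x \<in>: A ==> y \<in>: A ==> z \<in>: A ==>
   p x y z \<in>: A & q x y z \<in>: A & r x y z \<in>: A & o' x y z \<in>: A" for \<beta> p q r o'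
 proof -
  have "h (tsum ?T L ?a) = tsum A4 L (%x y z. h (?a x y z))"
   by (rule tsum_additive[OF ag L]) (use that cl(1,2) in auto)
  also have "... = ?r"
   by (rule tsum_cong[OF L]) (use that cl(3,4) in auto)
  finally show ?thesis .
 qed
 have double: "h (tsum ?T L (%x y z. tsum ?T L (%u v w. \<beta> (p x y z u v w) (q x y z u v w) (r x y z u v w) (o' x y z u v w)))) =
   tsum A4 L (%x y z. tsum A4 L (%u v w. t4 (p x y z u v w) (q x y z u v w) (r x y z u v w) (o' x y z u v w)))" (is "h (tsum _ _ ?a) = ?r")
  if b: "\<beta> \<in> {\<phi>, \<psi>}" and c: "!!x y z u v w. x \<in>: A ==> y \<in>: A ==> z \<in>: A ==> u \<in>: A ==> v \<in>: A ==> w \<in>: A ==>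
   p x y z u v w \<in>: A & q x y z u v w \<in>: A & r x y z u v w \<in>: A & o' x y z u v w \<in>: A" for \<beta> p q r o'
 proof -
  have "h (tsum ?T L ?a) =
   tsum A4 L (%x y z. h (?a x y z))"
   by (rule tsum_additive[OF ag L], rule tsum_closed[OF ag(1) L]) (use b c cl(1,2) in auto)
  also have "... = ?r"
   by (rule tsum_cong[OF L], rule single[OF b]) (use c in auto)
  finally show ?thesis .
 qed
 have "hexagon2 L"
 proof -
  note hv = hexagon1_values[OF cL AB AB AB e e e, folded \<phi>_def] and ha = hexagon_arrows1(2,4)[OF AB AB AB cL X]
  have "tsum ?T L (%x y z. \<phi> x \<one> y z) = tsum ?T L (%x y z. tsum ?T L (%p q r. \<phi> x (y * p) q (z * r)))"
   using cb(3)[OF AB AB AB] ha unfolding hv by simp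
  from arg_cong[OF this, of h] show ?thesis
   unfolding hexagon2_def by (subst (asm) single, simp, simp, subst (asm) double) simp_all
 qed
 moreover have "hexagon1 L"
 proof -
  note hv = hexagon2_values[OF cL AB AB AB e e e, folded \<psi>_def] and ha = hexagon_arrows2(2)[OF AB AB AB cL X]
  have "tsum ?T L (%x y z. \<psi> x y \<one> z) = tsum ?T L (%x y z. tsum ?T L (%p q r. \<psi> (p * x) (y * q) r z))"
   using ha unfolding cb(4)[OF AB AB AB, symmetric] hv .
  from arg_cong[OF this, of h] show ?thesis
   unfolding hexagon1_alt[OF cy] by (subst (asm) single, simp, simp, subst (asm) double) simp_all
 qed
 ultimately have "canonical_R_matrix k A (tsum A3 L t3)"
  unfolding canonical_iff[OF L] using cy p1 p2 swap23_triples[OF S] by blast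
 with cL show thesis by (rule that)
qed

lemma braiding_iff_canonical: "(\<exists>c. braiding \<B> c) \<longleftrightarrow> (\<exists>R. canonical_R_matrix k A R)"
proof
 assume "\<exists>c. braiding \<B> c"
 then obtain c where "braiding \<B> c" ..
 then obtain L where "canonical_R_matrix k A (tsum A3 L t3)" by (rule braiding_canonical)
 then show "\<exists>R. canonical_R_matrix k A R" ..
next
 assume "\<exists>R. canonical_R_matrix k A R"
 then obtain L L' where L: "cyc L" "hexagon1 L" "hexagon2 L" "triples L'" "prod_one L L'" "prod_one L' L"
  unfolding canonical_unfold by blast
 obtain c where c: "braid_by L c" by (rule list_braiding[OF L(1)])
 show "\<exists>c. braiding \<B> c" by (rule exI[of _ c], rule canonical_braiding[OF L c])
qed

lemma canonical_free_family:
 assumes free: "free_module k A" and L: "triples L" "canonical_R_matrix k A (tsum A3 L t3)"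
 obtains P where "normalized_family P" "tsum A3 (flat P) t3 = tsum A3 L t3"
proof -
 have c: "cyc L" "hexagon1 L" and "\<exists>L'. triples L' & prod_one L L'" using L(2) unfolding canonical_iff[OF L(1)] by blast+
 then obtain L' where L': "triples L'" "prod_one L L'" by blast
 show thesis by (rule free_family[OF free c(1) canonical_normalized[OF c L']]) (rule that)
qed

text \<open>Both braidings come from canonical R-matrices, which are normalized elements since \<open>A\<close> is free, and
  these are unique.\<close>
lemma braiding_unique:
 assumes free: "free_module k A" and c: "braiding \<B> c" "braiding \<B> c'" and M: "BM M" and N: "BM N"
 shows "c M N = c' M N"
proof -
 obtain L where L: "braid_by L c" "canonical_R_matrix k A (tsum A3 L t3)" by (rule braiding_canonical[OF c(1)])
 obtain L' where L': "braid_by L' c'" "canonical_R_matrix k A (tsum A3 L' t3)" by (rule braiding_canonical[OF c(2)])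
 note D = braid_byD[OF L(1)] and D' = braid_byD[OF L'(1)]
 obtain P where P: "normalized_family P" "tsum A3 (flat P) t3 = tsum A3 L t3" by (rule canonical_free_family[OF free D(1) L(2)])
 obtain P' where P': "normalized_family P'" "tsum A3 (flat P') t3 = tsum A3 L' t3" by (rule canonical_free_family[OF free D'(1) L'(2)])
 have e: "tsum A3 L t3 = tsum A3 L' t3" using normalized_unique[OF P(1) P'(1)] unfolding P(2) P'(2) .
 show ?thesis
 proof (rule Hom_eqI[OF D(2)[OF M N] D'(2)[OF M N]])
  fix X assume X: "X \<in>: (M \<otimes> N)"
  show "fn (c M N) X = fn (c' M N) X"
  proof (rule pt_ext[OF M N bimapD(2)[OF Hom_bimap(1)[OF D(2)[OF M N]]] bimapD(2)[OF Hom_bimap(1)[OF D'(2)[OF M N]]] _ X])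
   fix m n assume mn: "m \<in>: M" "n \<in>: N"
   note st = sweedler3_tsum[OF bimoduleD(1)[OF pt_bim[OF N M]] trilin_pt[OF M N mn]]
   show "fn (c M N) (pt M N m n) = fn (c' M N) (pt M N m n)"
    unfolding D(3)[OF M N mn] D'(3)[OF M N mn] st[OF D(1), symmetric] st[OF D'(1), symmetric] e ..
  qed
 qed
qed

end

no_notation mult (infixl "*\<index>" 70)
notation mult (infixl "\<otimes>\<index>" 70)

theorem theorem2p6:
  fixes k :: "'k ring" and A :: "('k, 'a) module"
  assumes "cring k" and "k_algebra k A"
    and "infinite (UNIV :: 'u set)"
    and "carrier k \<lesssim> (UNIV :: 'u set)" and "carrier A \<lesssim> (UNIV :: 'u set)"
    and "flat_module TYPE('u) k A"
  shows
    "let \<M> = Mod_cat TYPE('u) k; \<B> = Bimod_cat TYPE('u) k A; G = G_functor A;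
         normalized = (\<lambda>R. R \<in> A_inv_AA k A \<and>
           sweedler3 k A (alg2 k A) (\<lambda>x y z. tens2 k A (x \<otimes>\<^bsub>A\<^esub> y) z) R = tens2 k A \<one>\<^bsub>A\<^esub> \<one>\<^bsub>A\<^esub>);
         C1 = inverse_equivalences \<M> \<B> (F_functor k A) G (FG_unit k A) (FG_counit k A);
         C2 = fully_faithful \<B> \<M> G;
         C3 = separable_functor \<B> \<M> G;
         C4 = (\<exists>R. normalized R);
         C5 = (\<exists>!R. normalized R);
         C6 = (\<exists>c. braiding \<B> c)
     in (C1 \<longleftrightarrow> azumaya TYPE('u) k A) \<and>
        (C6 \<longleftrightarrow> (\<exists>R. canonical_R_matrix k A R)) \<and>
        (C1 \<longrightarrow> C2) \<and> (C2 \<longleftrightarrow> C3) \<and> (C3 \<longleftrightarrow> C4) \<and> (C4 \<longleftrightarrow> C5) \<and> (C5 \<longrightarrow> C6) \<and>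
        (central_algebra k A \<longrightarrow> C2 \<longrightarrow> C1) \<and>
        (free_module k A \<longrightarrow>
           (C6 \<longrightarrow> C5) \<and>
           (\<forall>c c'. braiding \<B> c \<and> braiding \<B> c' \<longrightarrow>
              (\<forall>M\<in>Ob \<B>. \<forall>N\<in>Ob \<B>. c M N = c' M N))) \<and>
        (field k \<and> finite_dimensional k A \<and> \<one>\<^bsub>A\<^esub> \<noteq> \<zero>\<^bsub>A\<^esub> \<longrightarrow>
           (C6 \<longrightarrow> C1) \<and>
           (C1 \<longleftrightarrow> C2) \<and> (C2 \<longleftrightarrow> C3) \<and> (C3 \<longleftrightarrow> C4) \<and> (C4 \<longleftrightarrow> C5) \<and> (C5 \<longleftrightarrow> C6))"
proof -
  interpret kalg_univ k A "TYPE('u)"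
    by (intro kalg_univ.intro kalg.intro kalg_univ_axioms.intro) (fact assms)+
  note flat = assms(6)
  let ?N = "\<exists>P. normalized_family P"
  have C1: "inverse_equivalences \<M> \<B> FF G unit counit \<longleftrightarrow> central_algebra k A \<and> ?N"
    using equivalence_normalized equivalence_central central_equivalence[OF flat] by blast
  have C2: "fully_faithful \<B> \<M> G \<longleftrightarrow> ?N" and C3: "separable_functor \<B> \<M> G \<longleftrightarrow> ?N"
    using normalized_fully_faithful[OF flat] fully_faithful_separable separable_normalized by blast+
  have C4: "(\<exists>R. R \<in> A_inv_AA k A \<and> sweedler3 k A A2 (\<lambda>x y z. t2 (x \<otimes>\<^bsub>A\<^esub> y) z) R = t2 \<one>\<^bsub>A\<^esub> \<one>\<^bsub>A\<^esub>) \<longleftrightarrow> ?N"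
    unfolding normalized_iff by blast
  have C6: "\<exists>R. canonical_R_matrix k A R" if ?N using that normalized_canonical by blast
  have free: ?N if fr: "free_module k A" and ex: "\<exists>R. canonical_R_matrix k A R"
  proof -
    obtain R where R: "canonical_R_matrix k A R" using ex ..
    obtain L where L: "triples L" "R = tsum A3 L t3" using R[unfolded canonical_unfold] by blast
    obtain P where "normalized_family P" by (rule canonical_free_family[OF fr L(1) R[unfolded L(2)]])
    then show ?N ..
  qed
  have fd: "free_module k A" if "finite_dimensional k A"
    using that unfolding finite_dimensional_def free_module_def by blast
  have fc: "central_algebra k A" if "field k" "finite_dimensional k A" "\<one>\<^bsub>A\<^esub> \<noteq> \<zero>\<^bsub>A\<^esub>" ?N
    using field_central[OF that(1) fd[OF that(2)] that(3)] that(4) by blast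
  have uniq: "\<forall>c c'. braiding \<B> c \<and> braiding \<B> c' \<longrightarrow> (\<forall>M\<in>Ob \<B>. \<forall>N\<in>Ob \<B>. c M N = c' M N)" if "free_module k A"
    using braiding_unique[OF that] by simp
  show ?thesis
    unfolding Let_def C1 C2 C3 C4 normalized_ex_unique azumaya_iff braiding_iff_canonical
    using C6 free fd fc uniq by blast
qed

end
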